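(* Let $n\ge 1$, $K\ge 2$, $\Omega=\mathbb{T}^n$, let $\mathcal{L}u=-\nabla\cdot(a\nabla u)+bu$ with real bounded measurable coefficients $a,b$ on $\mathbb{T}^n$ satisfying $a(x)\ge C>0$ and $b(x)\ge C_0>0$ for all $x$, for some constants $C,C_0$, and let $P$ be the windowed Fourier frame preconditioner $P=\sum_{j\in J} g_j S_j g_j$ defined in the context (with symbol weights built from the values $a(x_j)$). Then the self-adjoint operator $P\mathcal{L}P:L^2(\Omega)\to L^2(\Omega)$ is boundedly invertible; that is, there exist constants $c_2\ge c_1>0$ such that $$c_1\|u\|^2\le \langle P\mathcal{L}P u,u\rangle\le c_2\|u\|^2\qquad\text{for all } u\in L^2(\Omega),$$ where $\|\cdot\|$ and $\langle\cdot,\cdot\rangle$ are the norm and inner product of $L^2(\Omega)$.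
   Context: Torus and Sobolev spaces. $\mathbb{T}^n=[0,2\pi)^n$ with periodic identification; functions on $\mathbb{T}^n$ are functions on $\mathbb{R}^n$ that are $2\pi$-periodic in each coordinate. For $p\in\mathbb{R}$, $H^p(\Omega)$ is the space of (periodic distributions) $\psi$ with Fourier coefficients $a_m$, $m\in\mathbb{Z}^n$, such that $\|\psi\|_p^2=\sum_{m\in\mathbb{Z}^n}(1+|m|^2)^p|a_m|^2<\infty$; $H^0=L^2$. The operator $\mathcal{L}$ is understood in the weak sense as a map $H^1(\Omega)\to H^{-1}(\Omega)$ (it is boundedly invertible under the stated assumptions on $a,b$). Windows. Let $J=\{1,\dots,K^n\}$ and let $x_j$, $j\in J$, enumerate the points of $\frac{2\pi}{K}\{0,\dots,K-1\}^n\subset\mathbb{T}^n$. Let $D_j=x_j+[-\frac{2\pi}{K},\frac{2\pi}{K}]^n$ (mod $2\pi$), a cube of side $\frac{4\pi}{K}$ with midpoint $x_j$. Let $g_j\in C^\infty(\mathbb{T}^n)$ be real-valued, with support a compact subset of $x_j+(-\frac{2\pi}{K},\frac{2\pi}{K})^n$ (i.e. inside $D_j$ and away from its boundary), and $\sum_{j\in J} g_j(x)^2=1$ for all $x\in\Omega$. Preconditioner. For $k\in\mathbb{Z}^n$ put $\xi_k=\frac{K}{2}k$. For $v$ supported in a compact subset of the interior of $D_j$, extend $v$ periodically with period $\frac{4\pi}{K}$ in each coordinate, and let $\mathcal{F}_{D_j}v(k)=(\frac{4\pi}{K})^{-n}\int_{D_j}v(x)e^{-i\xi_k\cdot x}\,dx$,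 $k\in\mathbb{Z}^n$, be its Fourier coefficients (in the distributional sense if necessary; on $D_j$ one uses the coordinates $x\in x_j+[-\frac{2\pi}{K},\frac{2\pi}{K}]^n$). Define $$S_jv(x)=\big(\mathcal{F}_{D_j}^{-1}M^{-1/2}\mathcal{F}_{D_j}v\big)(x)=\sum_{k\in\mathbb{Z}^n}\big(1+a(x_j)|\xi_k|^2\big)^{-1/2}\,\mathcal{F}_{D_j}v(k)\,e^{i\xi_k\cdot x},$$ and $Pu=\sum_{j\in J} g_j\,S_j(g_ju)$, each term $g_jS_j(g_ju)$ being supported in $D_j$ and extended by zero to $\mathbb{T}^n$. $P$ acts on periodic distributions; in $P\mathcal{L}P$ the right factor acts on $L^2(\Omega)$ and the left factor on $H^{-1}(\Omega)$. *)

theory Defs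
  imports "HOL-Analysis.Analysis"
begin

section \<open>Periodic test functions and periodic distributions\<close>

text \<open>
  Functions on a torus with period \<open>L\<close> are functions on \<open>real^'n\<close> that are \<open>L\<close>-periodic in every
  coordinate.  The period is a parameter because two tori occur: the torus of the equation
  (\<open>L = 2 * pi\<close>) and the torus obtained by identifying opposite faces of a window cube
  (\<open>L = 4 * pi / K\<close>).
\<close>

definition periodic :: "real \<Rightarrow> (real^'n \<Rightarrow> 'b) \<Rightarrow> bool" where
  "periodic L f \<longleftrightarrow> (\<forall>i x. f (x + L *\<^sub>R axis i 1) = f x)"

definition cell :: "real \<Rightarrow> (real^'n) set" where
  "cell L = {x. \<forall>i. 0 \<le> x $ i \<and> x $ i < L}"

definition pderiv_at :: "'n \<Rightarrow> (real^'n \<Rightarrow> 'b) \<Rightarrow> real^'n \<Rightarrow> 'b::real_normed_vector" where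
  "pderiv_at i f x = frechet_derivative f (at x) (axis i 1)"

definition iter_pderiv :: "'n list \<Rightarrow> (real^'n \<Rightarrow> 'b) \<Rightarrow> real^'n \<Rightarrow> 'b::real_normed_vector" where
  "iter_pderiv ds f = foldr pderiv_at ds f"

definition smooth :: "(real^'n \<Rightarrow> 'b::real_normed_vector) \<Rightarrow> bool" where
  "smooth f \<longleftrightarrow> (\<forall>ds. iter_pderiv ds f differentiable_on UNIV)"

definition tests :: "real \<Rightarrow> (real^'n \<Rightarrow> complex) set" where
  "tests L = {\<phi>. periodic L \<phi> \<and> smooth \<phi>}"

text \<open>
  A distribution is represented by a functional on all functions, of which only the values on test
  functions matter.  The pairing is bilinear (no complex conjugation).
  The second condition is continuity in the topology of uniform convergence of all derivatives.
\<close>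

type_synonym 'n functional = "(real^'n \<Rightarrow> complex) \<Rightarrow> complex"

definition periodic_distribution :: "real \<Rightarrow> 'n::finite functional \<Rightarrow> bool" where
  "periodic_distribution L \<psi> \<longleftrightarrow>
     (\<forall>\<phi>\<in>tests L. \<forall>\<eta>\<in>tests L. \<forall>c d. \<psi> (\<lambda>x. c * \<phi> x + d * \<eta> x) = c * \<psi> \<phi> + d * \<psi> \<eta>) \<and>
     (\<exists>N B. \<forall>\<phi>\<in>tests L. \<forall>M.
        (\<forall>ds x. length ds \<le> N \<longrightarrow> cmod (iter_pderiv ds \<phi> x) \<le> M) \<longrightarrow> cmod (\<psi> \<phi>) \<le> B * M)"

definition dist_of :: "real \<Rightarrow> (real^'n \<Rightarrow> complex) \<Rightarrow> 'n::finite functional" where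
  "dist_of L f = (\<lambda>\<phi>. LINT x:cell L|lebesgue. f x * \<phi> x)"

definition dist_pderiv :: "'n \<Rightarrow> 'n::finite functional \<Rightarrow> 'n functional" where
  "dist_pderiv i \<psi> = (\<lambda>\<phi>. - \<psi> (pderiv_at i \<phi>))"

definition int_vec :: "int^'n \<Rightarrow> real^'n" where
  "int_vec m = (\<chi> i. real_of_int (m $ i))"

text \<open>For \<open>L = 2 * pi\<close> this is \<open>m\<close> itself; for \<open>L = 4 * pi / K\<close> it is \<open>(K / 2) m\<close>.\<close>

definition freq :: "real \<Rightarrow> int^'n \<Rightarrow> real^'n" where
  "freq L m = (2 * pi / L) *\<^sub>R int_vec m"

definition fourier_coeff :: "real \<Rightarrow> 'n::finite functional \<Rightarrow> int^'n \<Rightarrow> complex" where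
  "fourier_coeff L \<psi> m = \<psi> (\<lambda>x. cis (- (freq L m \<bullet> x))) / of_real (L ^ CARD('n))"


section \<open>Sobolev spaces and square integrable functions on the torus of period \<open>2 * pi\<close>\<close>

definition Sobolev :: "real \<Rightarrow> 'n::finite functional set" where
  "Sobolev p = {\<psi>. periodic_distribution (2 * pi) \<psi> \<and>
     (\<lambda>m::int^'n. (1 + (norm (int_vec m))\<^sup>2) powr p * (cmod (fourier_coeff (2 * pi) \<psi> m))\<^sup>2)
       summable_on UNIV}"

text \<open>Elements of \<open>L2\<close> are functions, to be identified when they agree almost everywhere.\<close>

definition L2 :: "(real^'n \<Rightarrow> complex) set" where
  "L2 = {f. periodic (2 * pi) f \<and> f \<in> borel_measurable lebesgue \<and>
            set_integrable lebesgue (cell (2 * pi)) (\<lambda>x. (cmod (f x))\<^sup>2)}"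

definition l2_inner :: "(real^'n \<Rightarrow> complex) \<Rightarrow> (real^'n \<Rightarrow> complex) \<Rightarrow> complex" where
  "l2_inner u v = (LINT x:cell (2 * pi)|lebesgue. u x * cnj (v x))"

definition l2_norm :: "(real^'n \<Rightarrow> complex) \<Rightarrow> real" where
  "l2_norm u = sqrt (LINT x:cell (2 * pi)|lebesgue. (cmod (u x))\<^sup>2)"

definition represents :: "(real^'n \<Rightarrow> complex) \<Rightarrow> 'n::finite functional \<Rightarrow> bool" where
  "represents f \<psi> \<longleftrightarrow> f \<in> L2 \<and> (\<forall>\<phi>\<in>tests (2 * pi). \<psi> \<phi> = dist_of (2 * pi) f \<phi>)"

text \<open>A representative of a distribution in \<open>H\<^sup>0 = L\<^sup>2\<close>, unique up to null sets.\<close>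

definition L2_rep :: "'n::finite functional \<Rightarrow> real^'n \<Rightarrow> complex" where
  "L2_rep \<psi> = (SOME f. represents f \<psi>)"

definition bounded_L2_operator :: "((real^'n \<Rightarrow> complex) \<Rightarrow> real^'n \<Rightarrow> complex) \<Rightarrow> bool" where
  "bounded_L2_operator T \<longleftrightarrow>
     (\<forall>u\<in>L2. T u \<in> L2) \<and>
     (\<forall>u\<in>L2. \<forall>v\<in>L2. \<forall>c d. AE x in lebesgue. T (\<lambda>y. c * u y + d * v y) x = c * T u x + d * T v x) \<and>
     (\<exists>B. \<forall>u\<in>L2. l2_norm (T u) \<le> B * l2_norm u)"

definition selfadjoint_L2_operator :: "((real^'n \<Rightarrow> complex) \<Rightarrow> real^'n \<Rightarrow> complex) \<Rightarrow> bool" where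
  "selfadjoint_L2_operator T \<longleftrightarrow>
     bounded_L2_operator T \<and> (\<forall>u\<in>L2. \<forall>v\<in>L2. l2_inner (T u) v = l2_inner u (T v))"

definition boundedly_invertible_L2 :: "((real^'n \<Rightarrow> complex) \<Rightarrow> real^'n \<Rightarrow> complex) \<Rightarrow> bool" where
  "boundedly_invertible_L2 T \<longleftrightarrow>
     (\<exists>R. bounded_L2_operator R \<and>
          (\<forall>u\<in>L2. (AE x in lebesgue. R (T u) x = u x) \<and> (AE x in lebesgue. T (R u) x = u x)))"


section \<open>The elliptic operator\<close>

text \<open>
  The weak form of \<open>- \<nabla> \<cdot> (a \<nabla> \<psi>) + b \<psi>\<close> for \<open>\<psi>\<close> in \<open>H\<^sup>1\<close>: the distributional first derivatives
  of \<open>\<psi>\<close> are then square integrable functions, which can be multiplied by \<open>a\<close>.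
\<close>

definition elliptic_op ::
  "(real^'n \<Rightarrow> real) \<Rightarrow> (real^'n \<Rightarrow> real) \<Rightarrow> 'n::finite functional \<Rightarrow> 'n functional" where
  "elliptic_op a b \<psi> = (\<lambda>\<phi>. LINT x:cell (2 * pi)|lebesgue.
     of_real (a x) * (\<Sum>i\<in>UNIV. L2_rep (dist_pderiv i \<psi>) x * pderiv_at i \<phi> x)
     + of_real (b x) * L2_rep \<psi> x * \<phi> x)"


section \<open>Windows and the preconditioner\<close>

definition window_grid :: "nat \<Rightarrow> (real^'n) set" where
  "window_grid K = {x. \<forall>i. \<exists>l<K. x $ i = 2 * pi / real K * real l}"

definition window_cube :: "nat \<Rightarrow> real^'n \<Rightarrow> (real^'n) set" where
  "window_cube K c = {x. \<forall>i. \<bar>x $ i - c $ i\<bar> < 2 * pi / real K}"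

text \<open>
  The support condition: the support of \<open>g j\<close> on the torus, seen as a periodic subset of
  \<open>real^'n\<close>, consists of the translates by \<open>2 * pi * m\<close> of a compact subset of the open cube.
\<close>

definition window_functions ::
  "nat \<Rightarrow> (nat \<Rightarrow> real^'n) \<Rightarrow> (nat \<Rightarrow> real^'n \<Rightarrow> real) \<Rightarrow> bool" where
  "window_functions K x g \<longleftrightarrow>
     (\<forall>j\<in>{1..K ^ CARD('n)}.
        periodic (2 * pi) (g j) \<and> smooth (g j) \<and>
        (\<exists>S. compact S \<and> S \<subseteq> window_cube K (x j) \<and>
             closure {y. g j y \<noteq> 0} = {s + (2 * pi) *\<^sub>R int_vec m | s m. s \<in> S})) \<and>
     (\<forall>y. (\<Sum>j\<in>{1..K ^ CARD('n)}. (g j y)\<^sup>2) = 1)"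

definition periodize :: "real \<Rightarrow> (real^'n \<Rightarrow> complex) \<Rightarrow> real^'n \<Rightarrow> complex" where
  "periodize L h y = (\<Sum>\<^sub>\<infinity>m\<in>UNIV. h (y + L *\<^sub>R int_vec m))"

text \<open>
  The part of a periodic \<open>f\<close> in the cube around \<open>c\<close>, in the local coordinates of the cube.
\<close>

definition local_window :: "nat \<Rightarrow> real^'n \<Rightarrow> (real^'n \<Rightarrow> real) \<Rightarrow> real^'n \<Rightarrow> real" where
  "local_window K c f x = (if x \<in> window_cube K c then f x else 0)"

text \<open>
  The product \<open>\<gamma> \<psi>\<close> of a distribution \<open>\<psi>\<close> of period \<open>L\<close> with a smooth compactly supported function
  \<open>\<gamma>\<close> on \<open>real^'n\<close>.  It is a compactly supported distribution on \<open>real^'n\<close>, and its extension with any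
  period \<open>L'\<close> is given by the same functional, now acting on test functions of period \<open>L'\<close>.
\<close>

definition localize :: "real \<Rightarrow> (real^'n \<Rightarrow> real) \<Rightarrow> 'n::finite functional \<Rightarrow> 'n functional" where
  "localize L \<gamma> \<psi> = (\<lambda>\<phi>. \<psi> (periodize L (\<lambda>x. of_real (\<gamma> x) * \<phi> x)))"

text \<open>
  The Fourier multiplier \<open>S\<^sub>j\<close> with \<open>\<alpha> = a (x\<^sub>j)\<close> on distributions of period \<open>4 * pi / K\<close>; the Fourier
  series is summed weakly.
\<close>

definition symbol_op :: "nat \<Rightarrow> real \<Rightarrow> 'n::finite functional \<Rightarrow> 'n functional" where
  "symbol_op K \<alpha> v = (let L = 4 * pi / real K in (\<lambda>\<phi>. \<Sum>\<^sub>\<infinity>k::int^'n\<in>UNIV.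
     of_real ((1 + \<alpha> * (norm (freq L k))\<^sup>2) powr (- (1/2))) * fourier_coeff L v k
       * dist_of L (\<lambda>x. cis (freq L k \<bullet> x)) \<phi>))"

text \<open>
  \<open>\<Sum>\<^sub>j g\<^sub>j S\<^sub>j (g\<^sub>j u)\<close>: the inner \<open>localize\<close> restricts \<open>g\<^sub>j u\<close> to the cube and passes from period
  \<open>2 * pi\<close> to period \<open>4 * pi / K\<close>; the outer one multiplies by \<open>g\<^sub>j\<close> on the cube and passes back, which
  amounts to extension by zero from the cube to the torus.
\<close>

definition preconditioner ::
  "nat \<Rightarrow> (nat \<Rightarrow> real^'n) \<Rightarrow> (nat \<Rightarrow> real^'n \<Rightarrow> real) \<Rightarrow> (real^'n \<Rightarrow> real) \<Rightarrow>
   'n::finite functional \<Rightarrow> 'n functional" where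
  "preconditioner K x g a u = (\<lambda>\<phi>. \<Sum>j\<in>{1..K ^ CARD('n)}.
     let \<gamma> = local_window K (x j) (g j)
     in localize (4 * pi / real K) \<gamma> (symbol_op K (a (x j)) (localize (2 * pi) \<gamma> u)) \<phi>)"

definition PLP ::
  "nat \<Rightarrow> (nat \<Rightarrow> real^'n) \<Rightarrow> (nat \<Rightarrow> real^'n \<Rightarrow> real) \<Rightarrow> (real^'n \<Rightarrow> real) \<Rightarrow> (real^'n \<Rightarrow> real) \<Rightarrow>
   (real^'n \<Rightarrow> complex) \<Rightarrow> real^'n::finite \<Rightarrow> complex" where
  "PLP K x g a b u =
     L2_rep (preconditioner K x g a (elliptic_op a b (preconditioner K x g a (dist_of (2 * pi) u))))"

end

theory Submission
  imports Defs
begin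

text \<open>The functions \<open>p\<close> obtained by periodizing \<open>g\<^sub>j(x) cis (\<xi>\<^sub>k \<bullet> x)\<close> form a Parseval frame up to a constant
  \<open>\<kappa>\<close>, and \<open>P u = \<kappa> \<Sum> \<sigma>(j, k) \<langle>u, p\<rangle> p\<close> with \<open>\<sigma>(j, k) = (1 + a(x\<^sub>j) |\<xi>\<^sub>k|^2)\<close> to the power \<open>-1/2\<close>.
  Since \<open>\<sigma>\<close> compensates one derivative of \<open>p\<close>, \<open>P\<close> maps the square integrable functions
  boundedly into the Sobolev space of order one, and the composite operator is the one associated with
  the bounded form \<open>\<integral> a \<nabla>Pu \<bullet> \<nabla>(cnj Pv) + b Pu (cnj Pv)\<close>.
  The lower bound reduces to \<open>norm u \<le> K * (norm (P u) + norm (\<nabla>(P u)))\<close>.  To obtain it, test \<open>P u\<close>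
  against \<open>\<Lambda> u\<close>, where \<open>\<Lambda>\<close> is the Fourier multiplier with symbol \<open>sqrt (1 + |\<xi>|^2)\<close>.  The atom with index
  \<open>k\<close> is almost an eigenvector of \<open>\<Lambda>\<close>, with eigenvalue \<open>w = sqrt (1 + |\<xi>\<^sub>k|^2)\<close>: by a Schur test with the rapidly
  decaying Fourier transforms of the windows, the error is bounded on square integrable functions.
  As \<open>\<sigma> w\<close> is bounded below, \<open>\<langle>P u, \<Lambda> u\<rangle>\<close> is at least a multiple of the squared norm of \<open>u\<close> up to the
  error, which is of lower order.  Bounded invertibility is then the Lax-Milgram theorem.\<close>

section \<open>Square integrable functions\<close>

text \<open>The obstacle is that \<langle>P u, u\<rangle> equals \<kappa> times the sum of \<sigma>
  times the squared coefficients of \<open>u\<close>, which measures \<open>u\<close> only like a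
  Sobolev norm of order -1/2; and since the weights differ between overlapping windows,
  \<open>P\<close> has no explicit inverse. Testing with \<Lambda> u restores the missing weight.
  The commutator error then has the same order as the wanted lower bound, but it enters multiplied
  by \<sigma>. Splitting \<sigma> evenly between the two factors bounds it by a multiple of the root
  of \<langle>P u, u\<rangle> times the norm of \<open>u\<close>; as \<langle>P u, u\<rangle> is at
  most the Sobolev norm of \<open>P u\<close> times the norm of \<open>u\<close>, Young's inequality
  absorbs the error with explicit constants. \<Lambda> has to commute, up to bounded errors, with
  the smooth windows only, never with the merely measurable coefficients \<open>a\<close> and
  \<open>b\<close>, which enter the form through pointwise bounds. As \<Lambda> u need not be square
  integrable, the estimate is made for trigonometric sums and extended by density. Operators are
  built from representatives chosen up to null sets, so their linearity holds almost
  everywhere.\<close>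

definition sq_int :: "'a measure \<Rightarrow> ('a \<Rightarrow> complex) \<Rightarrow> bool" where
  "sq_int M f \<longleftrightarrow> f \<in> borel_measurable M \<and> integrable M (\<lambda>x. (cmod (f x))\<^sup>2)"

definition nrm :: "'a measure \<Rightarrow> ('a \<Rightarrow> complex) \<Rightarrow> real" where
  "nrm M f = sqrt (\<integral>x. (cmod (f x))\<^sup>2 \<partial>M)"

lemma nrm_nonneg [simp]: "nrm M f \<ge> 0"
  by (simp add: nrm_def)

lemma nrm_square: "(nrm M f)\<^sup>2 = (\<integral>x. (cmod (f x))\<^sup>2 \<partial>M)"
  by (simp add: nrm_def)

lemma sq_int_measurable [measurable_dest]: "sq_int M f \<Longrightarrow> f \<in> borel_measurable M"
  by (simp add: sq_int_def)

lemma sq_int_integrable: "sq_int M f \<Longrightarrow> integrable M (\<lambda>x. (cmod (f x))\<^sup>2)"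
  by (simp add: sq_int_def)

lemma sq_int_norm_mult_integrable:
  assumes [measurable]: "sq_int M f" "sq_int M g"
  shows "integrable M (\<lambda>x. cmod (f x) * cmod (g x))"
proof (rule Bochner_Integration.integrable_bound)
  show "integrable M (\<lambda>x. (cmod (f x))\<^sup>2 + (cmod (g x))\<^sup>2)"
    using assms by (simp add: sq_int_integrable)
  show "(\<lambda>x. cmod (f x) * cmod (g x)) \<in> borel_measurable M"
    by measurable
  have "s * t \<le> s\<^sup>2 + t\<^sup>2" if "s \<ge> 0" "t \<ge> 0" for s t :: real
    using sum_squares_bound[of s t] mult_nonneg_nonneg[OF that] by linarith
  then show "AE x in M. norm (cmod (f x) * cmod (g x)) \<le> norm ((cmod (f x))\<^sup>2 + (cmod (g x))\<^sup>2)"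
    by (intro AE_I2) auto
qed

lemma sq_int_mult_integrable:
  assumes [measurable]: "sq_int M f" "sq_int M g"
  shows "integrable M (\<lambda>x. f x * g x)"
  by (rule Bochner_Integration.integrable_bound[OF sq_int_norm_mult_integrable[OF assms]])
     (measurable, simp add: norm_mult)

lemma borel_measurable_cnj:
  assumes "f \<in> borel_measurable M"
  shows "(\<lambda>x. cnj (f x)) \<in> borel_measurable M"
proof -
  have "cnj \<in> borel_measurable borel"
    by (intro borel_measurable_continuous_onI continuous_intros)
  from measurable_compose[OF assms this] show ?thesis .
qed

lemma sq_int_cnj: "sq_int M f \<Longrightarrow> sq_int M (\<lambda>x. cnj (f x))"
  by (simp add: sq_int_def borel_measurable_cnj)

lemma nrm_cnj: "nrm M (\<lambda>x. cnj (f x)) = nrm M f"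
  by (simp add: nrm_def)

lemma sq_int_bdd_mult:
  assumes [measurable]: "sq_int M f" "h \<in> borel_measurable M" and "\<And>x. x \<in> space M \<Longrightarrow> cmod (h x) \<le> B"
  shows "sq_int M (\<lambda>x. h x * f x)" "nrm M (\<lambda>x. h x * f x) \<le> \<bar>B\<bar> * nrm M f"
proof -
  have *: "(cmod (h x * f x))\<^sup>2 \<le> B\<^sup>2 * (cmod (f x))\<^sup>2" if "x \<in> space M" for x
    using assms(3)[OF that] by (simp add: norm_mult power_mult_distrib mult_right_mono power_mono)
  have i: "integrable M (\<lambda>x. B\<^sup>2 * (cmod (f x))\<^sup>2)"
    using sq_int_integrable[OF assms(1)] by simp
  have m: "(\<lambda>x. h x * f x) \<in> borel_measurable M"
    by measurable
  have i2: "integrable M (\<lambda>x. (cmod (h x * f x))\<^sup>2)"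
    by (rule Bochner_Integration.integrable_bound[OF i]) (use m * in \<open>auto intro!: AE_I2\<close>)
  show "sq_int M (\<lambda>x. h x * f x)"
    using m i2 by (simp add: sq_int_def)
  have "(\<integral>x. (cmod (h x * f x))\<^sup>2 \<partial>M) \<le> (\<integral>x. B\<^sup>2 * (cmod (f x))\<^sup>2 \<partial>M)"
    by (rule integral_mono[OF i2 i]) (use * in auto)
  then have "(\<integral>x. (cmod (h x * f x))\<^sup>2 \<partial>M) \<le> B\<^sup>2 * (\<integral>x. (cmod (f x))\<^sup>2 \<partial>M)"
    by simp
  then show "nrm M (\<lambda>x. h x * f x) \<le> \<bar>B\<bar> * nrm M f"
    unfolding nrm_def by (metis real_sqrt_abs real_sqrt_le_iff real_sqrt_mult)
qed

lemma sq_int_cmult: "sq_int M f \<Longrightarrow> sq_int M (\<lambda>x. c * f x)"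
  by (rule sq_int_bdd_mult(1)[where B = "cmod c"]) auto

lemma nrm_cmult: "nrm M (\<lambda>x. c * f x) = cmod c * nrm M f"
  by (simp add: nrm_def norm_mult power_mult_distrib real_sqrt_mult)

lemma sq_int_add:
  assumes [measurable]: "sq_int M f" "sq_int M g"
  shows "sq_int M (\<lambda>x. f x + g x)"
proof -
  have *: "(cmod (f x + g x))\<^sup>2 \<le> 2 * (cmod (f x))\<^sup>2 + 2 * (cmod (g x))\<^sup>2" for x
  proof -
    have "(cmod (f x + g x))\<^sup>2 \<le> (cmod (f x) + cmod (g x))\<^sup>2"
      by (intro power_mono norm_triangle_ineq) auto
    also have "\<dots> \<le> 2 * (cmod (f x))\<^sup>2 + 2 * (cmod (g x))\<^sup>2"
      using sum_squares_bound[of "cmod (f x)" "cmod (g x)"] by (simp add: power2_sum)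
    finally show ?thesis .
  qed
  have i: "integrable M (\<lambda>x. 2 * (cmod (f x))\<^sup>2 + 2 * (cmod (g x))\<^sup>2)"
    using assms by (simp add: sq_int_integrable)
  have "integrable M (\<lambda>x. (cmod (f x + g x))\<^sup>2)"
    by (rule Bochner_Integration.integrable_bound[OF i]) (measurable, use * in simp)
  then show ?thesis
    by (simp add: sq_int_def)
qed

lemma sq_int_diff: "sq_int M f \<Longrightarrow> sq_int M g \<Longrightarrow> sq_int M (\<lambda>x. f x - g x)"
  using sq_int_add[of M f "\<lambda>x. (-1) * g x"] sq_int_cmult[of M g "-1"] by simp

lemma sq_int_zero [simp]: "sq_int M (\<lambda>x. 0)"
  by (simp add: sq_int_def)

lemma sq_int_bounded:
  assumes "finite_measure M" "f \<in> borel_measurable M" "\<And>x. x \<in> space M \<Longrightarrow> cmod (f x) \<le> B"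
  shows "sq_int M f" "nrm M f \<le> \<bar>B\<bar> * sqrt (measure M (space M))"
proof -
  interpret finite_measure M by fact
  have "sq_int M (\<lambda>x. 1)"
    by (simp add: sq_int_def)
  from sq_int_bdd_mult[OF this assms(2,3)]
  show "sq_int M f" "nrm M f \<le> \<bar>B\<bar> * sqrt (measure M (space M))"
    by (simp_all add: nrm_def)
qed

section \<open>Cauchy-Schwarz and triangle inequalities\<close>

text \<open>The best weight in the hypothesis is \<open>t = sqrt B / sqrt A\<close>. Shifting
  \<open>A\<close> and \<open>B\<close> by \<open>e\<close> keeps this weight meaningful when one of
  them vanishes, and \<open>e\<close> tends to 0 at the end.\<close>

lemma le_sqrt_mult_sqrt:
  fixes A B X :: real
  assumes "A \<ge> 0" "B \<ge> 0" "\<And>t. t > 0 \<Longrightarrow> 2 * X \<le> t * A + B / t"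
  shows "X \<le> sqrt A * sqrt B"
proof -
  have "((\<lambda>e. sqrt (A + e) * sqrt (B + e)) \<longlongrightarrow> sqrt (A + 0) * sqrt (B + 0)) (at_right 0)"
    by (intro tendsto_intros)
  moreover have "eventually (\<lambda>e. X \<le> sqrt (A + e) * sqrt (B + e)) (at_right (0::real))"
    unfolding eventually_at_right_field
  proof (intro exI[of _ 1] conjI allI impI)
    fix e :: real assume e: "0 < e" "e < 1"
    define t where "t = sqrt (B + e) / sqrt (A + e)"
    have p: "sqrt (A + e) > 0" "sqrt (B + e) > 0" using assms e by auto
    then have t: "t > 0" by (simp add: t_def)
    have "2 * X \<le> t * A + B / t" by (rule assms(3)[OF t])
    also have "\<dots> \<le> t * (A + e) + (B + e) / t"
      using t e by (intro add_mono mult_left_mono divide_right_mono) auto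
    also have "t * (A + e) = sqrt (B + e) * ((A + e) / sqrt (A + e))"
      by (simp add: t_def)
    also have "(A + e) / sqrt (A + e) = sqrt (A + e)"
      using assms e by (intro real_div_sqrt) auto
    also have "(B + e) / t = (B + e) / sqrt (B + e) * sqrt (A + e)"
      by (simp add: t_def)
    also have "(B + e) / sqrt (B + e) = sqrt (B + e)"
      using assms e by (intro real_div_sqrt) auto
    finally show "X \<le> sqrt (A + e) * sqrt (B + e)" by simp
  qed simp
  ultimately have "X \<le> sqrt (A + 0) * sqrt (B + 0)"
    by (rule tendsto_lowerbound) simp
  then show ?thesis by simp
qed

lemma integral_norm_mult_le:
  assumes "sq_int M f" "sq_int M g"
  shows "(\<integral>x. cmod (f x) * cmod (g x) \<partial>M) \<le> nrm M f * nrm M g"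
  unfolding nrm_def
proof (rule le_sqrt_mult_sqrt)
  fix t :: real assume t: "t > 0"
  have *: "2 * (p * q) \<le> t * p\<^sup>2 + q\<^sup>2 / t" for p q :: real
  proof -
    have "0 \<le> (t * p - q)\<^sup>2 / t" using t by simp
    also have "\<dots> = t * p\<^sup>2 + q\<^sup>2 / t - 2 * (p * q)"
      using t by (simp add: power2_diff power_mult_distrib field_simps power2_eq_square)
    finally show ?thesis by simp
  qed
  have i: "integrable M (\<lambda>x. (cmod (f x))\<^sup>2)" "integrable M (\<lambda>x. (cmod (g x))\<^sup>2)"
    using assms by (simp_all add: sq_int_integrable)
  have "2 * (\<integral>x. cmod (f x) * cmod (g x) \<partial>M) = (\<integral>x. 2 * (cmod (f x) * cmod (g x)) \<partial>M)"
    by simp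
  also have "\<dots> \<le> (\<integral>x. t * (cmod (f x))\<^sup>2 + (cmod (g x))\<^sup>2 / t \<partial>M)"
    by (rule integral_mono)
       (use * in \<open>auto intro!: i sq_int_norm_mult_integrable[OF assms] Bochner_Integration.integrable_add\<close>)
  also have "\<dots> = t * (\<integral>x. (cmod (f x))\<^sup>2 \<partial>M) + (\<integral>x. (cmod (g x))\<^sup>2 \<partial>M) / t"
    using i by simp
  finally show "2 * (\<integral>x. cmod (f x) * cmod (g x) \<partial>M)
      \<le> t * (\<integral>x. (cmod (f x))\<^sup>2 \<partial>M) + (\<integral>x. (cmod (g x))\<^sup>2 \<partial>M) / t" .
qed auto

lemma norm_integral_mult_le:
  assumes "sq_int M f" "sq_int M g"
  shows "cmod (\<integral>x. f x * g x \<partial>M) \<le> nrm M f * nrm M g"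
proof -
  have "cmod (\<integral>x. f x * g x \<partial>M) \<le> (\<integral>x. cmod (f x * g x) \<partial>M)"
    by (rule integral_norm_bound)
  also have "\<dots> = (\<integral>x. cmod (f x) * cmod (g x) \<partial>M)" by (simp add: norm_mult)
  also have "\<dots> \<le> nrm M f * nrm M g" by (rule integral_norm_mult_le[OF assms])
  finally show ?thesis .
qed

lemma nrm_triangle:
  assumes "sq_int M f" "sq_int M g"
  shows "nrm M (\<lambda>x. f x + g x) \<le> nrm M f + nrm M g"
proof -
  have i: "integrable M (\<lambda>x. (cmod (f x))\<^sup>2)" "integrable M (\<lambda>x. (cmod (g x))\<^sup>2)"
    using assms by (simp_all add: sq_int_integrable)
  note ifg = sq_int_norm_mult_integrable[OF assms]
  have "(nrm M (\<lambda>x. f x + g x))\<^sup>2 = (\<integral>x. (cmod (f x + g x))\<^sup>2 \<partial>M)"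
    by (rule nrm_square)
  also have "\<dots> \<le> (\<integral>x. (cmod (f x))\<^sup>2 + 2 * (cmod (f x) * cmod (g x)) + (cmod (g x))\<^sup>2 \<partial>M)"
  proof (rule integral_mono)
    show "integrable M (\<lambda>x. (cmod (f x + g x))\<^sup>2)"
      using sq_int_add[OF assms] by (simp add: sq_int_def)
    show "integrable M (\<lambda>x. (cmod (f x))\<^sup>2 + 2 * (cmod (f x) * cmod (g x)) + (cmod (g x))\<^sup>2)"
      by (intro Bochner_Integration.integrable_add integrable_mult_right i ifg)
    fix x
    have "(cmod (f x + g x))\<^sup>2 \<le> (cmod (f x) + cmod (g x))\<^sup>2"
      by (intro power_mono norm_triangle_ineq) auto
    then show "(cmod (f x + g x))\<^sup>2 \<le> (cmod (f x))\<^sup>2 + 2 * (cmod (f x) * cmod (g x)) + (cmod (g x))\<^sup>2"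
      by (simp add: power2_sum algebra_simps)
  qed
  also have "\<dots> = (nrm M f)\<^sup>2 + 2 * (\<integral>x. cmod (f x) * cmod (g x) \<partial>M) + (nrm M g)\<^sup>2"
    using i ifg by (simp add: nrm_square)
  also have "\<dots> \<le> (nrm M f)\<^sup>2 + 2 * (nrm M f * nrm M g) + (nrm M g)\<^sup>2"
    using integral_norm_mult_le[OF assms] by simp
  also have "\<dots> = (nrm M f + nrm M g)\<^sup>2" by (simp add: power2_sum)
  finally show ?thesis by (rule power2_le_imp_le) simp
qed

lemma nrm_minus_commute: "nrm M (\<lambda>x. f x - g x) = nrm M (\<lambda>x. g x - f x)"
  by (simp add: nrm_def norm_minus_commute)

lemma nrm_triangle_diff:
  assumes "sq_int M f" "sq_int M g" "sq_int M h"
  shows "nrm M (\<lambda>x. f x - h x) \<le> nrm M (\<lambda>x. f x - g x) + nrm M (\<lambda>x. g x - h x)"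
  using nrm_triangle[of M "\<lambda>x. f x - g x" "\<lambda>x. g x - h x"] assms by (simp add: sq_int_diff)

lemma nrm_cong_AE:
  assumes "f \<in> borel_measurable M" "g \<in> borel_measurable M" "AE x in M. f x = g x"
  shows "nrm M f = nrm M g"
  unfolding nrm_def by (intro arg_cong[where f=sqrt] integral_cong_AE) (use assms in auto)

lemma nrm_eq_0_iff:
  assumes "sq_int M f"
  shows "nrm M f = 0 \<longleftrightarrow> (AE x in M. f x = 0)"
  using integral_nonneg_eq_0_iff_AE[of M "\<lambda>x. (cmod (f x))\<^sup>2"] assms
  by (auto simp: nrm_def sq_int_def)

section \<open>Completeness along geometrically convergent sequences\<close>

text \<open>On a finite measure space, increments of geometric size in the norm are also summable in
  mean, so by monotone convergence the telescoping series converges absolutely almost everywhere.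
  Fatou's lemma turns the pointwise limit into a limit in norm with the same geometric rate. On the
  exceptional null set \<open>lim\<close> has some fixed value, and measurability holds
  regardless.\<close>

lemma sq_int_complete:
  assumes "finite_measure M" and f: "\<And>n. sq_int M (f n)" and q: "0 \<le> q" "q < 1"
    and step: "\<And>n. nrm M (\<lambda>x. f (Suc n) x - f n x) \<le> B * q ^ n"
  shows "sq_int M (\<lambda>x. lim (\<lambda>n. f n x))"
    and "nrm M (\<lambda>x. f n x - lim (\<lambda>n. f n x)) \<le> B / (1 - q) * q ^ n"
proof -
  interpret finite_measure M by fact
  have fm[measurable]: "f n \<in> borel_measurable M" for n using f sq_int_def by blast
  have B: "B \<ge> 0" using step[of 0] nrm_nonneg[of M] by (metis mult.right_neutral order_trans power_0)
  define h where "h x = lim (\<lambda>n. f n x)" for x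
  have hm[measurable]: "h \<in> borel_measurable M"
    unfolding h_def by measurable
  define V where "V = nrm M (\<lambda>x. 1)"
  have one: "sq_int M (\<lambda>x. 1)" by (simp add: sq_int_def)
  define d where "d n x = cmod (f (Suc n) x - f n x)" for n x
  have dm[measurable]: "d n \<in> borel_measurable M" for n unfolding d_def by measurable
  have dint: "integrable M (d n)" for n
    using sq_int_norm_mult_integrable[OF sq_int_diff[OF f f] one, of "Suc n" n] by (simp add: d_def[abs_def])
  have dle: "(\<integral>x. d n x \<partial>M) \<le> B * q ^ n * V" for n
  proof -
    have "(\<integral>x. d n x \<partial>M) \<le> nrm M (\<lambda>x. f (Suc n) x - f n x) * V"
      using integral_norm_mult_le[OF sq_int_diff[OF f f] one, of "Suc n" n] by (simp add: d_def[abs_def] V_def)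
    also have "\<dots> \<le> B * q ^ n * V" by (intro mult_right_mono step) (simp add: V_def)
    finally show ?thesis .
  qed
  have "(\<integral>\<^sup>+x. (\<Sum>n. ennreal (d n x)) \<partial>M) = (\<Sum>n. \<integral>\<^sup>+x. ennreal (d n x) \<partial>M)"
    by (rule nn_integral_suminf) auto
  also have "\<dots> = (\<Sum>n. ennreal (\<integral>x. d n x \<partial>M))"
    by (intro suminf_cong nn_integral_eq_integral dint) (auto simp: d_def)
  also have "\<dots> \<le> (\<Sum>n. ennreal (B * q ^ n * V))"
    by (intro suminf_le ennreal_leI dle) auto
  also have "\<dots> = ennreal (\<Sum>n. B * q ^ n * V)"
    using B q by (intro suminf_ennreal2) (auto intro!: summable_mult summable_mult2 summable_geometric simp: V_def)
  also have "\<dots> < \<infinity>" by simp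
  finally have "(\<integral>\<^sup>+x. (\<Sum>n. ennreal (d n x)) \<partial>M) \<noteq> \<infinity>" by simp
  then have "AE x in M. (\<Sum>n. ennreal (d n x)) \<noteq> \<infinity>"
    by (rule nn_integral_PInf_AE[rotated]) measurable
  then have conv: "AE x in M. (\<lambda>n. f n x) \<longlonglongrightarrow> h x"
  proof (rule AE_mp, intro AE_I2 impI)
    fix x assume "(\<Sum>n. ennreal (d n x)) \<noteq> \<infinity>"
    then have "summable (\<lambda>n. d n x)"
      by (intro summable_suminf_not_top) (auto simp: d_def)
    then have "summable (\<lambda>n. f (Suc n) x - f n x)"
      unfolding d_def by (rule summable_norm_cancel)
    then have "convergent (\<lambda>n. \<Sum>i<n. f (Suc i) x - f i x)"
      by (simp add: summable_iff_convergent)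
    then have "convergent (\<lambda>n. f n x - f 0 x)"
      using sum_lessThan_telescope[of "\<lambda>n. f n x"] by simp
    then have "convergent (\<lambda>n. f n x)"
      by (simp add: convergent_diff_const_right_iff)
    then show "(\<lambda>n. f n x) \<longlonglongrightarrow> h x"
      by (simp add: h_def convergent_LIMSEQ_iff)
  qed
  have far: "nrm M (\<lambda>x. f n x - f (n + k) x) \<le> B / (1 - q) * q ^ n" for n k
  proof -
    have "nrm M (\<lambda>x. f n x - f (n + k) x) \<le> (\<Sum>i<k. B * q ^ (n + i))"
    proof (induction k)
      case (Suc k)
      have "nrm M (\<lambda>x. f n x - f (n + Suc k) x)
         \<le> nrm M (\<lambda>x. f n x - f (n + k) x) + nrm M (\<lambda>x. f (n + k) x - f (Suc (n + k)) x)"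
        using nrm_triangle_diff[OF f f f] by simp
      also have "nrm M (\<lambda>x. f (n + k) x - f (Suc (n + k)) x) \<le> B * q ^ (n + k)"
        using step[of "n + k"] by (subst nrm_minus_commute)
      finally show ?case using Suc by simp
    qed (simp add: nrm_def)
    also have "\<dots> = B * q ^ n * (\<Sum>i<k. q ^ i)"
      by (simp add: power_add sum_distrib_left mult.assoc)
    also have "\<dots> \<le> B * q ^ n * (1 / (1 - q))"
    proof (rule mult_left_mono)
      have "(\<Sum>i<k. q ^ i) \<le> (\<Sum>i. q ^ i)"
        using q by (intro sum_le_suminf summable_geometric) auto
      then show "(\<Sum>i<k. q ^ i) \<le> 1 / (1 - q)"
        using q by (simp add: suminf_geometric)
    qed (use B q in auto)
    finally show ?thesis by simp
  qed
  have key: "(\<integral>\<^sup>+x. ennreal ((cmod (f n x - h x))\<^sup>2) \<partial>M) \<le> ennreal ((B / (1 - q) * q ^ n)\<^sup>2)" for n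
  proof -
    have "(\<integral>\<^sup>+x. ennreal ((cmod (f n x - h x))\<^sup>2) \<partial>M)
        = (\<integral>\<^sup>+x. liminf (\<lambda>k. ennreal ((cmod (f n x - f (n + k) x))\<^sup>2)) \<partial>M)"
    proof (rule nn_integral_cong_AE, rule AE_mp[OF conv], intro AE_I2 impI)
      fix x assume "(\<lambda>n. f n x) \<longlonglongrightarrow> h x"
      then have "(\<lambda>k. f (n + k) x) \<longlonglongrightarrow> h x"
        using LIMSEQ_ignore_initial_segment[of "\<lambda>n. f n x" "h x" n] by (simp add: add.commute)
      then have "(\<lambda>k. ennreal ((cmod (f n x - f (n + k) x))\<^sup>2)) \<longlonglongrightarrow> ennreal ((cmod (f n x - h x))\<^sup>2)"
        by (intro tendsto_intros)
      from lim_imp_Liminf[OF _ this]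
      show "ennreal ((cmod (f n x - h x))\<^sup>2) = liminf (\<lambda>k. ennreal ((cmod (f n x - f (n + k) x))\<^sup>2))"
        by simp
    qed
    also have "\<dots> \<le> liminf (\<lambda>k. \<integral>\<^sup>+x. ennreal ((cmod (f n x - f (n + k) x))\<^sup>2) \<partial>M)"
      by (rule nn_integral_liminf) measurable
    also have "\<dots> \<le> ennreal ((B / (1 - q) * q ^ n)\<^sup>2)"
    proof -
      have "(\<integral>\<^sup>+x. ennreal ((cmod (f n x - f (n + k) x))\<^sup>2) \<partial>M) \<le> ennreal ((B / (1 - q) * q ^ n)\<^sup>2)" for k
      proof -
        have "(\<integral>\<^sup>+x. ennreal ((cmod (f n x - f (n + k) x))\<^sup>2) \<partial>M) = ennreal ((nrm M (\<lambda>x. f n x - f (n + k) x))\<^sup>2)"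
          unfolding nrm_square
          by (rule nn_integral_eq_integral) (use sq_int_diff[OF f f] in \<open>auto simp: sq_int_def\<close>)
        then show ?thesis
          using far[of n k] by (simp add: ennreal_leI power_mono)
      qed
      then have "liminf (\<lambda>k. \<integral>\<^sup>+x. ennreal ((cmod (f n x - f (n + k) x))\<^sup>2) \<partial>M) \<le> liminf (\<lambda>k. ennreal ((B / (1 - q) * q ^ n)\<^sup>2))"
        by (intro Liminf_mono) simp
      then show ?thesis by (simp add: Liminf_const)
    qed
    finally show ?thesis .
  qed
  have i: "integrable M (\<lambda>x. (cmod (f n x - h x))\<^sup>2)" for n
    by (rule integrableI_bounded) (use le_less_trans[OF key[of n]] in auto)
  have sqd: "sq_int M (\<lambda>x. f n x - h x)" for n
    using i by (simp add: sq_int_def)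
  \<comment> \<open>Only differences from the limit are controlled so far; the limit itself is
    recovered from the first of them.\<close>
  have "sq_int M (\<lambda>x. f 0 x - (f 0 x - h x))" by (rule sq_int_diff[OF f sqd])
  then show "sq_int M (\<lambda>x. lim (\<lambda>n. f n x))" by (simp add: h_def[abs_def])
  have "ennreal ((nrm M (\<lambda>x. f n x - h x))\<^sup>2) \<le> ennreal ((B / (1 - q) * q ^ n)\<^sup>2)"
    unfolding nrm_square using key[of n] by (subst (asm) nn_integral_eq_integral[OF i]) auto
  then have "(nrm M (\<lambda>x. f n x - h x))\<^sup>2 \<le> (B / (1 - q) * q ^ n)\<^sup>2"
    by simp
  then have "nrm M (\<lambda>x. f n x - h x) \<le> B / (1 - q) * q ^ n"
    by (rule power2_le_imp_le) (use B q in auto)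
  then show "nrm M (\<lambda>x. f n x - lim (\<lambda>n. f n x)) \<le> B / (1 - q) * q ^ n"
    by (simp add: h_def[abs_def])
qed

section \<open>Integration over the torus\<close>

lemma distr_lebesgue_translate: "distr lebesgue lebesgue (\<lambda>x. x + t) = (lebesgue :: 'a::euclidean_space measure)"
proof -
  have "lebesgue = density (distr lebesgue lebesgue (\<lambda>x::'a. t + (\<Sum>j\<in>Basis. (1 * (x \<bullet> j)) *\<^sub>R j))) (\<lambda>_. (\<Prod>j\<in>(Basis::'a set). \<bar>1::real\<bar>))"
    by (rule lebesgue_affine_euclidean) auto
  then show ?thesis
    by (simp add: euclidean_representation add.commute density_1 ennreal_1)
qed

lemma measurable_translate: "(\<lambda>x::'a::euclidean_space. x + t) \<in> lebesgue \<rightarrow>\<^sub>M lebesgue"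
proof -
  have "(\<lambda>x::'a. t + (\<Sum>j\<in>Basis. (1 * (x \<bullet> j)) *\<^sub>R j)) \<in> lebesgue \<rightarrow>\<^sub>M lebesgue"
    by (rule lebesgue_affine_measurable) auto
  then show ?thesis
    by (simp add: euclidean_representation add.commute)
qed

lemma borel_measurable_translate:
  "f \<in> borel_measurable lebesgue \<Longrightarrow> (\<lambda>x::'a::euclidean_space. f (x + t)) \<in> borel_measurable lebesgue"
  by (rule measurable_compose[OF measurable_translate])

lemma integral_translate:
  fixes f :: "'a::euclidean_space \<Rightarrow> 'b::{banach, second_countable_topology}"
  assumes "f \<in> borel_measurable lebesgue"
  shows "(\<integral>x. f (x + t) \<partial>lebesgue) = (\<integral>x. f x \<partial>lebesgue)"
  using integral_distr[OF measurable_translate[of t] assms] by (simp add: distr_lebesgue_translate)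

lemma integrable_translate_iff:
  fixes f :: "'a::euclidean_space \<Rightarrow> 'b::{banach, second_countable_topology}"
  assumes "f \<in> borel_measurable lebesgue"
  shows "integrable lebesgue (\<lambda>x. f (x + t)) \<longleftrightarrow> integrable lebesgue f"
  using integrable_distr_eq[OF measurable_translate[of t] assms] by (simp add: distr_lebesgue_translate)

section \<open>Lattice translates and the fundamental cell\<close>

lemma int_vec_add: "int_vec (m + k) = int_vec m + int_vec k"
  by (simp add: int_vec_def vec_eq_iff)

lemma int_vec_minus: "int_vec (- m) = - int_vec m"
  by (simp add: int_vec_def vec_eq_iff)

lemma int_vec_0 [simp]: "int_vec 0 = 0"
  by (simp add: int_vec_def vec_eq_iff)

lemma int_vec_nth [simp]: "int_vec m $ i = real_of_int (m $ i)"
  by (simp add: int_vec_def)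

lemma periodic_shift_axis:
  assumes "periodic L f"
  shows "f (x + (L * real_of_int k) *\<^sub>R axis i 1) = f x"
proof (induction k rule: int_induct[of _ 0])
  case (step1 k)
  have "f (x + (L * real_of_int (k + 1)) *\<^sub>R axis i 1) = f ((x + (L * real_of_int k) *\<^sub>R axis i 1) + L *\<^sub>R axis i 1)"
    by (simp add: algebra_simps)
  also have "\<dots> = f x" using assms step1 by (simp add: periodic_def)
  finally show ?case .
next
  case (step2 k)
  have "f (x + (L * real_of_int (k - 1)) *\<^sub>R axis i 1) = f ((x + (L * real_of_int (k - 1)) *\<^sub>R axis i 1) + L *\<^sub>R axis i 1)"
    using assms by (simp only: periodic_def)
  also have "\<dots> = f (x + (L * real_of_int k) *\<^sub>R axis i 1)"
    by (simp add: algebra_simps)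
  finally show ?case using step2 by simp
qed simp

lemma periodic_shift:
  fixes f :: "real^'n \<Rightarrow> 'b"
  assumes "periodic L f"
  shows "f (x + L *\<^sub>R int_vec m) = f x"
proof -
  have "f (x + (\<Sum>i\<in>I. (L * real_of_int (m $ i)) *\<^sub>R axis i 1)) = f x" if "finite I" for I
    using that
  proof (induction I)
    case (insert i I)
    have "f (x + (\<Sum>i\<in>insert i I. (L * real_of_int (m $ i)) *\<^sub>R axis i 1))
        = f ((x + (\<Sum>i\<in>I. (L * real_of_int (m $ i)) *\<^sub>R axis i 1)) + (L * real_of_int (m $ i)) *\<^sub>R axis i 1)"
      using insert by (simp add: algebra_simps)
    then show ?case using insert periodic_shift_axis[OF assms] by simp
  qed simp
  moreover have "(\<Sum>i\<in>UNIV. (L * real_of_int (m $ i)) *\<^sub>R axis i 1) = L *\<^sub>R int_vec m"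
    by (simp add: vec_eq_iff axis_def if_distrib[of "\<lambda>t. _ * t"] cong: if_cong)
  ultimately show ?thesis by (metis finite)
qed

definition int_floor :: "real \<Rightarrow> real^'n \<Rightarrow> int^'n" where
  "int_floor L x = (\<chi> i. \<lfloor>x $ i / L\<rfloor>)"

lemma mem_cell_iff:
  assumes "L > 0"
  shows "x - L *\<^sub>R int_vec m \<in> cell L \<longleftrightarrow> m = int_floor L x"
proof -
  have "0 \<le> x $ i - L * real_of_int k \<and> x $ i - L * real_of_int k < L \<longleftrightarrow> k = \<lfloor>x $ i / L\<rfloor>" for i k
  proof -
    have "0 \<le> x $ i - L * real_of_int k \<and> x $ i - L * real_of_int k < L \<longleftrightarrow> real_of_int k \<le> x $ i / L \<and> x $ i / L < real_of_int k + 1"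
      using assms by (simp add: field_simps)
    also have "\<dots> \<longleftrightarrow> k = \<lfloor>x $ i / L\<rfloor>"
      by linarith
    finally show ?thesis .
  qed
  then show ?thesis
    by (simp add: cell_def int_floor_def vec_eq_iff)
qed

lemma mem_cell_plus_iff:
  assumes "L > 0"
  shows "x + L *\<^sub>R int_vec m \<in> cell L \<longleftrightarrow> m = - int_floor L x"
  using mem_cell_iff[OF assms, of x "- m"] by (simp add: int_vec_minus) (metis minus_minus)

lemma cell_borel [measurable]: "cell L \<in> sets borel"
proof -
  have eq: "cell L = (\<Inter>i. {x. 0 \<le> x $ i} \<inter> {x. x $ i < L})"
    by (auto simp: cell_def)
  show ?thesis
    unfolding eq by (intro sets.finite_INT sets.Int)
      (auto intro!: borel_closed borel_open closed_Collect_le open_Collect_less continuous_intros)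
qed

lemma cell_lebesgue [measurable, simp]: "cell L \<in> sets lebesgue"
  by (rule sets_completionI_sets) simp

lemma norm_cell_le:
  assumes "x \<in> cell L"
  shows "norm (x::real^'n) \<le> L * real CARD('n)"
proof -
  have "norm x \<le> (\<Sum>i\<in>UNIV. \<bar>x $ i\<bar>)" by (rule norm_le_l1_cart)
  also have "\<dots> \<le> (\<Sum>i\<in>(UNIV::'n set). L)"
  proof (rule sum_mono)
    fix i
    have "0 \<le> x $ i" "x $ i < L" using assms by (auto simp: cell_def)
    then show "\<bar>x $ i\<bar> \<le> L" by linarith
  qed
  finally show ?thesis by (simp add: mult.commute)
qed

lemma measure_cell:
  assumes "L > 0"
  shows "(cell L :: (real^'n) set) \<in> lmeasurable" "measure lebesgue (cell L :: (real^'n) set) = L ^ CARD('n)"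
proof -
  let ?a = "0 :: real^'n" and ?b = "(\<chi> i. L) :: real^'n"
  have 1: "box ?a ?b \<subseteq> cell L" "cell L \<subseteq> cbox ?a ?b"
    by (auto simp: cell_def mem_box_cart less_imp_le)
  have c: "measure lborel (cbox ?a ?b) = L ^ CARD('n)"
    using assms by (subst content_cbox_cart) (auto simp: interval_eq_empty_cart dest: less_asym)
  show lm: "cell L \<in> (lmeasurable :: (real^'n) set set)"
    using bounded_set_imp_lmeasurable[OF bounded_subset[OF bounded_cbox 1(2)] cell_lebesgue] .
  have "measure lebesgue (box ?a ?b) \<le> measure lebesgue (cell L :: (real^'n) set)"
    using 1 lm by (intro measure_mono_fmeasurable) auto
  moreover have "measure lebesgue (cell L :: (real^'n) set) \<le> measure lebesgue (cbox ?a ?b)"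
    using 1 by (intro measure_mono_fmeasurable) auto
  moreover have "measure lebesgue (box ?a ?b) = measure lborel (cbox ?a ?b)" 
    by (simp add: measure_lborel_box_eq measure_lborel_cbox_eq)
  ultimately show "measure lebesgue (cell L :: (real^'n) set) = L ^ CARD('n)"
    using c by simp
qed

abbreviation torus :: "real \<Rightarrow> (real^'n) measure" where
  "torus L \<equiv> lebesgue_on (cell L)"

lemma finite_measure_torus: "L > 0 \<Longrightarrow> finite_measure (torus L)"
  by (rule finite_measure_lebesgue_on) (rule measure_cell)

lemma measure_torus: "L > 0 \<Longrightarrow> measure (torus L) (space (torus L :: (real^'n) measure)) = L ^ CARD('n)"
  using measure_cell(2)[where ?'n = 'n] by (simp add: measure_restrict_space)

lemma integral_torus:
  fixes f :: "real^'n \<Rightarrow> 'b::{banach, second_countable_topology}"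
  shows "(\<integral>x. f x \<partial>torus L) = (LINT x:cell L|lebesgue. f x)"
  by (simp add: integral_restrict_space set_lebesgue_integral_def)

lemma integrable_torus:
  fixes f :: "real^'n \<Rightarrow> 'b::{banach, second_countable_topology}"
  shows "integrable (torus L) f \<longleftrightarrow> set_integrable lebesgue (cell L) f"
  by (simp add: integrable_restrict_space set_integrable_def)

lemma measurable_torus: "f \<in> borel_measurable lebesgue \<Longrightarrow> f \<in> borel_measurable (torus L)"
  by (rule measurable_restrict_space1)

lemma finite_int_box: "finite {m::int^'n. \<forall>i. \<bar>m $ i\<bar> \<le> N}"
proof (rule finite_subset)
  show "{m::int^'n. \<forall>i. \<bar>m $ i\<bar> \<le> N} \<subseteq> (\<lambda>f. \<chi> i. f i) ` (PiE UNIV (\<lambda>_. {-N..N}))"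
  proof
    fix m :: "int^'n" assume "m \<in> {m. \<forall>i. \<bar>m $ i\<bar> \<le> N}"
    then have "(\<lambda>i. m $ i) \<in> PiE UNIV (\<lambda>_. {-N..N})"
      by (auto simp: abs_le_iff minus_le_iff)
    moreover have "m = (\<chi> i. m $ i)" by simp
    ultimately show "m \<in> (\<lambda>f. \<chi> i. f i) ` (PiE UNIV (\<lambda>_. {-N..N}))" by blast
  qed
  show "finite ((\<lambda>f. \<chi> i. f i :: int^'n) ` (PiE UNIV (\<lambda>_. {-N..N})))"
    by (intro finite_imageI finite_PiE) auto
qed

text \<open>Lattice sums of a function supported in a ball of radius \<open>R\<close> thereby become
  finite sums with an index set that is uniform for \<open>y\<close> in a ball, in particular over
  the fundamental cell.\<close>

lemma finitely_many_translates:
  assumes "L > 0"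
  obtains M :: "(int^'n) set" where "finite M"
    "\<And>y m. norm y \<le> r \<Longrightarrow> norm (y + L *\<^sub>R int_vec m) \<le> R \<Longrightarrow> m \<in> M"
proof
  let ?N = "\<lceil>(r + R) / L\<rceil>"
  show "finite {m::int^'n. \<forall>i. \<bar>m $ i\<bar> \<le> ?N}" by (rule finite_int_box)
  fix y :: "real^'n" and m assume *: "norm y \<le> r" "norm (y + L *\<^sub>R int_vec m) \<le> R"
  have "\<bar>m $ i\<bar> \<le> ?N" for i
  proof -
    have "norm (L *\<^sub>R int_vec m) \<le> norm (y + L *\<^sub>R int_vec m) + norm y"
      by (metis add_diff_cancel_left' norm_triangle_ineq4)
    moreover have "\<bar>(L *\<^sub>R int_vec m) $ i\<bar> \<le> norm (L *\<^sub>R int_vec m)" by (rule component_le_norm_cart)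
    ultimately have "\<bar>(L *\<^sub>R int_vec m) $ i\<bar> \<le> r + R"
      using * by linarith
    then have "L * \<bar>real_of_int (m $ i)\<bar> \<le> r + R"
      using assms by (simp add: abs_mult)
    then have "\<bar>real_of_int (m $ i)\<bar> \<le> (r + R) / L"
      using assms by (simp add: field_simps)
    then show ?thesis by linarith
  qed
  then show "m \<in> {m. \<forall>i. \<bar>m $ i\<bar> \<le> ?N}" by simp
qed

section \<open>Unfolding integrals over space into integrals over the torus\<close>

text \<open>The translates of the cell tile space, so exactly one indicator equals 1 at
  \<open>x\<close>; the hypothesis puts its index into \<open>M\<close> whenever \<open>F x\<close>
  is nonzero.\<close>

lemma sum_cell_translates:
  fixes F :: "real^'n \<Rightarrow> 'b::real_vector"
  assumes "L > 0" "finite M" "\<And>y m. y \<in> cell L \<Longrightarrow> F (y + L *\<^sub>R int_vec m) \<noteq> 0 \<Longrightarrow> m \<in> M"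
  shows "F x = (\<Sum>m\<in>M. indicator (cell L) (x - L *\<^sub>R int_vec m) *\<^sub>R F x)"
proof -
  define m where "m = int_floor L x"
  have eq: "indicator (cell L) (x - L *\<^sub>R int_vec k) *\<^sub>R F x = (if k = m then F x else 0)" for k
    using mem_cell_iff[OF assms(1), of x k] by (auto simp: m_def indicator_def)
  show ?thesis
  proof (cases "F x = 0")
    case False
    have "x - L *\<^sub>R int_vec m \<in> cell L" using mem_cell_iff[OF assms(1)] m_def by blast
    from assms(3)[OF this, of m] False have "m \<in> M" by simp
    then show ?thesis using assms(2) unfolding eq by simp
  qed simp
qed

lemma integrable_unfold:
  fixes F :: "real^'n \<Rightarrow> 'b::{banach, second_countable_topology}"
  assumes L: "L > 0" and R: "\<And>x. norm x > R \<Longrightarrow> F x = 0" and F: "F \<in> borel_measurable lebesgue"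
    and i: "\<And>m. integrable (torus L) (\<lambda>y. F (y + L *\<^sub>R int_vec m))"
  shows "integrable lebesgue F"
proof -
  obtain M :: "(int^'n) set" where M: "finite M"
    "\<And>y m. norm y \<le> L * real CARD('n) \<Longrightarrow> norm (y + L *\<^sub>R int_vec m) \<le> R \<Longrightarrow> m \<in> M"
    using finitely_many_translates[OF L] by metis
  have eq: "F x = (\<Sum>m\<in>M. indicator (cell L) (x - L *\<^sub>R int_vec m) *\<^sub>R F x)" for x
    by (rule sum_cell_translates[OF L M(1)]) (meson M(2) R norm_cell_le not_le)
  have "integrable lebesgue (\<lambda>x. indicator (cell L) (x - L *\<^sub>R int_vec m) *\<^sub>R F x)" for m
  proof -
    have "integrable lebesgue (\<lambda>x. indicator (cell L) x *\<^sub>R F (x + L *\<^sub>R int_vec m))"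
      using i[of m] by (simp add: integrable_restrict_space)
    moreover have "(\<lambda>x. indicator (cell L) x *\<^sub>R F (x + L *\<^sub>R int_vec m)) \<in> borel_measurable lebesgue"
      using borel_measurable_translate[OF F] by measurable
    ultimately show ?thesis
      using integrable_translate_iff[of "\<lambda>x. indicator (cell L) x *\<^sub>R F (x + L *\<^sub>R int_vec m)" "- (L *\<^sub>R int_vec m)"]
      by simp
  qed
  then have "integrable lebesgue (\<lambda>x. \<Sum>m\<in>M. indicator (cell L) (x - L *\<^sub>R int_vec m) *\<^sub>R F x)"
    by (intro Bochner_Integration.integrable_sum)
  then show ?thesis by (simp flip: eq)
qed

text \<open>Cut space into cells and move each back to the fundamental cell. Bounded support leaves
  finitely many of them, so the exchange of sum and integral is a finite one.\<close>

lemma integral_unfold: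
  fixes F :: "real^'n \<Rightarrow> 'b::{banach, second_countable_topology}"
  assumes L: "L > 0" and R: "\<And>x. norm x > R \<Longrightarrow> F x = 0" and F: "integrable lebesgue F"
  shows "integrable (torus L) (\<lambda>y. \<Sum>\<^sub>\<infinity>m. F (y + L *\<^sub>R int_vec m))"
    and "(\<integral>x. F x \<partial>lebesgue) = (\<integral>y. (\<Sum>\<^sub>\<infinity>m. F (y + L *\<^sub>R int_vec m)) \<partial>torus L)"
proof -
  obtain M :: "(int^'n) set" where M: "finite M"
    "\<And>y m. norm y \<le> L * real CARD('n) \<Longrightarrow> norm (y + L *\<^sub>R int_vec m) \<le> R \<Longrightarrow> m \<in> M"
    using finitely_many_translates[OF L] by metis
  have M2: "y \<in> cell L \<Longrightarrow> F (y + L *\<^sub>R int_vec m) \<noteq> 0 \<Longrightarrow> m \<in> M" for y m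
    by (meson M(2) R norm_cell_le not_le)
  have eq: "F x = (\<Sum>m\<in>M. indicator (cell L) (x - L *\<^sub>R int_vec m) *\<^sub>R F x)" for x
    by (rule sum_cell_translates[OF L M(1) M2])
  have Fm: "F \<in> borel_measurable lebesgue" using F by auto
  have m0: "(\<lambda>x. indicator (cell L) x *\<^sub>R F (x + L *\<^sub>R int_vec m)) \<in> borel_measurable lebesgue" for m
    using borel_measurable_translate[OF Fm] by measurable
  have i0: "integrable lebesgue (\<lambda>x. indicator (cell L) x *\<^sub>R F (x + L *\<^sub>R int_vec m))" for m
  proof -
    have "integrable lebesgue (\<lambda>x. F (x + L *\<^sub>R int_vec m))"
      using F integrable_translate_iff[OF Fm] by simp
    then show ?thesis by (intro integrable_mult_indicator) auto
  qed
  have i1: "integrable lebesgue (\<lambda>x. indicator (cell L) (x - L *\<^sub>R int_vec m) *\<^sub>R F x)"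
   and e1: "(\<integral>x. indicator (cell L) (x - L *\<^sub>R int_vec m) *\<^sub>R F x \<partial>lebesgue) = (\<integral>y. F (y + L *\<^sub>R int_vec m) \<partial>torus L)" for m
    using i0[of m] integrable_translate_iff[OF m0[of m], of "- (L *\<^sub>R int_vec m)"]
      integral_translate[OF m0[of m], of "- (L *\<^sub>R int_vec m)"]
    by (simp_all add: integral_restrict_space)
  have sumeq: "(\<Sum>\<^sub>\<infinity>m. F (y + L *\<^sub>R int_vec m)) = (\<Sum>m\<in>M. F (y + L *\<^sub>R int_vec m))" if "y \<in> cell L" for y
  proof -
    have "(\<Sum>\<^sub>\<infinity>m. F (y + L *\<^sub>R int_vec m)) = (\<Sum>\<^sub>\<infinity>m\<in>M. F (y + L *\<^sub>R int_vec m))"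
      by (rule infsum_cong_neutral) (use M2[OF that] in auto)
    then show ?thesis using M(1) by simp
  qed
  have i2: "integrable (torus L) (\<lambda>y. F (y + L *\<^sub>R int_vec m))" for m
    using i0[of m] by (simp add: integrable_restrict_space)
  have "integrable (torus L) (\<lambda>y. \<Sum>m\<in>M. F (y + L *\<^sub>R int_vec m))"
    by (intro Bochner_Integration.integrable_sum i2)
  then show "integrable (torus L) (\<lambda>y. \<Sum>\<^sub>\<infinity>m. F (y + L *\<^sub>R int_vec m))"
    by (subst Bochner_Integration.integrable_cong[OF refl sumeq]) auto
  have "(\<integral>x. F x \<partial>lebesgue) = (\<integral>x. (\<Sum>m\<in>M. indicator (cell L) (x - L *\<^sub>R int_vec m) *\<^sub>R F x) \<partial>lebesgue)"
    by (rule Bochner_Integration.integral_cong[OF refl eq])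
  also have "\<dots> = (\<Sum>m\<in>M. (\<integral>y. F (y + L *\<^sub>R int_vec m) \<partial>torus L))"
    by (subst Bochner_Integration.integral_sum[OF i1]) (simp add: e1)
  also have "\<dots> = (\<integral>y. (\<Sum>m\<in>M. F (y + L *\<^sub>R int_vec m)) \<partial>torus L)"
    by (subst Bochner_Integration.integral_sum[OF i2]) simp
  also have "\<dots> = (\<integral>y. (\<Sum>\<^sub>\<infinity>m. F (y + L *\<^sub>R int_vec m)) \<partial>torus L)"
    by (rule Bochner_Integration.integral_cong[OF refl]) (simp add: sumeq)
  finally show "(\<integral>x. F x \<partial>lebesgue) = (\<integral>y. (\<Sum>\<^sub>\<infinity>m. F (y + L *\<^sub>R int_vec m)) \<partial>torus L)" .
qed

text \<open>The shifted cell is another fundamental domain: unfolding \<open>f\<close> restricted to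
  it returns \<open>f\<close>, because each point has exactly one lattice translate in the shifted
  cell.\<close>

lemma integral_torus_translate:
  fixes f :: "real^'n \<Rightarrow> 'b::{banach, second_countable_topology}"
  assumes L: "L > 0" and p: "periodic L f" and f: "f \<in> borel_measurable lebesgue"
    and i: "integrable (torus L) f"
  shows "(\<integral>x. f (x + t) \<partial>torus L) = (\<integral>x. f x \<partial>torus L)"
proof -
  define F where "F x = indicator (cell L) (x - t) *\<^sub>R f x" for x
  have ind: "(\<lambda>x. indicat_real (cell L) (x - t)) \<in> borel_measurable lebesgue" for t
    using borel_measurable_translate[of "indicat_real (cell L)" "-t"] by simp
  have Fm: "F \<in> borel_measurable lebesgue"
    unfolding F_def by (intro borel_measurable_scaleR ind f)
  have R: "F x = 0" if "norm x > L * real CARD('n) + norm t" for x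
  proof -
    have "x - t \<notin> cell L"
      using norm_cell_le[of "x - t" L] that norm_triangle_ineq2[of x t] by auto
    then show ?thesis by (simp add: F_def)
  qed
  have "integrable (torus L) (\<lambda>y. F (y + L *\<^sub>R int_vec m))" for m
  proof (rule Bochner_Integration.integrable_bound[OF i])
    show "(\<lambda>y. F (y + L *\<^sub>R int_vec m)) \<in> borel_measurable (torus L)"
      by (intro measurable_torus borel_measurable_translate Fm)
    show "AE x in torus L. norm (F (x + L *\<^sub>R int_vec m)) \<le> norm (f x)"
      by (intro AE_I2) (simp add: F_def periodic_shift[OF p] indicator_def)
  qed
  from integrable_unfold[OF L R Fm this] have Fi: "integrable lebesgue F" by simp
  have "(\<integral>x. f (x + t) \<partial>torus L) = (\<integral>x. F (x + t) \<partial>lebesgue)"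
    by (simp add: F_def integral_restrict_space)
  also have "\<dots> = (\<integral>x. F x \<partial>lebesgue)" by (rule integral_translate[OF Fm])
  also have "\<dots> = (\<integral>y. (\<Sum>\<^sub>\<infinity>m. F (y + L *\<^sub>R int_vec m)) \<partial>torus L)"
    by (rule integral_unfold[OF L R Fi]) simp
  also have "\<dots> = (\<integral>y. f y \<partial>torus L)"
  proof (rule Bochner_Integration.integral_cong[OF refl])
    fix y
    have "F (y + L *\<^sub>R int_vec m) = (if m = - int_floor L (y - t) then f y else 0)" for m
    proof -
      have "y + L *\<^sub>R int_vec m - t = (y - t) + L *\<^sub>R int_vec m" by simp
      then have "y + L *\<^sub>R int_vec m - t \<in> cell L \<longleftrightarrow> m = - int_floor L (y - t)"
        using mem_cell_plus_iff[OF L, of "y - t" m] by presburger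
      then show ?thesis
        by (auto simp: F_def periodic_shift[OF p] indicator_def)
    qed
    then have "(\<Sum>\<^sub>\<infinity>m. F (y + L *\<^sub>R int_vec m)) = (\<Sum>\<^sub>\<infinity>m\<in>{- int_floor L (y - t)}. f y)"
      by (intro infsum_cong_neutral) auto
    then show "(\<Sum>\<^sub>\<infinity>m. F (y + L *\<^sub>R int_vec m)) = f y" by simp
  qed
  finally show ?thesis .
qed

text \<open>Space is a countable union of translated cells, and translations preserve null
  sets.\<close>

lemma AE_periodic:
  fixes P :: "real^'n \<Rightarrow> bool"
  assumes L: "L > 0" and p: "periodic L P" and ae: "AE x in torus L. P x"
  shows "AE x in lebesgue. P x"
proof -
  have ae': "AE x in lebesgue. x \<in> cell L \<longrightarrow> P x"
    using ae by (simp add: AE_restrict_space_iff)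
  have "AE x in lebesgue. x - L *\<^sub>R int_vec m \<in> cell L \<longrightarrow> P (x - L *\<^sub>R int_vec m)" for m
  proof -
    have "AE x in distr lebesgue lebesgue (\<lambda>x. x + - (L *\<^sub>R int_vec m)). x \<in> cell L \<longrightarrow> P x"
      unfolding distr_lebesgue_translate by (rule ae')
    from AE_distrD[OF measurable_translate this] show ?thesis by simp
  qed
  then have "AE x in lebesgue. \<forall>m\<in>UNIV. x - L *\<^sub>R int_vec m \<in> cell L \<longrightarrow> P (x - L *\<^sub>R int_vec m)"
    by (intro AE_ball_countable') auto
  then show ?thesis
  proof (rule AE_mp, intro AE_I2 impI)
    fix x assume "\<forall>m\<in>UNIV. x - L *\<^sub>R int_vec m \<in> cell L \<longrightarrow> P (x - L *\<^sub>R int_vec m)"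
    then have "P (x - L *\<^sub>R int_vec (int_floor L x))"
      using mem_cell_iff[OF L] by blast
    then show "P x"
      using periodic_shift[OF p, of x "- int_floor L x"] by (simp add: int_vec_minus)
  qed
qed

section \<open>Fourier series\<close>

definition expo :: "real \<Rightarrow> int^'n \<Rightarrow> real^'n \<Rightarrow> complex" where
  "expo L m x = cis (freq L m \<bullet> x)"

lemma freq_add: "freq L (m + k) = freq L m + freq L k"
  by (simp add: freq_def int_vec_add scaleR_add_right)

lemma freq_minus: "freq L (- m) = - freq L m"
  by (simp add: freq_def int_vec_minus)

lemma freq_nth: "freq L m $ i = 2 * pi / L * real_of_int (m $ i)"
  by (simp add: freq_def)

lemma norm_expo [simp]: "cmod (expo L m x) = 1"
  by (simp add: expo_def)

lemma expo_mult: "expo L m x * expo L k x = expo L (m + k) x"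
  by (simp add: expo_def freq_add inner_add_left cis_mult)

lemma cnj_expo: "cnj (expo L m x) = expo L (- m) x"
  by (simp add: expo_def freq_minus cis_cnj)

lemma expo_0 [simp]: "expo L 0 x = 1"
  by (simp add: expo_def freq_def)

lemma expo_translate: "expo L m (x + t) = expo L m x * cis (freq L m \<bullet> t)"
  by (simp add: expo_def inner_add_right cis_mult)

lemma continuous_on_expo: "continuous_on A (expo L m)"
  unfolding expo_def[abs_def] by (intro continuous_intros)

lemma lebesgue_measurable_if_continuous:
  fixes f :: "'a::euclidean_space \<Rightarrow> 'b::topological_space"
  assumes "continuous_on UNIV f"
  shows "f \<in> borel_measurable lebesgue"
proof (rule measurable_completion)
  show "f \<in> borel_measurable lborel"
    using borel_measurable_continuous_onI[OF assms] by simp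
qed

lemma borel_measurable_expo: "expo L m \<in> borel_measurable lebesgue"
  by (rule lebesgue_measurable_if_continuous[OF continuous_on_expo])

lemma periodic_expo:
  assumes "L > 0"
  shows "periodic L (expo L m)"
  unfolding periodic_def
proof (intro allI)
  fix i x
  have "freq L m \<bullet> (L *\<^sub>R axis i 1) = 2 * pi * real_of_int (m $ i)"
    using assms by (simp add: freq_def inner_axis)
  then have "cis (freq L m \<bullet> (L *\<^sub>R axis i 1)) = 1"
    by (simp only: cis_multiple_2pi Ints_of_int)
  then show "expo L m (x + L *\<^sub>R axis i 1) = expo L m x"
    by (simp add: expo_translate)
qed

lemma integrable_mult_expo:
  assumes "integrable (torus L) f"
  shows "integrable (torus L) (\<lambda>x. f x * expo L m x)"
proof (rule Bochner_Integration.integrable_bound[OF assms])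
  show "(\<lambda>x. f x * expo L m x) \<in> borel_measurable (torus L)"
    using assms measurable_torus[OF borel_measurable_expo] by (intro borel_measurable_times) auto
qed (simp add: norm_mult)

section \<open>Trigonometric polynomials and uniqueness of Fourier coefficients\<close>

text \<open>Generating the class from exponentials and sums, with repeated frequencies allowed,
  makes closure under products and the orthogonality argument plain inductions.\<close>

inductive trig_polynomial :: "real \<Rightarrow> (real^'n \<Rightarrow> complex) \<Rightarrow> bool" for L where
  expo: "trig_polynomial L (\<lambda>x. c * expo L m x)"
| add: "trig_polynomial L f \<Longrightarrow> trig_polynomial L g \<Longrightarrow> trig_polynomial L (\<lambda>x. f x + g x)"

lemma trig_polynomial_mult_expo:
  assumes "trig_polynomial L g"
  shows "trig_polynomial L (\<lambda>x. (c * expo L m x) * g x)"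
  using assms
proof induction
  case (expo d k)
  have "(\<lambda>x. (c * expo L m x) * (d * expo L k x)) = (\<lambda>x. (c * d) * expo L (m + k) x)"
    by (simp add: fun_eq_iff flip: expo_mult)
  then show ?case by (simp only: trig_polynomial.expo)
next
  case (add f g)
  then show ?case by (simp only: distrib_left trig_polynomial.add)
qed

lemma trig_polynomial_mult:
  assumes "trig_polynomial L f" "trig_polynomial L g"
  shows "trig_polynomial L (\<lambda>x. f x * g x)"
  using assms(1)
proof induction
  case (expo d k)
  then show ?case by (rule trig_polynomial_mult_expo[OF assms(2)])
next
  case (add f g)
  then show ?case by (simp only: distrib_right trig_polynomial.add)
qed

lemma trig_polynomial_const: "trig_polynomial L (\<lambda>x. c)"
  using trig_polynomial.expo[of L c 0] by simp

lemma trig_polynomial_cmult: "trig_polynomial L f \<Longrightarrow> trig_polynomial L (\<lambda>x. c * f x)"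
  using trig_polynomial_mult[OF trig_polynomial_const] .

lemma trig_polynomial_sum:
  "(\<And>i. i \<in> I \<Longrightarrow> trig_polynomial L (f i)) \<Longrightarrow> trig_polynomial L (\<lambda>x. \<Sum>i\<in>I. f i x)"
  by (induction I rule: infinite_finite_induct) (auto intro: trig_polynomial_const trig_polynomial.add)

lemma integral_trig_polynomial_eq_0:
  assumes f: "integrable (torus L) f" and 0: "\<And>m. (\<integral>x. f x * expo L m x \<partial>torus L) = 0"
    and g: "trig_polynomial L g"
  shows "integrable (torus L) (\<lambda>x. f x * g x) \<and> (\<integral>x. f x * g x \<partial>torus L) = 0"
  using g
proof induction
  case (expo c m)
  have "integrable (torus L) (\<lambda>x. c * (f x * expo L m x))"
    by (intro integrable_mult_right integrable_mult_expo f)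
  moreover have "(\<integral>x. c * (f x * expo L m x) \<partial>torus L) = 0"
    using 0 by simp
  ultimately show ?case by (simp add: mult.left_commute)
next
  case (add g h)
  then show ?case by (simp add: distrib_left)
qed

text \<open>The embedding of the torus into \<open>complex^'n\<close> as a product of unit circles.
  It moves uniform approximation to a compact set in a Euclidean space, where Stone-Weierstrass for
  real polynomials applies.\<close>

definition circles :: "real \<Rightarrow> real^'n \<Rightarrow> complex^'n" where
  "circles L x = (\<chi> i. cis (2 * pi / L * x $ i))"

lemma circle_trig_polynomial:
  fixes i :: "'n::finite"
  shows "trig_polynomial L (\<lambda>x. complex_of_real (Re (circles L x $ i)))"
  "trig_polynomial L (\<lambda>x. complex_of_real (Im (circles L x $ i)))"
proof -
  have e: "expo L (axis i 1) x = cis (2 * pi / L * x $ i)" for x :: "real^'n"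
  proof -
    have "freq L (axis i 1) = (2 * pi / L) *\<^sub>R axis i 1"
      by (simp add: freq_def int_vec_def axis_def vec_eq_iff)
    then show ?thesis by (simp add: expo_def inner_commute[of _ x] inner_axis)
  qed
  have "(\<lambda>x. complex_of_real (Re (circles L x $ i))) = (\<lambda>x. (1/2) * expo L (axis i 1) x + (1/2) * expo L (- axis i 1) x)"
    by (auto simp: fun_eq_iff circles_def complex_eq_iff e simp flip: cnj_expo)
  then show "trig_polynomial L (\<lambda>x. complex_of_real (Re (circles L x $ i)))"
    by (simp only: trig_polynomial.intros)
  have "(\<lambda>x. complex_of_real (Im (circles L x $ i))) = (\<lambda>x. (-\<i>/2) * expo L (axis i 1) x + (\<i>/2) * expo L (- axis i 1) x)"
    by (auto simp: fun_eq_iff circles_def complex_eq_iff e simp flip: cnj_expo)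
  then show "trig_polynomial L (\<lambda>x. complex_of_real (Im (circles L x $ i)))"
    by (simp only: trig_polynomial.intros)
qed

text \<open>The real coordinates of \<open>circles\<close> are cosines and sines, and trigonometric
  polynomials form an algebra.\<close>

lemma trig_polynomial_of_polynomial:
  fixes q :: "complex^'n \<Rightarrow> real"
  assumes "real_polynomial_function q"
  shows "trig_polynomial L (\<lambda>x. complex_of_real (q (circles L x)))"
  using assms
proof induction
  case (linear h)
  \<comment> \<open>\<open>h\<close> is linear over the reals only, so the real and imaginary
    direction of each coordinate are separate basis vectors.\<close>
  have H: "h z = (\<Sum>i\<in>UNIV. Re (z $ i) * h (axis i 1) + Im (z $ i) * h (axis i \<i>))" for z :: "complex^'n"
  proof -
    have z: "z = (\<Sum>i\<in>UNIV. Re (z $ i) *\<^sub>R axis i 1 + Im (z $ i) *\<^sub>R axis i \<i>)"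
    proof (subst vec_eq_iff, rule allI)
      fix k
      have "(\<Sum>i\<in>UNIV. Re (z $ i) *\<^sub>R axis i 1 + Im (z $ i) *\<^sub>R axis i \<i>) $ k
          = (\<Sum>i\<in>UNIV. if i = k then Re (z $ k) *\<^sub>R 1 + Im (z $ k) *\<^sub>R \<i> else 0)"
        by (simp only: sum_component, rule sum.cong) (auto simp: axis_def)
      also have "\<dots> = z $ k" by (simp add: complex_eq_iff)
      finally show "z $ k = (\<Sum>i\<in>UNIV. Re (z $ i) *\<^sub>R axis i 1 + Im (z $ i) *\<^sub>R axis i \<i>) $ k" by simp
    qed
    interpret h: bounded_linear h by fact
    show ?thesis by (subst z) (simp add: h.sum h.add h.scaleR)
  qed
  have eq: "(\<lambda>x. complex_of_real (h (circles L x))) =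
     (\<lambda>x. \<Sum>i\<in>UNIV. complex_of_real (h (axis i 1)) * complex_of_real (Re (circles L x $ i))
           + complex_of_real (h (axis i \<i>)) * complex_of_real (Im (circles L x $ i)))"
    by (rule ext, subst H) (simp add: mult.commute)
  show ?case
    unfolding eq by (intro trig_polynomial_sum trig_polynomial.add trig_polynomial_cmult circle_trig_polynomial)
next
  case (const c)
  then show ?case by (rule trig_polynomial_const)
next
  case (add f g)
  then show ?case by (simp add: trig_polynomial.add)
next
  case (mult f g)
  then show ?case by (simp add: trig_polynomial_mult)
qed

lemma continuous_on_circles: "continuous_on A (circles L)"
  unfolding circles_def[abs_def] by (intro continuous_intros)

lemma inj_on_circles:
  assumes "L > 0"
  shows "inj_on (circles L) (cell L)"
proof (rule inj_onI)
  fix x y :: "real^'n" assume x: "x \<in> cell L" and y: "y \<in> cell L" and eq: "circles L x = circles L y"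
  have "x $ i = y $ i" for i
  proof -
    have "cis (2 * pi / L * x $ i) = cis (2 * pi / L * y $ i)"
      using eq by (simp add: circles_def vec_eq_iff)
    then have "sin (2 * pi / L * x $ i) = sin (2 * pi / L * y $ i) \<and> cos (2 * pi / L * x $ i) = cos (2 * pi / L * y $ i)"
      by (simp add: complex_eq_iff)
    then obtain n :: int where "2 * pi / L * x $ i = 2 * pi / L * y $ i + 2 * pi * n"
      using sin_cos_eq_iff by blast
    then have "2 * pi * x $ i = 2 * pi * (y $ i + L * n)"
      using assms by (simp add: field_simps)
    then have n: "x $ i = y $ i + L * n" by simp
    have "0 \<le> x $ i" "x $ i < L" "0 \<le> y $ i" "y $ i < L" using x y by (auto simp: cell_def)
    then have "L * n < L * 1" "L * (-1) < L * n" using n by linarith+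
    then have "real_of_int n < 1" "-1 < real_of_int n"
      using mult_less_cancel_left_pos[OF assms] by blast+
    then have "n = 0" by linarith
    then show ?thesis using n by simp
  qed
  then show "x = y" by (simp add: vec_eq_iff)
qed

text \<open>By Stone-Weierstrass \<phi> is uniformly close to a polynomial in the circle
  coordinates, which \<open>f\<close> annihilates; the difference contributes at most
  \<open>e * N\<close>.\<close>

lemma integral_continuous_circles_eq_0:
  fixes \<phi> :: "complex^'n \<Rightarrow> real"
  assumes L: "L > 0" and f: "integrable (torus L) f" and 0: "\<And>m. (\<integral>x. f x * expo L m x \<partial>torus L) = 0"
    and \<phi>: "continuous_on UNIV \<phi>"
  shows "(\<integral>x. f x * complex_of_real (\<phi> (circles L x)) \<partial>torus L) = 0"
proof (rule ccontr)
  let ?I = "\<integral>x. f x * complex_of_real (\<phi> (circles L x)) \<partial>torus L"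
  assume ne: "?I \<noteq> 0"
  define N where "N = (\<integral>x. cmod (f x) \<partial>torus L)"
  have N: "N \<ge> 0" by (simp add: N_def)
  \<comment> \<open>Chosen so that \<open>e * N\<close> stays strictly below the modulus of the
    integral assumed nonzero; the added 1 covers \<open>N = 0\<close>.\<close>
  define e where "e = cmod ?I / (N + 1)"
  have e: "e > 0" using ne N by (simp add: e_def)
  let ?S = "circles L ` cbox 0 (\<chi> i. L)"
  have S: "compact ?S"
    by (intro compact_continuous_image continuous_on_circles compact_cbox)
  obtain q where q: "real_polynomial_function q" "\<And>z. z \<in> ?S \<Longrightarrow> \<bar>\<phi> z - q z\<bar> < e"
    using Stone_Weierstrass_real_polynomial_function[OF S continuous_on_subset[OF \<phi>] e] by blast
  have near: "\<bar>\<phi> (circles L x) - q (circles L x)\<bar> \<le> e" if "x \<in> cell L" for x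
  proof -
    have "x \<in> cbox 0 (\<chi> i. L)" using that by (auto simp: cell_def mem_box_cart less_imp_le)
    then show ?thesis using q(2) by (intro less_imp_le) blast
  qed
  note t = integral_trig_polynomial_eq_0[OF f 0 trig_polynomial_of_polynomial[OF q(1), of L]]
  have fm: "f \<in> borel_measurable (torus L)" using f by auto
  have \<phi>m: "(\<lambda>x. complex_of_real (\<phi> (circles L x))) \<in> borel_measurable lebesgue"
  proof -
    have "continuous_on UNIV (\<lambda>x. complex_of_real (\<phi> (circles L x)))"
      by (intro continuous_intros continuous_on_compose2[OF \<phi> continuous_on_circles]) auto
    then show ?thesis by (rule lebesgue_measurable_if_continuous)
  qed
  have di: "integrable (torus L) (\<lambda>x. f x * (complex_of_real (\<phi> (circles L x)) - complex_of_real (q (circles L x))))"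
  proof (rule Bochner_Integration.integrable_bound)
    show "integrable (torus L) (\<lambda>x. e * cmod (f x))" using f by simp
    have "(\<lambda>x. f x * complex_of_real (\<phi> (circles L x)) - f x * complex_of_real (q (circles L x))) \<in> borel_measurable (torus L)"
      by (rule borel_measurable_diff[OF borel_measurable_times[OF fm measurable_torus[OF \<phi>m]]
            borel_measurable_integrable[OF t[THEN conjunct1]]])
    then show "(\<lambda>x. f x * (complex_of_real (\<phi> (circles L x)) - complex_of_real (q (circles L x)))) \<in> borel_measurable (torus L)"
      by (simp add: right_diff_distrib)
    show "AE x in torus L. norm (f x * (complex_of_real (\<phi> (circles L x)) - complex_of_real (q (circles L x)))) \<le> norm (e * cmod (f x))"
    proof (rule AE_I2)
      fix x :: "real^'n" assume "x \<in> space (torus L)"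
      then have "x \<in> cell L" by simp
      from near[OF this] have "cmod (f x) * \<bar>\<phi> (circles L x) - q (circles L x)\<bar> \<le> cmod (f x) * e"
        by (intro mult_left_mono) auto
      then show "norm (f x * (complex_of_real (\<phi> (circles L x)) - complex_of_real (q (circles L x)))) \<le> norm (e * cmod (f x))"
        using e by (simp add: norm_mult mult.commute flip: of_real_diff)
    qed
  qed
  have "?I = (\<integral>x. f x * (complex_of_real (\<phi> (circles L x)) - complex_of_real (q (circles L x))) + f x * complex_of_real (q (circles L x)) \<partial>torus L)"
    by (simp add: algebra_simps)
  also have "\<dots> = (\<integral>x. f x * (complex_of_real (\<phi> (circles L x)) - complex_of_real (q (circles L x))) \<partial>torus L)"
    using t di by simp
  finally have "cmod ?I = cmod (\<integral>x. f x * (complex_of_real (\<phi> (circles L x)) - complex_of_real (q (circles L x))) \<partial>torus L)"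
    by simp
  also have "\<dots> \<le> (\<integral>x. cmod (f x * (complex_of_real (\<phi> (circles L x)) - complex_of_real (q (circles L x)))) \<partial>torus L)"
    by (rule integral_norm_bound)
  also have "\<dots> \<le> (\<integral>x. e * cmod (f x) \<partial>torus L)"
  proof (rule integral_mono)
    show "integrable (torus L) (\<lambda>x. cmod (f x * (complex_of_real (\<phi> (circles L x)) - complex_of_real (q (circles L x)))))"
      using di by (rule integrable_norm)
    show "integrable (torus L) (\<lambda>x. e * cmod (f x))" using f by simp
    fix x :: "real^'n" assume "x \<in> space (torus L)"
    then have "x \<in> cell L" by simp
    from near[OF this] have "cmod (f x) * \<bar>\<phi> (circles L x) - q (circles L x)\<bar> \<le> cmod (f x) * e"
      by (intro mult_left_mono) auto
    then show "cmod (f x * (complex_of_real (\<phi> (circles L x)) - complex_of_real (q (circles L x)))) \<le> e * cmod (f x)"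
      by (simp add: norm_mult mult.commute flip: of_real_diff)
  qed
  also have "\<dots> = e * N" by (simp add: N_def)
  also have "\<dots> < e * (N + 1)" using e by simp
  also have "\<dots> = cmod ?I" using N by (simp add: e_def)
  finally show False by simp
qed

text \<open>The indicator of \<open>C\<close> is the limit of tent functions of the distance to the
  image \<open>A\<close> of \<open>C\<close>, composed with \<open>circles\<close>. Since
  \<open>circles\<close> is injective on the cell, only points of \<open>C\<close> are mapped into
  \<open>A\<close>, so the tents converge to the indicator everywhere on the cell, and dominated
  convergence applies.\<close>

lemma integral_compact_eq_0:
  fixes f :: "real^'n \<Rightarrow> complex"
  assumes L: "L > 0" and f: "integrable (torus L) f" and 0: "\<And>m. (\<integral>x. f x * expo L m x \<partial>torus L) = 0"
    and C: "compact C" "C \<subseteq> cell L"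
  shows "(\<integral>x. f x * indicator C x \<partial>torus L) = 0"
proof (cases "C = {}")
  case False
  define A where "A = circles L ` C"
  have A: "closed A" "A \<noteq> {}"
    using C False by (auto simp: A_def intro!: compact_imp_closed compact_continuous_image continuous_on_circles)
  define \<phi> where "\<phi> k z = max 0 (1 - real k * infdist z A)" for k z
  have \<phi>c: "continuous_on UNIV (\<phi> k)" for k
    unfolding \<phi>_def[abs_def] by (intro continuous_intros)
  have fm: "f \<in> borel_measurable (torus L)" using f by auto
  have \<phi>m: "(\<lambda>x. complex_of_real (\<phi> k (circles L x))) \<in> borel_measurable lebesgue" for k
  proof -
    have "continuous_on UNIV (\<lambda>x. complex_of_real (\<phi> k (circles L x)))"
      by (intro continuous_intros continuous_on_compose2[OF \<phi>c continuous_on_circles]) auto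
    then show ?thesis by (rule lebesgue_measurable_if_continuous)
  qed
  have Cm: "C \<in> sets lebesgue" using C(1) by (simp add: sets_completionI_sets borel_compact)
  have "(\<lambda>k. \<integral>x. f x * complex_of_real (\<phi> k (circles L x)) \<partial>torus L) \<longlonglongrightarrow> (\<integral>x. f x * indicator C x \<partial>torus L)"
  proof (rule integral_dominated_convergence)
    show "(\<lambda>x. f x * indicator C x) \<in> borel_measurable (torus L)"
      by (rule borel_measurable_times[OF fm measurable_torus]) (use Cm in auto)
    show "(\<lambda>x. f x * complex_of_real (\<phi> k (circles L x))) \<in> borel_measurable (torus L)" for k
      by (intro borel_measurable_times fm measurable_torus \<phi>m)
    show "integrable (torus L) (\<lambda>x. cmod (f x))" using f by simp
    show "AE x in torus L. norm (f x * complex_of_real (\<phi> k (circles L x))) \<le> cmod (f x)" for k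
    proof (rule AE_I2)
      fix x
      have "\<bar>\<phi> k (circles L x)\<bar> \<le> 1"
        using infdist_nonneg[of "circles L x" A] by (simp add: \<phi>_def)
      then show "norm (f x * complex_of_real (\<phi> k (circles L x))) \<le> cmod (f x)"
        by (simp add: norm_mult mult_left_le)
    qed
    show "AE x in torus L. (\<lambda>k. f x * complex_of_real (\<phi> k (circles L x))) \<longlonglongrightarrow> f x * indicator C x"
    proof (rule AE_I2)
      fix x :: "real^'n" assume "x \<in> space (torus L)"
      then have x: "x \<in> cell L" by simp
      show "(\<lambda>k. f x * complex_of_real (\<phi> k (circles L x))) \<longlonglongrightarrow> f x * indicator C x"
      proof (cases "x \<in> C")
        case True
        then have "infdist (circles L x) A = 0" by (simp add: A_def)
        then show ?thesis using True by (simp add: \<phi>_def)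
      next
        case False
        then have "circles L x \<notin> A"
          using inj_on_circles[OF L] x C(2) by (auto simp: A_def inj_on_def)
        then have pos: "infdist (circles L x) A > 0"
          using A by (intro infdist_pos_not_in_closed)
        have "eventually (\<lambda>k. f x * complex_of_real (\<phi> k (circles L x)) = 0) sequentially"
        proof -
          obtain k0 :: nat where k0: "real k0 > 1 / infdist (circles L x) A" using reals_Archimedean2 by blast
          have "\<phi> k (circles L x) = 0" if "k \<ge> k0" for k
          proof -
            have "1 / infdist (circles L x) A \<le> real k" using that k0 by linarith
            then have "1 \<le> real k * infdist (circles L x) A" using pos by (simp add: field_simps)
            then show ?thesis by (simp add: \<phi>_def)
          qed
          then show ?thesis by (auto simp: eventually_sequentially intro!: exI[of _ k0])
        qed
        then show ?thesis using False by (simp add: tendsto_eventually)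
      qed
    qed
  qed
  then have "(\<lambda>k. 0) \<longlonglongrightarrow> (\<integral>x. f x * indicator C x \<partial>torus L)"
    using integral_continuous_circles_eq_0[OF L f 0 \<phi>c] by simp
  then show ?thesis using LIMSEQ_unique tendsto_const by blast
qed simp

text \<open>Inner regularity: a closed \<open>T\<close> fills the set \<open>P\<close> where
  \<open>g\<close> is positive up to measure \<open>e\<close>. As \<open>T\<close> is compact, the
  vanishing integral of the positive \<open>g\<close> over it makes it a null set, so
  \<open>P\<close> has measure at most \<open>e\<close> for every \<open>e\<close>.\<close>

lemma AE_nonpos_if_compact_integrals_zero:
  fixes g :: "real^'n \<Rightarrow> real"
  assumes g: "g \<in> borel_measurable lebesgue" "integrable (torus L) g"
    and 0: "\<And>C. compact C \<Longrightarrow> C \<subseteq> cell L \<Longrightarrow> (\<integral>x. g x * indicator C x \<partial>torus L) = 0"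
  shows "AE x in torus L. g x \<le> 0"
proof -
  define P where "P = {x \<in> cell L. g x > 0}"
  have Pm: "P \<in> sets lebesgue"
  proof -
    have "{x \<in> space lebesgue. g x > 0} \<in> sets lebesgue" using g(1) by measurable
    then have *: "cell L \<inter> {x \<in> space lebesgue. g x > 0} \<in> sets lebesgue" by (intro sets.Int) auto
    have "P = cell L \<inter> {x \<in> space lebesgue. g x > 0}" by (auto simp: P_def)
    with * show ?thesis by (simp only:)
  qed
  have E: "emeasure lebesgue P \<le> 0 + ennreal e" if e: "e > 0" for e
  proof -
    obtain T where T: "closed T" "T \<subseteq> P" "P - T \<in> lmeasurable" "emeasure lebesgue (P - T) < ennreal e"
      using sets_lebesgue_inner_closed[OF Pm e] by metis
    have TC: "T \<subseteq> cell L" using T(2) by (auto simp: P_def)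
    have "bounded T"
      unfolding bounded_iff using norm_cell_le TC by blast
    then have "compact T" using T(1) by (simp add: compact_eq_bounded_closed)
    then have z: "(\<integral>x. g x * indicator T x \<partial>torus L) = 0" using 0 TC by blast
    have Tm: "T \<in> sets lebesgue" using T(1) by (simp add: sets_completionI_sets)
    have gi: "integrable (torus L) (\<lambda>x. g x * indicator T x)"
    proof (rule Bochner_Integration.integrable_bound[OF g(2)])
      show "(\<lambda>x. g x * indicator T x) \<in> borel_measurable (torus L)"
        by (rule measurable_torus, rule borel_measurable_times[OF g(1)]) (use Tm in auto)
    qed (auto simp: indicator_def)
    have nn: "0 \<le> g x * indicator T x" for x using T(2) by (auto simp: indicator_def P_def)
    have "AE x in torus L. g x * indicator T x = 0"
      using z integral_nonneg_eq_0_iff_AE[OF gi] nn by simp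
    then have "AE x in torus L. x \<notin> T"
      by (rule AE_mp) (use T(2) in \<open>auto intro!: AE_I2 simp: P_def indicator_def split: if_splits\<close>)
    then have "AE x in lebesgue. x \<notin> T"
      using TC by (auto simp: AE_restrict_space_iff)
    then have "emeasure lebesgue T = 0"
      using Tm AE_iff_null_sets null_setsD1 by blast
    moreover have "emeasure lebesgue P \<le> emeasure lebesgue T + emeasure lebesgue (P - T)"
      using T(2) Tm Pm emeasure_subadditive[of T lebesgue "P - T"] by (simp add: Un_absorb1)
    ultimately show ?thesis using T(4) by (simp add: less_imp_le order.trans)
  qed
  have "emeasure lebesgue P \<le> 0"
    by (rule ennreal_le_epsilon) (rule E)
  then have "P \<in> null_sets lebesgue" using Pm by (simp add: null_setsI)
  then have "AE x in lebesgue. x \<notin> P" by (rule AE_not_in)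
  then have "AE x in lebesgue. x \<in> cell L \<longrightarrow> g x \<le> 0"
    by (rule AE_mp) (rule AE_I2, simp add: P_def not_less)
  then show ?thesis by (simp add: AE_restrict_space_iff)
qed

lemma Fourier_uniqueness:
  assumes L: "L > 0" and f: "f \<in> borel_measurable lebesgue" "integrable (torus L) f"
    and 0: "\<And>m. (\<integral>x. f x * expo L m x \<partial>torus L) = 0"
  shows "AE x in torus L. f x = 0"
proof -
  have c: "(\<integral>x. f x * indicator C x \<partial>torus L) = 0" if "compact C" "C \<subseteq> cell L" for C
    by (rule integral_compact_eq_0[OF L f(2) 0 that])
  have i: "integrable (torus L) (\<lambda>x. f x * indicator C x)" if "compact C" for C
  proof (rule Bochner_Integration.integrable_bound[OF f(2)])
    have "C \<in> sets lebesgue" using that by (simp add: sets_completionI_sets borel_compact)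
    then show "(\<lambda>x. f x * indicator C x) \<in> borel_measurable (torus L)"
      by (intro measurable_torus borel_measurable_times f(1)) auto
  qed (auto simp: indicator_def)
  have re: "(\<integral>x. Re (f x) * indicator C x \<partial>torus L) = 0"
    and im: "(\<integral>x. Im (f x) * indicator C x \<partial>torus L) = 0" if "compact C" "C \<subseteq> cell L" for C
  proof -
    have "(\<integral>x. Re (f x * indicator C x) \<partial>torus L) = 0" "(\<integral>x. Im (f x * indicator C x) \<partial>torus L) = 0"
      using c[OF that] integral_Re[OF i[OF that(1)]] integral_Im[OF i[OF that(1)]] by simp_all
    moreover have "Re (f x * indicator C x) = Re (f x) * indicator C x" "Im (f x * indicator C x) = Im (f x) * indicator C x" for x
      by (auto simp: indicator_def)
    ultimately show "(\<integral>x. Re (f x) * indicator C x \<partial>torus L) = 0" "(\<integral>x. Im (f x) * indicator C x \<partial>torus L) = 0"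
      by simp_all
  qed
  have m: "(\<lambda>x. Re (f x)) \<in> borel_measurable lebesgue" "(\<lambda>x. Im (f x)) \<in> borel_measurable lebesgue"
    using f(1) by measurable
  have "AE x in torus L. Re (f x) \<le> 0"
    by (rule AE_nonpos_if_compact_integrals_zero) (use m f re in auto)
  moreover have "AE x in torus L. - Re (f x) \<le> 0"
    by (rule AE_nonpos_if_compact_integrals_zero) (use m f re in auto)
  moreover have "AE x in torus L. Im (f x) \<le> 0"
    by (rule AE_nonpos_if_compact_integrals_zero) (use m f im in auto)
  moreover have "AE x in torus L. - Im (f x) \<le> 0"
    by (rule AE_nonpos_if_compact_integrals_zero) (use m f im in auto)
  ultimately show ?thesis
    by eventually_elim (simp add: complex_eq_iff)
qed

section \<open>Periodic square integrable functions and their bilinear pairing\<close>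

definition L2p :: "real \<Rightarrow> (real^'n \<Rightarrow> complex) set" where
  "L2p L = {f. periodic L f \<and> f \<in> borel_measurable lebesgue \<and> sq_int (torus L) f}"

text \<open>Bilinear, in keeping with the pairing of distributions and test functions; the inner
  product is written with an explicit conjugate in the second argument.\<close>

definition pair :: "real \<Rightarrow> (real^'n \<Rightarrow> complex) \<Rightarrow> (real^'n \<Rightarrow> complex) \<Rightarrow> complex" where
  "pair L f g = (\<integral>x. f x * g x \<partial>torus L)"

abbreviation tnorm :: "real \<Rightarrow> (real^'n \<Rightarrow> complex) \<Rightarrow> real" where
  "tnorm L \<equiv> nrm (torus L)"

lemma L2_eq_L2p: "L2 = L2p (2 * pi)"
  by (auto simp: L2_def L2p_def sq_int_def integrable_torus measurable_torus)

lemma l2_norm_eq: "l2_norm u = tnorm (2 * pi) u"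
  by (simp add: l2_norm_def nrm_def integral_torus)

lemma l2_inner_eq: "l2_inner u v = pair (2 * pi) u (\<lambda>x. cnj (v x))"
  by (simp add: l2_inner_def pair_def integral_torus)

lemma L2p_sq_int: "f \<in> L2p L \<Longrightarrow> sq_int (torus L) f"
  and L2p_measurable: "f \<in> L2p L \<Longrightarrow> f \<in> borel_measurable lebesgue"
  and L2p_periodic: "f \<in> L2p L \<Longrightarrow> periodic L f"
  by (auto simp: L2p_def)

lemma L2p_add: "f \<in> L2p L \<Longrightarrow> g \<in> L2p L \<Longrightarrow> (\<lambda>x. f x + g x) \<in> L2p L"
  by (auto simp: L2p_def periodic_def sq_int_add)

lemma L2p_diff: "f \<in> L2p L \<Longrightarrow> g \<in> L2p L \<Longrightarrow> (\<lambda>x. f x - g x) \<in> L2p L"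
  by (auto simp: L2p_def periodic_def sq_int_diff)

lemma L2p_cmult: "f \<in> L2p L \<Longrightarrow> (\<lambda>x. c * f x) \<in> L2p L"
  by (auto simp: L2p_def periodic_def sq_int_cmult)

lemma L2p_zero [simp]: "(\<lambda>x. 0) \<in> L2p L"
  by (auto simp: L2p_def periodic_def)

lemma L2p_sum: "(\<And>i. i \<in> I \<Longrightarrow> f i \<in> L2p L) \<Longrightarrow> (\<lambda>x. \<Sum>i\<in>I. f i x) \<in> L2p L"
  by (induction I rule: infinite_finite_induct) (auto intro: L2p_add)

lemma L2p_cnj: "f \<in> L2p L \<Longrightarrow> (\<lambda>x. cnj (f x)) \<in> L2p L"
  by (auto simp: L2p_def periodic_def sq_int_cnj borel_measurable_cnj)

lemma L2p_bdd_mult: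
  assumes "f \<in> L2p L" "periodic L h" "h \<in> borel_measurable lebesgue" "\<And>x. cmod (h x) \<le> B"
  shows "(\<lambda>x. h x * f x) \<in> L2p L" "tnorm L (\<lambda>x. h x * f x) \<le> \<bar>B\<bar> * tnorm L f"
proof -
  have s: "sq_int (torus L) f" using assms by (simp add: L2p_sq_int)
  note sq_int_bdd_mult[OF s measurable_torus[OF assms(3)], of B]
  then show "(\<lambda>x. h x * f x) \<in> L2p L" "tnorm L (\<lambda>x. h x * f x) \<le> \<bar>B\<bar> * tnorm L f"
    using assms by (auto simp: L2p_def periodic_def)
qed

lemma L2p_bounded:
  fixes f :: "real^'n \<Rightarrow> complex"
  assumes "L > 0" "periodic L f" "f \<in> borel_measurable lebesgue" "\<And>x. cmod (f x) \<le> B"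
  shows "f \<in> L2p L" "tnorm L f \<le> \<bar>B\<bar> * sqrt (L ^ CARD('n))"
  using sq_int_bounded[OF finite_measure_torus[OF assms(1)] measurable_torus[OF assms(3)], of B] assms
  by (auto simp: L2p_def measure_torus[simplified])

lemma pair_commute: "pair L f g = pair L g f"
  by (simp add: pair_def mult.commute)

lemma pair_integrable: "f \<in> L2p L \<Longrightarrow> g \<in> L2p L \<Longrightarrow> integrable (torus L) (\<lambda>x. f x * g x)"
  by (intro sq_int_mult_integrable L2p_sq_int)

lemma pair_add:
  assumes "f \<in> L2p L" "g \<in> L2p L" "h \<in> L2p L"
  shows "pair L f (\<lambda>x. g x + h x) = pair L f g + pair L f h"
        "pair L (\<lambda>x. g x + h x) f = pair L g f + pair L h f"
  using pair_integrable[OF assms(1,2)] pair_integrable[OF assms(1,3)]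
    pair_integrable[OF assms(2,1)] pair_integrable[OF assms(3,1)]
  by (simp_all add: pair_def distrib_left distrib_right)

lemma pair_diff:
  assumes "f \<in> L2p L" "g \<in> L2p L" "h \<in> L2p L"
  shows "pair L f (\<lambda>x. g x - h x) = pair L f g - pair L f h"
        "pair L (\<lambda>x. g x - h x) f = pair L g f - pair L h f"
  using pair_integrable[OF assms(1,2)] pair_integrable[OF assms(1,3)]
    pair_integrable[OF assms(2,1)] pair_integrable[OF assms(3,1)]
  by (simp_all add: pair_def left_diff_distrib right_diff_distrib)

lemma pair_cmult:
  "pair L f (\<lambda>x. c * g x) = c * pair L f g"
  "pair L (\<lambda>x. c * f x) g = c * pair L f g"
  by (simp_all add: pair_def mult.left_commute mult.assoc)

lemma pair_zero [simp]: "pair L f (\<lambda>x. 0) = 0" "pair L (\<lambda>x. 0) f = 0"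
  by (simp_all add: pair_def)

lemma pair_sum:
  assumes "f \<in> L2p L" "\<And>i. i \<in> I \<Longrightarrow> g i \<in> L2p L"
  shows "pair L f (\<lambda>x. \<Sum>i\<in>I. g i x) = (\<Sum>i\<in>I. pair L f (g i))"
  using assms(2)
proof (induction I rule: infinite_finite_induct)
  case (insert i I)
  then show ?case
    using pair_add(1)[OF assms(1), of "g i" "\<lambda>x. \<Sum>i\<in>I. g i x"] L2p_sum[of I g L] by simp
qed simp_all

lemma cnj_pair: "cnj (pair L f g) = pair L (\<lambda>x. cnj (f x)) (\<lambda>x. cnj (g x))"
  by (simp add: pair_def flip: complex_cnj_mult integral_cnj)

lemma norm_pair_le: "f \<in> L2p L \<Longrightarrow> g \<in> L2p L \<Longrightarrow> cmod (pair L f g) \<le> tnorm L f * tnorm L g"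
  unfolding pair_def by (intro norm_integral_mult_le L2p_sq_int)

lemma pair_cnj_self: "pair L f (\<lambda>x. cnj (f x)) = complex_of_real ((tnorm L f)\<^sup>2)"
proof -
  have "pair L f (\<lambda>x. cnj (f x)) = (\<integral>x. complex_of_real ((cmod (f x))\<^sup>2) \<partial>torus L)"
    unfolding pair_def by (intro Bochner_Integration.integral_cong refl) (simp only: complex_norm_square)
  then show ?thesis by (simp add: nrm_square del: of_real_power)
qed

lemma pair_cong_AE:
  assumes "f \<in> L2p L" "f' \<in> L2p L" "g \<in> L2p L" "AE x in torus L. f x = f' x"
  shows "pair L f g = pair L f' g"
  unfolding pair_def
proof (rule integral_cong_AE)
  show "AE x in torus L. f x * g x = f' x * g x" using assms(4) by eventually_elim simp
  show "(\<lambda>x. f x * g x) \<in> borel_measurable (torus L)" "(\<lambda>x. f' x * g x) \<in> borel_measurable (torus L)"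
    by (intro borel_measurable_integrable pair_integrable assms)+
qed

lemma expo_L2p: "L > 0 \<Longrightarrow> expo L m \<in> L2p L"
  by (rule L2p_bounded(1)[where B = 1]) (auto intro: periodic_expo borel_measurable_expo)

text \<open>Translation by half a wavelength in a coordinate with \<open>m $ i \<noteq> 0\<close>
  reverses the sign of the exponential but preserves its integral.\<close>

lemma integral_expo:
  assumes L: "L > 0"
  shows "(\<integral>x. expo L (m :: int^'n) x \<partial>torus L) = (if m = 0 then of_real (L ^ CARD('n)) else 0)"
proof (cases "m = 0")
  case True
  have "(\<integral>x. (1::complex) \<partial>(torus L :: (real^'n) measure)) = of_real (L ^ CARD('n))"
    using measure_torus[OF L, where ?'n = 'n] finite_measure.emeasure_finite[OF finite_measure_torus[OF L]]
    by (simp add: less_top scaleR_conv_of_real)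
  then show ?thesis using True by simp
next
  case False
  then obtain i where i: "m $ i \<noteq> 0" by (auto simp: vec_eq_iff)
  define t :: "real^'n" where "t = (L / (2 * real_of_int (m $ i))) *\<^sub>R axis i 1"
  have "freq L m \<bullet> t = pi" using i L by (simp add: t_def freq_def inner_axis)
  then have *: "expo L m (x + t) = - expo L m x" for x by (simp add: expo_translate)
  have int: "integrable (torus L) (expo L m)"
    using pair_integrable[OF expo_L2p expo_L2p, OF L L, of m 0] by simp
  have "(\<integral>x. expo L m (x + t) \<partial>torus L) = (\<integral>x. expo L m x \<partial>torus L)"
    by (rule integral_torus_translate[OF L periodic_expo[OF L] borel_measurable_expo int])
  then show ?thesis using False by (simp add: *)
qed

lemma pair_expo:
  "L > 0 \<Longrightarrow> pair L (expo L m) (expo L (k :: int^'n)) = (if m = - k then of_real (L ^ CARD('n)) else 0)"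
  by (simp add: pair_def expo_mult integral_expo eq_neg_iff_add_eq_0)

section \<open>Finite trigonometric sums and Bessel's inequality\<close>

definition tsum :: "real \<Rightarrow> (int^'n) set \<Rightarrow> (int^'n \<Rightarrow> complex) \<Rightarrow> real^'n \<Rightarrow> complex" where
  "tsum L F c = (\<lambda>x. \<Sum>m\<in>F. c m * expo L m x)"

lemma tsum_L2p: "L > 0 \<Longrightarrow> tsum L F c \<in> L2p L"
  unfolding tsum_def by (intro L2p_sum L2p_cmult expo_L2p)

lemma pair_tsum:
  assumes "L > 0" "f \<in> L2p L"
  shows "pair L f (tsum L F c) = (\<Sum>m\<in>F. c m * pair L f (expo L m))"
  unfolding tsum_def using assms by (subst pair_sum) (auto simp: pair_cmult intro: L2p_cmult expo_L2p)

lemma cnj_tsum: "(\<lambda>x. cnj (tsum L F c x)) = (\<lambda>x. \<Sum>m\<in>F. cnj (c m) * expo L (- m) x)"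
  by (simp add: tsum_def cnj_expo)

lemma pair_cnj_tsum:
  assumes "L > 0" "f \<in> L2p L"
  shows "pair L f (\<lambda>x. cnj (tsum L F c x)) = (\<Sum>m\<in>F. cnj (c m) * pair L f (expo L (- m)))"
  unfolding cnj_tsum using assms by (subst pair_sum) (auto simp: pair_cmult intro: L2p_cmult expo_L2p)

lemma tsum_coeff:
  assumes "L > 0" "finite F"
  shows "pair L (tsum L F c) (expo L (- (k :: int^'n))) = of_real (L ^ CARD('n)) * (if k \<in> F then c k else 0)"
proof -
  have "pair L (tsum L F c) (expo L (- k)) = (\<Sum>m\<in>F. c m * pair L (expo L (- k)) (expo L m))"
    by (subst pair_commute) (simp add: pair_tsum assms expo_L2p)
  also have "\<dots> = (\<Sum>m\<in>F. if m = k then c k * of_real (L ^ CARD('n)) else 0)"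
    by (intro sum.cong) (auto simp: pair_expo assms)
  finally show ?thesis using assms by simp
qed

lemma tsum_norm:
  assumes "L > 0" "finite F"
  shows "(tnorm L (tsum L F c :: real^'n \<Rightarrow> complex))\<^sup>2 = L ^ CARD('n) * (\<Sum>m\<in>F. (cmod (c m))\<^sup>2)"
proof -
  have "complex_of_real ((tnorm L (tsum L F c))\<^sup>2) = (\<Sum>m\<in>F. cnj (c m) * (of_real (L ^ CARD('n)) * c m))"
    unfolding pair_cnj_self[symmetric] using assms
    by (subst pair_cnj_tsum) (auto simp: tsum_L2p tsum_coeff)
  also have "\<dots> = (\<Sum>m\<in>F. complex_of_real (L ^ CARD('n) * (cmod (c m))\<^sup>2))"
    by (intro sum.cong refl) (simp only: of_real_mult complex_norm_square mult_ac)
  finally have "complex_of_real ((tnorm L (tsum L F c))\<^sup>2) = complex_of_real (L ^ CARD('n) * (\<Sum>m\<in>F. (cmod (c m))\<^sup>2))"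
    by (simp add: sum_distrib_left)
  then show ?thesis by (simp only: of_real_eq_iff)
qed

lemma le_of_square_le:
  fixes A B Q :: real
  assumes "Q \<le> A * sqrt (B * Q)" "Q \<ge> 0" "A \<ge> 0" "B \<ge> 0"
  shows "Q \<le> A\<^sup>2 * B"
proof (cases "Q = 0")
  case False
  have "Q * Q \<le> (A * sqrt (B * Q)) * (A * sqrt (B * Q))"
    using assms by (intro mult_mono) auto
  also have "\<dots> = A\<^sup>2 * B * Q"
    using assms by (simp add: power2_eq_square algebra_simps)
  finally show ?thesis using False assms by simp
qed (use assms in simp)

text \<open>Test \<psi> on the trigonometric sum \<open>S\<close> whose coefficients are the
  conjugates of the values of \<psi> on the exponentials: \<open>\<psi> S\<close> is the sum of
  squares \<open>Q\<close>, whereas the norm of \<open>S\<close> grows only like the square root of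
  \<open>Q\<close>. Bessel's inequality is the case of a pairing; the general form serves
  functionals that have no representing function yet.\<close>

lemma functional_coeff_bound:
  fixes \<psi> :: "(real^'n \<Rightarrow> complex) \<Rightarrow> complex"
  assumes L: "L > 0" and F: "finite F"
    and lin: "\<And>f g c. f \<in> L2p L \<Longrightarrow> g \<in> L2p L \<Longrightarrow> \<psi> (\<lambda>x. f x + c * g x) = \<psi> f + c * \<psi> g"
    and bdd: "\<And>f. f \<in> L2p L \<Longrightarrow> cmod (\<psi> f) \<le> B * tnorm L f" and B: "B \<ge> 0"
  shows "(\<Sum>m\<in>F. (cmod (\<psi> (expo L m)))\<^sup>2) \<le> B\<^sup>2 * L ^ CARD('n)"
proof -
  have z: "\<psi> (\<lambda>x. 0) = 0"
    using lin[of "\<lambda>x. 0" "\<lambda>x. 0" 1] by simp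
  have sum: "\<psi> (tsum L F c) = (\<Sum>m\<in>F. c m * \<psi> (expo L m))" for c
    using F unfolding tsum_def
  proof (induction F)
    case (insert m F)
    have "\<psi> (\<lambda>x. (\<Sum>m\<in>F. c m * expo L m x) + c m * expo L m x) = \<psi> (\<lambda>x. \<Sum>m\<in>F. c m * expo L m x) + c m * \<psi> (expo L m)"
      by (intro lin L2p_sum L2p_cmult expo_L2p L)
    then show ?case using insert by (simp add: add.commute)
  qed (simp add: z)
  define Q where "Q = (\<Sum>m\<in>F. (cmod (\<psi> (expo L m)))\<^sup>2)"
  have Q0: "Q \<ge> 0" by (auto simp: Q_def intro: sum_nonneg)
  define S where "S = tsum L F (\<lambda>m. cnj (\<psi> (expo L m)))"
  have "complex_of_real Q = \<psi> S"
    unfolding S_def sum Q_def of_real_sum by (intro sum.cong refl) (simp only: complex_norm_square mult.commute)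
  then have "Q = cmod (\<psi> S)" using Q0 by (metis norm_of_real abs_of_nonneg)
  also have "\<dots> \<le> B * tnorm L S" by (rule bdd) (simp add: S_def tsum_L2p L)
  also have "tnorm L S = sqrt (L ^ CARD('n) * Q)"
    using tsum_norm[OF L F, of "\<lambda>m. cnj (\<psi> (expo L m))"] unfolding S_def[symmetric]
    by (simp add: Q_def) (metis nrm_nonneg real_sqrt_unique)
  finally show ?thesis
    using le_of_square_le[of Q B "L ^ CARD('n)"] Q0 B L by (simp add: Q_def)
qed

lemma Bessel:
  fixes f :: "real^'n \<Rightarrow> complex"
  assumes L: "L > 0" and F: "finite F" and f: "f \<in> L2p L"
  shows "(\<Sum>m\<in>F. (cmod (pair L f (expo L m)))\<^sup>2) \<le> L ^ CARD('n) * (tnorm L f)\<^sup>2"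
proof -
  have "(\<Sum>m\<in>F. (cmod (pair L f (expo L m)))\<^sup>2) \<le> (tnorm L f)\<^sup>2 * L ^ CARD('n)"
    by (rule functional_coeff_bound[OF L F])
       (auto simp: pair_add pair_cmult f L2p_cmult intro: norm_pair_le)
  then show ?thesis by (simp add: mult.commute)
qed

lemma Fourier_unique:
  assumes L: "L > 0" and f: "f \<in> L2p L" "g \<in> L2p L"
    and eq: "\<And>m. pair L f (expo L m) = pair L g (expo L m)"
  shows "AE x in torus L. f x = g x"
proof -
  have d: "(\<lambda>x. f x - g x) \<in> L2p L" using f by (rule L2p_diff)
  have "AE x in torus L. f x - g x = 0"
  proof (rule Fourier_uniqueness[OF L])
    show "(\<lambda>x. f x - g x) \<in> borel_measurable lebesgue" using d by (rule L2p_measurable)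
    show "integrable (torus L) (\<lambda>x. f x - g x)"
      using pair_integrable[OF d expo_L2p[OF L, of 0]] by simp
    fix m
    have "pair L (\<lambda>x. f x - g x) (expo L m) = 0"
      using eq[of m] pair_diff(2)[OF expo_L2p[OF L] f] by simp
    then show "(\<integral>x. (f x - g x) * expo L m x \<partial>torus L) = 0" by (simp add: pair_def)
  qed
  then show ?thesis by simp
qed

section \<open>Riesz-Fischer, Parseval and the representation of functionals\<close>

lemma L2p_complete:
  fixes f :: "nat \<Rightarrow> real^'n \<Rightarrow> complex"
  assumes L: "L > 0" and f: "\<And>n. f n \<in> L2p L" and q: "0 \<le> q" "q < 1"
    and step: "\<And>n. tnorm L (\<lambda>x. f (Suc n) x - f n x) \<le> B * q ^ n"
  obtains h where "h \<in> L2p L" "\<And>n. tnorm L (\<lambda>x. f n x - h x) \<le> B / (1 - q) * q ^ n"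
proof
  let ?h = "\<lambda>x. lim (\<lambda>n. f n x)"
  have s: "\<And>n. sq_int (torus L) (f n)" using f by (rule L2p_sq_int)
  note c = sq_int_complete[OF finite_measure_torus[OF L] s q step]
  have [measurable]: "f n \<in> borel_measurable lebesgue" for n using f by (rule L2p_measurable)
  have "?h \<in> borel_measurable lebesgue" by measurable
  moreover have "periodic L ?h" using f by (simp add: L2p_def periodic_def)
  ultimately show "?h \<in> L2p L" using c(1) by (simp add: L2p_def)
  show "tnorm L (\<lambda>x. f n x - ?h x) \<le> B / (1 - q) * q ^ n" for n by (rule c(2))
qed

text \<open>The finite sets \<open>G k\<close> increase and miss at most \<open>(1/4) ^ k\<close> of
  the total, so consecutive partial sums differ in norm by at most a multiple of
  \<open>(1/2) ^ k\<close>, and the limit is supplied by geometric completeness.\<close>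

lemma Riesz_Fischer:
  fixes c :: "int^'n \<Rightarrow> complex"
  assumes L: "L > 0" and s: "(\<lambda>m. (cmod (c m))\<^sup>2) summable_on UNIV"
  obtains f where "f \<in> L2p L" "\<And>m. pair L f (expo L (- m)) = of_real (L ^ CARD('n)) * c m"
    "(tnorm L f)\<^sup>2 \<le> L ^ CARD('n) * (\<Sum>\<^sub>\<infinity>m. (cmod (c m))\<^sup>2)"
proof -
  define T where "T = (\<Sum>\<^sub>\<infinity>m. (cmod (c m))\<^sup>2)"
  define V where "V = L ^ CARD('n)"
  have V: "V > 0" using L by (simp add: V_def)
  have le: "(\<Sum>m\<in>F. (cmod (c m))\<^sup>2) \<le> T" if "finite F" for F
    unfolding T_def using s that by (intro finite_sum_le_infsum) auto
  have "\<exists>F. finite F \<and> T - (1/4) ^ k \<le> (\<Sum>m\<in>F. (cmod (c m))\<^sup>2)" for k :: nat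
    using infsum_finite_approximation[OF s, of "(1/4) ^ k"] by (auto simp: T_def dist_real_def abs_le_iff)
  then obtain F where F: "\<And>k. finite (F k)" "\<And>k. T - (1/4) ^ k \<le> (\<Sum>m\<in>F k. (cmod (c m))\<^sup>2)"
    by metis
  define G where "G k = (\<Union>i\<le>k. F i)" for k
  have G: "finite (G k)" "G k \<subseteq> G (Suc k)" for k
    unfolding G_def using F(1) by (auto, meson atMost_iff le_SucI)
  have GT: "T - (1/4) ^ k \<le> (\<Sum>m\<in>G k. (cmod (c m))\<^sup>2)" for k
  proof -
    have "(\<Sum>m\<in>F k. (cmod (c m))\<^sup>2) \<le> (\<Sum>m\<in>G k. (cmod (c m))\<^sup>2)"
      by (rule sum_mono2) (use G in \<open>auto simp: G_def\<close>)
    then show ?thesis using F(2)[of k] by linarith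
  qed
  have out: "(\<Sum>m\<in>A. (cmod (c m))\<^sup>2) \<le> (1/4) ^ k" if "finite A" "A \<inter> G k = {}" for A k
  proof -
    have "(\<Sum>m\<in>A. (cmod (c m))\<^sup>2) + (\<Sum>m\<in>G k. (cmod (c m))\<^sup>2) = (\<Sum>m\<in>A \<union> G k. (cmod (c m))\<^sup>2)"
      using that G(1) by (simp add: sum.union_disjoint)
    also have "\<dots> \<le> T" using that G(1) by (intro le) auto
    finally show ?thesis using GT[of k] by linarith
  qed
  define S where "S k = tsum L (G k) c" for k
  have SL: "S k \<in> L2p L" for k by (simp add: S_def tsum_L2p L)
  have step: "tnorm L (\<lambda>x. S (Suc k) x - S k x) \<le> sqrt V * (1/2) ^ k" for k
  proof -
    have "(\<lambda>x. S (Suc k) x - S k x) = tsum L (G (Suc k) - G k) c"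
      by (rule ext) (simp add: S_def tsum_def sum_diff[OF G(1) G(2)])
    then have "(tnorm L (\<lambda>x. S (Suc k) x - S k x))\<^sup>2 = V * (\<Sum>m\<in>G (Suc k) - G k. (cmod (c m))\<^sup>2)"
      using tsum_norm[OF L, of "G (Suc k) - G k" c] G(1) by (simp add: V_def)
    also have "\<dots> \<le> V * (1/4) ^ k" using V G(1) by (intro mult_left_mono out) auto
    also have "\<dots> = (sqrt V * (1/2) ^ k)\<^sup>2"
    proof -
      have "((1/2::real) ^ k)\<^sup>2 = (1/4) ^ k" by (simp add: power2_eq_square flip: power_mult_distrib)
      then show ?thesis using V by (simp add: power_mult_distrib)
    qed
    finally show ?thesis by (rule power2_le_imp_le) (use V in auto)
  qed
  obtain h where h: "h \<in> L2p L" "\<And>k. tnorm L (\<lambda>x. S k x - h x) \<le> sqrt V / (1 - 1/2) * (1/2) ^ k"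
    by (rule L2p_complete[OF L SL _ _ step]) auto
  have lim0: "(\<lambda>k. sqrt V / (1 - 1/2) * (1/2) ^ k) \<longlonglongrightarrow> 0"
    by (intro tendsto_mult_right_zero LIMSEQ_realpow_zero) auto
  have dl: "(\<lambda>k. tnorm L (\<lambda>x. S k x - h x)) \<longlonglongrightarrow> 0"
    by (rule tendsto_sandwich[OF _ _ tendsto_const lim0]) (use h in auto)
  have pl: "(\<lambda>k. pair L (S k) g) \<longlonglongrightarrow> pair L h g" if g: "g \<in> L2p L" for g
  proof (rule Lim_null_comparison[where g = "\<lambda>k. tnorm L (\<lambda>x. S k x - h x) * tnorm L g", THEN LIM_zero_cancel])
    show "(\<lambda>k. tnorm L (\<lambda>x. S k x - h x) * tnorm L g) \<longlonglongrightarrow> 0"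
      by (rule tendsto_mult_left_zero[OF dl])
    show "\<forall>\<^sub>F k in sequentially. norm (pair L (S k) g - pair L h g) \<le> tnorm L (\<lambda>x. S k x - h x) * tnorm L g"
      using norm_pair_le[OF L2p_diff[OF SL h(1)] g] pair_diff(2)[OF g SL h(1)] by simp
  qed
  show ?thesis
  proof (rule that[OF h(1)])
    fix m
    have "(\<lambda>k. pair L (S k) (expo L (- m))) \<longlonglongrightarrow> of_real V * c m"
    proof (cases "\<exists>k. m \<in> G k")
      case True
      then obtain k0 where k0: "m \<in> G k0" by blast
      have "m \<in> G k" if "k \<ge> k0" for k using k0 that by (fastforce simp: G_def)
      then have "eventually (\<lambda>k. pair L (S k) (expo L (- m)) = of_real V * c m) sequentially"
        unfolding S_def using tsum_coeff[OF L G(1)] by (auto simp: eventually_sequentially V_def intro!: exI[of _ k0])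
      then show ?thesis by (rule tendsto_eventually)
    next
      case False
      \<comment> \<open>An index contained in no \<open>G k\<close> lies in the tail beyond each of
        them; the tail bounds force its coefficient to vanish, as it does for all partial
        sums.\<close>
      have "(cmod (c m))\<^sup>2 \<le> (1/4) ^ k" for k using out[of "{m}" k] False by simp
      moreover have "(\<lambda>k. (1/4) ^ k :: real) \<longlonglongrightarrow> 0" by (intro LIMSEQ_realpow_zero) auto
      ultimately have "(cmod (c m))\<^sup>2 \<le> 0" by (intro LIMSEQ_le_const) auto
      then have "c m = 0" by simp
      moreover have "pair L (S k) (expo L (- m)) = 0" for k
        using False tsum_coeff[OF L G(1), of k c m] by (simp add: S_def)
      ultimately show ?thesis by simp
    qed
    with pl[OF expo_L2p[OF L]] show "pair L h (expo L (- m)) = of_real (L ^ CARD('n)) * c m"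
      by (auto simp: V_def intro: LIMSEQ_unique)
  next
    have "tnorm L h \<le> sqrt (V * T)"
    proof (rule LIMSEQ_le_const)
      show "(\<lambda>k. tnorm L (\<lambda>x. S k x - h x) + sqrt (V * T)) \<longlonglongrightarrow> sqrt (V * T)"
        using tendsto_add[OF dl tendsto_const[of "sqrt (V * T)"]] by simp
      have "tnorm L h \<le> tnorm L (\<lambda>x. S k x - h x) + sqrt (V * T)" for k
      proof -
        have "tnorm L h \<le> tnorm L (\<lambda>x. h x - S k x) + tnorm L (S k)"
          using nrm_triangle[OF L2p_sq_int[OF L2p_diff[OF h(1) SL[of k]]] L2p_sq_int[OF SL[of k]]] by simp
        moreover have "tnorm L (S k) \<le> sqrt (V * T)"
        proof (rule real_le_rsqrt)
          show "(tnorm L (S k))\<^sup>2 \<le> V * T"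
            using tsum_norm[OF L G(1), of k c] le[OF G(1), of k] V by (simp add: S_def V_def)
        qed
        ultimately show ?thesis by (simp add: nrm_minus_commute[of _ h])
      qed
      then show "\<exists>N. \<forall>k\<ge>N. tnorm L h \<le> tnorm L (\<lambda>x. S k x - h x) + sqrt (V * T)" by blast
    qed
    then have "(tnorm L h)\<^sup>2 \<le> (sqrt (V * T))\<^sup>2" by (intro power_mono) auto
    moreover have "T \<ge> 0" using le[of "{}"] by simp
    ultimately show "(tnorm L h)\<^sup>2 \<le> L ^ CARD('n) * (\<Sum>\<^sub>\<infinity>m. (cmod (c m))\<^sup>2)"
      using V by (simp add: V_def T_def)
  qed
qed

lemma bij_uminus_vec: "bij (uminus :: int^'n \<Rightarrow> int^'n)"
  by (rule involuntory_imp_bij) simp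

lemma summable_on_uminus_vec:
  fixes f :: "int^'n \<Rightarrow> 'b::{comm_monoid_add, topological_space}"
  shows "(\<lambda>m. f (- m)) summable_on UNIV \<longleftrightarrow> f summable_on UNIV"
  using summable_on_reindex_bij_betw[OF bij_uminus_vec, of f] by (simp add: o_def)

lemma infsum_uminus_vec:
  fixes f :: "int^'n \<Rightarrow> 'b::{comm_monoid_add, t2_space}"
  shows "(\<Sum>\<^sub>\<infinity>m. f (- m)) = infsum f UNIV"
  using infsum_reindex_bij_betw[OF bij_uminus_vec, of f] by (simp add: o_def)

text \<open>Bessel gives one inequality. For the other, the Riesz-Fischer function with the
  coefficients of \<open>f\<close> equals \<open>f\<close> almost everywhere by uniqueness, and its
  norm is at most the sum over the coefficients.\<close>

lemma Parseval:
  fixes f :: "real^'n \<Rightarrow> complex"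
  assumes L: "L > 0" and f: "f \<in> L2p L"
  shows "((\<lambda>m. (cmod (pair L f (expo L m)))\<^sup>2) has_sum (L ^ CARD('n) * (tnorm L f)\<^sup>2)) UNIV"
proof -
  define V where "V = L ^ CARD('n)"
  have V: "V > 0" using L by (simp add: V_def)
  let ?a = "\<lambda>m. (cmod (pair L f (expo L m)))\<^sup>2"
  have bess: "sum ?a F \<le> V * (tnorm L f)\<^sup>2" if "finite F" for F
    using Bessel[OF L that f] by (simp add: V_def)
  have sa: "?a summable_on UNIV"
    by (rule nonneg_bdd_above_summable_on) (use bess in \<open>auto intro!: bdd_aboveI2\<close>)
  define c where "c m = pair L f (expo L (- m)) / of_real V" for m
  have c2: "(cmod (c m))\<^sup>2 = ?a (- m) / V\<^sup>2" for m
    by (simp add: c_def norm_divide power_divide)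
  have sc: "(\<lambda>m. (cmod (c m))\<^sup>2) summable_on UNIV"
    unfolding c2 divide_inverse by (intro summable_on_cmult_left summable_on_uminus_vec[of ?a, THEN iffD2] sa)
  obtain g where g: "g \<in> L2p L" "\<And>m. pair L g (expo L (- m)) = of_real V * c m"
    "(tnorm L g)\<^sup>2 \<le> V * (\<Sum>\<^sub>\<infinity>m. (cmod (c m))\<^sup>2)"
    using Riesz_Fischer[OF L sc] unfolding V_def by metis
  have "AE x in torus L. f x = g x"
  proof (rule Fourier_unique[OF L f g(1)])
    fix m show "pair L f (expo L m) = pair L g (expo L m)"
      using g(2)[of "- m"] V by (simp add: c_def)
  qed
  then have "tnorm L f = tnorm L g"
    using f g(1) by (intro nrm_cong_AE) (auto dest: L2p_sq_int sq_int_measurable)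
  then have "(tnorm L f)\<^sup>2 \<le> V * (\<Sum>\<^sub>\<infinity>m. ?a (- m) / V\<^sup>2)"
    using g(3) unfolding c2 by simp
  also have "(\<Sum>\<^sub>\<infinity>m. ?a (- m) / V\<^sup>2) = infsum ?a UNIV / V\<^sup>2"
    unfolding divide_inverse by (subst infsum_cmult_left') (simp add: infsum_uminus_vec[of ?a])
  finally have "V * (tnorm L f)\<^sup>2 \<le> infsum ?a UNIV"
    using V by (simp add: power2_eq_square field_simps)
  moreover have "infsum ?a UNIV \<le> V * (tnorm L f)\<^sup>2"
    by (rule infsum_le_finite_sums[OF sa]) (use bess in auto)
  ultimately have "infsum ?a UNIV = V * (tnorm L f)\<^sup>2" by simp
  with has_sum_infsum[OF sa] show ?thesis by (simp add: V_def)
qed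

text \<open>The Fourier partial sum is an orthogonal projection, so its squared distance from
  \<open>f\<close> is the tail of the Parseval series divided by the volume
  \<open>V\<close>.\<close>

lemma tsum_dense:
  fixes f :: "real^'n \<Rightarrow> complex"
  assumes L: "L > 0" and f: "f \<in> L2p L" and e: "e > 0"
  obtains F c where "finite F" "tnorm L (\<lambda>x. f x - tsum L F c x) < e"
proof -
  define V where "V = L ^ CARD('n)"
  have V: "V > 0" using L by (simp add: V_def)
  define c where "c m = pair L f (expo L (- m)) / of_real V" for m
  let ?a = "\<lambda>m. (cmod (pair L f (expo L (- m))))\<^sup>2"
  have "(?a has_sum (V * (tnorm L f)\<^sup>2)) UNIV"
    using Parseval[OF L f] has_sum_reindex_bij_betw[OF bij_uminus_vec, of "\<lambda>m. (cmod (pair L f (expo L m)))\<^sup>2"]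
    by (simp add: V_def)
  then obtain F where F: "finite F" "dist (sum ?a F) (V * (tnorm L f)\<^sup>2) \<le> V * e\<^sup>2 / 2"
    using has_sum_finite_approximation[of ?a UNIV "V * (tnorm L f)\<^sup>2" "V * e\<^sup>2 / 2"] V e by auto
  define S where "S = tsum L F c"
  have S: "S \<in> L2p L" by (simp add: S_def tsum_L2p L)
  have cS: "(\<lambda>x. cnj (S x)) \<in> L2p L" by (rule L2p_cnj[OF S])
  have fS: "pair L f (\<lambda>x. cnj (S x)) = of_real (sum ?a F / V)"
  proof -
    have "pair L f (\<lambda>x. cnj (S x)) = (\<Sum>m\<in>F. cnj (c m) * pair L f (expo L (- m)))"
      unfolding S_def by (rule pair_cnj_tsum[OF L f])
    also have "\<dots> = (\<Sum>m\<in>F. of_real (?a m / V))"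
      by (intro sum.cong refl) (simp add: c_def complex_norm_square mult.commute del: of_real_power)
    finally show ?thesis by (simp add: sum_divide_distrib)
  qed
  have SS: "(tnorm L S)\<^sup>2 = sum ?a F / V"
    unfolding S_def tsum_norm[OF L F(1)] V_def[symmetric]
    using V by (simp add: c_def norm_divide power_divide sum_divide_distrib[symmetric] power2_eq_square)
  have "complex_of_real ((tnorm L (\<lambda>x. f x - S x))\<^sup>2) = pair L (\<lambda>x. f x - S x) (\<lambda>x. cnj (f x) - cnj (S x))"
    unfolding pair_cnj_self[symmetric] by simp
  also have "\<dots> = pair L f (\<lambda>x. cnj (f x)) - pair L f (\<lambda>x. cnj (S x)) - (pair L S (\<lambda>x. cnj (f x)) - pair L S (\<lambda>x. cnj (S x)))"
    using f S cS L2p_cnj[OF f] by (simp add: pair_diff L2p_diff)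
  also have "pair L S (\<lambda>x. cnj (f x)) = of_real (sum ?a F / V)"
    using cnj_pair[of L f "\<lambda>x. cnj (S x)"] fS by (simp add: pair_commute)
  finally have "complex_of_real ((tnorm L (\<lambda>x. f x - S x))\<^sup>2) = complex_of_real ((tnorm L f)\<^sup>2 - sum ?a F / V)"
    by (simp add: fS pair_cnj_self SS)
  then have "(tnorm L (\<lambda>x. f x - S x))\<^sup>2 = (tnorm L f)\<^sup>2 - sum ?a F / V"
    by (simp only: of_real_eq_iff)
  also have "\<dots> \<le> e\<^sup>2 / 2"
  proof -
    have "V * (tnorm L f)\<^sup>2 - sum ?a F \<le> V * e\<^sup>2 / 2"
      using F(2) by (simp only: dist_real_def abs_le_iff) linarith
    then show ?thesis using V by (simp add: field_simps)
  qed
  also have "\<dots> < e\<^sup>2" using e by simp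
  finally have "tnorm L (\<lambda>x. f x - S x) < e" by (rule power_less_imp_less_base) (use e in simp)
  then show ?thesis using that[OF F(1)] by (simp add: S_def)
qed

text \<open>The Riesz representation theorem for the bilinear pairing. The values of \<psi> on the
  exponentials are square summable, so Riesz-Fischer builds \<open>h\<close> from them; agreement on
  trigonometric sums extends by density and the bound on \<psi>.\<close>

lemma L2_functional_representation:
  fixes \<psi> :: "(real^'n \<Rightarrow> complex) \<Rightarrow> complex"
  assumes L: "L > 0"
    and lin: "\<And>f g c. f \<in> L2p L \<Longrightarrow> g \<in> L2p L \<Longrightarrow> \<psi> (\<lambda>x. f x + c * g x) = \<psi> f + c * \<psi> g"
    and bdd: "\<And>f. f \<in> L2p L \<Longrightarrow> cmod (\<psi> f) \<le> B * tnorm L f" and B: "B \<ge> 0"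
  obtains h where "h \<in> L2p L" "\<And>f. f \<in> L2p L \<Longrightarrow> \<psi> f = pair L h f" "tnorm L h \<le> B"
proof -
  define V where "V = L ^ CARD('n)"
  have V: "V > 0" using L by (simp add: V_def)
  define c where "c m = \<psi> (expo L (- m)) / of_real V" for m
  let ?a = "\<lambda>m. (cmod (\<psi> (expo L m)))\<^sup>2"
  have "sum ?a F \<le> B\<^sup>2 * L ^ CARD('n)" if "finite F" for F
    by (rule functional_coeff_bound[OF L that lin bdd B])
  then have sa: "?a summable_on UNIV"
    by (intro nonneg_bdd_above_summable_on) (auto intro!: bdd_aboveI2)
  have c2: "(cmod (c m))\<^sup>2 = ?a (- m) / V\<^sup>2" for m
    by (simp add: c_def norm_divide power_divide)
  have sc: "(\<lambda>m. (cmod (c m))\<^sup>2) summable_on UNIV"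
    unfolding c2 divide_inverse by (intro summable_on_cmult_left summable_on_uminus_vec[of ?a, THEN iffD2] sa)
  obtain h where h: "h \<in> L2p L" "\<And>m. pair L h (expo L (- m)) = of_real V * c m"
    using Riesz_Fischer[OF L sc] unfolding V_def by metis
  have he: "pair L h (expo L m) = \<psi> (expo L m)" for m
    using h(2)[of "- m"] V by (simp add: c_def)
  have "\<psi> (\<lambda>x. 0) = 0"
    using lin[of "\<lambda>x. 0" "\<lambda>x. 0" 1] by simp
  note z = this
  have hs: "pair L h (tsum L F d) = \<psi> (tsum L F d)" if "finite F" for F d
    using that
  proof (induction F)
    case (insert m F)
    have eq: "tsum L (insert m F) d = (\<lambda>x. tsum L F d x + d m * expo L m x)"
      using insert by (simp add: tsum_def fun_eq_iff)
    have "\<psi> (tsum L (insert m F) d) = \<psi> (tsum L F d) + d m * \<psi> (expo L m)"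
      unfolding eq by (intro lin tsum_L2p expo_L2p L)
    moreover have "pair L h (tsum L (insert m F) d) = pair L h (tsum L F d) + d m * pair L h (expo L m)"
      unfolding eq by (subst pair_add(1)) (auto intro: h(1) tsum_L2p L2p_cmult expo_L2p L simp: pair_cmult)
    ultimately show ?case using insert he by simp
  qed (simp add: tsum_def z)
  have eq: "\<psi> f = pair L h f" if f: "f \<in> L2p L" for f
  proof (rule ccontr)
    assume "\<psi> f \<noteq> pair L h f"
    then have p: "cmod (\<psi> f - pair L h f) > 0" by simp
    define e where "e = cmod (\<psi> f - pair L h f) / (B + tnorm L h + 1)"
    have D: "B + tnorm L h + 1 > 0" using B nrm_nonneg[of "torus L" h] by linarith
    then have e: "e > 0" using p by (simp add: e_def)
    obtain F d where F: "finite F" "tnorm L (\<lambda>x. f x - tsum L F d x) < e"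
      using tsum_dense[OF L f e] by metis
    let ?g = "\<lambda>x. f x - tsum L F d x"
    have g: "?g \<in> L2p L" by (intro L2p_diff f tsum_L2p L)
    have "\<psi> ?g = \<psi> f - \<psi> (tsum L F d)"
      using lin[OF f tsum_L2p[OF L], of "-1" F d] by simp
    moreover have "pair L h ?g = pair L h f - pair L h (tsum L F d)"
      by (rule pair_diff(1)[OF h(1) f tsum_L2p[OF L]])
    ultimately have "\<psi> f - pair L h f = \<psi> ?g - pair L h ?g" using hs[OF F(1)] by simp
    then have "cmod (\<psi> f - pair L h f) \<le> cmod (\<psi> ?g) + cmod (pair L h ?g)"
      using norm_triangle_ineq4 by metis
    also have "\<dots> \<le> B * tnorm L ?g + tnorm L h * tnorm L ?g"
      by (intro add_mono bdd g norm_pair_le h(1))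
    also have "\<dots> \<le> B * e + tnorm L h * e"
      using F(2) B by (intro add_mono mult_left_mono) auto
    also have "\<dots> < (B + tnorm L h + 1) * e" using e by (simp add: algebra_simps)
    also have "\<dots> = cmod (\<psi> f - pair L h f)" using D by (simp add: e_def)
    finally show False by simp
  qed
  \<comment> \<open>Testing on the conjugate of \<open>h\<close> produces the squared norm of
    \<open>h\<close>, hence the sharp bound.\<close>
  have "(tnorm L h)\<^sup>2 = cmod (\<psi> (\<lambda>x. cnj (h x)))"
    using eq[OF L2p_cnj[OF h(1)]] by (simp add: pair_cnj_self norm_power)
  also have "\<dots> \<le> B * tnorm L h"
    using bdd[OF L2p_cnj[OF h(1)]] by (simp add: nrm_cnj)
  finally have "tnorm L h \<le> B"
    using B nrm_nonneg[of "torus L" h] mult_right_le_imp_le[of "tnorm L h" "tnorm L h" B]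
    by (cases "tnorm L h = 0") (auto simp: power2_eq_square)
  then show ?thesis using that[OF h(1) eq] by blast
qed

section \<open>Smooth periodic functions\<close>

lemma pderiv_at_eq: "(f has_derivative D) (at x) \<Longrightarrow> pderiv_at i f x = D (axis i 1)"
  unfolding pderiv_at_def by (metis frechet_derivative_at)

lemma iter_pderiv_Nil [simp]: "iter_pderiv [] f = f"
  by (simp add: iter_pderiv_def)

lemma iter_pderiv_Cons [simp]: "iter_pderiv (d # ds) f = pderiv_at d (iter_pderiv ds f)"
  by (simp add: iter_pderiv_def)

lemma iter_pderiv_snoc: "iter_pderiv (ds @ [d]) f = iter_pderiv ds (pderiv_at d f)"
  by (simp add: iter_pderiv_def)

lemma smooth_differentiable: "smooth f \<Longrightarrow> f differentiable (at x)"
  unfolding smooth_def by (metis UNIV_I differentiable_on_def iter_pderiv_Nil open_UNIV at_within_open)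

lemma smooth_has_derivative: "smooth f \<Longrightarrow> (f has_derivative frechet_derivative f (at x)) (at x)"
  using smooth_differentiable frechet_derivative_works by blast

lemma smooth_pderiv: "smooth f \<Longrightarrow> smooth (pderiv_at i f)"
  unfolding smooth_def by (metis iter_pderiv_snoc)

lemma smooth_continuous: "smooth f \<Longrightarrow> continuous_on UNIV f"
  unfolding smooth_def by (metis differentiable_imp_continuous_on iter_pderiv_Nil)

lemma smooth_measurable:
  fixes f :: "real^'n \<Rightarrow> 'b::real_normed_vector"
  shows "smooth f \<Longrightarrow> f \<in> borel_measurable lebesgue"
  by (intro lebesgue_measurable_if_continuous smooth_continuous)

text \<open>To show smoothness it suffices to name a class of differentiable functions that contains
  \<open>f\<close> and is closed under partial derivatives. Most closure properties below are
  obtained by choosing such a class.\<close>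

lemma smooth_coinduct:
  assumes "X f" and "\<And>f x. X f \<Longrightarrow> f differentiable (at x)" and "\<And>f i. X f \<Longrightarrow> X (pderiv_at i f)"
  shows "smooth f"
proof -
  have "X (iter_pderiv ds f)" for ds
    by (induction ds) (use assms in auto)
  then show ?thesis
    using assms(2) by (simp add: smooth_def differentiable_on_def differentiable_at_withinI)
qed

lemma pderiv_bounded_linear:
  assumes "bounded_linear h" "smooth f"
  shows "pderiv_at i (\<lambda>x. h (f x)) = (\<lambda>x. h (pderiv_at i f x))"
proof
  fix x
  have "((\<lambda>x. h (f x)) has_derivative (\<lambda>y. h (frechet_derivative f (at x) y))) (at x)"
    by (rule bounded_linear.has_derivative[OF assms(1) smooth_has_derivative[OF assms(2)]])
  from pderiv_at_eq[OF this] show "pderiv_at i (\<lambda>x. h (f x)) x = h (pderiv_at i f x)"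
    by (simp add: pderiv_at_def)
qed

lemma smooth_bounded_linear:
  assumes "bounded_linear h" "smooth f"
  shows "smooth (\<lambda>x. h (f x))"
proof (rule smooth_coinduct[where X = "\<lambda>k. \<exists>f. smooth f \<and> k = (\<lambda>x. h (f x))"])
  show "\<exists>fa. smooth fa \<and> (\<lambda>x. h (f x)) = (\<lambda>x. h (fa x))" using assms by blast
next
  fix k x assume "\<exists>f. smooth f \<and> k = (\<lambda>x. h (f x))"
  then show "k differentiable at x"
    using bounded_linear.has_derivative[OF assms(1) smooth_has_derivative] differentiable_def by blast
next
  fix k i assume "\<exists>f. smooth f \<and> k = (\<lambda>x. h (f x))"
  then show "\<exists>f. smooth f \<and> pderiv_at i k = (\<lambda>x. h (f x))"
    using pderiv_bounded_linear[OF assms(1)] smooth_pderiv by metis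
qed

lemma pderiv_add:
  assumes "smooth f" "smooth g"
  shows "pderiv_at i (\<lambda>x. f x + g x) = (\<lambda>x. pderiv_at i f x + pderiv_at i g x)"
  using pderiv_at_eq[OF has_derivative_add[OF smooth_has_derivative[OF assms(1)] smooth_has_derivative[OF assms(2)]]]
  by (simp add: fun_eq_iff pderiv_at_def)

lemma smooth_add:
  assumes "smooth f" "smooth g"
  shows "smooth (\<lambda>x. f x + g x)"
proof (rule smooth_coinduct[where X = "\<lambda>k. \<exists>f g. smooth f \<and> smooth g \<and> k = (\<lambda>x. f x + g x)"])
  show "\<exists>fa ga. smooth fa \<and> smooth ga \<and> (\<lambda>x. f x + g x) = (\<lambda>x. fa x + ga x)" using assms by blast
next
  fix k x assume "\<exists>f g. smooth f \<and> smooth g \<and> k = (\<lambda>x. f x + g x)"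
  then show "k differentiable at x" using smooth_differentiable differentiable_add by blast
next
  fix k i assume "\<exists>f g. smooth f \<and> smooth g \<and> k = (\<lambda>x. f x + g x)"
  then show "\<exists>f g. smooth f \<and> smooth g \<and> pderiv_at i k = (\<lambda>x. f x + g x)"
    using pderiv_add smooth_pderiv by metis
qed

lemma pderiv_const: "pderiv_at i (\<lambda>x. c) = (\<lambda>x. 0)"
  by (rule ext, rule pderiv_at_eq[OF has_derivative_const])

lemma smooth_const: "smooth (\<lambda>x. c)"
  by (rule smooth_coinduct[where X = "\<lambda>k. \<exists>c. k = (\<lambda>x. c)"]) (auto simp: pderiv_const)

lemma smooth_sum: "(\<And>i. i \<in> I \<Longrightarrow> smooth (f i)) \<Longrightarrow> smooth (\<lambda>x. \<Sum>i\<in>I. f i x)"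
  by (induction I rule: infinite_finite_induct) (auto intro: smooth_const smooth_add)

lemma pderiv_sum:
  "(\<And>j. j \<in> I \<Longrightarrow> smooth (f j)) \<Longrightarrow> pderiv_at i (\<lambda>x. \<Sum>j\<in>I. f j x) = (\<lambda>x. \<Sum>j\<in>I. pderiv_at i (f j) x)"
  by (induction I rule: infinite_finite_induct) (auto simp: pderiv_const pderiv_add smooth_sum)

lemma pderiv_mult:
  fixes f g :: "real^'n \<Rightarrow> 'b::real_normed_algebra"
  assumes "smooth f" "smooth g"
  shows "pderiv_at i (\<lambda>x. f x * g x) = (\<lambda>x. f x * pderiv_at i g x + pderiv_at i f x * g x)"
  using pderiv_at_eq[OF has_derivative_mult[OF smooth_has_derivative[OF assms(1)] smooth_has_derivative[OF assms(2)]]]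
  by (simp add: fun_eq_iff pderiv_at_def)

text \<open>Single products are not preserved by the Leibniz rule, but finite sums of products are;
  this is the invariant class for \<open>smooth_coinduct\<close>.\<close>

inductive sum_of_products :: "(real^'n \<Rightarrow> 'b::real_normed_algebra) \<Rightarrow> bool" where
  mult: "smooth f \<Longrightarrow> smooth g \<Longrightarrow> sum_of_products (\<lambda>x. f x * g x)"
| add: "sum_of_products f \<Longrightarrow> sum_of_products g \<Longrightarrow> sum_of_products (\<lambda>x. f x + g x)"

lemma smooth_mult:
  fixes f g :: "real^'n \<Rightarrow> 'b::real_normed_algebra"
  assumes "smooth f" "smooth g"
  shows "smooth (\<lambda>x. f x * g x)"
proof (rule smooth_coinduct[where X = sum_of_products])
  have *: "(\<forall>x. k differentiable at x) \<and> (\<forall>i. sum_of_products (pderiv_at i k))"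
    if "sum_of_products k" for k :: "real^'n \<Rightarrow> 'b"
    using that
  proof induction
    case (mult f g)
    then have "sum_of_products (\<lambda>x. f x * pderiv_at i g x + pderiv_at i f x * g x)" for i
      by (intro sum_of_products.intros smooth_pderiv)
    moreover have "(\<lambda>x. f x * g x) differentiable at x" for x
      using has_derivative_mult[OF smooth_has_derivative[OF mult(1)] smooth_has_derivative[OF mult(2)]]
      by (rule differentiableI)
    ultimately show ?case using mult by (simp add: pderiv_mult)
  next
    case (add f g)
    have "pderiv_at i (\<lambda>x. f x + g x) = (\<lambda>x. pderiv_at i f x + pderiv_at i g x)" for i
    proof
      fix x
      have "(f has_derivative frechet_derivative f (at x)) (at x)" "(g has_derivative frechet_derivative g (at x)) (at x)"
        using add.IH frechet_derivative_works by blast+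
      from pderiv_at_eq[OF has_derivative_add[OF this]]
      show "pderiv_at i (\<lambda>x. f x + g x) x = pderiv_at i f x + pderiv_at i g x" by (simp add: pderiv_at_def)
    qed
    then show ?case using add by (auto intro: sum_of_products.add)
  qed
  show "k differentiable at x" if "sum_of_products k" for k :: "real^'n \<Rightarrow> 'b" and x using * that by blast
  show "sum_of_products (pderiv_at i k)" if "sum_of_products k" for k :: "real^'n \<Rightarrow> 'b" and i using * that by blast
qed (rule sum_of_products.mult[OF assms])

lemma smooth_cmult: "smooth f \<Longrightarrow> smooth (\<lambda>x. (c::complex) * f x)"
  by (rule smooth_mult[OF smooth_const])

lemma pderiv_cmult: "smooth f \<Longrightarrow> pderiv_at i (\<lambda>x. (c::complex) * f x) = (\<lambda>x. c * pderiv_at i f x)"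
  by (simp add: pderiv_mult[OF smooth_const] pderiv_const)

lemma pderiv_cis: "pderiv_at i (\<lambda>x. cis (\<xi> \<bullet> x)) = (\<lambda>x. \<i> * complex_of_real (\<xi> $ i) * cis (\<xi> \<bullet> x))"
  and differentiable_cis: "(\<lambda>x. cis (\<xi> \<bullet> x)) differentiable (at y)"
proof -
  have d: "((\<lambda>x. cis (\<xi> \<bullet> x)) has_derivative (\<lambda>h. (\<xi> \<bullet> h) *\<^sub>R (\<i> * cis (\<xi> \<bullet> x)))) (at x)" for x
  proof -
    have "((\<lambda>x. \<i> * complex_of_real (\<xi> \<bullet> x)) has_derivative (\<lambda>h. \<i> * complex_of_real (\<xi> \<bullet> h))) (at x)"
      by (auto intro!: derivative_eq_intros)
    moreover have "(exp has_derivative (\<lambda>h. h * exp (\<i> * complex_of_real (\<xi> \<bullet> x)))) (at (\<i> * complex_of_real (\<xi> \<bullet> x)))"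
      using DERIV_exp[of "\<i> * complex_of_real (\<xi> \<bullet> x)"] by (simp add: has_field_derivative_def mult_commute_abs)
    ultimately have "((\<lambda>x. exp (\<i> * complex_of_real (\<xi> \<bullet> x))) has_derivative
        (\<lambda>h. (\<i> * complex_of_real (\<xi> \<bullet> h)) * exp (\<i> * complex_of_real (\<xi> \<bullet> x)))) (at x)"
      by (rule has_derivative_compose)
    then show ?thesis
      by (simp add: cis_conv_exp scaleR_conv_of_real mult_ac)
  qed
  show "pderiv_at i (\<lambda>x. cis (\<xi> \<bullet> x)) = (\<lambda>x. \<i> * complex_of_real (\<xi> $ i) * cis (\<xi> \<bullet> x))"
    using pderiv_at_eq[OF d] by (simp add: fun_eq_iff inner_axis scaleR_conv_of_real mult_ac)
  show "(\<lambda>x. cis (\<xi> \<bullet> x)) differentiable (at y)"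
    using d differentiable_def by blast
qed

lemma smooth_cis: "smooth (\<lambda>x::real^'n. cis (\<xi> \<bullet> x))"
proof (rule smooth_coinduct[where X = "\<lambda>k. \<exists>c. k = (\<lambda>x. c * cis (\<xi> \<bullet> x))"])
  show "\<exists>c. (\<lambda>x::real^'n. cis (\<xi> \<bullet> x)) = (\<lambda>x. c * cis (\<xi> \<bullet> x))" by (rule exI[of _ 1]) simp
next
  fix k :: "real^'n \<Rightarrow> complex" and x assume "\<exists>c. k = (\<lambda>x. c * cis (\<xi> \<bullet> x))"
  then show "k differentiable at x" by (auto intro!: differentiable_mult differentiable_cis)
next
  fix k :: "real^'n \<Rightarrow> complex" and i assume "\<exists>c. k = (\<lambda>x. c * cis (\<xi> \<bullet> x))"
  then obtain c where k: "k = (\<lambda>x. c * cis (\<xi> \<bullet> x))" by blast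
  have "pderiv_at i k = (\<lambda>x. c * (\<i> * complex_of_real (\<xi> $ i)) * cis (\<xi> \<bullet> x))"
  proof
    fix x
    have "((\<lambda>x. cis (\<xi> \<bullet> x)) has_derivative frechet_derivative (\<lambda>x. cis (\<xi> \<bullet> x)) (at x)) (at x)"
      using differentiable_cis frechet_derivative_works by blast
    from pderiv_at_eq[OF has_derivative_mult_right[OF this, of c], of i]
    have "pderiv_at i k x = c * pderiv_at i (\<lambda>x. cis (\<xi> \<bullet> x)) x" by (simp add: k pderiv_at_def)
    then show "pderiv_at i k x = c * (\<i> * complex_of_real (\<xi> $ i)) * cis (\<xi> \<bullet> x)"
      by (simp add: pderiv_cis mult.assoc)
  qed
  then show "\<exists>c. pderiv_at i k = (\<lambda>x. c * cis (\<xi> \<bullet> x))" by blast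
qed

lemma smooth_expo: "smooth (expo L m)"
  unfolding expo_def[abs_def] by (rule smooth_cis)

lemma pderiv_expo: "pderiv_at i (expo L m) = (\<lambda>x. \<i> * complex_of_real (freq L m $ i) * expo L m x)"
  unfolding expo_def[abs_def] by (rule pderiv_cis)

section \<open>Locality of differentiation\<close>

lemma has_derivative_local:
  assumes "open U" "x \<in> U" "\<And>y. y \<in> U \<Longrightarrow> f y = g y"
  shows "(f has_derivative D) (at x) \<longleftrightarrow> (g has_derivative D) (at x)"
  using has_derivative_transform_within_open[OF _ assms(1,2), of f D UNIV g]
    has_derivative_transform_within_open[OF _ assms(1,2), of g D UNIV f] assms(3) by auto

lemma iter_pderiv_local:
  assumes "open U" "x \<in> U" "\<And>y. y \<in> U \<Longrightarrow> f y = g y"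
  shows "iter_pderiv ds f x = iter_pderiv ds g x"
  using assms(2)
proof (induction ds arbitrary: x)
  case (Cons d ds)
  \<comment> \<open>\<open>frechet_derivative\<close> chooses some \<open>D\<close> satisfying this
    relation, so equivalent relations give equal values whether or not a derivative exists.\<close>
  have "(iter_pderiv ds f has_derivative D) (at x) \<longleftrightarrow> (iter_pderiv ds g has_derivative D) (at x)" for D
    by (rule has_derivative_local[OF assms(1) Cons.prems Cons.IH])
  then show ?case by (simp add: pderiv_at_def frechet_derivative_def)
qed (use assms in simp)

lemma pderiv_local:
  assumes "open U" "x \<in> U" "\<And>y. y \<in> U \<Longrightarrow> f y = g y"
  shows "pderiv_at i f x = pderiv_at i g x"
  using iter_pderiv_local[of U x f g "[i]"] assms by simp

text \<open>This is how locally finite sums of translates and windows cut off at the boundary of a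
  cube are seen to be smooth.\<close>

lemma smooth_local:
  assumes "\<And>y. \<exists>U g. open U \<and> y \<in> U \<and> smooth g \<and> (\<forall>x\<in>U. f x = g x)"
  shows "smooth f"
  unfolding smooth_def
proof (intro allI)
  fix ds
  have "iter_pderiv ds f differentiable (at y)" for y
  proof -
    obtain U g where U: "open U" "y \<in> U" "smooth g" "\<And>x. x \<in> U \<Longrightarrow> f x = g x"
      using assms[of y] by blast
    have "iter_pderiv ds g differentiable (at y)"
      using U(3) by (simp add: smooth_def differentiable_on_def)
    then obtain D where "(iter_pderiv ds g has_derivative D) (at y)" by (auto simp: differentiable_def)
    then have "(iter_pderiv ds f has_derivative D) (at y)"
      using has_derivative_local[of U y "iter_pderiv ds f" "iter_pderiv ds g" D]
        iter_pderiv_local[of U _ f g ds] U by blast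
    then show ?thesis by (auto simp: differentiable_def)
  qed
  then show "iter_pderiv ds f differentiable_on UNIV"
    by (simp add: differentiable_on_def)
qed

lemma pderiv_translate:
  assumes "smooth f"
  shows "pderiv_at i (\<lambda>x. f (x + t)) = (\<lambda>x. pderiv_at i f (x + t))"
proof
  fix x
  have "((\<lambda>x. f (x + t)) has_derivative frechet_derivative f (at (x + t))) (at x)"
  proof (rule has_derivative_compose[of "\<lambda>x. x + t" "\<lambda>h. h" x UNIV f "frechet_derivative f (at (x + t))"])
    show "((\<lambda>x. x + t) has_derivative (\<lambda>h. h)) (at x)" by (auto intro!: derivative_eq_intros)
  qed (rule smooth_has_derivative[OF assms])
  from pderiv_at_eq[OF this] show "pderiv_at i (\<lambda>x. f (x + t)) x = pderiv_at i f (x + t)"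
    by (simp add: pderiv_at_def)
qed

lemma smooth_translate:
  assumes "smooth f"
  shows "smooth (\<lambda>x. f (x + t))"
proof (rule smooth_coinduct[where X = "\<lambda>k. \<exists>f. smooth f \<and> k = (\<lambda>x. f (x + t))"])
  show "\<exists>fa. smooth fa \<and> (\<lambda>x. f (x + t)) = (\<lambda>x. fa (x + t))" using assms by blast
next
  fix k x assume "\<exists>f. smooth f \<and> k = (\<lambda>x. f (x + t))"
  then obtain f where f: "smooth f" "k = (\<lambda>x. f (x + t))" by blast
  have "((\<lambda>x. f (x + t)) has_derivative frechet_derivative f (at (x + t))) (at x)"
  proof (rule has_derivative_compose[of "\<lambda>x. x + t" "\<lambda>h. h" x UNIV f "frechet_derivative f (at (x + t))"])
    show "((\<lambda>x. x + t) has_derivative (\<lambda>h. h)) (at x)" by (auto intro!: derivative_eq_intros)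
  qed (rule smooth_has_derivative[OF f(1)])
  then show "k differentiable at x" using f differentiable_def by blast
next
  fix k i assume "\<exists>f. smooth f \<and> k = (\<lambda>x. f (x + t))"
  then show "\<exists>f. smooth f \<and> pderiv_at i k = (\<lambda>x. f (x + t))"
    using pderiv_translate smooth_pderiv by metis
qed

lemma periodic_pderiv:
  assumes "smooth f" "periodic L f"
  shows "periodic L (pderiv_at i f)"
  unfolding periodic_def
proof (intro allI)
  fix k x
  have "(\<lambda>x. f (x + L *\<^sub>R axis k 1)) = f" using assms(2) by (simp add: periodic_def fun_eq_iff)
  then show "pderiv_at i f (x + L *\<^sub>R axis k 1) = pderiv_at i f x"
    using pderiv_translate[OF assms(1), of i "L *\<^sub>R axis k 1"] by (simp add: fun_eq_iff)
qed

lemma pderiv_outside_ball: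
  assumes "\<And>x. norm x > R \<Longrightarrow> f x = 0" "norm x > R"
  shows "pderiv_at i f x = 0"
proof -
  have "open {x. norm x > R}" by (intro open_Collect_less continuous_intros)
  from pderiv_local[OF this, of x f "\<lambda>x. 0"] show ?thesis using assms by (simp add: pderiv_const)
qed

lemma tests_smooth: "\<phi> \<in> tests L \<Longrightarrow> smooth \<phi>"
  and tests_periodic: "\<phi> \<in> tests L \<Longrightarrow> periodic L \<phi>"
  by (auto simp: tests_def)

lemma tests_pderiv: "\<phi> \<in> tests L \<Longrightarrow> pderiv_at i \<phi> \<in> tests L"
  by (simp add: tests_def periodic_pderiv smooth_pderiv)

lemma tests_cnj: "\<phi> \<in> tests L \<Longrightarrow> (\<lambda>x. cnj (\<phi> x)) \<in> tests L"
  by (auto simp: tests_def periodic_def intro: smooth_bounded_linear[OF bounded_linear_cnj])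

lemma tests_add: "\<phi> \<in> tests L \<Longrightarrow> \<eta> \<in> tests L \<Longrightarrow> (\<lambda>x. \<phi> x + \<eta> x) \<in> tests L"
  by (auto simp: tests_def periodic_def intro: smooth_add)

lemma tests_mult: "\<phi> \<in> tests L \<Longrightarrow> \<eta> \<in> tests L \<Longrightarrow> (\<lambda>x. \<phi> x * \<eta> x) \<in> tests L"
  by (auto simp: tests_def periodic_def intro: smooth_mult)

lemma tests_cmult: "\<phi> \<in> tests L \<Longrightarrow> (\<lambda>x. c * \<phi> x) \<in> tests L"
  by (auto simp: tests_def periodic_def intro: smooth_cmult)

lemma tests_expo: "L > 0 \<Longrightarrow> expo L m \<in> tests L"
  by (simp add: tests_def periodic_expo smooth_expo)

lemma pderiv_cnj: "smooth f \<Longrightarrow> pderiv_at i (\<lambda>x. cnj (f x)) = (\<lambda>x. cnj (pderiv_at i f x))"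
  by (rule pderiv_bounded_linear[OF bounded_linear_cnj])

lemma bounded_periodic:
  fixes f :: "real^'n \<Rightarrow> 'b::real_normed_vector"
  assumes L: "L > 0" and p: "periodic L f" and c: "continuous_on UNIV f"
  obtains B where "B \<ge> 0" "\<And>x. norm (f x) \<le> B"
proof -
  have "compact (f ` cball 0 (L * real CARD('n)))"
    by (intro compact_continuous_image continuous_on_subset[OF c]) auto
  then obtain B where B: "\<And>x. x \<in> cball 0 (L * real CARD('n)) \<Longrightarrow> norm (f x) \<le> B"
    using compact_imp_bounded bounded_iff by (metis imageI)
  have "norm (f x) \<le> B" for x
  proof -
    have c: "x - L *\<^sub>R int_vec (int_floor L x) \<in> cell L" using mem_cell_iff[OF L] by blast
    have "norm (f (x - L *\<^sub>R int_vec (int_floor L x))) \<le> B"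
      using norm_cell_le[OF c] by (intro B) simp
    then show ?thesis using periodic_shift[OF p, of x "- int_floor L x"] by (simp add: int_vec_minus)
  qed
  moreover have "B \<ge> 0" using calculation[of 0] norm_ge_zero order_trans by blast
  ultimately show ?thesis using that by blast
qed

lemma tests_bounded:
  assumes "L > 0" "\<phi> \<in> tests L"
  obtains B where "B \<ge> 0" "\<And>x. cmod (\<phi> x) \<le> B"
  using bounded_periodic[OF assms(1) tests_periodic[OF assms(2)] smooth_continuous[OF tests_smooth[OF assms(2)]]] by metis

lemma tests_L2p:
  assumes "L > 0" "\<phi> \<in> tests L"
  shows "\<phi> \<in> L2p L"
proof -
  obtain B where "\<And>x. cmod (\<phi> x) \<le> B" using tests_bounded[OF assms] by blast
  then show ?thesis
    using assms by (intro L2p_bounded(1)[where B = B]) (auto intro: tests_periodic smooth_measurable tests_smooth)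
qed

section \<open>Integration by parts on the torus\<close>

lemma norm_axis_translate_diff_le:
  assumes f: "\<And>x. f differentiable (at x)" and B: "\<And>x. norm (pderiv_at i f x) \<le> B"
  shows "norm (f (x + t *\<^sub>R axis i 1) - f x) \<le> B * \<bar>t\<bar>"
proof -
  define g where "g s = f (x + s *\<^sub>R axis i 1)" for s :: real
  have d: "(g has_derivative (\<lambda>h. h *\<^sub>R pderiv_at i f (x + s *\<^sub>R axis i 1))) (at s)" for s
  proof -
    have "(f has_derivative frechet_derivative f (at (x + s *\<^sub>R axis i 1))) (at (x + s *\<^sub>R axis i 1))"
      using f frechet_derivative_works by blast
    moreover have "((\<lambda>s. x + s *\<^sub>R axis i 1) has_derivative (\<lambda>h. h *\<^sub>R axis i 1)) (at s)"
      by (auto intro!: derivative_eq_intros)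
    ultimately have *: "(g has_derivative (\<lambda>h. frechet_derivative f (at (x + s *\<^sub>R axis i 1)) (h *\<^sub>R axis i 1))) (at s)"
      unfolding g_def using has_derivative_compose by fastforce
    have "linear (frechet_derivative f (at (x + s *\<^sub>R axis i 1)))"
      using f linear_frechet_derivative by blast
    then show ?thesis using * by (simp add: linear_scale pderiv_at_def)
  qed
  have o: "onorm (\<lambda>h. h *\<^sub>R pderiv_at i f (x + s *\<^sub>R axis i 1)) \<le> B" for s
    using B by (intro onorm_le) (simp add: mult.commute[of B] mult_left_mono)
  have "norm (g t - g 0) \<le> B * norm (t - 0)"
    by (rule differentiable_bound[of UNIV g]) (use d o in auto)
  then show ?thesis by (simp add: g_def)
qed

text \<open>Difference quotients have integral zero by translation invariance, and a bound
  \<open>B\<close> on the second derivative makes them approach the first derivative uniformly, with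
  error \<open>B * h\<close>.\<close>

lemma integral_pderiv_torus:
  fixes \<phi> :: "real^'n \<Rightarrow> complex"
  assumes L: "L > 0" and \<phi>: "\<phi> \<in> tests L"
  shows "(\<integral>x. pderiv_at i \<phi> x \<partial>torus L) = 0"
proof -
  let ?I = "\<integral>x. pderiv_at i \<phi> x \<partial>torus L"
  define V where "V = L ^ CARD('n)"
  have s: "smooth \<phi>" using \<phi> by (rule tests_smooth)
  obtain B where B: "B \<ge> 0" "\<And>x. cmod (pderiv_at i (pderiv_at i \<phi>) x) \<le> B"
    using tests_bounded[OF L tests_pderiv[OF tests_pderiv[OF \<phi>]]] by metis
  have int: "integrable (torus L) f" if "f \<in> tests L" for f
    using pair_integrable[OF tests_L2p[OF L that] expo_L2p[OF L, of 0]] by simp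
  have t: "cmod (\<phi> (x + h *\<^sub>R axis i 1) - \<phi> x - h *\<^sub>R pderiv_at i \<phi> x) \<le> B * h * h" if h: "h > 0" for h x
  proof -
    \<comment> \<open>The Taylor remainder as a mean value estimate: the derivative of
      \<open>g\<close> is a difference of first derivatives, hence at most \<open>B * h\<close> on
      \<open>{0..h}\<close>.\<close>
    define g where "g s = \<phi> (x + s *\<^sub>R axis i 1) - s *\<^sub>R pderiv_at i \<phi> x" for s :: real
    have d: "(g has_derivative (\<lambda>k. k *\<^sub>R (pderiv_at i \<phi> (x + s *\<^sub>R axis i 1) - pderiv_at i \<phi> x))) (at s within {0..h})" for s
    proof -
      have "((\<lambda>s. x + s *\<^sub>R axis i 1) has_derivative (\<lambda>h. h *\<^sub>R axis i 1)) (at s)"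
        by (auto intro!: derivative_eq_intros)
      with smooth_has_derivative[OF s, of "x + s *\<^sub>R axis i 1"]
      have *: "((\<lambda>s. \<phi> (x + s *\<^sub>R axis i 1)) has_derivative (\<lambda>h. frechet_derivative \<phi> (at (x + s *\<^sub>R axis i 1)) (h *\<^sub>R axis i 1))) (at s)"
        using has_derivative_compose by fastforce
      have "linear (frechet_derivative \<phi> (at (x + s *\<^sub>R axis i 1)))"
        using smooth_differentiable[OF s] linear_frechet_derivative by blast
      then have "((\<lambda>s. \<phi> (x + s *\<^sub>R axis i 1)) has_derivative (\<lambda>h. h *\<^sub>R pderiv_at i \<phi> (x + s *\<^sub>R axis i 1))) (at s)"
        using * by (simp add: linear_scale pderiv_at_def)
      moreover have "((\<lambda>s. s *\<^sub>R pderiv_at i \<phi> x) has_derivative (\<lambda>h. h *\<^sub>R pderiv_at i \<phi> x)) (at s)"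
        by (auto intro!: derivative_eq_intros)
      ultimately show ?thesis unfolding g_def
        using has_derivative_at_withinI[OF has_derivative_diff] by (fastforce simp: scaleR_diff_right)
    qed
    have o: "onorm (\<lambda>k. k *\<^sub>R (pderiv_at i \<phi> (x + s *\<^sub>R axis i 1) - pderiv_at i \<phi> x)) \<le> B * h" if "s \<in> {0..h}" for s
    proof (rule onorm_le)
      fix k :: real
      have "cmod (pderiv_at i \<phi> (x + s *\<^sub>R axis i 1) - pderiv_at i \<phi> x) \<le> B * \<bar>s\<bar>"
        by (rule norm_axis_translate_diff_le) (use B smooth_differentiable[OF smooth_pderiv[OF s]] in auto)
      also have "\<dots> \<le> B * h" using that B by (intro mult_left_mono) auto
      finally show "norm (k *\<^sub>R (pderiv_at i \<phi> (x + s *\<^sub>R axis i 1) - pderiv_at i \<phi> x)) \<le> B * h * norm k"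
        by (simp add: mult.commute[of _ "\<bar>k\<bar>"] mult_left_mono)
    qed
    have "norm (g h - g 0) \<le> (B * h) * norm (h - 0)"
      by (rule differentiable_bound[of "{0..h}" g]) (use d o h in auto)
    then show ?thesis using h by (simp add: g_def algebra_simps)
  qed
  have le: "cmod ?I \<le> B * h * V" if h: "h > 0" for h
  proof -
    have "\<phi> (x + L *\<^sub>R axis k 1 + h *\<^sub>R axis i 1) = \<phi> (x + h *\<^sub>R axis i 1)" for k x
    proof -
      have "x + L *\<^sub>R axis k 1 + h *\<^sub>R axis i 1 = (x + h *\<^sub>R axis i 1) + L *\<^sub>R axis k 1" by simp
      then show ?thesis using tests_periodic[OF \<phi>] by (simp only: periodic_def)
    qed
    then have pt: "(\<lambda>x. \<phi> (x + h *\<^sub>R axis i 1)) \<in> tests L"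
      using s by (simp add: tests_def periodic_def smooth_translate)
    note ii = int[OF pt] int[OF \<phi>] int[OF tests_pderiv[OF \<phi>, of i]]
    have "(\<integral>x. \<phi> (x + h *\<^sub>R axis i 1) - \<phi> x - h *\<^sub>R pderiv_at i \<phi> x \<partial>torus L) = - (h *\<^sub>R ?I)"
      using integral_torus_translate[OF L tests_periodic[OF \<phi>] smooth_measurable[OF s] int[OF \<phi>]] ii by simp
    then have "h * cmod ?I = cmod (\<integral>x. \<phi> (x + h *\<^sub>R axis i 1) - \<phi> x - h *\<^sub>R pderiv_at i \<phi> x \<partial>torus L)"
      using h by simp
    also have "\<dots> \<le> (\<integral>x. cmod (\<phi> (x + h *\<^sub>R axis i 1) - \<phi> x - h *\<^sub>R pderiv_at i \<phi> x) \<partial>torus L)"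
      by (rule integral_norm_bound)
    also have "\<dots> \<le> (\<integral>x. B * h * h \<partial>(torus L :: (real^'n) measure))"
    proof (rule integral_mono)
      show "integrable (torus L) (\<lambda>x. cmod (\<phi> (x + h *\<^sub>R axis i 1) - \<phi> x - h *\<^sub>R pderiv_at i \<phi> x))"
        using ii by simp
      show "integrable (torus L :: (real^'n) measure) (\<lambda>x. B * h * h)"
        using finite_measure.integrable_const[OF finite_measure_torus[OF L]] .
    qed (use t[OF h] in auto)
    also have "\<dots> = B * h * h * V"
      using measure_torus[OF L, where ?'n = 'n, simplified] by (simp add: V_def)
    finally show ?thesis using h by simp
  qed
  have "cmod ?I \<le> 0"
  proof (rule tendsto_lowerbound)
    show "((\<lambda>h. B * h * V) \<longlongrightarrow> 0) (at_right 0)"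
      using tendsto_mult_left_zero[OF tendsto_mult_right_zero[OF tendsto_ident_at]] by blast
    show "\<forall>\<^sub>F h in at_right 0. cmod ?I \<le> B * h * V"
      using le by (auto simp: eventually_at_right_field intro: exI[of _ 1])
  qed simp
  then show ?thesis by simp
qed

lemma pair_pderiv_tests:
  assumes L: "L > 0" and \<phi>: "\<phi> \<in> tests L" and \<eta>: "\<eta> \<in> tests L"
  shows "pair L \<phi> (pderiv_at i \<eta>) = - pair L (pderiv_at i \<phi>) \<eta>"
proof -
  have "(\<integral>x. pderiv_at i (\<lambda>x. \<phi> x * \<eta> x) x \<partial>torus L) = 0"
    by (rule integral_pderiv_torus[OF L tests_mult[OF \<phi> \<eta>]])
  then have "(\<integral>x. \<phi> x * pderiv_at i \<eta> x + pderiv_at i \<phi> x * \<eta> x \<partial>torus L) = 0"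
    by (simp add: pderiv_mult tests_smooth[OF \<phi>] tests_smooth[OF \<eta>])
  moreover have "integrable (torus L) (\<lambda>x. \<phi> x * pderiv_at i \<eta> x)" "integrable (torus L) (\<lambda>x. pderiv_at i \<phi> x * \<eta> x)"
    by (intro pair_integrable tests_L2p L tests_pderiv \<phi> \<eta>)+
  ultimately show ?thesis by (simp add: pair_def eq_neg_iff_add_eq_0)
qed

section \<open>Periodization of compactly supported functions\<close>

lemma periodic_periodize: "periodic L (periodize L h)"
  unfolding periodic_def
proof (intro allI)
  fix i x
  have b: "bij (\<lambda>m. m + axis i 1 :: int^'a)"
    by (rule bij_betwI[where g = "\<lambda>m. m - axis i 1"]) auto
  have "int_vec (axis i 1) = axis i 1" by (simp add: int_vec_def axis_def vec_eq_iff)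
  then have "h (x + L *\<^sub>R axis i 1 + L *\<^sub>R int_vec m) = h (x + L *\<^sub>R int_vec (m + axis i 1))" for m
    by (simp add: int_vec_add scaleR_add_right add_ac)
  then show "periodize L h (x + L *\<^sub>R axis i 1) = periodize L h x"
    unfolding periodize_def using infsum_reindex_bij_betw[OF b, of "\<lambda>m. h (x + L *\<^sub>R int_vec m)"] by simp
qed

text \<open>\<open>M\<close> depends on the two radii only, so a single finite set serves several
  functions at once, for instance a function and its derivatives.\<close>

lemma periodize_local:
  fixes h :: "real^'n \<Rightarrow> complex"
  assumes L: "L > 0"
  obtains M where "finite M"
    "\<And>h x. (\<And>x. norm x > R \<Longrightarrow> h x = 0) \<Longrightarrow> norm x \<le> r \<Longrightarrow> periodize L h x = (\<Sum>m\<in>M. h (x + L *\<^sub>R int_vec (m :: int^'n)))"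
proof -
  obtain M :: "(int^'n) set" where M: "finite M"
    "\<And>y m. norm y \<le> r \<Longrightarrow> norm (y + L *\<^sub>R int_vec m) \<le> R \<Longrightarrow> m \<in> M"
    using finitely_many_translates[OF L] by metis
  have "periodize L h x = (\<Sum>m\<in>M. h (x + L *\<^sub>R int_vec m))"
    if "\<And>x. norm x > R \<Longrightarrow> h x = 0" "norm x \<le> r" for h x
  proof -
    have "h (x + L *\<^sub>R int_vec m) = 0" if "m \<notin> M" for m
      using that M(2) \<open>norm x \<le> r\<close> \<open>\<And>x. norm x > R \<Longrightarrow> h x = 0\<close> not_le by blast
    then have "periodize L h x = (\<Sum>\<^sub>\<infinity>m\<in>M. h (x + L *\<^sub>R int_vec m))"
      unfolding periodize_def by (intro infsum_cong_neutral) auto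
    then show ?thesis using M(1) by simp
  qed
  then show ?thesis using that M(1) by blast
qed

lemma smooth_periodize:
  fixes h :: "real^'n \<Rightarrow> complex"
  assumes L: "L > 0" and h: "smooth h" and R: "\<And>x. norm x > R \<Longrightarrow> h x = 0"
  shows "smooth (periodize L h)" "pderiv_at i (periodize L h) = periodize L (pderiv_at i h)"
proof -
  have loc: "\<exists>M. finite M \<and> (\<forall>x\<in>ball y 1. periodize L h x = (\<Sum>m\<in>M. h (x + L *\<^sub>R int_vec m)))
      \<and> periodize L (pderiv_at i h) y = (\<Sum>m\<in>M. pderiv_at i h (y + L *\<^sub>R int_vec m))" for y i
  proof -
    obtain M where M: "finite M"
      "\<And>h x. (\<And>x. norm x > R \<Longrightarrow> h x = 0) \<Longrightarrow> norm x \<le> norm y + 1 \<Longrightarrow> periodize L h x = (\<Sum>m\<in>M. h (x + L *\<^sub>R int_vec (m :: int^'n)))"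
      using periodize_local[OF L] by metis
    have "norm x \<le> norm y + 1" if "x \<in> ball y 1" for x
      using that norm_triangle_ineq2[of x y] by (simp add: dist_norm norm_minus_commute)
    moreover have "pderiv_at i h x = 0" if "norm x > R" for x
      by (rule pderiv_outside_ball[of R h, OF R that])
    ultimately show ?thesis using M R by (intro exI[of _ M]) auto
  qed
  have sm: "smooth (\<lambda>x. \<Sum>m\<in>M. h (x + L *\<^sub>R int_vec m))" for M
    by (intro smooth_sum smooth_translate h)
  show "smooth (periodize L h)"
  proof (rule smooth_local)
    fix y
    obtain M where M: "\<forall>x\<in>ball y 1. periodize L h x = (\<Sum>m\<in>M. h (x + L *\<^sub>R int_vec m))"
      using loc[of y] by blast
    show "\<exists>U g. open U \<and> y \<in> U \<and> smooth g \<and> (\<forall>x\<in>U. periodize L h x = g x)"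
      by (intro exI[of _ "ball y 1"] exI[of _ "\<lambda>x. \<Sum>m\<in>M. h (x + L *\<^sub>R int_vec m)"]) (use M sm in auto)
  qed
  show "pderiv_at i (periodize L h) = periodize L (pderiv_at i h)"
  proof
    fix y
    obtain M where M: "finite M" "\<forall>x\<in>ball y 1. periodize L h x = (\<Sum>m\<in>M. h (x + L *\<^sub>R int_vec m))"
      "periodize L (pderiv_at i h) y = (\<Sum>m\<in>M. pderiv_at i h (y + L *\<^sub>R int_vec m))"
      using loc by blast
    have "pderiv_at i (periodize L h) y = pderiv_at i (\<lambda>x. \<Sum>m\<in>M. h (x + L *\<^sub>R int_vec m)) y"
      by (rule pderiv_local[of "ball y 1"]) (use M in auto)
    also have "\<dots> = (\<Sum>m\<in>M. pderiv_at i h (y + L *\<^sub>R int_vec m))"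
      by (subst pderiv_sum) (auto intro: smooth_translate h simp: pderiv_translate h)
    finally show "pderiv_at i (periodize L h) y = periodize L (pderiv_at i h) y" using M(3) by simp
  qed
qed

text \<open>Fold onto the torus of period 1; periodization commutes with differentiation, and there
  derivatives have mean zero.\<close>

lemma integral_pderiv_compact_support:
  fixes h :: "real^'n \<Rightarrow> complex"
  assumes h: "smooth h" and R: "\<And>x. norm x > R \<Longrightarrow> h x = 0"
  shows "integrable lebesgue h" "(\<integral>x. pderiv_at i h x \<partial>lebesgue) = 0"
proof -
  have int: "integrable lebesgue f" if f: "smooth f" "\<And>x. norm x > R \<Longrightarrow> f x = 0" for f :: "real^'n \<Rightarrow> complex"
  proof (rule integrable_unfold[OF zero_less_one f(2) smooth_measurable[OF f(1)]])
    fix m :: "int^'n"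
    have "continuous_on (cball 0 (real CARD('n))) (\<lambda>y. f (y + 1 *\<^sub>R int_vec m))"
      by (intro continuous_on_subset[OF smooth_continuous[OF smooth_translate[OF f(1)]]]) auto
    then have "compact ((\<lambda>y. f (y + 1 *\<^sub>R int_vec m)) ` cball 0 (real CARD('n)))"
      by (intro compact_continuous_image) auto
    then obtain B where B: "\<And>y. y \<in> cball 0 (real CARD('n)) \<Longrightarrow> cmod (f (y + 1 *\<^sub>R int_vec m)) \<le> B"
      using compact_imp_bounded bounded_iff by (metis (no_types, lifting) imageI)
    show "integrable (torus 1) (\<lambda>y. f (y + 1 *\<^sub>R int_vec m))"
    proof (rule finite_measure.integrable_const_bound[OF finite_measure_torus[OF zero_less_one], where B = B])
      show "AE x in torus 1. cmod (f (x + 1 *\<^sub>R int_vec m)) \<le> B"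
        by (rule AE_I2) (use norm_cell_le[where L = 1 and ?'n = 'n] B in auto)
      show "(\<lambda>y. f (y + 1 *\<^sub>R int_vec m)) \<in> borel_measurable (torus 1)"
        by (intro measurable_torus smooth_measurable smooth_translate f)
    qed
  qed
  show "integrable lebesgue h" by (rule int[OF h R])
  have R': "norm x > R \<Longrightarrow> pderiv_at i h x = 0" for x
    by (rule pderiv_outside_ball[of R h, OF R])
  have "(\<integral>x. pderiv_at i h x \<partial>lebesgue) = (\<integral>y. periodize 1 (pderiv_at i h) y \<partial>torus 1)"
    unfolding periodize_def
    by (rule integral_unfold(2)[OF zero_less_one R' int[OF smooth_pderiv[OF h] R']])
  also have "\<dots> = (\<integral>y. pderiv_at i (periodize 1 h) y \<partial>torus 1)"
    using smooth_periodize(2)[OF zero_less_one h R] by simp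
  also have "\<dots> = 0"
    by (rule integral_pderiv_torus) (auto simp: tests_def periodic_periodize intro: smooth_periodize(1)[OF zero_less_one h R])
  finally show "(\<integral>x. pderiv_at i h x \<partial>lebesgue) = 0" .
qed

section \<open>Weighted frames and the elliptic form\<close>

lemma has_sum_sum:
  fixes f :: "'j \<Rightarrow> 'i \<Rightarrow> 'a::topological_comm_monoid_add"
  assumes "\<And>j. j \<in> J \<Longrightarrow> (f j has_sum s j) A"
  shows "((\<lambda>i. \<Sum>j\<in>J. f j i) has_sum (\<Sum>j\<in>J. s j)) A"
  using assms by (induction J rule: infinite_finite_induct) (auto intro: has_sum_add)

lemma sum_mult_le_of_squares:
  fixes a b :: "'i \<Rightarrow> real"
  assumes "(\<Sum>i\<in>F. (a i)\<^sup>2) \<le> X\<^sup>2" "(\<Sum>i\<in>F. (b i)\<^sup>2) \<le> Y\<^sup>2" "X \<ge> 0" "Y \<ge> 0"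
  shows "(\<Sum>i\<in>F. a i * b i) \<le> X * Y"
proof -
  have "(\<Sum>i\<in>F. a i * b i)\<^sup>2 \<le> (\<Sum>i\<in>F. (a i)\<^sup>2) * (\<Sum>i\<in>F. (b i)\<^sup>2)"
    by (rule Cauchy_Schwarz_ineq_sum)
  also have "\<dots> \<le> X\<^sup>2 * Y\<^sup>2"
    by (intro mult_mono assms sum_nonneg) auto
  finally have "(\<Sum>i\<in>F. a i * b i)\<^sup>2 \<le> (X * Y)\<^sup>2" by (simp add: power_mult_distrib)
  then show ?thesis by (rule power2_le_imp_le) (use assms in simp)
qed

text \<open>The finite Cauchy-Schwarz inequality bounds all partial sums of
  \<open>cmod (z i)\<close>, which gives absolute summability and the estimate together. Only finite
  square sums have to be controlled.\<close>

lemma Cauchy_Schwarz_summable: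
  fixes z :: "'i \<Rightarrow> complex"
  assumes z: "\<And>i. i \<in> I \<Longrightarrow> cmod (z i) \<le> a i * b i"
    and a: "\<And>F. finite F \<Longrightarrow> F \<subseteq> I \<Longrightarrow> (\<Sum>i\<in>F. (a i)\<^sup>2) \<le> X\<^sup>2"
    and b: "\<And>F. finite F \<Longrightarrow> F \<subseteq> I \<Longrightarrow> (\<Sum>i\<in>F. (b i)\<^sup>2) \<le> Y\<^sup>2"
    and X: "X \<ge> 0" and Y: "Y \<ge> 0"
  shows "z summable_on I" "cmod (infsum z I) \<le> X * Y"
proof -
  have fin: "(\<Sum>i\<in>F. cmod (z i)) \<le> X * Y" if "finite F" "F \<subseteq> I" for F
  proof -
    have "(\<Sum>i\<in>F. cmod (z i)) \<le> (\<Sum>i\<in>F. a i * b i)"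
      using that z by (intro sum_mono) auto
    also have "\<dots> \<le> X * Y"
      using that a b X Y by (intro sum_mult_le_of_squares) auto
    finally show ?thesis .
  qed
  have abs: "(\<lambda>i. cmod (z i)) summable_on I"
    by (rule nonneg_bdd_above_summable_on) (use fin in \<open>auto intro!: bdd_aboveI2\<close>)
  then show "z summable_on I" by (rule abs_summable_summable)
  have "cmod (infsum z I) \<le> infsum (\<lambda>i. cmod (z i)) I"
    by (rule norm_infsum_bound[OF abs])
  also have "\<dots> \<le> X * Y"
    by (rule infsum_le_finite_sums[OF abs fin])
  finally show "cmod (infsum z I) \<le> X * Y" .
qed

abbreviation (input) torus_period :: real ("\<T>") where "\<T> \<equiv> 2 * pi"

text \<open>The Japanese bracket, symbol of the multiplier \<Lambda>.\<close>

definition japanese :: "real^'n \<Rightarrow> real" where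
  "japanese \<xi> = sqrt (1 + (norm \<xi>)\<^sup>2)"

text \<open>Separates the functional analysis from the geometry of the windows. Besides Parseval up
  to \<kappa>, the atoms have to satisfy a Bessel bound for their \<sigma>-weighted derivatives, a
  bound saying that \<Lambda> multiplies the coefficients by \<open>w\<close> up to a square
  summable error (stated on trigonometric sums, where \<Lambda> acts termwise), and a positive lower
  bound for \<open>\<sigma> i * w i\<close>. \<open>A\<close> and \<open>C\<close> are common bounds
  for both coefficients of the equation.\<close>

locale elliptic_frame =
  fixes I :: "'i set" and p :: "'i \<Rightarrow> real^'n \<Rightarrow> complex" and \<kappa> :: real and \<sigma> w :: "'i \<Rightarrow> real"
    and a b :: "real^'n \<Rightarrow> real" and A C :: real
  assumes p_tests: "i \<in> I \<Longrightarrow> p i \<in> tests \<T>"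
    and \<kappa>_pos: "\<kappa> > 0"
    and parseval: "u \<in> L2p \<T> \<Longrightarrow>
      ((\<lambda>i. (cmod (pair \<T> u (\<lambda>x. cnj (p i x))))\<^sup>2) has_sum (tnorm \<T> u)\<^sup>2 / \<kappa>) I"
    and \<sigma>_pos: "i \<in> I \<Longrightarrow> \<sigma> i > 0" and \<sigma>_le_1: "i \<in> I \<Longrightarrow> \<sigma> i \<le> 1"
    and derivative_bound: "\<exists>B\<ge>0. \<forall>k. \<forall>u\<in>L2p \<T>. \<forall>F. finite F \<longrightarrow> F \<subseteq> I \<longrightarrow>
      (\<Sum>i\<in>F. (\<sigma> i * cmod (pair \<T> (pderiv_at k (p i)) u))\<^sup>2) \<le> B * (tnorm \<T> u)\<^sup>2"
    and commutator_bound: "\<exists>B\<ge>0. \<forall>F c G. finite F \<longrightarrow> finite G \<longrightarrow> G \<subseteq> I \<longrightarrow>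
      (\<Sum>i\<in>G. (cmod (pair \<T> (tsum \<T> F (\<lambda>m. of_real (japanese (int_vec m)) * c m)) (\<lambda>x. cnj (p i x))
              - of_real (w i) * pair \<T> (tsum \<T> F c) (\<lambda>x. cnj (p i x))))\<^sup>2)
        \<le> B * (tnorm \<T> (tsum \<T> F c))\<^sup>2"
    and \<sigma>_w: "\<exists>c>0. \<forall>i\<in>I. c \<le> \<sigma> i * w i"
    and a_periodic: "periodic \<T> a" and a_measurable: "a \<in> borel_measurable lebesgue"
    and b_periodic: "periodic \<T> b" and b_measurable: "b \<in> borel_measurable lebesgue"
    and a_le: "\<bar>a y\<bar> \<le> A" and b_le: "\<bar>b y\<bar> \<le> A"
    and C_pos: "C > 0" and a_ge: "a y \<ge> C" and b_ge: "b y \<ge> C"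
begin

definition coef :: "(real^'n \<Rightarrow> complex) \<Rightarrow> 'i \<Rightarrow> complex" where
  "coef u i = pair \<T> u (\<lambda>x. cnj (p i x))"

lemma p_L2p: "i \<in> I \<Longrightarrow> p i \<in> L2p \<T>"
  by (intro tests_L2p p_tests) auto

lemma cnj_p_L2p: "i \<in> I \<Longrightarrow> (\<lambda>x. cnj (p i x)) \<in> L2p \<T>"
  by (intro L2p_cnj p_L2p)

lemma pderiv_p_L2p: "i \<in> I \<Longrightarrow> pderiv_at k (p i) \<in> L2p \<T>"
  by (intro tests_L2p tests_pderiv p_tests) auto

lemma coef_linear:
  "i \<in> I \<Longrightarrow> u \<in> L2p \<T> \<Longrightarrow> v \<in> L2p \<T> \<Longrightarrow> coef (\<lambda>x. u x + c * v x) i = coef u i + c * coef v i"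
  unfolding coef_def by (subst pair_add(2)) (auto simp: pair_cmult intro: cnj_p_L2p L2p_cmult)

lemma pair_p_eq: "pair \<T> (p i) \<phi> = cnj (coef (\<lambda>x. cnj (\<phi> x)) i)"
  by (simp add: coef_def cnj_pair pair_commute)

lemma coef_square_sum_le:
  assumes "u \<in> L2p \<T>" "finite F" "F \<subseteq> I"
  shows "(\<Sum>i\<in>F. (cmod (coef u i))\<^sup>2) \<le> (tnorm \<T> u / sqrt \<kappa>)\<^sup>2"
  using finite_sum_le_has_sum[OF parseval[OF assms(1)] assms(2,3)] \<kappa>_pos
  by (simp add: coef_def power_divide)

section \<open>Weak synthesis of the preconditioned function and its derivatives\<close>

text \<open>The series with summands \<open>\<kappa> * \<sigma> i * coef u i\<close> times
  \<open>q i\<close> is summed weakly: Parseval for the coefficients against the Bessel bound for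
  the weighted \<open>q i\<close> makes it a bounded functional, which has a representing function.
  It is used with the atoms for \<open>P\<close> and with their partial derivatives for
  \<open>D\<close>.\<close>

lemma synthesis:
  fixes q :: "'i \<Rightarrow> real^'n \<Rightarrow> complex"
  assumes q: "\<And>i. i \<in> I \<Longrightarrow> q i \<in> L2p \<T>" and B: "B \<ge> 0"
    and bound: "\<And>\<phi> F. \<phi> \<in> L2p \<T> \<Longrightarrow> finite F \<Longrightarrow> F \<subseteq> I \<Longrightarrow>
      (\<Sum>i\<in>F. (\<sigma> i * cmod (pair \<T> (q i) \<phi>))\<^sup>2) \<le> (B * tnorm \<T> \<phi>)\<^sup>2"
    and u: "u \<in> L2p \<T>"
  shows "\<exists>h\<in>L2p \<T>. tnorm \<T> h \<le> sqrt \<kappa> * B * tnorm \<T> u \<and>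
    (\<forall>\<phi>\<in>L2p \<T>. ((\<lambda>i. of_real (\<kappa> * \<sigma> i) * coef u i * pair \<T> (q i) \<phi>) has_sum pair \<T> h \<phi>) I)"
proof -
  define \<psi> where "\<psi> \<phi> = (\<Sum>\<^sub>\<infinity>i\<in>I. of_real (\<kappa> * \<sigma> i) * coef u i * pair \<T> (q i) \<phi>)" for \<phi>
  have s: "(\<lambda>i. of_real (\<kappa> * \<sigma> i) * coef u i * pair \<T> (q i) \<phi>) summable_on I"
    and n: "cmod (\<psi> \<phi>) \<le> (tnorm \<T> u / sqrt \<kappa>) * (\<kappa> * (B * tnorm \<T> \<phi>))" if \<phi>: "\<phi> \<in> L2p \<T>" for \<phi>
  proof -
    have 1: "cmod (of_real (\<kappa> * \<sigma> i) * coef u i * pair \<T> (q i) \<phi>) \<le> cmod (coef u i) * (\<kappa> * (\<sigma> i * cmod (pair \<T> (q i) \<phi>)))"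
      if "i \<in> I" for i
      using \<kappa>_pos \<sigma>_pos[OF that] by (simp add: norm_mult)
    have 2: "(\<Sum>i\<in>F. (\<kappa> * (\<sigma> i * cmod (pair \<T> (q i) \<phi>)))\<^sup>2) \<le> (\<kappa> * (B * tnorm \<T> \<phi>))\<^sup>2" if "finite F" "F \<subseteq> I" for F
    proof -
      have "(\<Sum>i\<in>F. (\<kappa> * (\<sigma> i * cmod (pair \<T> (q i) \<phi>)))\<^sup>2) = \<kappa>\<^sup>2 * (\<Sum>i\<in>F. (\<sigma> i * cmod (pair \<T> (q i) \<phi>))\<^sup>2)"
        by (simp add: power_mult_distrib sum_distrib_left)
      also have "\<dots> \<le> \<kappa>\<^sup>2 * (B * tnorm \<T> \<phi>)\<^sup>2"
        by (intro mult_left_mono bound \<phi> that) auto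
      finally show ?thesis by (simp add: power_mult_distrib)
    qed
    have 3: "tnorm \<T> u / sqrt \<kappa> \<ge> 0" "\<kappa> * (B * tnorm \<T> \<phi>) \<ge> 0"
      using \<kappa>_pos B by auto
    note cs = Cauchy_Schwarz_summable[OF 1 coef_square_sum_le[OF u] 2 3]
    show "(\<lambda>i. of_real (\<kappa> * \<sigma> i) * coef u i * pair \<T> (q i) \<phi>) summable_on I" by (rule cs(1))
    show "cmod (\<psi> \<phi>) \<le> (tnorm \<T> u / sqrt \<kappa>) * (\<kappa> * (B * tnorm \<T> \<phi>))"
      unfolding \<psi>_def by (rule cs(2))
  qed
  have hs: "((\<lambda>i. of_real (\<kappa> * \<sigma> i) * coef u i * pair \<T> (q i) \<phi>) has_sum \<psi> \<phi>) I" if "\<phi> \<in> L2p \<T>" for \<phi>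
    unfolding \<psi>_def by (rule has_sum_infsum[OF s[OF that]])
  have lin: "\<psi> (\<lambda>x. f x + c * g x) = \<psi> f + c * \<psi> g" if f: "f \<in> L2p \<T>" and g: "g \<in> L2p \<T>" for f g c
  proof (rule has_sum_unique)
    show "((\<lambda>i. of_real (\<kappa> * \<sigma> i) * coef u i * pair \<T> (q i) (\<lambda>x. f x + c * g x)) has_sum \<psi> (\<lambda>x. f x + c * g x)) I"
      by (intro hs L2p_add L2p_cmult f g)
    have "((\<lambda>i. of_real (\<kappa> * \<sigma> i) * coef u i * pair \<T> (q i) f + c * (of_real (\<kappa> * \<sigma> i) * coef u i * pair \<T> (q i) g))
        has_sum (\<psi> f + c * \<psi> g)) I"
      by (intro has_sum_add has_sum_cmult_right hs f g)
    then show "((\<lambda>i. of_real (\<kappa> * \<sigma> i) * coef u i * pair \<T> (q i) (\<lambda>x. f x + c * g x)) has_sum (\<psi> f + c * \<psi> g)) I"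
    proof (subst has_sum_cong)
      fix i assume i: "i \<in> I"
      show "of_real (\<kappa> * \<sigma> i) * coef u i * pair \<T> (q i) (\<lambda>x. f x + c * g x)
          = of_real (\<kappa> * \<sigma> i) * coef u i * pair \<T> (q i) f + c * (of_real (\<kappa> * \<sigma> i) * coef u i * pair \<T> (q i) g)"
        using pair_add(1)[OF q[OF i] f L2p_cmult[OF g]] by (simp add: pair_cmult algebra_simps)
    qed
  qed
  have sk: "\<kappa> / sqrt \<kappa> = sqrt \<kappa>" using \<kappa>_pos by (simp add: real_div_sqrt)
  have bd: "cmod (\<psi> \<phi>) \<le> (sqrt \<kappa> * B * tnorm \<T> u) * tnorm \<T> \<phi>" if "\<phi> \<in> L2p \<T>" for \<phi>
  proof -
    have "(tnorm \<T> u / sqrt \<kappa>) * (\<kappa> * (B * tnorm \<T> \<phi>)) = (\<kappa> / sqrt \<kappa> * B * tnorm \<T> u) * tnorm \<T> \<phi>" by simp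
    then show ?thesis using n[OF that] by (simp add: sk)
  qed
  obtain h where h: "h \<in> L2p \<T>" "\<And>f. f \<in> L2p \<T> \<Longrightarrow> \<psi> f = pair \<T> h f" "tnorm \<T> h \<le> sqrt \<kappa> * B * tnorm \<T> u"
    by (rule L2_functional_representation[of \<T> \<psi>, OF _ lin bd]) (use \<kappa>_pos B in auto)
  show ?thesis
  proof (intro bexI[OF _ h(1)] conjI ballI h(3))
    fix \<phi> :: "real^'n \<Rightarrow> complex" assume \<phi>: "\<phi> \<in> L2p \<T>"
    show "((\<lambda>i. of_real (\<kappa> * \<sigma> i) * coef u i * pair \<T> (q i) \<phi>) has_sum pair \<T> h \<phi>) I"
      using hs[OF \<phi>] h(2)[OF \<phi>] by (simp only:)
  qed
qed

lemma P_exists: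
  assumes u: "u \<in> L2p \<T>"
  shows "\<exists>h\<in>L2p \<T>. tnorm \<T> h \<le> tnorm \<T> u \<and>
    (\<forall>\<phi>\<in>L2p \<T>. ((\<lambda>i. of_real (\<kappa> * \<sigma> i) * coef u i * pair \<T> (p i) \<phi>) has_sum pair \<T> h \<phi>) I)"
proof -
  have bound: "(\<Sum>i\<in>F. (\<sigma> i * cmod (pair \<T> (p i) \<phi>))\<^sup>2) \<le> (1 / sqrt \<kappa> * tnorm \<T> \<phi>)\<^sup>2"
    if "\<phi> \<in> L2p \<T>" "finite F" "F \<subseteq> I" for \<phi> F
  proof -
    have "(\<Sum>i\<in>F. (\<sigma> i * cmod (pair \<T> (p i) \<phi>))\<^sup>2) \<le> (\<Sum>i\<in>F. (cmod (coef (\<lambda>x. cnj (\<phi> x)) i))\<^sup>2)"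
    proof (intro sum_mono power_mono)
      fix i assume "i \<in> F"
      then have i: "i \<in> I" using that by auto
      show "\<sigma> i * cmod (pair \<T> (p i) \<phi>) \<le> cmod (coef (\<lambda>x. cnj (\<phi> x)) i)"
        using \<sigma>_pos[OF i] \<sigma>_le_1[OF i] by (simp add: pair_p_eq mult_left_le_one_le)
      show "0 \<le> \<sigma> i * cmod (pair \<T> (p i) \<phi>)" using \<sigma>_pos[OF i] by simp
    qed
    also have "\<dots> \<le> (tnorm \<T> (\<lambda>x. cnj (\<phi> x)) / sqrt \<kappa>)\<^sup>2"
      by (intro coef_square_sum_le L2p_cnj that)
    finally show ?thesis by (simp add: nrm_cnj)
  qed
  have z: "0 \<le> 1 / sqrt \<kappa>" using \<kappa>_pos by simp
  have one: "sqrt \<kappa> * (1 / sqrt \<kappa>) = 1" using \<kappa>_pos by simp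
  show ?thesis
    using synthesis[of p "1 / sqrt \<kappa>" u, OF p_L2p z bound u] unfolding one by simp
qed

text \<open>A chosen representative: the weak expansion determines all pairings of
  \<open>P u\<close>, hence \<open>P u\<close> up to null sets.\<close>

definition P :: "(real^'n \<Rightarrow> complex) \<Rightarrow> real^'n \<Rightarrow> complex" where
  "P u = (SOME h. h \<in> L2p \<T> \<and> tnorm \<T> h \<le> tnorm \<T> u \<and>
    (\<forall>\<phi>\<in>L2p \<T>. ((\<lambda>i. of_real (\<kappa> * \<sigma> i) * coef u i * pair \<T> (p i) \<phi>) has_sum pair \<T> h \<phi>) I))"

lemma P:
  assumes "u \<in> L2p \<T>"
  shows "P u \<in> L2p \<T>" "tnorm \<T> (P u) \<le> tnorm \<T> u"
    "\<phi> \<in> L2p \<T> \<Longrightarrow> ((\<lambda>i. of_real (\<kappa> * \<sigma> i) * coef u i * pair \<T> (p i) \<phi>) has_sum pair \<T> (P u) \<phi>) I"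
  using someI_ex[OF P_exists[OF assms, unfolded Bex_def]] unfolding P_def[symmetric] by auto

lemma D_exists:
  "\<exists>B\<ge>0. \<forall>k. \<forall>u\<in>L2p \<T>. \<exists>h\<in>L2p \<T>. tnorm \<T> h \<le> B * tnorm \<T> u \<and>
    (\<forall>\<phi>\<in>L2p \<T>. ((\<lambda>i. of_real (\<kappa> * \<sigma> i) * coef u i * pair \<T> (pderiv_at k (p i)) \<phi>) has_sum pair \<T> h \<phi>) I)"
proof -
  obtain B where B: "B \<ge> 0" "\<forall>k. \<forall>u\<in>L2p \<T>. \<forall>F. finite F \<longrightarrow> F \<subseteq> I \<longrightarrow>
      (\<Sum>i\<in>F. (\<sigma> i * cmod (pair \<T> (pderiv_at k (p i)) u))\<^sup>2) \<le> B * (tnorm \<T> u)\<^sup>2"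
    using derivative_bound by (elim exE conjE)
  have "\<exists>h\<in>L2p \<T>. tnorm \<T> h \<le> (sqrt \<kappa> * sqrt B) * tnorm \<T> u \<and>
    (\<forall>\<phi>\<in>L2p \<T>. ((\<lambda>i. of_real (\<kappa> * \<sigma> i) * coef u i * pair \<T> (pderiv_at k (p i)) \<phi>) has_sum pair \<T> h \<phi>) I)"
    if u: "u \<in> L2p \<T>" for k u
  proof -
    have "(\<Sum>i\<in>F. (\<sigma> i * cmod (pair \<T> (pderiv_at k (p i)) \<phi>))\<^sup>2) \<le> (sqrt B * tnorm \<T> \<phi>)\<^sup>2"
      if "\<phi> \<in> L2p \<T>" "finite F" "F \<subseteq> I" for \<phi> F
      using B(2)[rule_format, OF that] B(1) by (simp add: power_mult_distrib)
    from synthesis[of "\<lambda>i. pderiv_at k (p i)" "sqrt B" u, OF pderiv_p_L2p real_sqrt_ge_zero[OF B(1)] this u]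
    show ?thesis .
  qed
  moreover have "0 \<le> sqrt \<kappa> * sqrt B" using \<kappa>_pos B(1) by simp
  ultimately show ?thesis by blast
qed

text \<open>One constant for all directions and all \<open>u\<close>, fixed before the functions
  \<open>D k u\<close> are chosen, so that each choice can carry the bound with it.\<close>

definition D_bound :: real where
  "D_bound = (SOME B. B \<ge> 0 \<and> (\<forall>k. \<forall>u\<in>L2p \<T>. \<exists>h\<in>L2p \<T>. tnorm \<T> h \<le> B * tnorm \<T> u \<and>
    (\<forall>\<phi>\<in>L2p \<T>. ((\<lambda>i. of_real (\<kappa> * \<sigma> i) * coef u i * pair \<T> (pderiv_at k (p i)) \<phi>) has_sum pair \<T> h \<phi>) I)))"

definition D :: "'n \<Rightarrow> (real^'n \<Rightarrow> complex) \<Rightarrow> real^'n \<Rightarrow> complex" where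
  "D k u = (SOME h. h \<in> L2p \<T> \<and> tnorm \<T> h \<le> D_bound * tnorm \<T> u \<and>
    (\<forall>\<phi>\<in>L2p \<T>. ((\<lambda>i. of_real (\<kappa> * \<sigma> i) * coef u i * pair \<T> (pderiv_at k (p i)) \<phi>) has_sum pair \<T> h \<phi>) I))"

lemma D_bound:
  "D_bound \<ge> 0"
  "u \<in> L2p \<T> \<Longrightarrow> \<exists>h. h \<in> L2p \<T> \<and> tnorm \<T> h \<le> D_bound * tnorm \<T> u \<and>
    (\<forall>\<phi>\<in>L2p \<T>. ((\<lambda>i. of_real (\<kappa> * \<sigma> i) * coef u i * pair \<T> (pderiv_at k (p i)) \<phi>) has_sum pair \<T> h \<phi>) I)"
  using someI_ex[OF D_exists] unfolding D_bound_def[symmetric] by blast+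

lemma D:
  assumes "u \<in> L2p \<T>"
  shows "D k u \<in> L2p \<T>" "tnorm \<T> (D k u) \<le> D_bound * tnorm \<T> u"
    "\<phi> \<in> L2p \<T> \<Longrightarrow> ((\<lambda>i. of_real (\<kappa> * \<sigma> i) * coef u i * pair \<T> (pderiv_at k (p i)) \<phi>) has_sum pair \<T> (D k u) \<phi>) I"
  using someI_ex[OF D_bound(2)[OF assms]] unfolding D_def[symmetric] by auto

lemma AE_eq_if_pair_eq:
  assumes "f \<in> L2p \<T>" "g \<in> L2p \<T>" "\<And>\<phi>. \<phi> \<in> tests \<T> \<Longrightarrow> pair \<T> f \<phi> = pair \<T> g \<phi>"
  shows "AE x in torus \<T>. f x = g x"
  by (rule Fourier_unique[OF _ assms(1,2) assms(3)[OF tests_expo]]) auto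

text \<open>Linearity of the coefficients passes to everything given by such an expansion because
  sums are unique; for the chosen functions \<open>P u\<close> and \<open>D k u\<close> it survives
  up to null sets.\<close>

lemma expansion_linear:
  fixes q :: "'i \<Rightarrow> real^'n \<Rightarrow> complex"
  assumes q: "\<And>i. i \<in> I \<Longrightarrow> q i \<in> L2p \<T>" and u: "u \<in> L2p \<T>" and v: "v \<in> L2p \<T>"
    and hs: "\<And>u. u \<in> L2p \<T> \<Longrightarrow> ((\<lambda>i. of_real (\<kappa> * \<sigma> i) * coef u i * pair \<T> (q i) \<phi>) has_sum s u) I"
  shows "s (\<lambda>x. u x + c * v x) = s u + c * s v"
proof (rule has_sum_unique)
  show "((\<lambda>i. of_real (\<kappa> * \<sigma> i) * coef (\<lambda>x. u x + c * v x) i * pair \<T> (q i) \<phi>) has_sum s (\<lambda>x. u x + c * v x)) I"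
    by (intro hs L2p_add L2p_cmult u v)
  have "((\<lambda>i. of_real (\<kappa> * \<sigma> i) * coef u i * pair \<T> (q i) \<phi> + c * (of_real (\<kappa> * \<sigma> i) * coef v i * pair \<T> (q i) \<phi>))
      has_sum (s u + c * s v)) I"
    by (intro has_sum_add has_sum_cmult_right hs u v)
  then show "((\<lambda>i. of_real (\<kappa> * \<sigma> i) * coef (\<lambda>x. u x + c * v x) i * pair \<T> (q i) \<phi>) has_sum (s u + c * s v)) I"
    by (subst has_sum_cong) (auto simp: coef_linear[OF _ u v] algebra_simps)
qed

lemma P_linear:
  assumes u: "u \<in> L2p \<T>" and v: "v \<in> L2p \<T>"
  shows "AE x in torus \<T>. P (\<lambda>x. u x + c * v x) x = P u x + c * P v x"
proof (rule AE_eq_if_pair_eq)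
  show "P (\<lambda>x. u x + c * v x) \<in> L2p \<T>" "(\<lambda>x. P u x + c * P v x) \<in> L2p \<T>"
    by (intro P(1) L2p_add L2p_cmult u v)+
  fix \<phi> :: "real^'n \<Rightarrow> complex" assume "\<phi> \<in> tests \<T>"
  then have \<phi>: "\<phi> \<in> L2p \<T>" by (intro tests_L2p) auto
  have "pair \<T> (P (\<lambda>x. u x + c * v x)) \<phi> = pair \<T> (P u) \<phi> + c * pair \<T> (P v) \<phi>"
    by (rule expansion_linear[of p u v, OF p_L2p u v P(3)[OF _ \<phi>]])
  also have "\<dots> = pair \<T> (\<lambda>x. P u x + c * P v x) \<phi>"
    by (subst pair_add(2)) (auto simp: pair_cmult intro: \<phi> P(1) u v L2p_cmult)
  finally show "pair \<T> (P (\<lambda>x. u x + c * v x)) \<phi> = pair \<T> (\<lambda>x. P u x + c * P v x) \<phi>" .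
qed

lemma D_linear:
  assumes u: "u \<in> L2p \<T>" and v: "v \<in> L2p \<T>"
  shows "AE x in torus \<T>. D k (\<lambda>x. u x + c * v x) x = D k u x + c * D k v x"
proof (rule AE_eq_if_pair_eq)
  show "D k (\<lambda>x. u x + c * v x) \<in> L2p \<T>" "(\<lambda>x. D k u x + c * D k v x) \<in> L2p \<T>"
    by (intro D(1) L2p_add L2p_cmult u v)+
  fix \<phi> :: "real^'n \<Rightarrow> complex" assume "\<phi> \<in> tests \<T>"
  then have \<phi>: "\<phi> \<in> L2p \<T>" by (intro tests_L2p) auto
  have "pair \<T> (D k (\<lambda>x. u x + c * v x)) \<phi> = pair \<T> (D k u) \<phi> + c * pair \<T> (D k v) \<phi>"
    by (rule expansion_linear[of "\<lambda>i. pderiv_at k (p i)" u v, OF pderiv_p_L2p u v D(3)[OF _ \<phi>]])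
  also have "\<dots> = pair \<T> (\<lambda>x. D k u x + c * D k v x) \<phi>"
    by (subst pair_add(2)) (auto simp: pair_cmult intro: \<phi> D(1) u v L2p_cmult)
  finally show "pair \<T> (D k (\<lambda>x. u x + c * v x)) \<phi> = pair \<T> (\<lambda>x. D k u x + c * D k v x) \<phi>" .
qed

text \<open>Termwise integration by parts in the weak expansions shows that \<open>D k u\<close> is
  the weak derivative of \<open>P u\<close>.\<close>

lemma pair_D:
  assumes u: "u \<in> L2p \<T>" and \<phi>: "\<phi> \<in> tests \<T>"
  shows "pair \<T> (D k u) \<phi> = - pair \<T> (P u) (pderiv_at k \<phi>)"
proof (rule has_sum_unique)
  have T: "\<T> > 0" by simp
  show "((\<lambda>i. of_real (\<kappa> * \<sigma> i) * coef u i * pair \<T> (pderiv_at k (p i)) \<phi>) has_sum pair \<T> (D k u) \<phi>) I"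
    by (rule D(3)[OF u tests_L2p[OF T \<phi>]])
  have "((\<lambda>i. - (of_real (\<kappa> * \<sigma> i) * coef u i * pair \<T> (p i) (pderiv_at k \<phi>))) has_sum - pair \<T> (P u) (pderiv_at k \<phi>)) I"
    by (rule has_sum_uminusI[OF P(3)[OF u tests_L2p[OF T tests_pderiv[OF \<phi>]]]])
  then show "((\<lambda>i. of_real (\<kappa> * \<sigma> i) * coef u i * pair \<T> (pderiv_at k (p i)) \<phi>) has_sum - pair \<T> (P u) (pderiv_at k \<phi>)) I"
    by (subst has_sum_cong) (auto simp: pair_pderiv_tests[OF T p_tests \<phi>])
qed

lemma a_mult:
  assumes "f \<in> L2p \<T>"
  shows "(\<lambda>x. of_real (a x) * f x) \<in> L2p \<T>" "tnorm \<T> (\<lambda>x. of_real (a x) * f x) \<le> \<bar>A\<bar> * tnorm \<T> f"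
  by (rule L2p_bdd_mult[OF assms];
      use a_periodic a_measurable a_le in \<open>auto simp: periodic_def intro: borel_measurable_of_real\<close>)+

lemma b_mult:
  assumes "f \<in> L2p \<T>"
  shows "(\<lambda>x. of_real (b x) * f x) \<in> L2p \<T>" "tnorm \<T> (\<lambda>x. of_real (b x) * f x) \<le> \<bar>A\<bar> * tnorm \<T> f"
  by (rule L2p_bdd_mult[OF assms];
      use b_periodic b_measurable b_le in \<open>auto simp: periodic_def intro: borel_measurable_of_real\<close>)+

section \<open>The elliptic form and the functional it induces\<close>

text \<open>The elliptic operator applied to \<open>P u\<close>, as a functional on smooth test
  functions.\<close>

definition W :: "(real^'n \<Rightarrow> complex) \<Rightarrow> (real^'n \<Rightarrow> complex) \<Rightarrow> complex" where
  "W u \<eta> = (\<Sum>k\<in>UNIV. pair \<T> (\<lambda>x. of_real (a x) * D k u x) (pderiv_at k \<eta>))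
     + pair \<T> (\<lambda>x. of_real (b x) * P u x) \<eta>"

text \<open>Extends \<open>W u\<close> from test functions to the conjugate of \<open>P v\<close>,
  whose weak derivatives are the conjugates of \<open>D k v\<close>.\<close>

definition form :: "(real^'n \<Rightarrow> complex) \<Rightarrow> (real^'n \<Rightarrow> complex) \<Rightarrow> complex" where
  "form u v = (\<Sum>k\<in>UNIV. pair \<T> (\<lambda>x. of_real (a x) * D k u x) (\<lambda>x. cnj (D k v x)))
     + pair \<T> (\<lambda>x. of_real (b x) * P u x) (\<lambda>x. cnj (P v x))"

text \<open>The expansion of \<open>P v\<close> is transposed onto the left argument, so that no convergence in the
  Sobolev norm is needed.\<close>

lemma has_sum_form:
  assumes u: "u \<in> L2p \<T>" and v: "v \<in> L2p \<T>"
  shows "((\<lambda>i. of_real (\<kappa> * \<sigma> i) * W u (\<lambda>x. cnj (p i x)) * pair \<T> (p i) (\<lambda>x. cnj (v x))) has_sum form u v) I"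
proof -
  have tr: "((\<lambda>i. of_real (\<kappa> * \<sigma> i) * pair \<T> (p i) (\<lambda>x. cnj (v x)) * pair \<T> \<zeta> (\<lambda>x. cnj (q i x))) has_sum pair \<T> \<zeta> (\<lambda>x. cnj (h x))) I"
    if "((\<lambda>i. of_real (\<kappa> * \<sigma> i) * coef v i * pair \<T> (q i) (\<lambda>x. cnj (\<zeta> x))) has_sum pair \<T> h (\<lambda>x. cnj (\<zeta> x))) I" for q h \<zeta>
  proof -
    have "((\<lambda>i. cnj (of_real (\<kappa> * \<sigma> i) * coef v i * pair \<T> (q i) (\<lambda>x. cnj (\<zeta> x)))) has_sum cnj (pair \<T> h (\<lambda>x. cnj (\<zeta> x)))) I"
      using that by (simp only: has_sum_cnj_iff)
    moreover have "cnj (coef v i) = pair \<T> (p i) (\<lambda>x. cnj (v x))" for i by (simp add: pair_p_eq)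
    ultimately show ?thesis by (simp add: cnj_pair pair_commute)
  qed
  have "((\<lambda>i. (\<Sum>k\<in>UNIV. of_real (\<kappa> * \<sigma> i) * pair \<T> (p i) (\<lambda>x. cnj (v x)) * pair \<T> (\<lambda>x. of_real (a x) * D k u x) (\<lambda>x. cnj (pderiv_at k (p i) x)))
      + of_real (\<kappa> * \<sigma> i) * pair \<T> (p i) (\<lambda>x. cnj (v x)) * pair \<T> (\<lambda>x. of_real (b x) * P u x) (\<lambda>x. cnj (p i x))) has_sum form u v) I"
    unfolding form_def
    by (intro has_sum_add has_sum_sum tr P(3) D(3) v L2p_cnj a_mult b_mult P(1) D(1) u)
  then show ?thesis
  proof (subst has_sum_cong)
    fix i assume i: "i \<in> I"
    show "of_real (\<kappa> * \<sigma> i) * W u (\<lambda>x. cnj (p i x)) * pair \<T> (p i) (\<lambda>x. cnj (v x)) =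
      (\<Sum>k\<in>UNIV. of_real (\<kappa> * \<sigma> i) * pair \<T> (p i) (\<lambda>x. cnj (v x)) * pair \<T> (\<lambda>x. of_real (a x) * D k u x) (\<lambda>x. cnj (pderiv_at k (p i) x)))
      + of_real (\<kappa> * \<sigma> i) * pair \<T> (p i) (\<lambda>x. cnj (v x)) * pair \<T> (\<lambda>x. of_real (b x) * P u x) (\<lambda>x. cnj (p i x))"
      by (simp add: W_def pderiv_cnj tests_smooth[OF p_tests[OF i]] distrib_left sum_distrib_left mult_ac)
  qed
qed

lemma norm_form_le:
  assumes u: "u \<in> L2p \<T>" and v: "v \<in> L2p \<T>"
  shows "cmod (form u v) \<le> (\<bar>A\<bar> * (real CARD('n) * D_bound\<^sup>2 + 1)) * tnorm \<T> u * tnorm \<T> v"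
proof -
  have d: "cmod (pair \<T> (\<lambda>x. of_real (a x) * D k u x) (\<lambda>x. cnj (D k v x))) \<le> \<bar>A\<bar> * D_bound\<^sup>2 * tnorm \<T> u * tnorm \<T> v" for k
  proof -
    have "cmod (pair \<T> (\<lambda>x. of_real (a x) * D k u x) (\<lambda>x. cnj (D k v x)))
        \<le> tnorm \<T> (\<lambda>x. of_real (a x) * D k u x) * tnorm \<T> (\<lambda>x. cnj (D k v x))"
      by (intro norm_pair_le a_mult L2p_cnj D u v)
    also have "\<dots> \<le> (\<bar>A\<bar> * (D_bound * tnorm \<T> u)) * (D_bound * tnorm \<T> v)"
      unfolding nrm_cnj using D_bound(1)
      by (intro mult_mono D order_trans[OF a_mult(2)[OF D(1)[OF u]]] mult_left_mono u v) auto
    finally show ?thesis by (simp add: power2_eq_square mult_ac)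
  qed
  have p: "cmod (pair \<T> (\<lambda>x. of_real (b x) * P u x) (\<lambda>x. cnj (P v x))) \<le> \<bar>A\<bar> * tnorm \<T> u * tnorm \<T> v"
  proof -
    have "cmod (pair \<T> (\<lambda>x. of_real (b x) * P u x) (\<lambda>x. cnj (P v x)))
        \<le> tnorm \<T> (\<lambda>x. of_real (b x) * P u x) * tnorm \<T> (\<lambda>x. cnj (P v x))"
      by (intro norm_pair_le b_mult L2p_cnj P u v)
    also have "\<dots> \<le> (\<bar>A\<bar> * tnorm \<T> u) * tnorm \<T> v"
      unfolding nrm_cnj
      by (intro mult_mono P order_trans[OF b_mult(2)[OF P(1)[OF u]]] mult_left_mono u v) auto
    finally show ?thesis .
  qed
  have "cmod (form u v) \<le> (\<Sum>k\<in>(UNIV::'n set). \<bar>A\<bar> * D_bound\<^sup>2 * tnorm \<T> u * tnorm \<T> v) + \<bar>A\<bar> * tnorm \<T> u * tnorm \<T> v"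
    unfolding form_def by (intro norm_triangle_mono sum_norm_le d p)
  then show ?thesis by (simp add: algebra_simps)
qed

text \<open>The bounded form is conjugate linear in \<open>v\<close>, so conjugating that argument
  gives a bounded linear functional, to which the representation theorem applies.\<close>

lemma T_exists:
  assumes u: "u \<in> L2p \<T>"
  shows "\<exists>h. h \<in> L2p \<T> \<and> (\<forall>v\<in>L2p \<T>. pair \<T> h (\<lambda>x. cnj (v x)) = form u v)
    \<and> tnorm \<T> h \<le> (\<bar>A\<bar> * (real CARD('n) * D_bound\<^sup>2 + 1)) * tnorm \<T> u"
proof -
  define \<psi> where "\<psi> \<phi> = form u (\<lambda>x. cnj (\<phi> x))" for \<phi>
  have hs: "((\<lambda>i. of_real (\<kappa> * \<sigma> i) * W u (\<lambda>x. cnj (p i x)) * pair \<T> (p i) \<phi>) has_sum \<psi> \<phi>) I" if "\<phi> \<in> L2p \<T>" for \<phi>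
    using has_sum_form[OF u L2p_cnj[OF that]] by (simp add: \<psi>_def)
  \<comment> \<open>Read off from the series: \<open>P\<close> and \<open>D\<close> are linear only
    almost everywhere, whereas pairings with the fixed atoms are linear exactly.\<close>
  have lin: "\<psi> (\<lambda>x. f x + c * g x) = \<psi> f + c * \<psi> g" if f: "f \<in> L2p \<T>" and g: "g \<in> L2p \<T>" for f g c
  proof (rule has_sum_unique)
    show "((\<lambda>i. of_real (\<kappa> * \<sigma> i) * W u (\<lambda>x. cnj (p i x)) * pair \<T> (p i) (\<lambda>x. f x + c * g x)) has_sum \<psi> (\<lambda>x. f x + c * g x)) I"
      by (intro hs L2p_add L2p_cmult f g)
    have "((\<lambda>i. of_real (\<kappa> * \<sigma> i) * W u (\<lambda>x. cnj (p i x)) * pair \<T> (p i) f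
        + c * (of_real (\<kappa> * \<sigma> i) * W u (\<lambda>x. cnj (p i x)) * pair \<T> (p i) g)) has_sum (\<psi> f + c * \<psi> g)) I"
      by (intro has_sum_add has_sum_cmult_right hs f g)
    then show "((\<lambda>i. of_real (\<kappa> * \<sigma> i) * W u (\<lambda>x. cnj (p i x)) * pair \<T> (p i) (\<lambda>x. f x + c * g x)) has_sum (\<psi> f + c * \<psi> g)) I"
    proof (subst has_sum_cong)
      fix i assume i: "i \<in> I"
      show "of_real (\<kappa> * \<sigma> i) * W u (\<lambda>x. cnj (p i x)) * pair \<T> (p i) (\<lambda>x. f x + c * g x)
        = of_real (\<kappa> * \<sigma> i) * W u (\<lambda>x. cnj (p i x)) * pair \<T> (p i) f
        + c * (of_real (\<kappa> * \<sigma> i) * W u (\<lambda>x. cnj (p i x)) * pair \<T> (p i) g)"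
        using pair_add(1)[OF p_L2p[OF i] f L2p_cmult[OF g]] by (simp add: pair_cmult algebra_simps)
    qed
  qed
  have bd: "cmod (\<psi> \<phi>) \<le> ((\<bar>A\<bar> * (real CARD('n) * D_bound\<^sup>2 + 1)) * tnorm \<T> u) * tnorm \<T> \<phi>" if "\<phi> \<in> L2p \<T>" for \<phi>
    using norm_form_le[OF u L2p_cnj[OF that]] by (simp add: \<psi>_def nrm_cnj)
  obtain h where h: "h \<in> L2p \<T>" "\<And>f. f \<in> L2p \<T> \<Longrightarrow> \<psi> f = pair \<T> h f"
    "tnorm \<T> h \<le> (\<bar>A\<bar> * (real CARD('n) * D_bound\<^sup>2 + 1)) * tnorm \<T> u"
    by (rule L2_functional_representation[of \<T> \<psi>, OF _ lin bd]) auto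
  have "pair \<T> h (\<lambda>x. cnj (v x)) = form u v" if "v \<in> L2p \<T>" for v
    using h(2)[OF L2p_cnj[OF that]] by (simp add: \<psi>_def)
  with h show ?thesis by blast
qed

end

section \<open>Coercivity\<close>

lemma tnorm_diff_square:
  assumes f: "f \<in> L2p L" and g: "g \<in> L2p L"
  shows "(tnorm L (\<lambda>x. f x - g x))\<^sup>2 = (tnorm L f)\<^sup>2 - 2 * Re (pair L f (\<lambda>x. cnj (g x))) + (tnorm L g)\<^sup>2"
proof -
  have "complex_of_real ((tnorm L (\<lambda>x. f x - g x))\<^sup>2) = pair L (\<lambda>x. f x - g x) (\<lambda>x. cnj (f x) - cnj (g x))"
    unfolding pair_cnj_self[symmetric] by simp
  also have "\<dots> = pair L f (\<lambda>x. cnj (f x)) - pair L g (\<lambda>x. cnj (f x)) - (pair L f (\<lambda>x. cnj (g x)) - pair L g (\<lambda>x. cnj (g x)))"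
    using L2p_cnj[OF f] L2p_cnj[OF g] f g by (simp add: pair_diff L2p_diff)
  also have "pair L g (\<lambda>x. cnj (f x)) = cnj (pair L f (\<lambda>x. cnj (g x)))"
    by (simp add: cnj_pair pair_commute)
  finally have "Re (complex_of_real ((tnorm L (\<lambda>x. f x - g x))\<^sup>2)) = Re (complex_of_real ((tnorm L f)\<^sup>2) - cnj (pair L f (\<lambda>x. cnj (g x)))
      - (pair L f (\<lambda>x. cnj (g x)) - complex_of_real ((tnorm L g)\<^sup>2)))"
    by (simp only: pair_cnj_self)
  then show ?thesis by (simp del: of_real_power)
qed

lemma tnorm_cong_AE:
  "f \<in> L2p L \<Longrightarrow> g \<in> L2p L \<Longrightarrow> AE x in torus L. f x = g x \<Longrightarrow> tnorm L f = tnorm L g"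
  by (intro nrm_cong_AE measurable_torus L2p_measurable)

lemma tnorm_triangle: "f \<in> L2p L \<Longrightarrow> g \<in> L2p L \<Longrightarrow> tnorm L (\<lambda>x. f x + g x) \<le> tnorm L f + tnorm L g"
  by (intro nrm_triangle L2p_sq_int)

lemma tnorm_diff_eq_0:
  assumes "f \<in> L2p L" "g \<in> L2p L" "tnorm L (\<lambda>x. f x - g x) = 0"
  shows "AE x in torus L. f x = g x"
  using assms nrm_eq_0_iff[OF L2p_sq_int[OF L2p_diff[OF assms(1,2)]]] by simp

section \<open>The Lax-Milgram theorem\<close>

text \<open>Coercivity gives injectivity up to null sets and the bound on the inverse. Surjectivity
  comes from the iteration that replaces \<open>u\<close> by
  \<open>u + \<omega> * (f - T u)\<close>, a contraction for suitable \<omega>, whose geometric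
  convergence fits \<open>L2p_complete\<close>.\<close>

lemma Lax_Milgram_torus:
  fixes T :: "(real^'n \<Rightarrow> complex) \<Rightarrow> real^'n \<Rightarrow> complex"
  assumes L: "L > 0" and TL: "\<And>u. u \<in> L2p L \<Longrightarrow> T u \<in> L2p L"
    and lin: "\<And>u v c. u \<in> L2p L \<Longrightarrow> v \<in> L2p L \<Longrightarrow> AE x in torus L. T (\<lambda>y. u y + c * v y) x = T u x + c * T v x"
    and bdd: "\<And>u. u \<in> L2p L \<Longrightarrow> tnorm L (T u) \<le> M * tnorm L u"
    and coer: "\<And>u. u \<in> L2p L \<Longrightarrow> c * (tnorm L u)\<^sup>2 \<le> Re (pair L (T u) (\<lambda>x. cnj (u x)))"
    and c: "c > 0"
  obtains R where "\<And>u. u \<in> L2p L \<Longrightarrow> R u \<in> L2p L"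
    "\<And>u. u \<in> L2p L \<Longrightarrow> AE x in torus L. T (R u) x = u x"
    "\<And>u. u \<in> L2p L \<Longrightarrow> AE x in torus L. R (T u) x = u x"
    "\<And>u v d. u \<in> L2p L \<Longrightarrow> v \<in> L2p L \<Longrightarrow> AE x in torus L. R (\<lambda>y. u y + d * v y) x = R u x + d * R v x"
    "\<And>u. u \<in> L2p L \<Longrightarrow> tnorm L (R u) \<le> (1 / c) * tnorm L u"
proof -
  have lin_diff: "AE x in torus L. T (\<lambda>y. u y - v y) x = T u x - T v x" if "u \<in> L2p L" "v \<in> L2p L" for u v
    using lin[OF that, of "-1"] by simp
  have inj: "AE x in torus L. u x = v x"
    if u: "u \<in> L2p L" and v: "v \<in> L2p L" and eq: "AE x in torus L. T u x = T v x" for u v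
  proof -
    have d: "(\<lambda>x. u x - v x) \<in> L2p L" by (rule L2p_diff[OF u v])
    have "AE x in torus L. T (\<lambda>y. u y - v y) x = 0"
      using lin_diff[OF u v] eq by eventually_elim simp
    then have "pair L (T (\<lambda>y. u y - v y)) (\<lambda>x. cnj (u x - v x)) = pair L (\<lambda>x. 0) (\<lambda>x. cnj (u x - v x))"
      by (intro pair_cong_AE TL d L2p_cnj) auto
    then have "c * (tnorm L (\<lambda>x. u x - v x))\<^sup>2 \<le> 0" using coer[OF d] by simp
    then have "tnorm L (\<lambda>x. u x - v x) = 0" using c by (simp add: mult_le_0_iff)
    then show ?thesis by (rule tnorm_diff_eq_0[OF u v])
  qed
  \<comment> \<open>The contraction factor squared is at most \<open>1 - 2 * \<omega> * c\<close>
    plus the square of \<open>\<omega> * M'\<close>, which is smallest at the \<omega> chosen below.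
    Taking \<open>M'\<close> at least \<open>c\<close> keeps this minimum nonnegative, so
    \<open>q\<close> is a real number below 1.\<close>
  define M' where "M' = max M c"
  have M': "M' > 0" "M \<le> M'" "c \<le> M'" using c by (auto simp: M'_def)
  define \<omega> where "\<omega> = c / M'\<^sup>2"
  have \<omega>: "\<omega> > 0" using c M' by (simp add: \<omega>_def)
  define q where "q = sqrt (1 - c\<^sup>2 / M'\<^sup>2)"
  have c1: "c\<^sup>2 / M'\<^sup>2 \<le> 1" "c\<^sup>2 / M'\<^sup>2 > 0" using c M' by (auto simp: power_mono)
  have q: "0 \<le> q" "q < 1" "q\<^sup>2 = 1 - c\<^sup>2 / M'\<^sup>2" using c1 by (auto simp: q_def)
  have contr: "tnorm L (\<lambda>x. v x - \<omega> * T v x) \<le> q * tnorm L v" if v: "v \<in> L2p L" for v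
  proof (rule power2_le_imp_le)
    have "(tnorm L (\<lambda>x. v x - \<omega> * T v x))\<^sup>2
      = (tnorm L v)\<^sup>2 - 2 * Re (pair L v (\<lambda>x. cnj (\<omega> * T v x))) + (tnorm L (\<lambda>x. \<omega> * T v x))\<^sup>2"
      by (rule tnorm_diff_square[OF v L2p_cmult[OF TL[OF v]]])
    also have "Re (pair L v (\<lambda>x. cnj (\<omega> * T v x))) = \<omega> * Re (pair L (T v) (\<lambda>x. cnj (v x)))"
    proof -
      have "pair L v (\<lambda>x. cnj (\<omega> * T v x)) = \<omega> * pair L v (\<lambda>x. cnj (T v x))"
        by (simp add: pair_cmult)
      moreover have "pair L v (\<lambda>x. cnj (T v x)) = cnj (pair L (T v) (\<lambda>x. cnj (v x)))"
        by (simp add: cnj_pair pair_commute)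
      ultimately show ?thesis by simp
    qed
    also have "(tnorm L (\<lambda>x. \<omega> * T v x))\<^sup>2 = \<omega>\<^sup>2 * (tnorm L (T v))\<^sup>2"
      using \<omega> by (simp add: nrm_cmult power_mult_distrib)
    also have "(tnorm L v)\<^sup>2 - 2 * (\<omega> * Re (pair L (T v) (\<lambda>x. cnj (v x)))) + \<omega>\<^sup>2 * (tnorm L (T v))\<^sup>2
      \<le> (tnorm L v)\<^sup>2 - 2 * (\<omega> * (c * (tnorm L v)\<^sup>2)) + \<omega>\<^sup>2 * (M' * tnorm L v)\<^sup>2"
    proof -
      have "\<omega> * (c * (tnorm L v)\<^sup>2) \<le> \<omega> * Re (pair L (T v) (\<lambda>x. cnj (v x)))"
        using \<omega> coer[OF v] by (intro mult_left_mono) auto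
      moreover have "tnorm L (T v) \<le> M' * tnorm L v"
        using bdd[OF v] M'(2) mult_right_mono[OF M'(2) nrm_nonneg[of "torus L" v]] by linarith
      then have "\<omega>\<^sup>2 * (tnorm L (T v))\<^sup>2 \<le> \<omega>\<^sup>2 * (M' * tnorm L v)\<^sup>2"
        by (intro mult_left_mono power_mono) auto
      ultimately show ?thesis by linarith
    qed
    also have "\<dots> = (1 - 2 * (\<omega> * c) + \<omega>\<^sup>2 * M'\<^sup>2) * (tnorm L v)\<^sup>2"
      by (simp add: power_mult_distrib algebra_simps)
    also have "\<omega> * c = c\<^sup>2 / M'\<^sup>2" by (simp add: \<omega>_def power2_eq_square)
    also have "\<omega>\<^sup>2 * M'\<^sup>2 = c\<^sup>2 / M'\<^sup>2" using M' by (simp add: \<omega>_def power2_eq_square)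
    also have "(1 - 2 * (c\<^sup>2 / M'\<^sup>2) + c\<^sup>2 / M'\<^sup>2) * (tnorm L v)\<^sup>2 = (q * tnorm L v)\<^sup>2"
      by (simp add: power_mult_distrib q(3))
    finally show "(tnorm L (\<lambda>x. v x - \<omega> * T v x))\<^sup>2 \<le> (q * tnorm L v)\<^sup>2" .
  qed (use q in simp)
  have surj: "\<exists>u. u \<in> L2p L \<and> (AE x in torus L. T u x = f x)" if f: "f \<in> L2p L" for f
  proof -
    define U where "U = rec_nat (\<lambda>x. 0) (\<lambda>_ u. (\<lambda>x. u x + \<omega> * (f x - T u x)))"
    have U0: "U 0 = (\<lambda>x. 0)" and US: "U (Suc k) = (\<lambda>x. U k x + \<omega> * (f x - T (U k) x))" for k
      by (simp_all add: U_def)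
    have UL: "U k \<in> L2p L" for k
      by (induction k) (auto simp: U0 US intro!: L2p_add L2p_cmult L2p_diff f TL)
    have dL: "(\<lambda>x. U (Suc k) x - U k x) \<in> L2p L" for k by (rule L2p_diff[OF UL UL])
    have step: "tnorm L (\<lambda>x. U (Suc k) x - U k x) \<le> tnorm L (U 1) * q ^ k" for k
    proof (induction k)
      case 0
      then show ?case by (simp add: U0)
    next
      case (Suc k)
      let ?v = "\<lambda>x. U (Suc k) x - U k x"
      \<comment> \<open>The increments obey the contracted recursion only almost everywhere, as
        \<open>T\<close> is linear only in that sense; their norms do not notice.\<close>
      have "AE x in torus L. U (Suc (Suc k)) x - U (Suc k) x = ?v x - \<omega> * T ?v x"
        using lin_diff[OF UL UL, of "Suc k" k]
      proof eventually_elim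
        case (elim x)
        have "U (Suc (Suc k)) x - U (Suc k) x = (U (Suc k) x - U k x) - \<omega> * (T (U (Suc k)) x - T (U k) x)"
          using US[of "Suc k"] US[of k] by (simp add: algebra_simps)
        then show ?case by (simp only: elim)
      qed
      then have "tnorm L (\<lambda>x. U (Suc (Suc k)) x - U (Suc k) x) = tnorm L (\<lambda>x. ?v x - \<omega> * T ?v x)"
        by (intro tnorm_cong_AE dL L2p_diff L2p_cmult TL)
      also have "\<dots> \<le> q * tnorm L ?v" by (rule contr[OF dL])
      also have "\<dots> \<le> q * (tnorm L (U 1) * q ^ k)" using q Suc by (intro mult_left_mono) auto
      finally show ?case by (simp add: mult_ac)
    qed
    obtain h where h: "h \<in> L2p L" "\<And>k. tnorm L (\<lambda>x. U k x - h x) \<le> tnorm L (U 1) / (1 - q) * q ^ k"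
      by (rule L2p_complete[OF L UL q(1,2) step]) auto
    \<comment> \<open>The first term bounds \<open>T\<close> applied to \<open>h\<close> minus an
      iterate, the second the residual of that iterate, which is its next increment divided by
      \<omega>.\<close>
    define B where "B = M' * (tnorm L (U 1) / (1 - q)) + tnorm L (U 1) / \<omega>"
    have le: "tnorm L (\<lambda>x. T h x - f x) \<le> B * q ^ k" for k
    proof -
      have "tnorm L (\<lambda>x. T h x - f x) \<le> tnorm L (\<lambda>x. T h x - T (U k) x) + tnorm L (\<lambda>x. T (U k) x - f x)"
        by (intro nrm_triangle_diff L2p_sq_int TL h UL f)
      moreover have "tnorm L (\<lambda>x. T h x - T (U k) x) \<le> M' * (tnorm L (U 1) / (1 - q) * q ^ k)"
      proof -
        have "tnorm L (\<lambda>x. T h x - T (U k) x) = tnorm L (T (\<lambda>x. h x - U k x))"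
          using lin_diff[OF h(1) UL[of k]]
          by (intro tnorm_cong_AE L2p_diff TL h UL) (auto elim: AE_mp)
        also have "\<dots> \<le> M * tnorm L (\<lambda>x. h x - U k x)" by (intro bdd L2p_diff h UL)
        also have "\<dots> \<le> M' * tnorm L (\<lambda>x. h x - U k x)" using M' by (intro mult_right_mono) auto
        also have "\<dots> \<le> M' * (tnorm L (U 1) / (1 - q) * q ^ k)"
          using M' h(2)[of k] by (intro mult_left_mono) (auto simp: nrm_minus_commute[of _ h])
        finally show ?thesis .
      qed
      moreover have "tnorm L (\<lambda>x. T (U k) x - f x) \<le> tnorm L (U 1) / \<omega> * q ^ k"
      proof -
        have "(\<lambda>x. T (U k) x - f x) = (\<lambda>x. (- 1 / \<omega>) * (U (Suc k) x - U k x))"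
          using \<omega> by (simp add: US fun_eq_iff)
        then have "tnorm L (\<lambda>x. T (U k) x - f x) = cmod (complex_of_real (- 1 / \<omega>)) * tnorm L (\<lambda>x. U (Suc k) x - U k x)"
          by (simp only: nrm_cmult)
        also have "\<dots> = (1 / \<omega>) * tnorm L (\<lambda>x. U (Suc k) x - U k x)"
          using \<omega> by (subst norm_of_real) simp
        also have "\<dots> \<le> (1 / \<omega>) * (tnorm L (U 1) * q ^ k)"
          using \<omega> step[of k] by (intro mult_left_mono) auto
        finally show ?thesis by simp
      qed
      ultimately show ?thesis by (simp add: B_def algebra_simps)
    qed
    have "(\<lambda>k. B * q ^ k) \<longlonglongrightarrow> 0"
      using q by (intro tendsto_mult_right_zero LIMSEQ_realpow_zero) auto
    then have "tnorm L (\<lambda>x. T h x - f x) \<le> 0" using le by (intro LIMSEQ_le_const) auto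
    then have "tnorm L (\<lambda>x. T h x - f x) = 0" by (simp add: order_antisym)
    then show ?thesis using tnorm_diff_eq_0[OF TL[OF h(1)] f] h(1) by blast
  qed
  define R where "R f = (SOME u. u \<in> L2p L \<and> (AE x in torus L. T u x = f x))" for f
  have R: "R f \<in> L2p L" "AE x in torus L. T (R f) x = f x" if "f \<in> L2p L" for f
    using someI_ex[OF surj[OF that]] unfolding R_def[symmetric] by auto
  show ?thesis
  proof
    show "R u \<in> L2p L" "AE x in torus L. T (R u) x = u x" if "u \<in> L2p L" for u using R that by auto
    show "AE x in torus L. R (T u) x = u x" if "u \<in> L2p L" for u
      by (rule inj[OF R(1)[OF TL[OF that]] that R(2)[OF TL[OF that]]])
    show "AE x in torus L. R (\<lambda>y. u y + d * v y) x = R u x + d * R v x" if u: "u \<in> L2p L" and v: "v \<in> L2p L" for u v d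
    proof (rule inj)
      have uv: "(\<lambda>y. u y + d * v y) \<in> L2p L" by (intro L2p_add L2p_cmult u v)
      show "R (\<lambda>y. u y + d * v y) \<in> L2p L" "(\<lambda>x. R u x + d * R v x) \<in> L2p L"
        by (intro R uv L2p_add L2p_cmult u v)+
      show "AE x in torus L. T (R (\<lambda>y. u y + d * v y)) x = T (\<lambda>x. R u x + d * R v x) x"
        using R(2)[OF uv] R(2)[OF u] R(2)[OF v] lin[OF R(1)[OF u] R(1)[OF v], of d]
        by eventually_elim simp
    qed
    show "tnorm L (R u) \<le> (1 / c) * tnorm L u" if u: "u \<in> L2p L" for u
    proof (cases "tnorm L (R u) = 0")
      case False
      have "c * (tnorm L (R u))\<^sup>2 \<le> Re (pair L (T (R u)) (\<lambda>x. cnj (R u x)))" by (rule coer[OF R(1)[OF u]])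
      also have "\<dots> \<le> cmod (pair L (T (R u)) (\<lambda>x. cnj (R u x)))" by (rule complex_Re_le_cmod)
      also have "\<dots> \<le> tnorm L (T (R u)) * tnorm L (\<lambda>x. cnj (R u x))"
        by (intro norm_pair_le TL R u L2p_cnj)
      also have "\<dots> = tnorm L u * tnorm L (R u)"
        using tnorm_cong_AE[OF TL[OF R(1)[OF u]] u R(2)[OF u]] by (simp add: nrm_cnj)
      finally have "(c * tnorm L (R u)) * tnorm L (R u) \<le> tnorm L u * tnorm L (R u)"
        by (simp add: power2_eq_square mult.assoc)
      then have "c * tnorm L (R u) \<le> tnorm L u"
        by (rule mult_right_le_imp_le) (use False in \<open>simp add: less_le\<close>)
      then show ?thesis using c by (simp add: field_simps)
    qed (use c in simp)
  qed
qed

text \<open>After division by \<open>t\<close>, the arithmetic-geometric mean of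
  \<open>c * t\<close> and \<open>s\<^sup>2 * E / c\<close> bounds the mixed term, and half of
  \<open>c * t\<close> is absorbed on the left.\<close>

lemma le_of_interpolated_bound:
  fixes c t E s :: real
  assumes c: "c > 0" and t: "t \<ge> 0" and E: "E \<ge> 0" and s: "s \<ge> 0"
    and le: "c * t\<^sup>2 \<le> t * E + sqrt (E * t) * s * t"
  shows "t \<le> 2 / c * (1 + s\<^sup>2 / (2 * c)) * E"
proof (cases "t = 0")
  case True
  then show ?thesis using c E by simp
next
  case False
  then have tp: "t > 0" using t by simp
  have "(c * t) * t \<le> (E + sqrt (E * t) * s) * t" using le by (simp add: power2_eq_square algebra_simps)
  then have 1: "c * t \<le> E + sqrt (E * t) * s" using tp by simp
  have "sqrt (E * t) * s = sqrt ((c * t) * (s\<^sup>2 * E / c))"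
    using c s by (simp add: real_sqrt_mult mult_ac)
  also have "\<dots> \<le> (c * t + s\<^sup>2 * E / c) / 2"
    using c tp E by (intro arith_geo_mean_sqrt) auto
  finally have "c * t \<le> E + (c * t + s\<^sup>2 * E / c) / 2" using 1 by linarith
  then have "c * t \<le> 2 * (E + s\<^sup>2 * E / c / 2)" by (simp add: field_simps)
  also have "\<dots> = c * (2 / c * (1 + s\<^sup>2 / (2 * c)) * E)" using c by (simp add: field_simps)
  finally show ?thesis using mult_le_cancel_left_pos[OF c] by blast
qed

lemma Bessel_minus:
  fixes f :: "real^'n \<Rightarrow> complex"
  assumes "L > 0" "finite F" "f \<in> L2p L"
  shows "(\<Sum>m\<in>F. (cmod (pair L f (expo L (- m))))\<^sup>2) \<le> L ^ CARD('n) * (tnorm L f)\<^sup>2"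
proof -
  have "(\<Sum>m\<in>F. (cmod (pair L f (expo L (- m))))\<^sup>2) = (\<Sum>m\<in>uminus ` F. (cmod (pair L f (expo L m)))\<^sup>2)"
    by (subst sum.reindex) (auto simp: inj_on_def)
  then show ?thesis using Bessel[OF assms(1) _ assms(3), of "uminus ` F"] assms(2) by simp
qed

lemma norm_int_vec_square: "(norm (int_vec m))\<^sup>2 = (\<Sum>k\<in>UNIV. (real_of_int (m $ k))\<^sup>2)"
  unfolding power2_norm_eq_inner by (simp add: inner_vec_def power2_eq_square)

lemma weighted_pair_self:
  assumes f: "f \<in> L2p L" and af: "(\<lambda>x. complex_of_real (a x) * f x) \<in> L2p L" and ge: "\<And>x. a x \<ge> C"
  shows "Im (pair L (\<lambda>x. of_real (a x) * f x) (\<lambda>x. cnj (f x))) = 0"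
    "C * (tnorm L f)\<^sup>2 \<le> Re (pair L (\<lambda>x. of_real (a x) * f x) (\<lambda>x. cnj (f x)))"
proof -
  have eq: "of_real (a x) * f x * cnj (f x) = complex_of_real (a x * (cmod (f x))\<^sup>2)" for x
    by (simp only: of_real_mult complex_norm_square mult.assoc)
  have i: "integrable (torus L) (\<lambda>x. complex_of_real (a x * (cmod (f x))\<^sup>2))"
    using pair_integrable[OF af L2p_cnj[OF f]] unfolding eq .
  then have i2: "integrable (torus L) (\<lambda>x. a x * (cmod (f x))\<^sup>2)"
    using integrable_Re[OF i] by simp
  have p: "pair L (\<lambda>x. of_real (a x) * f x) (\<lambda>x. cnj (f x)) = complex_of_real (\<integral>x. a x * (cmod (f x))\<^sup>2 \<partial>torus L)"
    unfolding pair_def eq by (rule integral_complex_of_real)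
  then show "Im (pair L (\<lambda>x. of_real (a x) * f x) (\<lambda>x. cnj (f x))) = 0" by simp
  have "C * (tnorm L f)\<^sup>2 = (\<integral>x. C * (cmod (f x))\<^sup>2 \<partial>torus L)" by (simp add: nrm_square)
  also have "\<dots> \<le> (\<integral>x. a x * (cmod (f x))\<^sup>2 \<partial>torus L)"
    using sq_int_integrable[OF L2p_sq_int[OF f]] i2 ge by (intro integral_mono) (auto intro: mult_right_mono)
  finally show "C * (tnorm L f)\<^sup>2 \<le> Re (pair L (\<lambda>x. of_real (a x) * f x) (\<lambda>x. cnj (f x)))" by (simp add: p)
qed

section \<open>Energy estimates and coercivity of the form\<close>

context elliptic_frame
begin

text \<open>Comparable to the Sobolev norm of order one of \<open>P u\<close>. A sum of norms,
  rather than the root of a sum of squares, gives the triangle inequality term by term.\<close>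

definition energy :: "(real^'n \<Rightarrow> complex) \<Rightarrow> real" where
  "energy u = tnorm \<T> (P u) + (\<Sum>k\<in>UNIV. tnorm \<T> (D k u))"

lemma energy_nonneg: "energy u \<ge> 0"
  by (auto simp: energy_def intro!: add_nonneg_nonneg sum_nonneg)

lemma P_le_energy: "tnorm \<T> (P u) \<le> energy u"
  by (auto simp: energy_def intro!: sum_nonneg)

lemma energy_squares_le: "(tnorm \<T> (P u))\<^sup>2 + (\<Sum>k\<in>UNIV. (tnorm \<T> (D k u))\<^sup>2) \<le> (energy u)\<^sup>2"
proof -
  have "(\<Sum>k\<in>UNIV. (tnorm \<T> (D k u))\<^sup>2) = (L2_set (\<lambda>k. tnorm \<T> (D k u)) UNIV)\<^sup>2"
    unfolding L2_set_def by (rule real_sqrt_pow2[symmetric]) (auto intro: sum_nonneg)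
  also have "\<dots> \<le> (\<Sum>k\<in>UNIV. tnorm \<T> (D k u))\<^sup>2"
    by (intro power_mono L2_set_le_sum L2_set_nonneg) auto
  finally have 1: "(\<Sum>k\<in>UNIV. (tnorm \<T> (D k u))\<^sup>2) \<le> (\<Sum>k\<in>UNIV. tnorm \<T> (D k u))\<^sup>2" .
  have "0 \<le> tnorm \<T> (P u) * (\<Sum>k\<in>UNIV. tnorm \<T> (D k u))" by (intro mult_nonneg_nonneg sum_nonneg) auto
  then show ?thesis using 1 by (simp add: energy_def power2_sum)
qed

text \<open>On exponentials \<open>pair_D\<close> turns \<open>D k\<close> into multiplication by
  \<open>m $ k\<close> up to a unimodular factor; together with the weight 1 of \<open>P u\<close>
  these squares add up to the squared Japanese bracket.\<close>

lemma japanese_square_coeff: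
  assumes u: "u \<in> L2p \<T>"
  shows "(japanese (int_vec m) * cmod (pair \<T> (P u) (expo \<T> (- m))))\<^sup>2
    = (cmod (pair \<T> (P u) (expo \<T> (- m))))\<^sup>2 + (\<Sum>k\<in>UNIV. (cmod (pair \<T> (D k u) (expo \<T> (- m))))\<^sup>2)"
proof -
  have D: "(cmod (pair \<T> (D k u) (expo \<T> (- m))))\<^sup>2 = (real_of_int (m $ k))\<^sup>2 * (cmod (pair \<T> (P u) (expo \<T> (- m))))\<^sup>2" for k
  proof -
    have "pair \<T> (D k u) (expo \<T> (- m)) = - pair \<T> (P u) (pderiv_at k (expo \<T> (- m)))"
      by (rule pair_D[OF u tests_expo]) simp
    also have "pderiv_at k (expo \<T> (- m)) = (\<lambda>x. (- (\<i> * complex_of_real (real_of_int (m $ k)))) * expo \<T> (- m) x)"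
      by (simp add: pderiv_expo freq_nth)
    also have "- pair \<T> (P u) \<dots> = \<i> * complex_of_real (real_of_int (m $ k)) * pair \<T> (P u) (expo \<T> (- m))"
      by (subst pair_cmult) simp
    finally show ?thesis by (simp add: norm_mult power_mult_distrib)
  qed
  have "(japanese (int_vec m))\<^sup>2 = 1 + (\<Sum>k\<in>UNIV. (real_of_int (m $ k))\<^sup>2)"
    by (simp add: japanese_def norm_int_vec_square sum_nonneg)
  then show ?thesis by (simp add: power_mult_distrib D distrib_right sum_distrib_right)
qed

lemma sobolev_coeff_sum_le:
  assumes u: "u \<in> L2p \<T>" and F: "finite F"
  shows "(\<Sum>m\<in>F. (japanese (int_vec m) * cmod (pair \<T> (P u) (expo \<T> (- m))))\<^sup>2) \<le> \<T> ^ CARD('n) * (energy u)\<^sup>2"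
proof -
  have T: "\<T> > 0" by simp
  have "(\<Sum>m\<in>F. (japanese (int_vec m) * cmod (pair \<T> (P u) (expo \<T> (- m))))\<^sup>2)
    = (\<Sum>m\<in>F. (cmod (pair \<T> (P u) (expo \<T> (- m))))\<^sup>2) + (\<Sum>k\<in>UNIV. \<Sum>m\<in>F. (cmod (pair \<T> (D k u) (expo \<T> (- m))))\<^sup>2)"
    unfolding japanese_square_coeff[OF u] sum.distrib by (simp add: sum.swap[of _ F])
  also have "\<dots> \<le> \<T> ^ CARD('n) * (tnorm \<T> (P u))\<^sup>2 + (\<Sum>k\<in>UNIV. \<T> ^ CARD('n) * (tnorm \<T> (D k u))\<^sup>2)"
    by (intro add_mono sum_mono Bessel_minus T F P D u)
  also have "\<dots> = \<T> ^ CARD('n) * ((tnorm \<T> (P u))\<^sup>2 + (\<Sum>k\<in>UNIV. (tnorm \<T> (D k u))\<^sup>2))"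
    by (simp add: distrib_left sum_distrib_left)
  also have "\<dots> \<le> \<T> ^ CARD('n) * (energy u)\<^sup>2"
    by (intro mult_left_mono energy_squares_le) auto
  finally show ?thesis .
qed

text \<open>Testing \<open>P u\<close> against \<open>\<Lambda> u\<close>: the pairing is at most the Sobolev norm of \<open>P u\<close> times the norm of \<open>u\<close>,
  and by Cauchy-Schwarz the commutator term is at most a constant times \<open>\<langle>P u, u\<rangle>\<close> to the power
  one half times the norm of \<open>u\<close>.\<close>

lemma energy_lower_bound_tsum:
  "\<exists>K\<ge>0. \<forall>F c. finite F \<longrightarrow> tnorm \<T> (tsum \<T> F c) \<le> K * energy (tsum \<T> F c)"
proof -
  have T: "\<T> > 0" by simp
  obtain B where B: "B \<ge> 0" "\<forall>F c G. finite F \<longrightarrow> finite G \<longrightarrow> G \<subseteq> I \<longrightarrow>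
      (\<Sum>i\<in>G. (cmod (pair \<T> (tsum \<T> F (\<lambda>m. of_real (japanese (int_vec m)) * c m)) (\<lambda>x. cnj (p i x))
              - of_real (w i) * pair \<T> (tsum \<T> F c) (\<lambda>x. cnj (p i x))))\<^sup>2)
        \<le> B * (tnorm \<T> (tsum \<T> F c))\<^sup>2"
    using commutator_bound by (elim exE conjE)
  obtain c0 where c0: "c0 > 0" "\<And>i. i \<in> I \<Longrightarrow> c0 \<le> \<sigma> i * w i"
    using \<sigma>_w by blast
  define s where "s = sqrt (\<kappa> * B)"
  have s: "s \<ge> 0" using \<kappa>_pos B by (simp add: s_def)
  have main: "tnorm \<T> (tsum \<T> F c) \<le> 2 / c0 * (1 + s\<^sup>2 / (2 * c0)) * energy (tsum \<T> F c)" if F: "finite F" for F c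
  proof -
    define u where "u = tsum \<T> F c"
    define v where "v = tsum \<T> F (\<lambda>m. of_real (japanese (int_vec m)) * c m)"
    define t where "t = tnorm \<T> u"
    define E where "E = energy u"
    have u: "u \<in> L2p \<T>" and v: "v \<in> L2p \<T>" by (simp_all add: u_def v_def tsum_L2p)
    have t: "t \<ge> 0" by (simp add: t_def)
    \<comment> \<open>The commutator seen on the coefficients: the part of \<Lambda> that is not
      multiplication by \<open>w\<close>.\<close>
    define e where "e i = coef v i - of_real (w i) * coef u i" for i
    have e: "(\<Sum>i\<in>G. (cmod (e i))\<^sup>2) \<le> B * t\<^sup>2" if "finite G" "G \<subseteq> I" for G
      using B(2)[rule_format, OF F that, of c] by (simp add: e_def coef_def u_def v_def t_def)
    define S where "S = pair \<T> (P u) (\<lambda>x. cnj (v x))"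
    have S_le: "cmod S \<le> t * E"
    proof -
      define V where "V = \<T> ^ CARD('n)"
      have V: "V > 0" by (simp add: V_def)
      have "S = (\<Sum>m\<in>F. cnj (of_real (japanese (int_vec m)) * c m) * pair \<T> (P u) (expo \<T> (- m)))"
        unfolding S_def v_def by (rule pair_cnj_tsum[OF T P(1)[OF u]])
      then have "cmod S \<le> (\<Sum>m\<in>F. cmod (cnj (of_real (japanese (int_vec m)) * c m) * pair \<T> (P u) (expo \<T> (- m))))"
        by (simp only: norm_sum)
      also have "\<dots> = (\<Sum>m\<in>F. cmod (c m) * (japanese (int_vec m) * cmod (pair \<T> (P u) (expo \<T> (- m)))))"
        by (intro sum.cong refl) (simp add: norm_mult japanese_def)
      \<comment> \<open>The weight of \<Lambda> is moved from \<open>v\<close> onto the coefficients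
        of \<open>P u\<close>, where the Sobolev bound pays for it; the bare coefficients
        \<open>c m\<close> are left with the norm of \<open>u\<close>.\<close>
      also have "\<dots> \<le> (t / sqrt V) * (sqrt V * E)"
      proof (rule sum_mult_le_of_squares)
        have "t\<^sup>2 = V * (\<Sum>m\<in>F. (cmod (c m))\<^sup>2)" unfolding t_def u_def V_def by (rule tsum_norm[OF T F])
        then show "(\<Sum>m\<in>F. (cmod (c m))\<^sup>2) \<le> (t / sqrt V)\<^sup>2" using V by (simp add: power_divide)
        show "(\<Sum>m\<in>F. (japanese (int_vec m) * cmod (pair \<T> (P u) (expo \<T> (- m))))\<^sup>2) \<le> (sqrt V * E)\<^sup>2"
          using sobolev_coeff_sum_le[OF u F] V by (simp add: power_mult_distrib V_def E_def)
      qed (use t V energy_nonneg in \<open>auto simp: E_def\<close>)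
      also have "\<dots> = t * E" using V by simp
      finally show ?thesis .
    qed
    have hsS: "((\<lambda>i. of_real (\<kappa> * \<sigma> i) * coef u i * cnj (coef v i)) has_sum S) I"
      using P(3)[OF u L2p_cnj[OF v]] by (simp add: S_def pair_p_eq)
    have hsQ: "((\<lambda>i. of_real (\<kappa> * \<sigma> i) * coef u i * cnj (coef u i)) has_sum pair \<T> (P u) (\<lambda>x. cnj (u x))) I"
      using P(3)[OF u L2p_cnj[OF u]] by (simp add: pair_p_eq)
    have Qle: "Re (pair \<T> (P u) (\<lambda>x. cnj (u x))) \<le> E * t"
    proof -
      have "Re (pair \<T> (P u) (\<lambda>x. cnj (u x))) \<le> cmod (pair \<T> (P u) (\<lambda>x. cnj (u x)))" by (rule complex_Re_le_cmod)
      also have "\<dots> \<le> tnorm \<T> (P u) * t"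
        using norm_pair_le[OF P(1)[OF u] L2p_cnj[OF u]] by (simp add: nrm_cnj t_def)
      also have "\<dots> \<le> E * t" using P_le_energy t by (intro mult_right_mono) (auto simp: E_def)
      finally show ?thesis .
    qed
    have Qsum: "((\<lambda>i. (sqrt (\<kappa> * \<sigma> i) * cmod (coef u i))\<^sup>2) has_sum Re (pair \<T> (P u) (\<lambda>x. cnj (u x)))) I"
    proof -
      have "Re (of_real (\<kappa> * \<sigma> i) * coef u i * cnj (coef u i)) = (sqrt (\<kappa> * \<sigma> i) * cmod (coef u i))\<^sup>2" if "i \<in> I" for i
      proof -
        have "of_real (\<kappa> * \<sigma> i) * coef u i * cnj (coef u i) = complex_of_real (\<kappa> * \<sigma> i * (cmod (coef u i))\<^sup>2)"
          by (simp only: of_real_mult complex_norm_square mult.assoc)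
        then have "Re (of_real (\<kappa> * \<sigma> i) * coef u i * cnj (coef u i)) = \<kappa> * \<sigma> i * (cmod (coef u i))\<^sup>2"
          by (simp only: Re_complex_of_real)
        then show ?thesis using \<kappa>_pos \<sigma>_pos[OF that] by (simp only: power_mult_distrib) simp
      qed
      then show ?thesis using has_sum_Re[OF hsQ] by (simp cong: has_sum_cong)
    qed
    define z where "z i = of_real (\<kappa> * \<sigma> i) * coef u i * cnj (e i)" for i
    have zc: "z summable_on I" "cmod (infsum z I) \<le> sqrt (E * t) * (s * t)"
    proof -
      have 1: "cmod (z i) \<le> (sqrt (\<kappa> * \<sigma> i) * cmod (coef u i)) * (sqrt \<kappa> * cmod (e i))" if "i \<in> I" for i
      proof -
        \<comment> \<open>One square root of \<open>\<sigma> i\<close> stays with the coefficient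
          and builds the quadratic form of \<open>P u\<close>; the other is bounded by 1 and goes
          with the error.\<close>
        have "\<kappa> * \<sigma> i = sqrt (\<kappa> * \<sigma> i) * sqrt (\<kappa> * \<sigma> i)" using \<kappa>_pos \<sigma>_pos[OF that] by simp
        also have "\<dots> \<le> sqrt (\<kappa> * \<sigma> i) * sqrt \<kappa>"
          using \<kappa>_pos \<sigma>_pos[OF that] \<sigma>_le_1[OF that] by (intro mult_left_mono) (auto simp: mult_left_le)
        finally have "(\<kappa> * \<sigma> i) * (cmod (coef u i) * cmod (e i)) \<le> (sqrt (\<kappa> * \<sigma> i) * sqrt \<kappa>) * (cmod (coef u i) * cmod (e i))"
          by (intro mult_right_mono) auto
        then show ?thesis using \<kappa>_pos \<sigma>_pos[OF that] by (simp add: z_def norm_mult mult_ac)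
      qed
      have 2: "(\<Sum>i\<in>G. (sqrt (\<kappa> * \<sigma> i) * cmod (coef u i))\<^sup>2) \<le> (sqrt (E * t))\<^sup>2" if "finite G" "G \<subseteq> I" for G
        using finite_sum_le_has_sum[OF Qsum that] Qle energy_nonneg[of u] t by (simp add: E_def)
      have 3: "(\<Sum>i\<in>G. (sqrt \<kappa> * cmod (e i))\<^sup>2) \<le> (s * t)\<^sup>2" if "finite G" "G \<subseteq> I" for G
        using mult_left_mono[OF e[OF that], of \<kappa>] \<kappa>_pos B(1)
        by (simp add: power_mult_distrib s_def sum_distrib_left[symmetric] mult.assoc)
      have 4: "sqrt (E * t) \<ge> 0" "s * t \<ge> 0" using s t energy_nonneg[of u] by (auto simp: E_def)
      note cs = Cauchy_Schwarz_summable[OF 1 2 3 4]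
      show "z summable_on I" by (rule cs(1))
      show "cmod (infsum z I) \<le> sqrt (E * t) * (s * t)" by (rule cs(2))
    qed
    \<comment> \<open>Subtracting the error terms \<open>z i\<close> leaves summands
      \<open>\<kappa> * (\<sigma> i * w i)\<close> times squared coefficients, so the lower bound on
      \<open>\<sigma> i * w i\<close> and Parseval apply.\<close>
    have hsd: "((\<lambda>i. of_real (\<kappa> * \<sigma> i) * coef u i * cnj (coef v i) + - z i) has_sum (S + - infsum z I)) I"
      by (intro has_sum_add hsS has_sum_uminusI has_sum_infsum zc)
    have "c0 * t\<^sup>2 \<le> Re (S + - infsum z I)"
    proof (rule has_sum_mono[OF _ has_sum_Re[OF hsd]])
      have "((\<lambda>i. (c0 * \<kappa>) * (cmod (coef u i))\<^sup>2) has_sum ((c0 * \<kappa>) * (t\<^sup>2 / \<kappa>))) I"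
        unfolding coef_def t_def by (intro has_sum_cmult_right parseval u)
      then show "((\<lambda>i. (c0 * \<kappa>) * (cmod (coef u i))\<^sup>2) has_sum (c0 * t\<^sup>2)) I"
        using \<kappa>_pos by simp
      fix i assume i: "i \<in> I"
      have "of_real (\<kappa> * \<sigma> i) * coef u i * cnj (coef v i) + - z i = of_real (\<kappa> * \<sigma> i) * coef u i * cnj (of_real (w i) * coef u i)"
        by (simp add: z_def e_def algebra_simps)
      also have "\<dots> = complex_of_real (\<kappa> * (\<sigma> i * w i) * (cmod (coef u i))\<^sup>2)"
        by (simp only: of_real_mult complex_norm_square complex_cnj_mult complex_cnj_complex_of_real mult_ac)
      finally have "Re (of_real (\<kappa> * \<sigma> i) * coef u i * cnj (coef v i) + - z i) = \<kappa> * (\<sigma> i * w i) * (cmod (coef u i))\<^sup>2"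
        by (simp only: Re_complex_of_real)
      moreover have "(c0 * \<kappa>) * (cmod (coef u i))\<^sup>2 \<le> \<kappa> * (\<sigma> i * w i) * (cmod (coef u i))\<^sup>2"
        using c0(2)[OF i] \<kappa>_pos by (intro mult_right_mono) (auto simp: mult.commute[of c0])
      ultimately show "(c0 * \<kappa>) * (cmod (coef u i))\<^sup>2 \<le> Re (of_real (\<kappa> * \<sigma> i) * coef u i * cnj (coef v i) + - z i)"
        by simp
    qed
    also have "\<dots> \<le> cmod S + cmod (infsum z I)"
      using complex_Re_le_cmod[of S] abs_Re_le_cmod[of "infsum z I"] by simp
    also have "\<dots> \<le> t * E + sqrt (E * t) * s * t"
      using S_le zc(2) by (simp add: mult.assoc)
    finally have "t \<le> 2 / c0 * (1 + s\<^sup>2 / (2 * c0)) * E"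
      using c0(1) t s energy_nonneg[of u] by (intro le_of_interpolated_bound) (auto simp: E_def)
    then show ?thesis by (simp add: t_def E_def u_def)
  qed
  moreover have "2 / c0 * (1 + s\<^sup>2 / (2 * c0)) \<ge> 0" using c0 by simp
  ultimately show ?thesis by blast
qed

text \<open>The energy is Lipschitz continuous in the norm of \<open>u\<close>, since
  \<open>P\<close> and each \<open>D k\<close> are bounded; this allows the passage from
  trigonometric sums to all \<open>u\<close>.\<close>

lemma energy_triangle:
  assumes u: "u \<in> L2p \<T>" and v: "v \<in> L2p \<T>"
  shows "energy v \<le> energy u + (1 + real CARD('n) * D_bound) * tnorm \<T> (\<lambda>x. u x - v x)"
proof -
  define d where "d = (\<lambda>x. u x - v x)"
  have d: "d \<in> L2p \<T>" unfolding d_def by (rule L2p_diff[OF u v])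
  have veq: "v = (\<lambda>x. u x + (-1) * d x)" by (simp add: d_def fun_eq_iff)
  have tri: "tnorm \<T> (Q v) \<le> tnorm \<T> (Q u) + tnorm \<T> (Q d)"
    if Q: "\<And>u. u \<in> L2p \<T> \<Longrightarrow> Q u \<in> L2p \<T>"
      and lin: "AE x in torus \<T>. Q (\<lambda>x. u x + (-1) * d x) x = Q u x + (-1) * Q d x" for Q
  proof -
    have "tnorm \<T> (Q v) = tnorm \<T> (\<lambda>x. Q u x + (-1) * Q d x)"
      using lin unfolding veq[symmetric] by (intro tnorm_cong_AE Q L2p_add L2p_cmult u v d)
    also have "\<dots> \<le> tnorm \<T> (Q u) + tnorm \<T> (\<lambda>x. (-1) * Q d x)"
      by (intro tnorm_triangle Q u L2p_cmult d)
    also have "tnorm \<T> (\<lambda>x. (-1) * Q d x) = tnorm \<T> (Q d)" by (subst nrm_cmult) simp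
    finally show ?thesis .
  qed
  have 1: "tnorm \<T> (P v) \<le> tnorm \<T> (P u) + tnorm \<T> d"
    using tri[of P, OF P(1) P_linear[OF u d]] P(2)[OF d] by linarith
  have 2: "tnorm \<T> (D k v) \<le> tnorm \<T> (D k u) + D_bound * tnorm \<T> d" for k
    using tri[of "D k", OF D(1) D_linear[OF u d]] D(2)[OF d, of k] by linarith
  have "energy v \<le> (tnorm \<T> (P u) + tnorm \<T> d) + (\<Sum>k\<in>UNIV. tnorm \<T> (D k u) + D_bound * tnorm \<T> d)"
    unfolding energy_def by (intro add_mono sum_mono 1 2)
  then show ?thesis by (simp add: energy_def sum.distrib d_def algebra_simps)
qed

lemma energy_lower_bound: "\<exists>K\<ge>0. \<forall>u\<in>L2p \<T>. tnorm \<T> u \<le> K * energy u"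
proof -
  have T: "\<T> > 0" by simp
  obtain K where K: "K \<ge> 0" "\<And>F c. finite F \<Longrightarrow> tnorm \<T> (tsum \<T> F c) \<le> K * energy (tsum \<T> F c)"
    using energy_lower_bound_tsum by blast
  \<comment> \<open>The total factor of the approximation error: 1 from the norm of
    \<open>u\<close>, the rest from the Lipschitz constant of the energy.\<close>
  define M where "M = 1 + K * (1 + real CARD('n) * D_bound)"
  have M: "M > 0" unfolding M_def using K(1) D_bound(1) by (intro add_pos_nonneg mult_nonneg_nonneg) auto
  have "tnorm \<T> u \<le> K * energy u" if u: "u \<in> L2p \<T>" for u
  proof (rule field_le_epsilon)
    fix e :: real assume "e > 0"
    then have "e / M > 0" using M by simp
    then obtain F c where F: "finite F" "tnorm \<T> (\<lambda>x. u x - tsum \<T> F c x) < e / M"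
      using tsum_dense[OF T u] by metis
    define v where "v = tsum \<T> F c"
    define d where "d = tnorm \<T> (\<lambda>x. u x - v x)"
    have v: "v \<in> L2p \<T>" by (simp add: v_def tsum_L2p)
    have "tnorm \<T> u \<le> d + tnorm \<T> v"
      using tnorm_triangle[OF L2p_diff[OF u v] v] by (simp add: d_def)
    also have "tnorm \<T> v \<le> K * energy v" unfolding v_def by (rule K(2)[OF F(1)])
    also have "K * energy v \<le> K * (energy u + (1 + real CARD('n) * D_bound) * d)"
      unfolding d_def by (intro mult_left_mono energy_triangle u v K)
    also have "d + K * (energy u + (1 + real CARD('n) * D_bound) * d) = K * energy u + M * d"
      by (simp add: M_def algebra_simps)
    also have "M * d \<le> e" using F(2) M by (simp add: d_def v_def field_simps)
    finally show "tnorm \<T> u \<le> K * energy u + e" by simp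
  qed
  then show ?thesis using K(1) by blast
qed

lemma form_hermitian: "form v u = cnj (form u v)"
proof -
  have H: "pair \<T> (\<lambda>x. of_real (r x) * f x) (\<lambda>x. cnj (g x)) = cnj (pair \<T> (\<lambda>x. of_real (r x) * g x) (\<lambda>x. cnj (f x)))"
    for r :: "real^'n \<Rightarrow> real" and f g
    by (subst cnj_pair, unfold pair_def, intro Bochner_Integration.integral_cong refl) simp
  show ?thesis
    unfolding form_def complex_cnj_add cnj_sum by (intro arg_cong2[where f = "(+)"] sum.cong refl H)
qed

lemma Im_form_self: "u \<in> L2p \<T> \<Longrightarrow> Im (form u u) = 0"
  by (simp add: form_def weighted_pair_self(1)[OF D(1) a_mult(1)[OF D(1)] a_ge]
      weighted_pair_self(1)[OF P(1) b_mult(1)[OF P(1)] b_ge])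

text \<open>The pointwise lower bounds of the coefficients reduce the form to the squared norms of
  \<open>P u\<close> and its derivatives, and these dominate the energy, hence the norm of
  \<open>u\<close>.\<close>

lemma form_lower_bound: "\<exists>c>0. \<forall>u\<in>L2p \<T>. c * (tnorm \<T> u)\<^sup>2 \<le> Re (form u u)"
proof -
  obtain K where K: "K \<ge> 0" "\<And>u. u \<in> L2p \<T> \<Longrightarrow> tnorm \<T> u \<le> K * energy u"
    using energy_lower_bound by blast
  \<comment> \<open>The energy consists of 1 plus dimension many norms, each at most
    \<open>sqrt Q\<close>; \<open>K + 1\<close> replaces \<open>K\<close> so that \<open>N\<close>
    is positive.\<close>
  define N where "N = (K + 1) * (1 + real CARD('n))"
  have N: "N > 0" using K(1) by (simp add: N_def)
  have "C / N\<^sup>2 * (tnorm \<T> u)\<^sup>2 \<le> Re (form u u)" if u: "u \<in> L2p \<T>" for u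
  proof -
    define Q where "Q = (tnorm \<T> (P u))\<^sup>2 + (\<Sum>k\<in>UNIV. (tnorm \<T> (D k u))\<^sup>2)"
    have Q: "Q \<ge> 0" by (auto simp: Q_def intro!: add_nonneg_nonneg sum_nonneg)
    have P': "tnorm \<T> (P u) \<le> sqrt Q"
      by (rule real_le_rsqrt) (auto simp: Q_def intro!: sum_nonneg)
    have D': "tnorm \<T> (D k u) \<le> sqrt Q" for k
    proof (rule real_le_rsqrt)
      have "(tnorm \<T> (D k u))\<^sup>2 \<le> (\<Sum>k\<in>UNIV. (tnorm \<T> (D k u))\<^sup>2)"
        by (rule member_le_sum) auto
      then show "(tnorm \<T> (D k u))\<^sup>2 \<le> Q" by (simp add: Q_def add_increasing)
    qed
    have "energy u \<le> sqrt Q + (\<Sum>k\<in>(UNIV::'n set). sqrt Q)"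
      unfolding energy_def by (intro add_mono sum_mono P' D')
    then have en: "energy u \<le> (1 + real CARD('n)) * sqrt Q" by (simp add: algebra_simps)
    have "tnorm \<T> u \<le> K * energy u" by (rule K(2)[OF u])
    also have "\<dots> \<le> (K + 1) * energy u" using energy_nonneg by (intro mult_right_mono) auto
    also have "\<dots> \<le> (K + 1) * ((1 + real CARD('n)) * sqrt Q)"
      using en K(1) by (intro mult_left_mono) auto
    finally have "tnorm \<T> u \<le> N * sqrt Q" by (simp add: N_def mult.assoc)
    then have "(tnorm \<T> u)\<^sup>2 \<le> (N * sqrt Q)\<^sup>2" by (intro power_mono) auto
    then have "(tnorm \<T> u)\<^sup>2 \<le> N\<^sup>2 * Q" using Q by (simp add: power_mult_distrib)
    then have "C / N\<^sup>2 * (tnorm \<T> u)\<^sup>2 \<le> C / N\<^sup>2 * (N\<^sup>2 * Q)"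
      using C_pos by (intro mult_left_mono) auto
    also have "\<dots> = C * Q" using N by simp
    also have "\<dots> = C * (tnorm \<T> (P u))\<^sup>2 + (\<Sum>k\<in>UNIV. C * (tnorm \<T> (D k u))\<^sup>2)"
      by (simp add: Q_def distrib_left sum_distrib_left)
    also have "\<dots> \<le> Re (pair \<T> (\<lambda>x. of_real (b x) * P u x) (\<lambda>x. cnj (P u x)))
        + (\<Sum>k\<in>UNIV. Re (pair \<T> (\<lambda>x. of_real (a x) * D k u x) (\<lambda>x. cnj (D k u x))))"
      by (intro add_mono sum_mono weighted_pair_self(2) a_mult b_mult a_ge b_ge P D u)
    also have "\<dots> = Re (form u u)" by (simp add: form_def)
    finally show ?thesis .
  qed
  moreover have "C / N\<^sup>2 > 0" using C_pos N by simp
  ultimately show ?thesis by blast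
qed

end

section \<open>Windowed Fourier atoms\<close>

text \<open>A window in the local coordinates of its cube: compactly supported on the whole space
  instead of periodic. The class is closed under partial derivatives.\<close>

definition window_fn :: "nat \<Rightarrow> real^'n \<Rightarrow> (real^'n \<Rightarrow> real) \<Rightarrow> bool" where
  "window_fn K c \<gamma> \<longleftrightarrow> smooth \<gamma> \<and> (\<exists>S. compact S \<and> S \<subseteq> window_cube K c \<and> (\<forall>x. x \<notin> S \<longrightarrow> \<gamma> x = 0))"

definition wave :: "real \<Rightarrow> (real^'n \<Rightarrow> real) \<Rightarrow> int^'n \<Rightarrow> real^'n \<Rightarrow> complex" where
  "wave L \<gamma> k = (\<lambda>x. complex_of_real (\<gamma> x) * expo L k x)"

text \<open>The frequencies belong to the torus of period \<open>L\<close>, so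
  \<open>expo L k\<close> alone is in general not periodic with period \<open>\<T>\<close>.
  Multiplied by the window and then periodized, it becomes a test function on the torus of the
  equation.\<close>

definition atom :: "real \<Rightarrow> (real^'n \<Rightarrow> real) \<Rightarrow> int^'n \<Rightarrow> real^'n \<Rightarrow> complex" where
  "atom L \<gamma> k = periodize \<T> (wave L \<gamma> k)"

definition window_radius :: "nat \<Rightarrow> real^'n \<Rightarrow> real" where
  "window_radius K c = norm c + real CARD('n) * (2 * pi / real K)"

lemma norm_window_cube_le:
  assumes "x \<in> window_cube K c"
  shows "norm x \<le> window_radius K (c :: real^'n)"
proof -
  have "norm (x - c) \<le> (\<Sum>i\<in>UNIV. \<bar>(x - c) $ i\<bar>)" by (rule norm_le_l1_cart)
  also have "\<dots> \<le> (\<Sum>i\<in>(UNIV::'n set). 2 * pi / real K)"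
    using assms by (intro sum_mono) (auto simp: window_cube_def less_imp_le)
  finally have "norm (x - c) \<le> real CARD('n) * (2 * pi / real K)" by simp
  moreover have "norm x \<le> norm c + norm (x - c)" using norm_triangle_sub by blast
  ultimately show ?thesis by (simp add: window_radius_def)
qed

lemma window_fn_smooth: "window_fn K c \<gamma> \<Longrightarrow> smooth \<gamma>"
  by (simp add: window_fn_def)

lemma window_fn_outside: "window_fn K c \<gamma> \<Longrightarrow> x \<notin> window_cube K c \<Longrightarrow> \<gamma> x = 0"
  by (auto simp: window_fn_def)

lemma window_fn_outside_ball: "window_fn K c \<gamma> \<Longrightarrow> norm x > window_radius K c \<Longrightarrow> \<gamma> x = 0"
  using window_fn_outside norm_window_cube_le not_le by blast

lemma window_fn_pderiv:
  assumes "window_fn K c \<gamma>"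
  shows "window_fn K c (pderiv_at i \<gamma>)"
proof -
  obtain S where S: "compact S" "S \<subseteq> window_cube K c" "\<And>x. x \<notin> S \<Longrightarrow> \<gamma> x = 0"
    using assms by (auto simp: window_fn_def)
  have "pderiv_at i \<gamma> x = 0" if "x \<notin> S" for x
  proof -
    have "open (- S)" using S(1) by (simp add: compact_imp_closed open_Compl)
    from pderiv_local[OF this, of x \<gamma> "\<lambda>x. 0"] show ?thesis using S(3) that by (simp add: pderiv_const)
  qed
  then show ?thesis using S smooth_pderiv[OF window_fn_smooth[OF assms]] by (auto simp: window_fn_def)
qed

lemma window_fn_bounded:
  assumes "window_fn K c \<gamma>"
  obtains B where "B \<ge> 0" "\<And>x. \<bar>\<gamma> x\<bar> \<le> B"
proof -
  obtain S where S: "compact S" "S \<subseteq> window_cube K c" "\<And>x. x \<notin> S \<Longrightarrow> \<gamma> x = 0"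
    using assms by (auto simp: window_fn_def)
  have "compact (\<gamma> ` S)"
    by (intro compact_continuous_image S(1) continuous_on_subset[OF smooth_continuous[OF window_fn_smooth[OF assms]]]) auto
  then obtain B where B: "\<And>x. x \<in> S \<Longrightarrow> \<bar>\<gamma> x\<bar> \<le> B"
    using compact_imp_bounded bounded_iff by (metis imageI real_norm_def)
  show ?thesis
  proof (rule that[of "\<bar>B\<bar>"])
    show "\<bar>\<gamma> x\<bar> \<le> \<bar>B\<bar>" for x
      using B[of x] S(3)[of x] by (cases "x \<in> S") auto
  qed simp
qed

lemma window_fn_measurable: "window_fn K c \<gamma> \<Longrightarrow> \<gamma> \<in> borel_measurable lebesgue"
  by (intro smooth_measurable window_fn_smooth)

text \<open>The open cube has side \<open>4 * pi / K\<close>, so it contains at most one point from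
  each orbit of a lattice with at least that period. Both periods in play qualify,
  \<open>\<T>\<close> because \<open>K\<close> is at least 2.\<close>

lemma window_translate_unique:
  assumes "L \<ge> 4 * pi / real K" "x + L *\<^sub>R int_vec m \<in> window_cube K c" "x + L *\<^sub>R int_vec m' \<in> window_cube K c"
  shows "m = m'"
proof -
  have "m $ i = m' $ i" for i
  proof (rule ccontr)
    assume "m $ i \<noteq> m' $ i"
    then have "1 \<le> \<bar>m $ i - m' $ i\<bar>" by linarith
    then have 1: "1 \<le> \<bar>real_of_int (m $ i) - real_of_int (m' $ i)\<bar>"
      by (metis of_int_1_le_iff of_int_abs of_int_diff)
    have "\<bar>x $ i + L * real_of_int (m $ i) - c $ i\<bar> < 2 * pi / real K" "\<bar>x $ i + L * real_of_int (m' $ i) - c $ i\<bar> < 2 * pi / real K"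
      using assms(2,3) by (auto simp: window_cube_def)
    then have "\<bar>L * real_of_int (m $ i) - L * real_of_int (m' $ i)\<bar> < 4 * pi / real K" by linarith
    then have "\<bar>L\<bar> * \<bar>real_of_int (m $ i) - real_of_int (m' $ i)\<bar> < 4 * pi / real K"
      by (simp add: abs_mult flip: right_diff_distrib)
    moreover have "\<bar>L\<bar> * 1 \<le> \<bar>L\<bar> * \<bar>real_of_int (m $ i) - real_of_int (m' $ i)\<bar>"
      using 1 by (intro mult_left_mono) auto
    ultimately show False using assms(1) by linarith
  qed
  then show ?thesis by (simp add: vec_eq_iff)
qed

lemma L2p_integrable:
  assumes "L > 0" "u \<in> L2p L"
  shows "integrable (torus L) u"
  using pair_integrable[OF assms(2) expo_L2p[OF assms(1), of 0]] by simp

text \<open>Unfolding a pairing with a periodization gives an integral over space, the common ground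
  on which functions of the two different periods are compared.\<close>

lemma pair_periodize:
  fixes u \<eta> :: "real^'n \<Rightarrow> complex"
  assumes L: "L > 0" and u: "u \<in> L2p L" and \<eta>: "\<eta> \<in> borel_measurable lebesgue"
    and B: "\<And>x. cmod (\<eta> x) \<le> B" and R: "\<And>x. norm x > R \<Longrightarrow> \<eta> x = 0"
  shows "integrable lebesgue (\<lambda>x. u x * \<eta> x)" "pair L u (periodize L \<eta>) = (\<integral>x. u x * \<eta> x \<partial>lebesgue)"
proof -
  have R': "norm x > R \<Longrightarrow> u x * \<eta> x = 0" for x using R by simp
  show i: "integrable lebesgue (\<lambda>x. u x * \<eta> x)"
  proof (rule integrable_unfold[OF L R'])
    show "(\<lambda>x. u x * \<eta> x) \<in> borel_measurable lebesgue"
      by (intro borel_measurable_times L2p_measurable[OF u] \<eta>)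
    fix m :: "int^'n"
    have eq: "u (y + L *\<^sub>R int_vec m) = u y" for y by (rule periodic_shift[OF L2p_periodic[OF u]])
    show "integrable (torus L) (\<lambda>y. u (y + L *\<^sub>R int_vec m) * \<eta> (y + L *\<^sub>R int_vec m))"
      unfolding eq
    proof (rule Bochner_Integration.integrable_bound)
      show "integrable (torus L) (\<lambda>y. B * cmod (u y))" using L2p_integrable[OF L u] by simp
      show "(\<lambda>y. u y * \<eta> (y + L *\<^sub>R int_vec m)) \<in> borel_measurable (torus L)"
        by (intro measurable_torus borel_measurable_times L2p_measurable[OF u] borel_measurable_translate \<eta>)
      have "cmod (u y) * cmod (\<eta> (y + L *\<^sub>R int_vec m)) \<le> \<bar>B * cmod (u y)\<bar>" for y
      proof -
        have "cmod (u y) * cmod (\<eta> (y + L *\<^sub>R int_vec m)) \<le> cmod (u y) * B" by (intro mult_left_mono B) simp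
        then show ?thesis by (simp add: mult.commute)
      qed
      then show "AE y in torus L. norm (u y * \<eta> (y + L *\<^sub>R int_vec m)) \<le> norm (B * cmod (u y))"
        by (simp add: norm_mult)
    qed
  qed auto
  have "(\<integral>x. u x * \<eta> x \<partial>lebesgue) = (\<integral>y. (\<Sum>\<^sub>\<infinity>m. u (y + L *\<^sub>R int_vec m) * \<eta> (y + L *\<^sub>R int_vec m)) \<partial>torus L)"
    by (rule integral_unfold(2)[OF L R' i]) auto
  also have "\<dots> = pair L u (periodize L \<eta>)"
    unfolding pair_def periodize_def
    by (simp add: periodic_shift[OF L2p_periodic[OF u]] infsum_cmult_right')
  finally show "pair L u (periodize L \<eta>) = (\<integral>x. u x * \<eta> x \<partial>lebesgue)" by simp
qed

lemma cnj_periodize: "cnj (periodize L h x) = periodize L (\<lambda>x. cnj (h x)) x"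
  unfolding periodize_def by (simp add: infsum_cnj)

lemma cnj_wave: "cnj (wave L \<gamma> k x) = wave L \<gamma> (- k) x"
  by (simp add: wave_def cnj_expo)

lemma cnj_atom: "(\<lambda>x. cnj (atom L \<gamma> k x)) = atom L \<gamma> (- k)"
  by (simp add: atom_def cnj_periodize cnj_wave fun_eq_iff)

context
  fixes K :: nat and c :: "real^'n" and L :: real and \<gamma> :: "real^'n \<Rightarrow> real"
  assumes K: "K \<ge> 2" and L_def: "L = 4 * pi / real K" and \<gamma>: "window_fn K c \<gamma>"
begin

lemma window_period_pos: "L > 0"
  using K by (simp add: L_def)

lemma window_period_le: "\<T> \<ge> 4 * pi / real K"
  using K by (simp add: field_simps)

lemma wave_outside: "norm x > window_radius K c \<Longrightarrow> wave L \<gamma> k x = 0"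
  using window_fn_outside_ball[OF \<gamma>] by (simp add: wave_def)

lemma smooth_of_real_window: "smooth (\<lambda>x. complex_of_real (\<gamma> x))"
  by (rule smooth_bounded_linear[OF bounded_linear_of_real window_fn_smooth[OF \<gamma>]])

lemma smooth_wave: "smooth (wave L \<gamma> k)"
  unfolding wave_def by (intro smooth_mult smooth_of_real_window smooth_expo)

lemma pderiv_wave:
  "pderiv_at i (wave L \<gamma> k) = (\<lambda>x. wave L (pderiv_at i \<gamma>) k x + \<i> * complex_of_real (freq L k $ i) * wave L \<gamma> k x)"
proof -
  have "pderiv_at i (\<lambda>x. complex_of_real (\<gamma> x)) = (\<lambda>x. complex_of_real (pderiv_at i \<gamma> x))"
    by (rule pderiv_bounded_linear[OF bounded_linear_of_real window_fn_smooth[OF \<gamma>]])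
  then show ?thesis
    unfolding wave_def
    by (simp add: pderiv_mult[OF smooth_of_real_window smooth_expo] pderiv_expo fun_eq_iff mult_ac add.commute)
qed

lemma atom_tests: "atom L \<gamma> k \<in> tests \<T>"
  unfolding tests_def atom_def
  using smooth_periodize(1)[of \<T> "wave L \<gamma> k" "window_radius K c"] smooth_wave wave_outside
  by (auto simp: periodic_periodize)

lemma pair_atom:
  assumes u: "u \<in> L2p \<T>"
  shows "pair \<T> u (atom L \<gamma> k) = (\<integral>x. u x * wave L \<gamma> k x \<partial>lebesgue)"
proof -
  obtain B where "B \<ge> 0" "\<And>x. \<bar>\<gamma> x\<bar> \<le> B" using window_fn_bounded[OF \<gamma>] by blast
  then show ?thesis unfolding atom_def
    by (intro pair_periodize(2)[where B = B and R = "window_radius K c"] u smooth_measurable smooth_wave wave_outside)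
       (auto simp: wave_def norm_mult)
qed

lemma window_square_integrable:
  assumes u: "u \<in> L2p \<T>"
  shows "integrable lebesgue (\<lambda>x. (\<gamma> x)\<^sup>2 * (cmod (u x))\<^sup>2)"
proof (rule integrable_unfold[of \<T> "window_radius K c"])
  obtain B where B: "B \<ge> 0" "\<And>x. \<bar>\<gamma> x\<bar> \<le> B" using window_fn_bounded[OF \<gamma>] by blast
  have m: "(\<lambda>x. (\<gamma> x)\<^sup>2) \<in> borel_measurable lebesgue" "(\<lambda>x. (cmod (u x))\<^sup>2) \<in> borel_measurable lebesgue"
    using window_fn_measurable[OF \<gamma>] L2p_measurable[OF u] by measurable
  then show "(\<lambda>x. (\<gamma> x)\<^sup>2 * (cmod (u x))\<^sup>2) \<in> borel_measurable lebesgue" by measurable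
  fix m :: "int^'n"
  have eq: "u (y + \<T> *\<^sub>R int_vec m) = u y" for y by (rule periodic_shift[OF L2p_periodic[OF u]])
  show "integrable (torus \<T>) (\<lambda>y. (\<gamma> (y + \<T> *\<^sub>R int_vec m))\<^sup>2 * (cmod (u (y + \<T> *\<^sub>R int_vec m)))\<^sup>2)"
    unfolding eq
  proof (rule Bochner_Integration.integrable_bound)
    show "integrable (torus \<T>) (\<lambda>y. B\<^sup>2 * (cmod (u y))\<^sup>2)"
      using sq_int_integrable[OF L2p_sq_int[OF u]] by simp
    show "(\<lambda>y. (\<gamma> (y + \<T> *\<^sub>R int_vec m))\<^sup>2 * (cmod (u y))\<^sup>2) \<in> borel_measurable (torus \<T>)"
      by (intro measurable_torus borel_measurable_times borel_measurable_translate[OF m(1)] m(2))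
    have "(\<gamma> y)\<^sup>2 \<le> B\<^sup>2" for y using B by (metis abs_le_square_iff abs_of_nonneg)
    then show "AE y in torus \<T>. norm ((\<gamma> (y + \<T> *\<^sub>R int_vec m))\<^sup>2 * (cmod (u y))\<^sup>2) \<le> norm (B\<^sup>2 * (cmod (u y))\<^sup>2)"
      by (intro AE_I2) (simp add: mult_right_mono)
  qed
qed (use window_fn_outside_ball[OF \<gamma>] in auto)

text \<open>Parseval on the torus obtained by gluing opposite faces of the window cube.\<close>

lemma atom_Parseval_window:
  assumes u: "u \<in> L2p \<T>"
  shows "((\<lambda>k. (cmod (pair \<T> u (\<lambda>x. cnj (atom L \<gamma> k x))))\<^sup>2) has_sum
    (L ^ CARD('n) * (\<integral>x. (\<gamma> x)\<^sup>2 * (cmod (u x))\<^sup>2 \<partial>lebesgue))) UNIV"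
proof -
  note L = window_period_pos
  have LK: "L \<ge> 4 * pi / real K" by (simp add: L_def)
  define h where "h x = complex_of_real (\<gamma> x) * u x" for x
  define v where "v = periodize L h"
  have h0: "h x = 0" if "x \<notin> window_cube K c" for x using window_fn_outside[OF \<gamma> that] by (simp add: h_def)
  have hR: "h x = 0" if "norm x > window_radius K c" for x using window_fn_outside_ball[OF \<gamma> that] by (simp add: h_def)
  have hm: "h \<in> borel_measurable lebesgue"
    unfolding h_def by (intro borel_measurable_times smooth_measurable[OF smooth_of_real_window] L2p_measurable[OF u])
  have vm: "v \<in> borel_measurable lebesgue"
  \<comment> \<open>On each ball the periodization is a finite sum of translates, and
    \<open>v\<close> is the pointwise limit of its truncations to balls.\<close>
  proof (rule borel_measurable_LIMSEQ_metric)
    fix N :: nat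
    obtain M where M: "finite M"
      "\<And>h x. (\<And>x. norm x > window_radius K c \<Longrightarrow> h x = 0) \<Longrightarrow> norm x \<le> real N \<Longrightarrow> periodize L h x = (\<Sum>m\<in>M. h (x + L *\<^sub>R int_vec (m :: int^'n)))"
      by (rule periodize_local[OF L]) blast
    have "(\<lambda>x. indicator (cball 0 (real N)) x * v x) = (\<lambda>x. indicator (cball 0 (real N)) x * (\<Sum>m\<in>M. h (x + L *\<^sub>R int_vec m)))"
      using M(2)[of h] hR by (auto simp: fun_eq_iff v_def indicator_def)
    moreover have "(\<lambda>x. indicator (cball 0 (real N)) x * (\<Sum>m\<in>M. h (x + L *\<^sub>R int_vec m))) \<in> borel_measurable lebesgue"
      by (intro borel_measurable_times borel_measurable_sum borel_measurable_translate hm borel_measurable_indicator) auto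
    ultimately show "(\<lambda>x. indicator (cball 0 (real N)) x * v x) \<in> borel_measurable lebesgue" by (simp only:)
  next
    fix x :: "real^'n"
    obtain N0 :: nat where "norm x \<le> real N0" using real_arch_simple by blast
    then have "indicator (cball 0 (real N)) x * v x = v x" if "N \<ge> N0" for N
      using that by (simp add: indicator_def)
    then show "(\<lambda>N. indicator (cball 0 (real N)) x * v x) \<longlonglongrightarrow> v x"
      by (intro tendsto_eventually) (auto simp: eventually_sequentially)
  qed
  \<comment> \<open>At most one translate is nonzero at each point, so the square of the lattice sum
    is the lattice sum of the squares.\<close>
  have v2: "(cmod (v x))\<^sup>2 = (\<Sum>\<^sub>\<infinity>m. (\<gamma> (x + L *\<^sub>R int_vec m))\<^sup>2 * (cmod (u (x + L *\<^sub>R int_vec m)))\<^sup>2)" for x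
  proof -
    obtain m where m: "\<And>k. k \<noteq> m \<Longrightarrow> x + L *\<^sub>R int_vec k \<notin> window_cube K c"
      using window_translate_unique[OF LK, of x] by metis
    have "v x = (\<Sum>\<^sub>\<infinity>k\<in>{m}. h (x + L *\<^sub>R int_vec k))"
      unfolding v_def periodize_def by (rule infsum_cong_neutral) (use m h0 in auto)
    moreover have "(\<Sum>\<^sub>\<infinity>m. (\<gamma> (x + L *\<^sub>R int_vec m))\<^sup>2 * (cmod (u (x + L *\<^sub>R int_vec m)))\<^sup>2)
        = (\<Sum>\<^sub>\<infinity>m\<in>{m}. (\<gamma> (x + L *\<^sub>R int_vec m))\<^sup>2 * (cmod (u (x + L *\<^sub>R int_vec m)))\<^sup>2)"
      by (rule infsum_cong_neutral) (use m window_fn_outside[OF \<gamma>] in auto)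
    ultimately show ?thesis by (simp add: h_def norm_mult power_mult_distrib)
  qed
  have R2: "(\<gamma> x)\<^sup>2 * (cmod (u x))\<^sup>2 = 0" if "norm x > window_radius K c" for x
    using window_fn_outside_ball[OF \<gamma> that] by simp
  note unf = integral_unfold[OF L R2 window_square_integrable[OF u], folded v2]
  have vL: "v \<in> L2p L"
    using vm unf(1) by (simp add: L2p_def v_def periodic_periodize sq_int_def measurable_torus)
  have vn: "(tnorm L v)\<^sup>2 = (\<integral>x. (\<gamma> x)\<^sup>2 * (cmod (u x))\<^sup>2 \<partial>lebesgue)"
    unfolding nrm_square by (rule unf(2)[symmetric])
  \<comment> \<open>The same integral over space is folded with period \<open>\<T>\<close> on the
    left and with period \<open>L\<close> on the right.\<close>
  have coef: "pair \<T> u (\<lambda>x. cnj (atom L \<gamma> k x)) = pair L v (expo L (- k))" for k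
  proof -
    have i: "integrable lebesgue h"
    proof -
      obtain B where B: "B \<ge> 0" "\<And>x. \<bar>\<gamma> x\<bar> \<le> B" using window_fn_bounded[OF \<gamma>] by blast
      have "integrable lebesgue (\<lambda>x. u x * complex_of_real (\<gamma> x))"
        by (rule pair_periodize(1)[of \<T> u _ B "window_radius K c"])
           (use u B window_fn_outside_ball[OF \<gamma>] smooth_measurable[OF smooth_of_real_window] in auto)
      then show ?thesis by (simp add: h_def[abs_def] mult.commute)
    qed
    have i2: "integrable lebesgue (\<lambda>x. h x * expo L (- k) x)"
      by (rule Bochner_Integration.integrable_bound[OF i])
         (auto simp: norm_mult intro!: borel_measurable_times hm borel_measurable_expo)
    have R3: "h x * expo L (- k) x = 0" if "norm x > window_radius K c" for x using hR[OF that] by simp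
    have "pair \<T> u (\<lambda>x. cnj (atom L \<gamma> k x)) = (\<integral>x. h x * expo L (- k) x \<partial>lebesgue)"
      unfolding cnj_atom pair_atom[OF u] by (simp add: h_def wave_def mult_ac)
    also have "\<dots> = (\<integral>y. (\<Sum>\<^sub>\<infinity>m. h (y + L *\<^sub>R int_vec m) * expo L (- k) (y + L *\<^sub>R int_vec m)) \<partial>torus L)"
      by (rule integral_unfold(2)[OF L R3 i2])
    also have "\<dots> = pair L v (expo L (- k))"
      unfolding pair_def v_def periodize_def
      by (simp add: periodic_shift[OF periodic_expo[OF L]] infsum_cmult_left')
    finally show ?thesis .
  qed
  have "((\<lambda>k. (cmod (pair L v (expo L (- k))))\<^sup>2) has_sum (L ^ CARD('n) * (tnorm L v)\<^sup>2)) UNIV"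
    using Parseval[OF L vL] has_sum_reindex_bij_betw[OF bij_uminus_vec, of "\<lambda>m. (cmod (pair L v (expo L m)))\<^sup>2"]
    by simp
  then show ?thesis by (simp only: coef vn)
qed

lemma window_square_integral:
  assumes u: "u \<in> L2p \<T>"
  shows "integrable (torus \<T>) (\<lambda>y. (\<Sum>\<^sub>\<infinity>m. (\<gamma> (y + \<T> *\<^sub>R int_vec m))\<^sup>2) * (cmod (u y))\<^sup>2)"
    "(\<integral>x. (\<gamma> x)\<^sup>2 * (cmod (u x))\<^sup>2 \<partial>lebesgue) = (\<integral>y. (\<Sum>\<^sub>\<infinity>m. (\<gamma> (y + \<T> *\<^sub>R int_vec m))\<^sup>2) * (cmod (u y))\<^sup>2 \<partial>torus \<T>)"
proof -
  have R2: "(\<gamma> x)\<^sup>2 * (cmod (u x))\<^sup>2 = 0" if "norm x > window_radius K c" for x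
    using window_fn_outside_ball[OF \<gamma> that] by simp
  have T: "\<T> > 0" by simp
  note unf = integral_unfold[OF T R2 window_square_integrable[OF u]]
  have eq: "(\<Sum>\<^sub>\<infinity>m. (\<gamma> (y + \<T> *\<^sub>R int_vec m))\<^sup>2 * (cmod (u (y + \<T> *\<^sub>R int_vec m)))\<^sup>2)
      = (\<Sum>\<^sub>\<infinity>m. (\<gamma> (y + \<T> *\<^sub>R int_vec m))\<^sup>2) * (cmod (u y))\<^sup>2" for y
    by (simp only: periodic_shift[OF L2p_periodic[OF u]] infsum_cmult_left')
  show "integrable (torus \<T>) (\<lambda>y. (\<Sum>\<^sub>\<infinity>m. (\<gamma> (y + \<T> *\<^sub>R int_vec m))\<^sup>2) * (cmod (u y))\<^sup>2)"
    using unf(1) unfolding eq .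
  show "(\<integral>x. (\<gamma> x)\<^sup>2 * (cmod (u x))\<^sup>2 \<partial>lebesgue) = (\<integral>y. (\<Sum>\<^sub>\<infinity>m. (\<gamma> (y + \<T> *\<^sub>R int_vec m))\<^sup>2) * (cmod (u y))\<^sup>2 \<partial>torus \<T>)"
    using unf(2) unfolding eq .
qed

text \<open>At most one translate of the window is nonzero at a given point, so the periodized
  square keeps the bound of a single window.\<close>

lemma window_square_integral_le:
  assumes u: "u \<in> L2p \<T>" and B: "\<And>x. \<bar>\<gamma> x\<bar> \<le> B"
  shows "(\<integral>x. (\<gamma> x)\<^sup>2 * (cmod (u x))\<^sup>2 \<partial>lebesgue) \<le> B\<^sup>2 * (tnorm \<T> u)\<^sup>2"
proof -
  have le: "(\<Sum>\<^sub>\<infinity>m. (\<gamma> (y + \<T> *\<^sub>R int_vec m))\<^sup>2) \<le> B\<^sup>2" for y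
  proof -
    obtain m where m: "\<And>k. k \<noteq> m \<Longrightarrow> y + \<T> *\<^sub>R int_vec k \<notin> window_cube K c"
      using window_translate_unique[OF window_period_le, of y] by metis
    have "(\<Sum>\<^sub>\<infinity>m. (\<gamma> (y + \<T> *\<^sub>R int_vec m))\<^sup>2) = (\<Sum>\<^sub>\<infinity>m\<in>{m}. (\<gamma> (y + \<T> *\<^sub>R int_vec m))\<^sup>2)"
      by (rule infsum_cong_neutral) (use m window_fn_outside[OF \<gamma>] in auto)
    also have "\<dots> \<le> B\<^sup>2" using B[of "y + \<T> *\<^sub>R int_vec m"] abs_le_square_iff[of "\<gamma> (y + \<T> *\<^sub>R int_vec m)" B] by auto
    finally show ?thesis .
  qed
  have "(\<integral>x. (\<gamma> x)\<^sup>2 * (cmod (u x))\<^sup>2 \<partial>lebesgue) \<le> (\<integral>y. B\<^sup>2 * (cmod (u y))\<^sup>2 \<partial>torus \<T>)"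
    unfolding window_square_integral(2)[OF u]
    by (intro integral_mono window_square_integral(1)[OF u])
       (use sq_int_integrable[OF L2p_sq_int[OF u]] le in \<open>auto intro: mult_right_mono\<close>)
  then show ?thesis by (simp add: nrm_square)
qed

end

section \<open>The commutator with the Fourier multiplier\<close>

definition FT :: "(real^'n \<Rightarrow> real) \<Rightarrow> real^'n \<Rightarrow> complex" where
  "FT \<gamma> \<zeta> = (\<integral>x. complex_of_real (\<gamma> x) * cis ((- \<zeta>) \<bullet> x) \<partial>lebesgue)"

lemma window_cis_smooth:
  assumes "window_fn K c \<gamma>"
  shows "smooth (\<lambda>x. complex_of_real (\<gamma> x) * cis (\<zeta> \<bullet> x))"
    "norm x > window_radius K c \<Longrightarrow> complex_of_real (\<gamma> x) * cis (\<zeta> \<bullet> x) = 0"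
proof -
  show "smooth (\<lambda>x. complex_of_real (\<gamma> x) * cis (\<zeta> \<bullet> x))"
    by (intro smooth_mult smooth_cis smooth_bounded_linear[OF bounded_linear_of_real] window_fn_smooth[OF assms])
  show "norm x > window_radius K c \<Longrightarrow> complex_of_real (\<gamma> x) * cis (\<zeta> \<bullet> x) = 0"
    using window_fn_outside_ball[OF assms] by simp
qed

lemma FT_pderiv:
  assumes \<gamma>: "window_fn K c \<gamma>"
  shows "FT (pderiv_at i \<gamma>) \<zeta> = \<i> * complex_of_real (\<zeta> $ i) * FT \<gamma> \<zeta>"
proof -
  let ?e = "\<lambda>x. cis ((- \<zeta>) \<bullet> x)"
  have sg: "smooth (\<lambda>x. complex_of_real (\<gamma> x))"
    by (rule smooth_bounded_linear[OF bounded_linear_of_real window_fn_smooth[OF \<gamma>]])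
  have "pderiv_at i (\<lambda>x. complex_of_real (\<gamma> x)) = (\<lambda>x. complex_of_real (pderiv_at i \<gamma> x))"
    by (rule pderiv_bounded_linear[OF bounded_linear_of_real window_fn_smooth[OF \<gamma>]])
  then have eq: "pderiv_at i (\<lambda>x. complex_of_real (\<gamma> x) * ?e x)
      = (\<lambda>x. (- \<i> * complex_of_real (\<zeta> $ i)) * (complex_of_real (\<gamma> x) * ?e x) + complex_of_real (pderiv_at i \<gamma> x) * ?e x)"
    unfolding pderiv_mult[OF sg smooth_cis] pderiv_cis by (simp add: fun_eq_iff mult_ac)
  have i1: "integrable lebesgue (\<lambda>x. complex_of_real (\<gamma> x) * ?e x)"
    by (rule integral_pderiv_compact_support(1)[OF window_cis_smooth[OF \<gamma>]])
  have i2: "integrable lebesgue (\<lambda>x. complex_of_real (pderiv_at i \<gamma> x) * ?e x)"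
    by (rule integral_pderiv_compact_support(1)[OF window_cis_smooth[OF window_fn_pderiv[OF \<gamma>]]])
  have "(\<integral>x. pderiv_at i (\<lambda>x. complex_of_real (\<gamma> x) * ?e x) x \<partial>lebesgue) = 0"
    by (rule integral_pderiv_compact_support(2)[OF window_cis_smooth[OF \<gamma>]])
  then have "(- \<i> * complex_of_real (\<zeta> $ i)) * FT \<gamma> \<zeta> + FT (pderiv_at i \<gamma>) \<zeta> = 0"
    unfolding eq FT_def
    by (subst (asm) Bochner_Integration.integral_add[OF integrable_mult_right[OF i1] i2]) (simp only: integral_mult_right_zero)
  then show ?thesis by (simp add: add_eq_0_iff)
qed

lemma FT_decay_coordinate:
  assumes "window_fn K c \<gamma>"
  shows "\<exists>B. \<forall>\<zeta>. \<bar>\<zeta> $ i\<bar> ^ N * cmod (FT \<gamma> \<zeta>) \<le> B"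
  using assms
proof (induction N arbitrary: \<gamma>)
  case 0
  have "cmod (FT \<gamma> \<zeta>) \<le> (\<integral>x. cmod (complex_of_real (\<gamma> x)) \<partial>lebesgue)" for \<zeta>
  proof -
    have "cmod (FT \<gamma> \<zeta>) \<le> (\<integral>x. cmod (complex_of_real (\<gamma> x) * cis ((- \<zeta>) \<bullet> x)) \<partial>lebesgue)"
      unfolding FT_def by (rule integral_norm_bound)
    then show ?thesis by (simp add: norm_mult)
  qed
  then show ?case by auto
next
  case (Suc N)
  obtain B where B: "\<And>\<zeta>. \<bar>\<zeta> $ i\<bar> ^ N * cmod (FT (pderiv_at i \<gamma>) \<zeta>) \<le> B"
    using Suc.IH[OF window_fn_pderiv[OF Suc.prems]] by blast
  have "\<bar>\<zeta> $ i\<bar> ^ Suc N * cmod (FT \<gamma> \<zeta>) \<le> B" for \<zeta>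
    using B[of \<zeta>] unfolding FT_pderiv[OF Suc.prems] by (simp add: norm_mult mult_ac)
  then show ?case by blast
qed

text \<open>Repeated integration by parts gives decay in each coordinate separately; at every point
  the dominant coordinate, or the trivial bound if all coordinates are at most 1, yields decay in
  all directions.\<close>

lemma FT_decay:
  assumes \<gamma>: "window_fn K c \<gamma>"
  shows "\<exists>B\<ge>0. \<forall>\<zeta>. (1 + (\<Sum>i\<in>UNIV. \<bar>\<zeta> $ i\<bar>)) ^ N * cmod (FT \<gamma> (\<zeta> :: real^'n)) \<le> B"
proof -
  obtain B0 where B0: "\<And>\<zeta>. cmod (FT \<gamma> \<zeta>) \<le> B0"
    using FT_decay_coordinate[OF \<gamma>, of _ 0] by auto
  have "\<forall>i. \<exists>B. \<forall>\<zeta>. \<bar>\<zeta> $ i\<bar> ^ N * cmod (FT \<gamma> \<zeta>) \<le> B"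
    using FT_decay_coordinate[OF \<gamma>] by blast
  then obtain B where B: "\<And>i \<zeta>. \<bar>\<zeta> $ i\<bar> ^ N * cmod (FT \<gamma> \<zeta>) \<le> B i" by metis
  let ?n = "1 + real CARD('n)"
  have "(1 + (\<Sum>i\<in>UNIV. \<bar>\<zeta> $ i\<bar>)) ^ N * cmod (FT \<gamma> \<zeta>) \<le> ?n ^ N * (B0 + (\<Sum>i\<in>UNIV. B i))" for \<zeta> :: "real^'n"
  proof -
    \<comment> \<open>The largest of 1 and the coordinates in modulus; the base of the power is at
      most \<open>?n * m\<close>.\<close>
    define m where "m = Max (insert 1 (range (\<lambda>i. \<bar>\<zeta> $ i\<bar>)))"
    have m: "1 \<le> m" "\<bar>\<zeta> $ i\<bar> \<le> m" for i unfolding m_def by (rule Max_ge; simp)+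
    have min: "m \<in> insert 1 (range (\<lambda>i. \<bar>\<zeta> $ i\<bar>))" unfolding m_def by (rule Max_in) auto
    have "(\<Sum>i\<in>UNIV. \<bar>\<zeta> $ i\<bar>) \<le> (\<Sum>i\<in>(UNIV::'n set). m)" by (intro sum_mono m)
    then have "1 + (\<Sum>i\<in>UNIV. \<bar>\<zeta> $ i\<bar>) \<le> ?n * m" using m(1) by (simp add: distrib_right)
    then have "(1 + (\<Sum>i\<in>UNIV. \<bar>\<zeta> $ i\<bar>)) ^ N \<le> (?n * m) ^ N"
      by (intro power_mono add_nonneg_nonneg sum_nonneg) auto
    then have 1: "(1 + (\<Sum>i\<in>UNIV. \<bar>\<zeta> $ i\<bar>)) ^ N * cmod (FT \<gamma> \<zeta>) \<le> ?n ^ N * (m ^ N * cmod (FT \<gamma> \<zeta>))"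
      using mult_right_mono by (fastforce simp: power_mult_distrib mult.assoc)
    have Bn: "0 \<le> B i" for i by (rule order_trans[OF _ B[of 0 i]]) simp
    have B0n: "0 \<le> B0" by (rule order_trans[OF norm_ge_zero B0[of 0]])
    have "m ^ N * cmod (FT \<gamma> \<zeta>) \<le> B0 + (\<Sum>i\<in>UNIV. B i)"
    proof (cases "m = 1")
      case True
      then show ?thesis using B0[of \<zeta>] sum_nonneg[of UNIV B] Bn by (simp add: add_increasing2)
    next
      case False
      then obtain i where "m = \<bar>\<zeta> $ i\<bar>" using min by auto
      then have "m ^ N * cmod (FT \<gamma> \<zeta>) \<le> B i" using B by simp
      also have "B i \<le> (\<Sum>i\<in>UNIV. B i)" using Bn by (intro member_le_sum) auto
      finally show ?thesis using B0n by simp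
    qed
    then have "?n ^ N * (m ^ N * cmod (FT \<gamma> \<zeta>)) \<le> ?n ^ N * (B0 + (\<Sum>i\<in>UNIV. B i))"
      by (intro mult_left_mono) auto
    with 1 show ?thesis by linarith
  qed
  moreover have "0 \<le> ?n ^ N * (B0 + (\<Sum>i\<in>UNIV. B i))"
    by (rule order_trans[OF _ calculation[of 0]]) simp
  ultimately show ?thesis by blast
qed

section \<open>Summable lattice weights and the Schur test\<close>

text \<open>A product weight, so that sums over boxes of the lattice factor into one-dimensional
  sums.\<close>

definition lattice_weight :: "int^'n \<Rightarrow> real" where
  "lattice_weight l = (\<Prod>i\<in>UNIV. 1 / (1 + \<bar>real_of_int (l $ i)\<bar>)\<^sup>2)"

lemma lattice_weight_nonneg: "lattice_weight l \<ge> 0"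
  by (auto simp: lattice_weight_def intro: prod_nonneg)

lemma sum_int_weight_le: "\<exists>S. \<forall>N::nat. (\<Sum>j\<in>{- int N..int N}. 1 / (1 + \<bar>real_of_int j\<bar>)\<^sup>2) \<le> S"
proof -
  \<comment> \<open>The subtracted term carries the induction: the two new summands are covered by
    twice the telescoping difference of \<open>1 / (1 + N)\<close> and
    \<open>1 / (2 + N)\<close>.\<close>
  have "(\<Sum>j\<in>{- int N..int N}. 1 / (1 + \<bar>real_of_int j\<bar>)\<^sup>2) \<le> 4 - 2 / (1 + real N)" for N
  proof (induction N)
    case (Suc N)
    have "{- int (Suc N)..int (Suc N)} = insert (- int (Suc N)) (insert (int (Suc N)) {- int N..int N})" by auto
    then have "(\<Sum>j\<in>{- int (Suc N)..int (Suc N)}. 1 / (1 + \<bar>real_of_int j\<bar>)\<^sup>2)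
      = 2 * (1 / (2 + real N)\<^sup>2) + (\<Sum>j\<in>{- int N..int N}. 1 / (1 + \<bar>real_of_int j\<bar>)\<^sup>2)"
      by simp
    also have "\<dots> \<le> 2 * (1 / (2 + real N)\<^sup>2) + (4 - 2 / (1 + real N))" using Suc by simp
    also have "\<dots> \<le> 4 - 2 / (1 + real (Suc N))"
    proof -
      have "1 / (2 + real N)\<^sup>2 \<le> 1 / ((1 + real N) * (2 + real N))"
        by (intro divide_left_mono) (auto simp: power2_eq_square mult_right_mono)
      also have "\<dots> = 1 / (1 + real N) - 1 / (2 + real N)" by (simp add: field_simps)
      finally show ?thesis by simp
    qed
    finally show ?case .
  qed simp
  then have "(\<Sum>j\<in>{- int N..int N}. 1 / (1 + \<bar>real_of_int j\<bar>)\<^sup>2) \<le> 4" for N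
    by (rule order_trans) simp
  then show ?thesis by blast
qed

text \<open>Enclose \<open>F\<close> in a box of integer vectors and distribute the product over the
  sum.\<close>

lemma lattice_weight_sum_le: "\<exists>W\<ge>0. \<forall>F. finite F \<longrightarrow> (\<Sum>l\<in>F. lattice_weight (l :: int^'n)) \<le> W"
proof -
  obtain S where S: "\<And>N::nat. (\<Sum>j\<in>{- int N..int N}. 1 / (1 + \<bar>real_of_int j\<bar>)\<^sup>2) \<le> S"
    using sum_int_weight_le by blast
  have S0: "S \<ge> 0" by (rule order_trans[OF _ S[of 0]]) simp
  have "(\<Sum>l\<in>F. lattice_weight l) \<le> S ^ CARD('n)" if F: "finite F" for F :: "(int^'n) set"
  proof -
    define N where "N = Max (insert 0 ((\<lambda>(l, i). nat \<bar>l $ i\<bar>) ` (F \<times> UNIV)))"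
    have N: "nat \<bar>l $ i\<bar> \<le> N" if "l \<in> F" for l i
      unfolding N_def using that F by (intro Max_ge) force+
    let ?A = "PiE (UNIV :: 'n set) (\<lambda>_. {- int N..int N})"
    have inj: "inj_on vec_nth F" by (auto simp: inj_on_def vec_eq_iff fun_eq_iff)
    have sub: "vec_nth ` F \<subseteq> ?A"
    proof
      fix f assume "f \<in> vec_nth ` F"
      then obtain l where l: "l \<in> F" "f = vec_nth l" by blast
      have "\<bar>l $ i\<bar> \<le> int N" for i using N[OF l(1), of i] by linarith
      then show "f \<in> ?A" using l by (auto simp: abs_le_iff minus_le_iff)
    qed
    have "(\<Sum>l\<in>F. lattice_weight l) = (\<Sum>f\<in>vec_nth ` F. \<Prod>i\<in>UNIV. 1 / (1 + \<bar>real_of_int (f i)\<bar>)\<^sup>2)"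
      by (subst sum.reindex[OF inj]) (simp add: lattice_weight_def)
    also have "\<dots> \<le> (\<Sum>f\<in>?A. \<Prod>i\<in>UNIV. 1 / (1 + \<bar>real_of_int (f i)\<bar>)\<^sup>2)"
      by (rule sum_mono2[OF finite_PiE sub]) (auto intro: prod_nonneg)
    also have "\<dots> = (\<Prod>i\<in>(UNIV::'n set). \<Sum>j\<in>{- int N..int N}. 1 / (1 + \<bar>real_of_int j\<bar>)\<^sup>2)"
      by (rule prod_sum_PiE[symmetric]) auto
    also have "\<dots> \<le> (\<Prod>i\<in>(UNIV::'n set). S)"
      by (intro prod_mono conjI sum_nonneg S) auto
    finally show ?thesis by simp
  qed
  then show ?thesis using S0 by (intro exI[of _ "S ^ CARD('n)"]) auto
qed

text \<open>Write \<open>N k m\<close> as a product of two square roots and apply Cauchy-Schwarz: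
  one factor produces the row sum, and exchanging the sums in the other produces the column
  sum.\<close>

lemma Schur_test:
  fixes N :: "'k \<Rightarrow> 'm \<Rightarrow> real"
  assumes N: "\<And>k m. N k m \<ge> 0" and x: "\<And>m. x m \<ge> 0" and W: "W \<ge> 0"
    and rows: "\<And>k. (\<Sum>m\<in>F. N k m) \<le> W" and cols: "\<And>m. (\<Sum>k\<in>G. N k m) \<le> W"
  shows "(\<Sum>k\<in>G. (\<Sum>m\<in>F. N k m * x m)\<^sup>2) \<le> W\<^sup>2 * (\<Sum>m\<in>F. (x m)\<^sup>2)"
proof -
  have "(\<Sum>m\<in>F. N k m * x m)\<^sup>2 \<le> W * (\<Sum>m\<in>F. N k m * (x m)\<^sup>2)" for k
  proof -
    have "(\<Sum>m\<in>F. N k m * x m)\<^sup>2 = (\<Sum>m\<in>F. sqrt (N k m) * (sqrt (N k m) * x m))\<^sup>2"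
      using N by (simp flip: mult.assoc)
    also have "\<dots> \<le> (\<Sum>m\<in>F. (sqrt (N k m))\<^sup>2) * (\<Sum>m\<in>F. (sqrt (N k m) * x m)\<^sup>2)"
      by (rule Cauchy_Schwarz_ineq_sum)
    also have "\<dots> = (\<Sum>m\<in>F. N k m) * (\<Sum>m\<in>F. N k m * (x m)\<^sup>2)"
      using N by (simp add: power_mult_distrib)
    also have "\<dots> \<le> W * (\<Sum>m\<in>F. N k m * (x m)\<^sup>2)"
      using N by (intro mult_right_mono rows sum_nonneg) auto
    finally show ?thesis .
  qed
  then have "(\<Sum>k\<in>G. (\<Sum>m\<in>F. N k m * x m)\<^sup>2) \<le> (\<Sum>k\<in>G. W * (\<Sum>m\<in>F. N k m * (x m)\<^sup>2))"
    by (rule sum_mono)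
  also have "\<dots> = W * (\<Sum>m\<in>F. (\<Sum>k\<in>G. N k m) * (x m)\<^sup>2)"
    by (simp add: sum_distrib_left[symmetric] sum_distrib_right sum.swap[of _ G])
  also have "\<dots> \<le> W * (\<Sum>m\<in>F. W * (x m)\<^sup>2)"
    using W by (intro mult_left_mono sum_mono mult_right_mono cols) auto
  also have "\<dots> = W\<^sup>2 * (\<Sum>m\<in>F. (x m)\<^sup>2)"
    by (simp add: sum_distrib_left power2_eq_square mult.assoc)
  finally show ?thesis .
qed

text \<open>The Japanese bracket is the Euclidean norm of the pair consisting of 1 and the vector,
  so this is the reverse triangle inequality.\<close>

lemma japanese_Lipschitz: "\<bar>japanese x - japanese y\<bar> \<le> norm (x - y)"
proof -
  have j: "japanese x = norm (1::real, x)" for x :: "real^'n" by (simp add: japanese_def norm_Pair)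
  have "\<bar>norm (1::real, x) - norm (1::real, y)\<bar> \<le> norm ((1::real, x) - (1, y))" by (rule norm_triangle_ineq3)
  then show ?thesis by (simp add: j norm_Pair)
qed

section \<open>Kernel estimates for the commutator\<close>

context
  fixes K :: nat and c :: "real^'n" and L :: real and \<gamma> :: "real^'n \<Rightarrow> real"
  assumes K: "K \<ge> 2" and L_def: "L = 4 * pi / real K" and \<gamma>: "window_fn K c \<gamma>"
begin

text \<open>In the Fourier basis the frame coefficients form a matrix that depends only on the
  difference of the two frequencies and decays away from it; this is why an atom is almost an
  eigenvector of \<Lambda>.\<close>

lemma pair_atom_expo: "pair \<T> (expo \<T> m) (\<lambda>x. cnj (atom L \<gamma> k x)) = FT \<gamma> (freq L k - int_vec m)"
proof -
  have f: "freq \<T> m = int_vec m" by (simp add: freq_def)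
  have "pair \<T> (expo \<T> m) (\<lambda>x. cnj (atom L \<gamma> k x)) = (\<integral>x. expo \<T> m x * wave L \<gamma> (- k) x \<partial>lebesgue)"
    unfolding cnj_atom by (rule pair_atom[OF K L_def \<gamma> expo_L2p]) simp
  also have "\<dots> = FT \<gamma> (freq L k - int_vec m)"
    unfolding FT_def
  proof (rule Bochner_Integration.integral_cong[OF refl])
    fix x
    have "expo \<T> m x * expo L (- k) x = cis ((- (freq L k - int_vec m)) \<bullet> x)"
      by (simp add: expo_def cis_mult f freq_minus inner_diff_left)
    then show "expo \<T> m x * wave L \<gamma> (- k) x = complex_of_real (\<gamma> x) * cis ((- (freq L k - int_vec m)) \<bullet> x)"
      by (simp add: wave_def mult.left_commute)
  qed
  finally show ?thesis .
qed

text \<open>The frequency difference is half the integer vector with entries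
  \<open>K * k $ i - 2 * m $ i\<close>, so the decay of the transform can be measured by the lattice
  weight of that vector.\<close>

lemma commutator_kernel_bound:
  "\<exists>B\<ge>0. \<forall>k m. norm (freq L k - int_vec m) * cmod (FT \<gamma> (freq L k - int_vec m))
     \<le> B * lattice_weight (\<chi> i. int K * k $ i - 2 * m $ i)"
proof -
  let ?n = "CARD('n)"
  \<comment> \<open>Twice the dimension many powers pay for the lattice weight; the additional one
    absorbs the factor \<open>norm \<zeta>\<close>.\<close>
  obtain B where B: "B \<ge> 0" "\<And>\<zeta>. (1 + (\<Sum>i\<in>UNIV. \<bar>\<zeta> $ i\<bar>)) ^ (2 * ?n + 1) * cmod (FT \<gamma> \<zeta>) \<le> B"
    using FT_decay[OF \<gamma>] by blast
  have "norm \<zeta> * cmod (FT \<gamma> \<zeta>) \<le> (B * 4 ^ ?n) * lattice_weight l"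
    if \<zeta>: "\<zeta> = freq L k - int_vec m" and l: "l = (\<chi> i. int K * k $ i - 2 * m $ i)" for \<zeta> l k m
  proof -
    define s where "s = 1 + (\<Sum>i\<in>UNIV. \<bar>\<zeta> $ i\<bar>)"
    have s1: "s \<ge> 1" by (auto simp: s_def intro: sum_nonneg)
    have li: "\<bar>real_of_int (l $ i)\<bar> = 2 * \<bar>\<zeta> $ i\<bar>" for i
    proof -
      have "\<zeta> $ i = real K / 2 * real_of_int (k $ i) - real_of_int (m $ i)"
        using K by (simp add: \<zeta> freq_nth L_def)
      then show ?thesis by (simp add: l abs_if)
    qed
    have "(1 + \<bar>real_of_int (l $ i)\<bar>)\<^sup>2 \<le> 4 * s\<^sup>2" for i
    proof -
      define z where "z = \<bar>\<zeta> $ i\<bar>"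
      have "z \<le> (\<Sum>i\<in>UNIV. \<bar>\<zeta> $ i\<bar>)" unfolding z_def by (rule member_le_sum) auto
      then have "z \<le> s - 1" by (simp add: s_def)
      then have "1 + \<bar>real_of_int (l $ i)\<bar> \<le> 2 * s" unfolding li z_def[symmetric] by linarith
      then have "(1 + \<bar>real_of_int (l $ i)\<bar>)\<^sup>2 \<le> (2 * s)\<^sup>2" by (intro power_mono) auto
      then show ?thesis by (simp add: power_mult_distrib)
    qed
    then have "1 / (4 * s\<^sup>2) \<le> 1 / (1 + \<bar>real_of_int (l $ i)\<bar>)\<^sup>2" for i
      using s1 by (intro divide_left_mono) (auto simp: zero_less_mult_iff add_pos_nonneg)
    then have "(\<Prod>i\<in>(UNIV::'n set). 1 / (4 * s\<^sup>2)) \<le> lattice_weight l"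
      unfolding lattice_weight_def by (intro prod_mono) auto
    then have lw: "1 / (4 ^ ?n * s ^ (2 * ?n)) \<le> lattice_weight l"
      by (simp add: power_divide power_mult_distrib power_mult power_one_over)
    have "norm \<zeta> \<le> s" using norm_le_l1_cart[of \<zeta>] by (simp add: s_def)
    then have "norm \<zeta> * cmod (FT \<gamma> \<zeta>) \<le> s * cmod (FT \<gamma> \<zeta>)" by (intro mult_right_mono) auto
    also have "\<dots> = (s ^ (2 * ?n + 1) * cmod (FT \<gamma> \<zeta>)) / s ^ (2 * ?n)" using s1 by simp
    also have "\<dots> \<le> B / s ^ (2 * ?n)" using B(2)[of \<zeta>] s1 by (intro divide_right_mono) (auto simp: s_def[symmetric])
    also have "\<dots> = (B * 4 ^ ?n) * (1 / (4 ^ ?n * s ^ (2 * ?n)))" by simp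
    also have "\<dots> \<le> (B * 4 ^ ?n) * lattice_weight l" using B(1) by (intro mult_left_mono lw) auto
    finally show ?thesis .
  qed
  then show ?thesis using B(1) by (intro exI[of _ "B * 4 ^ ?n"]) auto
qed

text \<open>The commutator has matrix entries given by a difference of Japanese brackets times the
  transform of the window. The Lipschitz bound replaces that difference by the distance of the
  frequencies, and the Schur test concludes, since the lattice weight is summable along rows and
  columns.\<close>

lemma commutator_bound_window:
  "\<exists>B\<ge>0. \<forall>F d G. finite F \<longrightarrow> finite G \<longrightarrow>
      (\<Sum>k\<in>G. (cmod (pair \<T> (tsum \<T> F (\<lambda>m. of_real (japanese (int_vec m)) * d m)) (\<lambda>x. cnj (atom L \<gamma> k x))
              - of_real (japanese (freq L k)) * pair \<T> (tsum \<T> F d) (\<lambda>x. cnj (atom L \<gamma> k x))))\<^sup>2)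
        \<le> B * (tnorm \<T> (tsum \<T> F d))\<^sup>2"
proof -
  have T: "\<T> > 0" by simp
  obtain B where B: "B \<ge> 0" "\<And>k m. norm (freq L k - int_vec m) * cmod (FT \<gamma> (freq L k - int_vec m))
     \<le> B * lattice_weight (\<chi> i. int K * k $ i - 2 * m $ i)"
    using commutator_kernel_bound by blast
  obtain W where W: "W \<ge> 0" "\<And>F. finite F \<Longrightarrow> (\<Sum>l\<in>F. lattice_weight (l :: int^'n)) \<le> W"
    using lattice_weight_sum_le by blast
  define N where "N k m = B * lattice_weight (\<chi> i. int K * k $ i - 2 * m $ i)" for k m :: "int^'n"
  have N0: "N k m \<ge> 0" for k m unfolding N_def by (rule mult_nonneg_nonneg[OF B(1) lattice_weight_nonneg])
  \<comment> \<open>Along a row the integer vector is injective in \<open>m\<close> thanks to the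
    factor 2; along a column it is injective in \<open>k\<close> because \<open>K\<close> is
    nonzero.\<close>
  have rows: "(\<Sum>m\<in>F. N k m) \<le> B * W" if "finite F" for F k
  proof -
    have inj: "inj_on (\<lambda>m. \<chi> i. int K * k $ i - 2 * m $ i) F" by (auto simp: inj_on_def vec_eq_iff)
    have "(\<Sum>m\<in>F. N k m) = B * (\<Sum>l\<in>(\<lambda>m. \<chi> i. int K * k $ i - 2 * m $ i) ` F. lattice_weight l)"
      by (subst sum.reindex[OF inj]) (simp add: N_def sum_distrib_left)
    also have "\<dots> \<le> B * W" using B(1) W(2) that by (intro mult_left_mono) auto
    finally show ?thesis .
  qed
  have cols: "(\<Sum>k\<in>G. N k m) \<le> B * W" if "finite G" for G m
  proof -
    have inj: "inj_on (\<lambda>k. \<chi> i. int K * k $ i - 2 * m $ i) G" using K by (auto simp: inj_on_def vec_eq_iff)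
    have "(\<Sum>k\<in>G. N k m) = B * (\<Sum>l\<in>(\<lambda>k. \<chi> i. int K * k $ i - 2 * m $ i) ` G. lattice_weight l)"
      by (subst sum.reindex[OF inj]) (simp add: N_def sum_distrib_left)
    also have "\<dots> \<le> B * W" using B(1) W(2) that by (intro mult_left_mono) auto
    finally show ?thesis .
  qed
  have "(\<Sum>k\<in>G. (cmod (pair \<T> (tsum \<T> F (\<lambda>m. of_real (japanese (int_vec m)) * d m)) (\<lambda>x. cnj (atom L \<gamma> k x))
              - of_real (japanese (freq L k)) * pair \<T> (tsum \<T> F d) (\<lambda>x. cnj (atom L \<gamma> k x))))\<^sup>2)
        \<le> ((B * W)\<^sup>2 / \<T> ^ CARD('n)) * (tnorm \<T> (tsum \<T> F d))\<^sup>2"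
    if F: "finite F" and G: "finite G" for F G d
  proof -
    have aL: "(\<lambda>x. cnj (atom L \<gamma> k x)) \<in> L2p \<T>" for k
      by (intro L2p_cnj tests_L2p T atom_tests[OF K L_def \<gamma>])
    have ts: "pair \<T> (tsum \<T> F d) (\<lambda>x. cnj (atom L \<gamma> k x)) = (\<Sum>m\<in>F. d m * FT \<gamma> (freq L k - int_vec m))" for k d
      by (subst pair_commute, subst pair_tsum[OF T aL]) (simp add: pair_commute pair_atom_expo[symmetric])
    have "cmod (pair \<T> (tsum \<T> F (\<lambda>m. of_real (japanese (int_vec m)) * d m)) (\<lambda>x. cnj (atom L \<gamma> k x))
              - of_real (japanese (freq L k)) * pair \<T> (tsum \<T> F d) (\<lambda>x. cnj (atom L \<gamma> k x)))
        \<le> (\<Sum>m\<in>F. N k m * cmod (d m))" for k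
    proof -
      have "pair \<T> (tsum \<T> F (\<lambda>m. of_real (japanese (int_vec m)) * d m)) (\<lambda>x. cnj (atom L \<gamma> k x))
              - of_real (japanese (freq L k)) * pair \<T> (tsum \<T> F d) (\<lambda>x. cnj (atom L \<gamma> k x))
        = (\<Sum>m\<in>F. of_real (japanese (int_vec m) - japanese (freq L k)) * FT \<gamma> (freq L k - int_vec m) * d m)"
        unfolding ts sum_distrib_left sum_subtractf[symmetric] by (intro sum.cong refl) (simp add: algebra_simps)
      also have "cmod \<dots> \<le> (\<Sum>m\<in>F. N k m * cmod (d m))"
      proof (rule sum_norm_le)
        fix m
        have "\<bar>japanese (int_vec m) - japanese (freq L k)\<bar> * cmod (FT \<gamma> (freq L k - int_vec m)) \<le> N k m"
        proof (rule order_trans[OF _ B(2)[of k m, folded N_def]])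
          show "\<bar>japanese (int_vec m) - japanese (freq L k)\<bar> * cmod (FT \<gamma> (freq L k - int_vec m))
            \<le> norm (freq L k - int_vec m) * cmod (FT \<gamma> (freq L k - int_vec m))"
            using japanese_Lipschitz[of "int_vec m" "freq L k"] by (intro mult_right_mono) (auto simp: norm_minus_commute)
        qed
        then show "cmod (of_real (japanese (int_vec m) - japanese (freq L k)) * FT \<gamma> (freq L k - int_vec m) * d m) \<le> N k m * cmod (d m)"
          unfolding norm_mult norm_of_real by (intro mult_right_mono) auto
      qed
      finally show ?thesis .
    qed
    then have "(\<Sum>k\<in>G. (cmod (pair \<T> (tsum \<T> F (\<lambda>m. of_real (japanese (int_vec m)) * d m)) (\<lambda>x. cnj (atom L \<gamma> k x))
              - of_real (japanese (freq L k)) * pair \<T> (tsum \<T> F d) (\<lambda>x. cnj (atom L \<gamma> k x))))\<^sup>2)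
      \<le> (\<Sum>k\<in>G. (\<Sum>m\<in>F. N k m * cmod (d m))\<^sup>2)"
      by (intro sum_mono power_mono) auto
    also have "\<dots> \<le> (B * W)\<^sup>2 * (\<Sum>m\<in>F. (cmod (d m))\<^sup>2)"
      by (rule Schur_test) (use N0 rows[OF F] cols[OF G] B(1) W(1) in auto)
    also have "\<dots> = ((B * W)\<^sup>2 / \<T> ^ CARD('n)) * (tnorm \<T> (tsum \<T> F d))\<^sup>2"
      unfolding tsum_norm[OF T F] by simp
    finally show ?thesis .
  qed
  then show ?thesis by (intro exI[of _ "(B * W)\<^sup>2 / \<T> ^ CARD('n)"]) auto
qed

lemma atom_Bessel_window:
  assumes u: "u \<in> L2p \<T>" and B: "\<And>x. \<bar>\<gamma> x\<bar> \<le> B" and F: "finite F"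
  shows "(\<Sum>k\<in>F. (cmod (pair \<T> (atom L \<gamma> k) u))\<^sup>2) \<le> (L ^ CARD('n) * B\<^sup>2) * (tnorm \<T> u)\<^sup>2"
proof -
  have L: "L > 0" by (rule window_period_pos[OF K L_def \<gamma>])
  have uc: "(\<lambda>x. cnj (u x)) \<in> L2p \<T>" by (rule L2p_cnj[OF u])
  have "pair \<T> (atom L \<gamma> k) u = cnj (pair \<T> (\<lambda>x. cnj (u x)) (\<lambda>x. cnj (atom L \<gamma> k x)))" for k
    by (simp add: cnj_pair pair_commute)
  then have "(\<Sum>k\<in>F. (cmod (pair \<T> (atom L \<gamma> k) u))\<^sup>2) = (\<Sum>k\<in>F. (cmod (pair \<T> (\<lambda>x. cnj (u x)) (\<lambda>x. cnj (atom L \<gamma> k x))))\<^sup>2)"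
    by simp
  also have "\<dots> \<le> L ^ CARD('n) * (\<integral>x. (\<gamma> x)\<^sup>2 * (cmod (cnj (u x)))\<^sup>2 \<partial>lebesgue)"
    by (rule finite_sum_le_has_sum[OF atom_Parseval_window[OF K L_def \<gamma> uc] F]) auto
  also have "\<dots> \<le> L ^ CARD('n) * (B\<^sup>2 * (tnorm \<T> (\<lambda>x. cnj (u x)))\<^sup>2)"
    using L by (intro mult_left_mono window_square_integral_le[OF K L_def \<gamma> uc B]) auto
  finally show ?thesis by (simp add: nrm_cnj mult.assoc)
qed

end

text \<open>Differentiating an atom gives the atom of the differentiated window plus the frequency
  times the atom itself. The weight is at most 1, and its square times the squared frequency
  component is at most \<open>1 / \<alpha>\<close>, so both parts reduce to Bessel bounds.\<close>

lemma derivative_bound_window: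
  fixes c :: "real^'n"
  assumes K: "K \<ge> 2" and L_def: "L = 4 * pi / real K" and \<gamma>: "window_fn K c \<gamma>" and \<alpha>: "\<alpha> > 0"
  shows "\<exists>B\<ge>0. \<forall>u\<in>L2p \<T>. \<forall>F. finite F \<longrightarrow>
    (\<Sum>k\<in>F. ((1 + \<alpha> * (norm (freq L k))\<^sup>2) powr (- (1/2)) * cmod (pair \<T> (pderiv_at i (atom L \<gamma> k)) u))\<^sup>2)
      \<le> B * (tnorm \<T> u)\<^sup>2"
proof -
  let ?s = "\<lambda>k. (1 + \<alpha> * (norm (freq L k))\<^sup>2) powr (- (1/2))"
  let ?\<gamma>' = "pderiv_at i \<gamma>"
  note \<gamma>' = window_fn_pderiv[OF \<gamma>, of i]
  have L: "L > 0" by (rule window_period_pos[OF K L_def \<gamma>])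
  obtain B0 where B0: "B0 \<ge> 0" "\<And>x. \<bar>\<gamma> x\<bar> \<le> B0" using window_fn_bounded[OF \<gamma>] by blast
  obtain B1 where B1: "B1 \<ge> 0" "\<And>x. \<bar>?\<gamma>' x\<bar> \<le> B1" using window_fn_bounded[OF \<gamma>'] by blast
  define V where "V = L ^ CARD('n)"
  have V: "V \<ge> 0" using L by (simp add: V_def)
  have s2: "(?s k)\<^sup>2 = 1 / (1 + \<alpha> * (norm (freq L k))\<^sup>2)" for k :: "int^'n"
  proof -
    have p: "1 + \<alpha> * (norm (freq L k))\<^sup>2 > 0" using \<alpha> by (intro add_pos_nonneg) auto
    have "(?s k)\<^sup>2 = (1 + \<alpha> * (norm (freq L k))\<^sup>2) powr (- 1)"
      by (simp add: power2_eq_square powr_add[symmetric])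
    then show ?thesis using p by (simp add: powr_minus_divide)
  qed
  have s_le: "(?s k)\<^sup>2 \<le> 1" and s_freq: "(?s k)\<^sup>2 * (freq L k $ i)\<^sup>2 \<le> 1 / \<alpha>" for k
  proof -
    have p: "1 + \<alpha> * (norm (freq L k))\<^sup>2 > 0" using \<alpha> by (intro add_pos_nonneg) auto
    show "(?s k)\<^sup>2 \<le> 1" unfolding s2 using \<alpha> p by (simp add: divide_le_eq_1_pos)
    have "(freq L k $ i)\<^sup>2 \<le> (norm (freq L k))\<^sup>2"
      using component_le_norm_cart[of "freq L k" i] by (metis abs_le_square_iff abs_norm_cancel)
    then have "\<alpha> * (freq L k $ i)\<^sup>2 \<le> \<alpha> * (norm (freq L k))\<^sup>2" using \<alpha> by simp
    then have "\<alpha> * (freq L k $ i)\<^sup>2 \<le> 1 + \<alpha> * (norm (freq L k))\<^sup>2" by linarith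
    then show "(?s k)\<^sup>2 * (freq L k $ i)\<^sup>2 \<le> 1 / \<alpha>"
      unfolding s2 using \<alpha> p by (simp add: field_simps)
  qed
  have at: "atom L \<gamma> k \<in> L2p \<T>" "atom L ?\<gamma>' k \<in> L2p \<T>" for k
    by (intro tests_L2p atom_tests[OF K L_def \<gamma>] atom_tests[OF K L_def \<gamma>'], simp)+
  have eq: "pderiv_at i (atom L \<gamma> k) = (\<lambda>x. atom L ?\<gamma>' k x + (\<i> * complex_of_real (freq L k $ i)) * atom L \<gamma> k x)" for k
  proof -
    have T: "\<T> > 0" by simp
    have "pderiv_at i (atom L \<gamma> k) = periodize \<T> (pderiv_at i (wave L \<gamma> k))"
      unfolding atom_def by (rule smooth_periodize(2)[OF T smooth_wave[OF K L_def \<gamma>] wave_outside[OF K L_def \<gamma>]])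
    also have "\<dots> = (\<lambda>x. atom L ?\<gamma>' k x + (\<i> * complex_of_real (freq L k $ i)) * atom L \<gamma> k x)"
    proof
      fix x :: "real^'n"
      \<comment> \<open>The same finite set of translates evaluates all three periodizations at
        \<open>x\<close>, which makes the lattice sum additive.\<close>
      obtain M where M: "finite M"
        "\<And>h y. (\<And>x. norm x > window_radius K c \<Longrightarrow> h x = 0) \<Longrightarrow> norm y \<le> norm x \<Longrightarrow> periodize \<T> h y = (\<Sum>m\<in>M. h (y + \<T> *\<^sub>R int_vec (m :: int^'n)))"
        by (rule periodize_local[OF T]) blast
      have "periodize \<T> (pderiv_at i (wave L \<gamma> k)) x = (\<Sum>m\<in>M. pderiv_at i (wave L \<gamma> k) (x + \<T> *\<^sub>R int_vec m))"
        using wave_outside[OF K L_def \<gamma>] wave_outside[OF K L_def \<gamma>']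
        by (intro M(2)) (auto simp: pderiv_wave[OF K L_def \<gamma>])
      moreover have "atom L \<gamma> k x = (\<Sum>m\<in>M. wave L \<gamma> k (x + \<T> *\<^sub>R int_vec m))"
        unfolding atom_def by (intro M(2) wave_outside[OF K L_def \<gamma>]) auto
      moreover have "atom L ?\<gamma>' k x = (\<Sum>m\<in>M. wave L ?\<gamma>' k (x + \<T> *\<^sub>R int_vec m))"
        unfolding atom_def by (intro M(2) wave_outside[OF K L_def \<gamma>']) auto
      ultimately show "periodize \<T> (pderiv_at i (wave L \<gamma> k)) x = atom L ?\<gamma>' k x + (\<i> * complex_of_real (freq L k $ i)) * atom L \<gamma> k x"
        by (simp add: pderiv_wave[OF K L_def \<gamma>] sum.distrib sum_distrib_left)
    qed
    finally show ?thesis .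
  qed
  have "(\<Sum>k\<in>F. (?s k * cmod (pair \<T> (pderiv_at i (atom L \<gamma> k)) u))\<^sup>2) \<le> (2 * (V * B1\<^sup>2) + 2 / \<alpha> * (V * B0\<^sup>2)) * (tnorm \<T> u)\<^sup>2"
    if u: "u \<in> L2p \<T>" and F: "finite F" for u F
  proof -
    have "(?s k * cmod (pair \<T> (pderiv_at i (atom L \<gamma> k)) u))\<^sup>2
      \<le> 2 * (cmod (pair \<T> (atom L ?\<gamma>' k) u))\<^sup>2 + 2 / \<alpha> * (cmod (pair \<T> (atom L \<gamma> k) u))\<^sup>2" for k
    proof -
      let ?x = "cmod (pair \<T> (atom L ?\<gamma>' k) u)" and ?y = "\<bar>freq L k $ i\<bar> * cmod (pair \<T> (atom L \<gamma> k) u)"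
      have "pair \<T> (pderiv_at i (atom L \<gamma> k)) u = pair \<T> (atom L ?\<gamma>' k) u + (\<i> * complex_of_real (freq L k $ i)) * pair \<T> (atom L \<gamma> k) u"
        unfolding eq by (subst pair_add(2)[OF u at(2) L2p_cmult[OF at(1)]]) (simp only: pair_cmult)
      then have "cmod (pair \<T> (pderiv_at i (atom L \<gamma> k)) u) \<le> ?x + ?y"
        using norm_triangle_ineq[of "pair \<T> (atom L ?\<gamma>' k) u" "(\<i> * complex_of_real (freq L k $ i)) * pair \<T> (atom L \<gamma> k) u"]
        by (simp add: norm_mult)
      then have "(cmod (pair \<T> (pderiv_at i (atom L \<gamma> k)) u))\<^sup>2 \<le> (?x + ?y)\<^sup>2" by (intro power_mono) auto
      also have "\<dots> \<le> 2 * ?x\<^sup>2 + 2 * ?y\<^sup>2" using sum_squares_bound[of ?x ?y] by (simp add: power2_sum)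
      finally have "(?s k)\<^sup>2 * (cmod (pair \<T> (pderiv_at i (atom L \<gamma> k)) u))\<^sup>2 \<le> (?s k)\<^sup>2 * (2 * ?x\<^sup>2 + 2 * ?y\<^sup>2)"
        by (intro mult_left_mono) auto
      also have "\<dots> = (?s k)\<^sup>2 * (2 * ?x\<^sup>2) + ((?s k)\<^sup>2 * (freq L k $ i)\<^sup>2) * (2 * (cmod (pair \<T> (atom L \<gamma> k) u))\<^sup>2)"
        by (simp add: power_mult_distrib algebra_simps)
      also have "\<dots> \<le> 1 * (2 * ?x\<^sup>2) + (1 / \<alpha>) * (2 * (cmod (pair \<T> (atom L \<gamma> k) u))\<^sup>2)"
        by (intro add_mono mult_right_mono s_le s_freq) auto
      finally show ?thesis by (simp add: power_mult_distrib)
    qed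
    then have "(\<Sum>k\<in>F. (?s k * cmod (pair \<T> (pderiv_at i (atom L \<gamma> k)) u))\<^sup>2)
      \<le> (\<Sum>k\<in>F. 2 * (cmod (pair \<T> (atom L ?\<gamma>' k) u))\<^sup>2 + 2 / \<alpha> * (cmod (pair \<T> (atom L \<gamma> k) u))\<^sup>2)"
      by (rule sum_mono)
    also have "\<dots> = 2 * (\<Sum>k\<in>F. (cmod (pair \<T> (atom L ?\<gamma>' k) u))\<^sup>2) + 2 / \<alpha> * (\<Sum>k\<in>F. (cmod (pair \<T> (atom L \<gamma> k) u))\<^sup>2)"
      by (simp only: sum.distrib sum_distrib_left)
    also have "\<dots> \<le> 2 * ((V * B1\<^sup>2) * (tnorm \<T> u)\<^sup>2) + 2 / \<alpha> * ((V * B0\<^sup>2) * (tnorm \<T> u)\<^sup>2)"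
      unfolding V_def using \<alpha>
      by (intro add_mono mult_left_mono atom_Bessel_window[OF K L_def \<gamma>' u B1(2) F] atom_Bessel_window[OF K L_def \<gamma> u B0(2) F]) auto
    finally show ?thesis by (simp add: algebra_simps)
  qed
  moreover have "0 \<le> 2 * (V * B1\<^sup>2) + 2 / \<alpha> * (V * B0\<^sup>2)" using V \<alpha> by simp
  ultimately show ?thesis by blast
qed

section \<open>The windowed preconditioner\<close>

lemma has_sum_Times_finite:
  fixes f :: "'j \<Rightarrow> 'k \<Rightarrow> 'b::{topological_comm_monoid_add, t2_space}"
  assumes "finite J" "\<And>j. j \<in> J \<Longrightarrow> (f j has_sum s j) B"
  shows "((\<lambda>(j, k). f j k) has_sum (\<Sum>j\<in>J. s j)) (J \<times> B)"
  using assms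
proof (induction J)
  case (insert j J)
  have inj: "inj_on (Pair j) B" by (auto simp: inj_on_def)
  have "((\<lambda>(j, k). f j k) has_sum s j) (Pair j ` B)"
    using insert.prems[of j] by (subst has_sum_reindex[OF inj]) (simp add: o_def)
  moreover have "((\<lambda>(j, k). f j k) has_sum (\<Sum>j\<in>J. s j)) (J \<times> B)"
    using insert by auto
  ultimately have "((\<lambda>(j, k). f j k) has_sum (s j + (\<Sum>j\<in>J. s j))) (Pair j ` B \<union> J \<times> B)"
    using insert.hyps by (intro has_sum_Un_disjoint) auto
  moreover have "Pair j ` B \<union> J \<times> B = insert j J \<times> B" by auto
  ultimately show ?case using insert.hyps by simp
qed simp

lemma sum_infsum_eq_infsum_Times:
  fixes f :: "'j \<Rightarrow> 'k \<Rightarrow> complex"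
  assumes "finite J" "(\<lambda>(j, k). f j k) summable_on (J \<times> B)"
  shows "(\<Sum>j\<in>J. \<Sum>\<^sub>\<infinity>k\<in>B. f j k) = infsum (\<lambda>(j, k). f j k) (J \<times> B)"
proof -
  have "f j summable_on B" if "j \<in> J" for j
  proof -
    have "(\<lambda>(j, k). f j k) summable_on (Pair j ` B)"
      by (rule summable_on_subset_banach[OF assms(2)]) (use that in auto)
    moreover have "inj_on (Pair j) B" by (auto simp: inj_on_def)
    ultimately show ?thesis by (subst (asm) summable_on_reindex) (auto simp: o_def)
  qed
  then have "((\<lambda>(j, k). f j k) has_sum (\<Sum>j\<in>J. \<Sum>\<^sub>\<infinity>k\<in>B. f j k)) (J \<times> B)"
    by (intro has_sum_Times_finite assms(1) has_sum_infsum)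
  then show ?thesis by (simp add: infsumI)
qed

lemma sum_slices_le:
  fixes f :: "'j \<Rightarrow> 'k \<Rightarrow> real"
  assumes J: "finite J" and F: "finite F" "F \<subseteq> J \<times> UNIV" and f: "\<And>j k. f j k \<ge> 0"
    and le: "\<And>j G. j \<in> J \<Longrightarrow> finite G \<Longrightarrow> (\<Sum>k\<in>G. f j k) \<le> B j"
  shows "(\<Sum>(j, k)\<in>F. f j k) \<le> (\<Sum>j\<in>J. B j)"
proof -
  have "(\<Sum>(j, k)\<in>F. f j k) \<le> (\<Sum>(j, k)\<in>J \<times> snd ` F. f j k)"
    by (rule sum_mono2) (use J F f in \<open>auto simp: subset_iff image_iff, force\<close>)
  also have "\<dots> = (\<Sum>j\<in>J. \<Sum>k\<in>snd ` F. f j k)" by (simp add: sum.cartesian_product)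
  also have "\<dots> \<le> (\<Sum>j\<in>J. B j)" using F by (intro sum_mono le) auto
  finally show ?thesis .
qed

lemma AE_lebesgue_if_AE_torus:
  assumes "L > 0" "f \<in> L2p L" "g \<in> L2p L" "AE x in torus L. f x = g x"
  shows "AE x in lebesgue. f x = g x"
  by (rule AE_periodic[OF assms(1) _ assms(4)])
     (use L2p_periodic[OF assms(2)] L2p_periodic[OF assms(3)] in \<open>simp add: periodic_def\<close>)

lemma bounded_L2_operatorI:
  fixes S :: "(real^'n \<Rightarrow> complex) \<Rightarrow> real^'n \<Rightarrow> complex"
  assumes SL: "\<And>u. u \<in> L2p \<T> \<Longrightarrow> S u \<in> L2p \<T>"
    and lin: "\<And>u v c. u \<in> L2p \<T> \<Longrightarrow> v \<in> L2p \<T> \<Longrightarrow> AE x in torus \<T>. S (\<lambda>y. u y + c * v y) x = S u x + c * S v x"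
    and bdd: "\<And>u. u \<in> L2p \<T> \<Longrightarrow> tnorm \<T> (S u) \<le> M * tnorm \<T> u"
  shows "bounded_L2_operator S"
  unfolding bounded_L2_operator_def L2_eq_L2p l2_norm_eq
proof (intro conjI ballI allI exI[of _ M] SL bdd)
  fix u v :: "real^'n \<Rightarrow> complex" and c d assume u: "u \<in> L2p \<T>" and v: "v \<in> L2p \<T>"
  \<comment> \<open>The hypothesis covers combinations in which the first function has factor 1; the
    general combination starts from the zero function, whose image vanishes almost everywhere by the
    norm bound.\<close>
  have z: "AE x in torus \<T>. S (\<lambda>x. 0) x = 0"
  proof -
    have "tnorm \<T> (S (\<lambda>x. 0)) \<le> M * tnorm \<T> (\<lambda>x :: real^'n. 0)" by (rule bdd) simp
    then have "tnorm \<T> (S (\<lambda>x. 0)) = 0" by (simp add: nrm_def order_antisym)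
    then show ?thesis using nrm_eq_0_iff[OF L2p_sq_int[OF SL]] by simp
  qed
  have "AE x in torus \<T>. S (\<lambda>y. c * u y) x = S (\<lambda>x. 0) x + c * S u x"
    using lin[of "\<lambda>x. 0" u c] u by simp
  moreover have "AE x in torus \<T>. S (\<lambda>y. c * u y + d * v y) x = S (\<lambda>y. c * u y) x + d * S v x"
    by (rule lin[OF L2p_cmult[OF u] v])
  ultimately have "AE x in torus \<T>. S (\<lambda>y. c * u y + d * v y) x = c * S u x + d * S v x"
    using z by eventually_elim simp
  then show "AE x in lebesgue. S (\<lambda>y. c * u y + d * v y) x = c * S u x + d * S v x"
    by (intro AE_lebesgue_if_AE_torus[of \<T>] SL L2p_add L2p_cmult u v) auto
qed

section \<open>Representatives of distributions\<close>

text \<open>Exponentials are test functions, so two representing functions have equal Fourier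
  coefficients and the arbitrary choice in \<open>L2_rep\<close> is harmless up to null
  sets.\<close>

lemma represents_L2_rep:
  fixes f :: "real^'n \<Rightarrow> complex"
  assumes "represents f \<psi>"
  shows "represents (L2_rep \<psi>) \<psi>" "AE x in torus \<T>. L2_rep \<psi> x = f x"
proof -
  show r: "represents (L2_rep \<psi>) \<psi>" unfolding L2_rep_def by (rule someI[where P = "\<lambda>f. represents f \<psi>", OF assms])
  show "AE x in torus \<T>. L2_rep \<psi> x = f x"
  proof (rule Fourier_unique)
    show "L2_rep \<psi> \<in> L2p \<T>" "f \<in> L2p \<T>" using r assms by (auto simp: represents_def L2_eq_L2p)
    fix m :: "int^'n"
    have "expo \<T> m \<in> tests \<T>" by (rule tests_expo) simp
    then have "dist_of \<T> (L2_rep \<psi>) (expo \<T> m) = dist_of \<T> f (expo \<T> m)"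
      using r assms by (auto simp: represents_def)
    then show "pair \<T> (L2_rep \<psi>) (expo \<T> m) = pair \<T> f (expo \<T> m)"
      by (simp add: dist_of_def pair_def integral_torus)
  qed simp
qed

lemma dist_of_eq_pair: "dist_of L f \<phi> = pair L f \<phi>"
  by (simp add: dist_of_def pair_def integral_torus)

lemma periodic_distributionI:
  fixes \<psi> :: "'n::finite functional"
  assumes "\<And>\<phi> \<eta> c d. \<phi> \<in> tests L \<Longrightarrow> \<eta> \<in> tests L \<Longrightarrow> \<psi> (\<lambda>x. c * \<phi> x + d * \<eta> x) = c * \<psi> \<phi> + d * \<psi> \<eta>"
    and "\<And>\<phi> M. \<phi> \<in> tests L \<Longrightarrow> (\<And>ds x. length ds \<le> N \<Longrightarrow> cmod (iter_pderiv ds \<phi> x) \<le> M) \<Longrightarrow> cmod (\<psi> \<phi>) \<le> B * M"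
  shows "periodic_distribution L \<psi>"
  unfolding periodic_distribution_def using assms by blast

text \<open>The functionals of the problem are identified with simpler ones on test functions only,
  and nothing is known about their values elsewhere.\<close>

lemma periodic_distribution_cong:
  assumes "\<And>\<phi>. \<phi> \<in> tests L \<Longrightarrow> \<psi> \<phi> = \<psi>' \<phi>" "periodic_distribution L \<psi>'"
  shows "periodic_distribution L \<psi>"
proof -
  obtain N B where lin: "\<forall>\<phi>\<in>tests L. \<forall>\<eta>\<in>tests L. \<forall>c d. \<psi>' (\<lambda>x. c * \<phi> x + d * \<eta> x) = c * \<psi>' \<phi> + d * \<psi>' \<eta>"
    and bound: "\<forall>\<phi>\<in>tests L. \<forall>M. (\<forall>ds x. length ds \<le> N \<longrightarrow> cmod (iter_pderiv ds \<phi> x) \<le> M) \<longrightarrow> cmod (\<psi>' \<phi>) \<le> B * M"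
    using assms(2) unfolding periodic_distribution_def by blast
  show ?thesis
  proof (rule periodic_distributionI[where N = N and B = B])
    fix \<phi> \<eta> :: "real^'a \<Rightarrow> complex" and c d assume t: "\<phi> \<in> tests L" "\<eta> \<in> tests L"
    then have "(\<lambda>x. c * \<phi> x + d * \<eta> x) \<in> tests L" by (intro tests_add tests_cmult)
    then show "\<psi> (\<lambda>x. c * \<phi> x + d * \<eta> x) = c * \<psi> \<phi> + d * \<psi> \<eta>"
      using lin t by (simp only: assms(1))
  next
    fix \<phi> :: "real^'a \<Rightarrow> complex" and M
    assume t: "\<phi> \<in> tests L" and "\<And>ds x. length ds \<le> N \<Longrightarrow> cmod (iter_pderiv ds \<phi> x) \<le> M"
    then show "cmod (\<psi> \<phi>) \<le> B * M" using bound by (simp add: assms(1))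
  qed
qed

lemma fourier_coeff_eq: "fourier_coeff L \<psi> m = \<psi> (expo L (- m)) / of_real (L ^ CARD('n))"
  for m :: "int^'n"
  by (simp add: fourier_coeff_def expo_def[abs_def] freq_minus)

lemma tnorm_tests_le:
  assumes "\<phi> \<in> tests \<T>" "\<And>x. cmod (\<phi> x) \<le> M"
  shows "tnorm \<T> (\<phi> :: real^'n \<Rightarrow> complex) \<le> sqrt (\<T> ^ CARD('n)) * M"
proof -
  have "M \<ge> 0" by (rule order_trans[OF norm_ge_zero assms(2)[of 0]])
  moreover have "tnorm \<T> \<phi> \<le> \<bar>M\<bar> * sqrt (\<T> ^ CARD('n))"
    by (rule L2p_bounded(2)[OF _ tests_periodic[OF assms(1)] smooth_measurable[OF tests_smooth[OF assms(1)]] assms(2)]) simp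
  ultimately show ?thesis by (simp add: mult.commute)
qed

section \<open>The frame formed by all windows\<close>

locale windowed_problem =
  fixes K :: nat
    and a b :: "real^'n::finite \<Rightarrow> real"
    and C C\<^sub>0 :: real
    and x :: "nat \<Rightarrow> real^'n"
    and g :: "nat \<Rightarrow> real^'n \<Rightarrow> real"
  assumes K: "K \<ge> 2"
    and a: "periodic \<T> a" "a \<in> borel_measurable lebesgue" "bounded (range a)"
    and b: "periodic \<T> b" "b \<in> borel_measurable lebesgue" "bounded (range b)"
    and C: "C > 0" "\<And>y. a y \<ge> C"
    and C\<^sub>0: "C\<^sub>0 > 0" "\<And>y. b y \<ge> C\<^sub>0"
    and g: "window_functions K x g"
begin

definition L :: real where "L = 4 * pi / real K"
definition \<gamma> :: "nat \<Rightarrow> real^'n \<Rightarrow> real" where "\<gamma> j = local_window K (x j) (g j)"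
definition J :: "nat set" where "J = {1..K ^ CARD('n)}"
definition p :: "nat \<times> (int^'n) \<Rightarrow> real^'n \<Rightarrow> complex" where "p i = atom L (\<gamma> (fst i)) (snd i)"
definition \<sigma> :: "nat \<times> (int^'n) \<Rightarrow> real" where
  "\<sigma> i = (1 + a (x (fst i)) * (norm (freq L (snd i)))\<^sup>2) powr (- (1/2))"
definition w :: "nat \<times> (int^'n) \<Rightarrow> real" where "w i = japanese (freq L (snd i))"
definition A :: real where "A = (SOME A. \<forall>y. \<bar>a y\<bar> \<le> A \<and> \<bar>b y\<bar> \<le> A)"

lemma A: "\<bar>a y\<bar> \<le> A" "\<bar>b y\<bar> \<le> A"
proof -
  obtain A1 A2 where "\<forall>y. \<bar>a y\<bar> \<le> A1" "\<forall>y. \<bar>b y\<bar> \<le> A2"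
    using a(3) b(3) by (auto simp: bounded_iff)
  then have "\<exists>A. \<forall>y. \<bar>a y\<bar> \<le> A \<and> \<bar>b y\<bar> \<le> A"
    by (intro exI[of _ "max A1 A2"]) (auto simp: le_max_iff_disj)
  from someI_ex[OF this] show "\<bar>a y\<bar> \<le> A" "\<bar>b y\<bar> \<le> A" unfolding A_def[symmetric] by auto
qed

lemma L_pos: "L > 0"
  using K by (simp add: L_def)

lemma finite_J: "finite J"
  by (simp add: J_def)

lemma window_props:
  assumes "j \<in> J"
  shows "periodic \<T> (g j)" "smooth (g j)"
    "\<exists>S. compact S \<and> S \<subseteq> window_cube K (x j) \<and> closure {y. g j y \<noteq> 0} = {s + \<T> *\<^sub>R int_vec m | s m. s \<in> S}"
  using g assms by (auto simp: window_functions_def J_def)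

lemma sum_g_square: "(\<Sum>j\<in>J. (g j y)\<^sup>2) = 1"
  using g by (simp add: window_functions_def J_def)

lemma period_le: "\<T> \<ge> 4 * pi / real K"
  using K by (simp add: field_simps)

text \<open>Cutting \<open>g j\<close> off at the cube creates no jump: the open cube and the
  complement of the compact set \<open>S\<close> inside it cover space, with \<gamma> equal to
  \<open>g j\<close> on the first and zero on the second.\<close>

lemma window_fn_\<gamma>:
  assumes j: "j \<in> J"
  shows "window_fn K (x j) (\<gamma> j)"
proof -
  obtain S where S: "compact S" "S \<subseteq> window_cube K (x j)" "closure {y. g j y \<noteq> 0} = {s + \<T> *\<^sub>R int_vec m | s m. s \<in> S}"
    using window_props(3)[OF j] by blast
  \<comment> \<open>A point of the cube where \<open>g j\<close> is nonzero lies in some translate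
    of \<open>S\<close>; that translate is \<open>S\<close> itself, as the cube contains only one
    point of each orbit.\<close>
  have out: "\<gamma> j y = 0" if "y \<notin> S" for y
  proof (rule ccontr)
    assume "\<gamma> j y \<noteq> 0"
    then have y: "y \<in> window_cube K (x j)" "g j y \<noteq> 0" by (auto simp: \<gamma>_def local_window_def split: if_splits)
    then have "y \<in> closure {y. g j y \<noteq> 0}" by (intro subsetD[OF closure_subset]) simp
    then obtain s m where s: "s \<in> S" "y = s + \<T> *\<^sub>R int_vec m" using S(3) by auto
    have "0 = m"
      by (rule window_translate_unique[OF period_le, of s]) (use s y S(2) in auto)
    then show False using s that by auto
  qed
  have "smooth (\<gamma> j)"
  proof (rule smooth_local)
    fix y
    show "\<exists>U f. open U \<and> y \<in> U \<and> smooth f \<and> (\<forall>z\<in>U. \<gamma> j z = f z)"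
    proof (cases "y \<in> window_cube K (x j)")
      case True
      have eq: "window_cube K (x j) = (\<Inter>i. {z. \<bar>z $ i - x j $ i\<bar> < 2 * pi / real K})"
        by (auto simp: window_cube_def)
      have "open (window_cube K (x j))"
        unfolding eq by (intro open_INT ballI open_Collect_less continuous_intros) auto
      then show ?thesis
        using True window_props(2)[OF j]
        by (intro exI[of _ "window_cube K (x j)"] exI[of _ "g j"]) (auto simp: \<gamma>_def local_window_def)
    next
      case False
      then show ?thesis
        using S(1,2) out
        by (intro exI[of _ "- S"] exI[of _ "\<lambda>z. 0"]) (auto simp: smooth_const compact_imp_closed open_Compl)
    qed
  qed
  then show ?thesis using S(1,2) out by (auto simp: window_fn_def)
qed

text \<open>Either exactly one translate of \<open>y\<close> lies in the cube, and periodicity gives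
  the value of \<open>g j\<close> there, or none does and \<open>g j\<close> vanishes by the support
  condition. This is how the partition of unity enters Parseval.\<close>

lemma periodized_\<gamma>_square:
  assumes j: "j \<in> J"
  shows "(\<Sum>\<^sub>\<infinity>m. (\<gamma> j (y + \<T> *\<^sub>R int_vec m))\<^sup>2) = (g j y)\<^sup>2"
proof (cases "\<exists>m. y + \<T> *\<^sub>R int_vec m \<in> window_cube K (x j)")
  case True
  then obtain m where m: "y + \<T> *\<^sub>R int_vec m \<in> window_cube K (x j)" by blast
  then have "y + \<T> *\<^sub>R int_vec k \<notin> window_cube K (x j)" if "k \<noteq> m" for k
    using window_translate_unique[OF period_le, of y] that by metis
  then have "(\<Sum>\<^sub>\<infinity>m. (\<gamma> j (y + \<T> *\<^sub>R int_vec m))\<^sup>2) = (\<Sum>\<^sub>\<infinity>m\<in>{m}. (\<gamma> j (y + \<T> *\<^sub>R int_vec m))\<^sup>2)"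
    by (intro infsum_cong_neutral) (auto simp: \<gamma>_def local_window_def)
  also have "\<dots> = (g j (y + \<T> *\<^sub>R int_vec m))\<^sup>2" using m by (simp add: \<gamma>_def local_window_def)
  also have "\<dots> = (g j y)\<^sup>2" using periodic_shift[OF window_props(1)[OF j]] by simp
  finally show ?thesis .
next
  case False
  obtain S where S: "compact S" "S \<subseteq> window_cube K (x j)" "closure {y. g j y \<noteq> 0} = {s + \<T> *\<^sub>R int_vec m | s m. s \<in> S}"
    using window_props(3)[OF j] by blast
  have "g j y = 0"
  proof (rule ccontr)
    assume "g j y \<noteq> 0"
    then have "y \<in> closure {y. g j y \<noteq> 0}" by (intro subsetD[OF closure_subset]) simp
    then obtain s m where "s \<in> S" "y = s + \<T> *\<^sub>R int_vec m" using S(3) by auto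
    then have "y + \<T> *\<^sub>R int_vec (- m) \<in> window_cube K (x j)" using S(2) by (auto simp: int_vec_minus)
    then show False using False by blast
  qed
  moreover have "(\<gamma> j (y + \<T> *\<^sub>R int_vec m))\<^sup>2 = 0" for m using False by (simp add: \<gamma>_def local_window_def)
  ultimately show ?thesis by simp
qed

text \<open>Sum the Parseval identities of the single windows: each contributes the volume of its
  cube times a windowed norm, and the squared windows add up to 1. Hence the frame constant is the
  inverse of that volume.\<close>

lemma frame_parseval:
  assumes u: "u \<in> L2p \<T>"
  shows "((\<lambda>i. (cmod (pair \<T> u (\<lambda>y. cnj (p i y))))\<^sup>2) has_sum (tnorm \<T> u)\<^sup>2 / (1 / L ^ CARD('n))) (J \<times> UNIV)"
proof -
  have "((\<lambda>(j, k). (cmod (pair \<T> u (\<lambda>y. cnj (atom L (\<gamma> j) k y))))\<^sup>2) has_sum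
      (\<Sum>j\<in>J. L ^ CARD('n) * (\<integral>y. (\<gamma> j y)\<^sup>2 * (cmod (u y))\<^sup>2 \<partial>lebesgue))) (J \<times> UNIV)"
    by (intro has_sum_Times_finite finite_J atom_Parseval_window[OF K L_def window_fn_\<gamma> u])
  moreover have "(\<Sum>j\<in>J. L ^ CARD('n) * (\<integral>y. (\<gamma> j y)\<^sup>2 * (cmod (u y))\<^sup>2 \<partial>lebesgue)) = L ^ CARD('n) * (tnorm \<T> u)\<^sup>2"
  proof -
    have i: "integrable (torus \<T>) (\<lambda>y. (g j y)\<^sup>2 * (cmod (u y))\<^sup>2)" if "j \<in> J" for j
      using window_square_integral(1)[OF K L_def window_fn_\<gamma>[OF that] u] by (simp add: periodized_\<gamma>_square[OF that])
    have "(\<Sum>j\<in>J. (\<integral>y. (\<gamma> j y)\<^sup>2 * (cmod (u y))\<^sup>2 \<partial>lebesgue)) = (\<Sum>j\<in>J. (\<integral>y. (g j y)\<^sup>2 * (cmod (u y))\<^sup>2 \<partial>torus \<T>))"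
      by (intro sum.cong refl) (simp add: window_square_integral(2)[OF K L_def window_fn_\<gamma> u] periodized_\<gamma>_square)
    also have "\<dots> = (\<integral>y. (\<Sum>j\<in>J. (g j y)\<^sup>2 * (cmod (u y))\<^sup>2) \<partial>torus \<T>)"
      by (rule Bochner_Integration.integral_sum[symmetric]) (rule i)
    also have "\<dots> = (tnorm \<T> u)\<^sup>2"
      by (simp add: sum_distrib_right[symmetric] sum_g_square nrm_square)
    finally show ?thesis by (simp add: sum_distrib_left[symmetric])
  qed
  ultimately show ?thesis by (simp add: p_def case_prod_unfold mult.commute)
qed

lemma symbol_base: "1 + a (x j) * (norm (freq L k))\<^sup>2 \<ge> 1"
  using C(1) C(2)[of "x j"] by simp

lemma \<sigma>_bounds: "\<sigma> i > 0" "\<sigma> i \<le> 1"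
proof -
  note s = symbol_base[of "fst i" "snd i"]
  show "\<sigma> i > 0" using s by (simp add: \<sigma>_def)
  show "\<sigma> i \<le> 1" using powr_mono[of "- (1/2)" 0 "1 + a (x (fst i)) * (norm (freq L (snd i)))\<^sup>2"] s by (simp add: \<sigma>_def)
qed

lemma \<sigma>_w_bound: "\<exists>c>0. \<forall>i\<in>J \<times> UNIV. c \<le> \<sigma> i * w i"
\<comment> \<open>With \<open>a \<le> A\<close>, the expression under the root in
  \<open>\<sigma>\<close> is at most \<open>1 + A\<close> times the squared Japanese bracket
  \<open>w\<close>.\<close>
proof (intro exI[of _ "1 / sqrt (1 + A)"] conjI ballI)
  have A0: "A \<ge> 0" by (rule order_trans[OF abs_ge_zero A(1)[of 0]])
  then show "0 < 1 / sqrt (1 + A)" by simp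
  fix i :: "nat \<times> (int^'n)"
  let ?n = "(norm (freq L (snd i)))\<^sup>2"
  note s = symbol_base[of "fst i" "snd i"]
  have "a (x (fst i)) \<le> A" using A(1)[of "x (fst i)"] by linarith
  then have "a (x (fst i)) * ?n \<le> A * ?n" by (rule mult_right_mono) simp
  then have le: "1 + a (x (fst i)) * ?n \<le> (1 + A) * (1 + ?n)" using A0 by (simp add: algebra_simps add_increasing)
  have "\<sigma> i = 1 / sqrt (1 + a (x (fst i)) * ?n)"
    using s by (simp add: \<sigma>_def powr_minus_divide powr_half_sqrt)
  also have "\<dots> \<ge> 1 / sqrt ((1 + A) * (1 + ?n))"
    using s le A0 by (intro divide_left_mono) (auto simp: zero_less_mult_iff add_pos_nonneg)
  finally have "1 / sqrt ((1 + A) * (1 + ?n)) * w i \<le> \<sigma> i * w i"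
    by (intro mult_right_mono) (auto simp: w_def japanese_def)
  moreover have "1 / sqrt ((1 + A) * (1 + ?n)) * w i = 1 / sqrt (1 + A)"
  proof -
    have "sqrt (1 + ?n) > 0" by (simp add: add_pos_nonneg)
    then show ?thesis by (simp add: w_def japanese_def real_sqrt_mult)
  qed
  ultimately show "1 / sqrt (1 + A) \<le> \<sigma> i * w i" by simp
qed

lemma frame_derivative_bound: "\<exists>B\<ge>0. \<forall>k. \<forall>u\<in>L2p \<T>. \<forall>F. finite F \<longrightarrow> F \<subseteq> J \<times> UNIV \<longrightarrow>
    (\<Sum>i\<in>F. (\<sigma> i * cmod (pair \<T> (pderiv_at k (p i)) u))\<^sup>2) \<le> B * (tnorm \<T> u)\<^sup>2"
proof -
  have "\<forall>j\<in>J. \<forall>l. \<exists>B\<ge>0. \<forall>u\<in>L2p \<T>. \<forall>F. finite F \<longrightarrow>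
    (\<Sum>k\<in>F. ((1 + a (x j) * (norm (freq L k))\<^sup>2) powr (- (1/2)) * cmod (pair \<T> (pderiv_at l (atom L (\<gamma> j) k)) u))\<^sup>2)
      \<le> B * (tnorm \<T> u)\<^sup>2"
  proof (intro ballI allI)
    fix j l assume j: "j \<in> J"
    have "a (x j) > 0" using C(1) C(2)[of "x j"] by linarith
    from derivative_bound_window[OF K L_def window_fn_\<gamma>[OF j] this]
    show "\<exists>B\<ge>0. \<forall>u\<in>L2p \<T>. \<forall>F. finite F \<longrightarrow>
      (\<Sum>k\<in>F. ((1 + a (x j) * (norm (freq L k))\<^sup>2) powr (- (1/2)) * cmod (pair \<T> (pderiv_at l (atom L (\<gamma> j) k)) u))\<^sup>2)
        \<le> B * (tnorm \<T> u)\<^sup>2" .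
  qed
  from bchoice[OF this[unfolded choice_iff]]
  obtain B where B: "\<forall>j\<in>J. \<forall>l. 0 \<le> B j l \<and> (\<forall>u\<in>L2p \<T>. \<forall>F. finite F \<longrightarrow>
    (\<Sum>k\<in>F. ((1 + a (x j) * (norm (freq L k))\<^sup>2) powr (- (1/2)) * cmod (pair \<T> (pderiv_at l (atom L (\<gamma> j) k)) u))\<^sup>2)
      \<le> B j l * (tnorm \<T> u)\<^sup>2)" by blast
  \<comment> \<open>Adding the finitely many constants over windows and directions gives one that
    serves all of them.\<close>
  define B' where "B' = (\<Sum>l\<in>UNIV. \<Sum>j\<in>J. B j l)"
  have B0: "B' \<ge> 0" unfolding B'_def using B by (intro sum_nonneg) auto
  have "(\<Sum>i\<in>F. (\<sigma> i * cmod (pair \<T> (pderiv_at l (p i)) u))\<^sup>2) \<le> B' * (tnorm \<T> u)\<^sup>2"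
    if u: "u \<in> L2p \<T>" and F: "finite F" "F \<subseteq> J \<times> UNIV" for l u F
  proof -
    let ?f = "\<lambda>j k. ((1 + a (x j) * (norm (freq L k))\<^sup>2) powr (- (1/2)) * cmod (pair \<T> (pderiv_at l (atom L (\<gamma> j) k)) u))\<^sup>2"
    have "(\<Sum>i\<in>F. (\<sigma> i * cmod (pair \<T> (pderiv_at l (p i)) u))\<^sup>2) = (\<Sum>(j, k)\<in>F. ?f j k)"
      by (intro sum.cong refl) (auto simp: \<sigma>_def p_def case_prod_unfold)
    also have "\<dots> \<le> (\<Sum>j\<in>J. B j l * (tnorm \<T> u)\<^sup>2)"
      using B u by (intro sum_slices_le finite_J F) auto
    also have "\<dots> = (\<Sum>j\<in>J. B j l) * (tnorm \<T> u)\<^sup>2" by (simp add: sum_distrib_right)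
    also have "\<dots> \<le> B' * (tnorm \<T> u)\<^sup>2"
    proof (rule mult_right_mono)
      show "(\<Sum>j\<in>J. B j l) \<le> B'"
        unfolding B'_def by (rule member_le_sum[of l UNIV "\<lambda>l. \<Sum>j\<in>J. B j l"]) (use B in \<open>auto intro: sum_nonneg\<close>)
    qed simp
    finally show ?thesis .
  qed
  then show ?thesis using B0 by blast
qed

lemma frame_commutator_bound: "\<exists>B\<ge>0. \<forall>F c G. finite F \<longrightarrow> finite G \<longrightarrow> G \<subseteq> J \<times> UNIV \<longrightarrow>
      (\<Sum>i\<in>G. (cmod (pair \<T> (tsum \<T> F (\<lambda>m. of_real (japanese (int_vec m)) * c m)) (\<lambda>y. cnj (p i y))
              - of_real (w i) * pair \<T> (tsum \<T> F c) (\<lambda>y. cnj (p i y))))\<^sup>2)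
        \<le> B * (tnorm \<T> (tsum \<T> F c))\<^sup>2"
proof -
  let ?f = "\<lambda>F c j k. (cmod (pair \<T> (tsum \<T> F (\<lambda>m. of_real (japanese (int_vec m)) * c m)) (\<lambda>y. cnj (atom L (\<gamma> j) k y))
              - of_real (japanese (freq L k)) * pair \<T> (tsum \<T> F c) (\<lambda>y. cnj (atom L (\<gamma> j) k y))))\<^sup>2"
  have "\<forall>j\<in>J. \<exists>B\<ge>0. \<forall>F c G. finite F \<longrightarrow> finite G \<longrightarrow> (\<Sum>k\<in>G. ?f F c j k) \<le> B * (tnorm \<T> (tsum \<T> F c))\<^sup>2"
    using commutator_bound_window[OF K L_def window_fn_\<gamma>] by blast
  from bchoice[OF this]
  obtain B where B: "\<forall>j\<in>J. 0 \<le> B j \<and> (\<forall>F c G. finite F \<longrightarrow> finite G \<longrightarrow> (\<Sum>k\<in>G. ?f F c j k) \<le> B j * (tnorm \<T> (tsum \<T> F c))\<^sup>2)"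
    by blast
  have "(\<Sum>i\<in>G. (cmod (pair \<T> (tsum \<T> F (\<lambda>m. of_real (japanese (int_vec m)) * c m)) (\<lambda>y. cnj (p i y))
              - of_real (w i) * pair \<T> (tsum \<T> F c) (\<lambda>y. cnj (p i y))))\<^sup>2)
        \<le> (\<Sum>j\<in>J. B j) * (tnorm \<T> (tsum \<T> F c))\<^sup>2"
    if "finite F" "finite G" "G \<subseteq> J \<times> UNIV" for F c G
  proof -
    have "(\<Sum>i\<in>G. (cmod (pair \<T> (tsum \<T> F (\<lambda>m. of_real (japanese (int_vec m)) * c m)) (\<lambda>y. cnj (p i y))
              - of_real (w i) * pair \<T> (tsum \<T> F c) (\<lambda>y. cnj (p i y))))\<^sup>2) = (\<Sum>(j, k)\<in>G. ?f F c j k)"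
      by (intro sum.cong refl) (auto simp: w_def p_def case_prod_unfold)
    also have "\<dots> \<le> (\<Sum>j\<in>J. B j * (tnorm \<T> (tsum \<T> F c))\<^sup>2)"
      using B that by (intro sum_slices_le finite_J) auto
    finally show ?thesis by (simp add: sum_distrib_right)
  qed
  moreover have "(\<Sum>j\<in>J. B j) \<ge> 0" using B by (intro sum_nonneg) auto
  ultimately show ?thesis by blast
qed

text \<open>The smaller of \<open>C\<close> and \<open>C\<^sub>0\<close> is a common lower bound for
  the two coefficients.\<close>

sublocale elliptic_frame "J \<times> UNIV" p "1 / L ^ CARD('n)" \<sigma> w a b A "min C C\<^sub>0"
proof
  show "p i \<in> tests \<T>" if "i \<in> J \<times> UNIV" for i
    using that unfolding p_def by (intro atom_tests[OF K L_def window_fn_\<gamma>]) auto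
  show "1 / L ^ CARD('n) > 0" using L_pos by simp
  show "min C C\<^sub>0 > 0" using C(1) C\<^sub>0(1) by simp
  show "min C C\<^sub>0 \<le> a y" for y using C(2)[of y] by linarith
  show "min C C\<^sub>0 \<le> b y" for y using C\<^sub>0(2)[of y] by linarith
  show "0 < \<sigma> i" "\<sigma> i \<le> 1" for i by (fact \<sigma>_bounds)+
qed (fact frame_parseval frame_derivative_bound frame_commutator_bound \<sigma>_w_bound a b A)+

section \<open>Identification with the distributional operators\<close>

text \<open>Localization, Fourier multiplier and second localization collapse to the frame series.
  \<open>U\<close> is an arbitrary functional, so the same statement serves the right factor, acting
  on a square integrable function, and the left factor, acting on the image under the elliptic
  operator.\<close>

lemma preconditioner_eq:
  assumes \<phi>: "\<phi> \<in> tests \<T>"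
    and hs: "((\<lambda>i. of_real (1 / L ^ CARD('n) * \<sigma> i) * U (\<lambda>y. cnj (p i y)) * pair \<T> (p i) \<phi>) has_sum S) (J \<times> UNIV)"
  shows "preconditioner K x g a U \<phi> = S"
proof -
  have T: "\<T> > 0" by simp
  let ?f = "\<lambda>j k. of_real (1 / L ^ CARD('n) * \<sigma> (j, k)) * U (\<lambda>y. cnj (p (j, k) y)) * pair \<T> (p (j, k)) \<phi>"
  have summand: "of_real ((1 + a (x j) * (norm (freq L k))\<^sup>2) powr (- (1/2))) * fourier_coeff L (localize \<T> (\<gamma> j) U) k
       * dist_of L (\<lambda>y. cis (freq L k \<bullet> y)) (periodize L (\<lambda>y. of_real (\<gamma> j y) * \<phi> y)) = ?f j k"
    if j: "j \<in> J" for j k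
  proof -
    note wf = window_fn_\<gamma>[OF j]
    \<comment> \<open>The Fourier coefficient of the localized functional is \<open>U\<close> on a
      conjugate atom; the normalization of Fourier coefficients supplies the frame constant.\<close>
    have 1: "fourier_coeff L (localize \<T> (\<gamma> j) U) k = U (\<lambda>y. cnj (p (j, k) y)) / of_real (L ^ CARD('n))"
      unfolding fourier_coeff_eq localize_def p_def fst_conv snd_conv cnj_atom by (simp add: atom_def wave_def)
    obtain B where B: "B \<ge> 0" "\<And>y. \<bar>\<gamma> j y\<bar> \<le> B" using window_fn_bounded[OF wf] by blast
    obtain B' where B': "B' \<ge> 0" "\<And>y. cmod (\<phi> y) \<le> B'" using tests_bounded[OF T \<phi>] by blast
    \<comment> \<open>On the side of the test function, unfold with period \<open>L\<close> to an
      integral over space and fold again with period \<open>\<T>\<close>, which turns the pairing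
      into one with an atom.\<close>
    have "dist_of L (\<lambda>y. cis (freq L k \<bullet> y)) (periodize L (\<lambda>y. of_real (\<gamma> j y) * \<phi> y))
      = pair L (expo L k) (periodize L (\<lambda>y. of_real (\<gamma> j y) * \<phi> y))"
      by (simp add: dist_of_eq_pair expo_def[abs_def])
    also have "\<dots> = (\<integral>y. expo L k y * (of_real (\<gamma> j y) * \<phi> y) \<partial>lebesgue)"
    proof (rule pair_periodize(2)[OF L_pos expo_L2p[OF L_pos]])
      show "(\<lambda>y. of_real (\<gamma> j y) * \<phi> y) \<in> borel_measurable lebesgue"
        by (intro borel_measurable_times smooth_measurable tests_smooth[OF \<phi>] smooth_of_real_window[OF K L_def wf])
      show "cmod (of_real (\<gamma> j y) * \<phi> y) \<le> B * B'" for y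
        unfolding norm_mult by (intro mult_mono) (use B B' in auto)
      show "of_real (\<gamma> j y) * \<phi> y = 0" if "norm y > window_radius K (x j)" for y
        using window_fn_outside_ball[OF wf that] by simp
    qed
    also have "\<dots> = (\<integral>y. \<phi> y * wave L (\<gamma> j) k y \<partial>lebesgue)"
      by (simp add: wave_def mult_ac)
    also have "\<dots> = pair \<T> (p (j, k)) \<phi>"
      using pair_atom[OF K L_def wf tests_L2p[OF T \<phi>], of k] by (simp add: p_def pair_commute)
    finally show ?thesis by (simp add: 1 \<sigma>_def)
  qed
  have "preconditioner K x g a U \<phi> = (\<Sum>j\<in>J. \<Sum>\<^sub>\<infinity>k. ?f j k)"
    unfolding preconditioner_def symbol_op_def Let_def L_def[symmetric] \<gamma>_def[symmetric] J_def[symmetric]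
    by (intro sum.cong refl, subst localize_def) (simp only: summand)
  also have "\<dots> = infsum (\<lambda>(j, k). ?f j k) (J \<times> UNIV)"
    using hs by (intro sum_infsum_eq_infsum_Times finite_J) (auto simp: summable_on_def case_prod_unfold)
  also have "\<dots> = S" using hs by (simp add: infsumI case_prod_unfold)
  finally show ?thesis .
qed

abbreviation Pu :: "(real^'n \<Rightarrow> complex) \<Rightarrow> 'n functional" where
  "Pu u \<equiv> preconditioner K x g a (dist_of \<T> u)"

lemma tests_in_L2p: "\<phi> \<in> tests \<T> \<Longrightarrow> \<phi> \<in> L2p \<T>"
  by (rule tests_L2p) auto

lemma Pu_eq:
  assumes u: "u \<in> L2p \<T>" and \<phi>: "\<phi> \<in> tests \<T>"
  shows "Pu u \<phi> = pair \<T> (P u) \<phi>"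
  by (rule preconditioner_eq[OF \<phi>]) (use P(3)[OF u tests_in_L2p[OF \<phi>]] in \<open>simp add: dist_of_eq_pair coef_def\<close>)

lemma represents_P: "u \<in> L2p \<T> \<Longrightarrow> represents (P u) (Pu u)"
  by (simp add: represents_def L2_eq_L2p P(1) Pu_eq dist_of_eq_pair)

lemma represents_D: "u \<in> L2p \<T> \<Longrightarrow> represents (D k u) (dist_pderiv k (Pu u))"
  by (simp add: represents_def L2_eq_L2p D(1) dist_pderiv_def Pu_eq tests_pderiv pair_D dist_of_eq_pair)

text \<open>The representatives chosen by \<open>L2_rep\<close> agree almost everywhere with
  \<open>P u\<close> and \<open>D k u\<close>, hence give the same integrals.\<close>

lemma elliptic_op_eq:
  assumes u: "u \<in> L2p \<T>" and \<phi>: "\<phi> \<in> tests \<T>"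
  shows "elliptic_op a b (Pu u) \<phi> = W u \<phi>"
proof -
  let ?D = "\<lambda>k. L2_rep (dist_pderiv k (Pu u))" and ?P = "L2_rep (Pu u)"
  note rD = represents_L2_rep[OF represents_D[OF u]] and rP = represents_L2_rep[OF represents_P[OF u]]
  have DL: "?D k \<in> L2p \<T>" for k using rD(1) by (simp add: represents_def L2_eq_L2p)
  have PL: "?P \<in> L2p \<T>" using rP(1) by (simp add: represents_def L2_eq_L2p)
  have i: "integrable (torus \<T>) (\<lambda>y. of_real (a y) * D k u y * pderiv_at k \<phi> y)" for k
    by (intro pair_integrable a_mult D(1) u tests_in_L2p tests_pderiv \<phi>)
  have i2: "integrable (torus \<T>) (\<lambda>y. of_real (b y) * P u y * \<phi> y)"
    by (intro pair_integrable b_mult P(1) u tests_in_L2p \<phi>)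
  have m: "(\<lambda>y. of_real (a y) * f y * pderiv_at k \<phi> y) \<in> borel_measurable (torus \<T>)" if "f \<in> L2p \<T>" for f k
    by (intro borel_measurable_integrable pair_integrable a_mult that tests_in_L2p tests_pderiv \<phi>)
  have m2: "(\<lambda>y. of_real (b y) * f y * \<phi> y) \<in> borel_measurable (torus \<T>)" if "f \<in> L2p \<T>" for f
    by (intro borel_measurable_integrable pair_integrable b_mult that tests_in_L2p \<phi>)
  have "elliptic_op a b (Pu u) \<phi> = (\<integral>y. (\<Sum>k\<in>UNIV. of_real (a y) * ?D k y * pderiv_at k \<phi> y) + of_real (b y) * ?P y * \<phi> y \<partial>torus \<T>)"
    by (simp add: elliptic_op_def integral_torus sum_distrib_left mult.assoc)
  also have "\<dots> = (\<integral>y. (\<Sum>k\<in>UNIV. of_real (a y) * D k u y * pderiv_at k \<phi> y) + of_real (b y) * P u y * \<phi> y \<partial>torus \<T>)"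
  proof (rule integral_cong_AE)
    have "AE y in torus \<T>. \<forall>k\<in>UNIV. ?D k y = D k u y"
      by (rule AE_finite_allI) (use rD(2) in auto)
    then show "AE y in torus \<T>. (\<Sum>k\<in>UNIV. of_real (a y) * ?D k y * pderiv_at k \<phi> y) + of_real (b y) * ?P y * \<phi> y
      = (\<Sum>k\<in>UNIV. of_real (a y) * D k u y * pderiv_at k \<phi> y) + of_real (b y) * P u y * \<phi> y"
      using rP(2) by eventually_elim simp
  qed (intro borel_measurable_add borel_measurable_sum m m2 DL PL D(1) P(1) u)+
  also have "\<dots> = W u \<phi>"
    unfolding W_def pair_def using i i2
    by (subst Bochner_Integration.integral_add) (auto simp: Bochner_Integration.integral_sum)
  finally show ?thesis .
qed

text \<open>For exponent 1 the Sobolev weight is the squared Japanese bracket, so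
  \<open>sobolev_coeff_sum_le\<close> bounds all partial sums.\<close>

lemma Sobolev_Pu:
  assumes u: "u \<in> L2p \<T>"
  shows "Pu u \<in> Sobolev 1"
proof -
  have "periodic_distribution \<T> (\<lambda>\<phi>. pair \<T> (P u) \<phi>)"
  proof (rule periodic_distributionI[where N = 0 and B = "tnorm \<T> (P u) * sqrt (\<T> ^ CARD('n))"])
    fix \<phi> \<eta> :: "real^'n \<Rightarrow> complex" and c d assume "\<phi> \<in> tests \<T>" "\<eta> \<in> tests \<T>"
    then show "pair \<T> (P u) (\<lambda>x. c * \<phi> x + d * \<eta> x) = c * pair \<T> (P u) \<phi> + d * pair \<T> (P u) \<eta>"
      by (subst pair_add(1)) (auto simp: pair_cmult intro: P(1) u L2p_cmult tests_in_L2p)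
  next
    fix \<phi> :: "real^'n \<Rightarrow> complex" and M
    assume \<phi>: "\<phi> \<in> tests \<T>" and M: "\<And>ds x. length ds \<le> 0 \<Longrightarrow> cmod (iter_pderiv ds \<phi> x) \<le> M"
    have "cmod (pair \<T> (P u) \<phi>) \<le> tnorm \<T> (P u) * tnorm \<T> \<phi>"
      by (intro norm_pair_le P(1) u tests_in_L2p \<phi>)
    also have "\<dots> \<le> tnorm \<T> (P u) * (sqrt (\<T> ^ CARD('n)) * M)"
      using M[of "[]"] by (intro mult_left_mono tnorm_tests_le \<phi>) auto
    finally show "cmod (pair \<T> (P u) \<phi>) \<le> tnorm \<T> (P u) * sqrt (\<T> ^ CARD('n)) * M"
      by (simp add: mult.assoc)
  qed
  then have pd: "periodic_distribution \<T> (Pu u)"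
    using periodic_distribution_cong[of \<T> "Pu u" "pair \<T> (P u)"] Pu_eq[OF u] by blast
  define V where "V = \<T> ^ CARD('n)"
  have V: "V > 0" by (simp add: V_def)
  have eq: "(1 + (norm (int_vec m))\<^sup>2) powr 1 * (cmod (fourier_coeff \<T> (Pu u) m))\<^sup>2
    = (japanese (int_vec m) * cmod (pair \<T> (P u) (expo \<T> (- m))))\<^sup>2 / V\<^sup>2" for m :: "int^'n"
  proof -
    have j: "(japanese (int_vec m))\<^sup>2 = 1 + (norm (int_vec m))\<^sup>2" by (simp add: japanese_def)
    have "fourier_coeff \<T> (Pu u) m = pair \<T> (P u) (expo \<T> (- m)) / of_real V"
      unfolding fourier_coeff_eq V_def by (subst Pu_eq[OF u tests_expo]) auto
    then show ?thesis using V by (simp add: norm_divide power_divide power_mult_distrib j add_pos_nonneg)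
  qed
  have "(\<lambda>m::int^'n. (1 + (norm (int_vec m))\<^sup>2) powr 1 * (cmod (fourier_coeff \<T> (Pu u) m))\<^sup>2) summable_on UNIV"
  proof (rule nonneg_bdd_above_summable_on)
    have "(\<Sum>m\<in>F. (1 + (norm (int_vec m))\<^sup>2) powr 1 * (cmod (fourier_coeff \<T> (Pu u) m))\<^sup>2) \<le> V * (energy u)\<^sup>2 / V\<^sup>2"
      if "finite F" for F :: "(int^'n) set"
      unfolding eq sum_divide_distrib[symmetric] V_def
      by (intro divide_right_mono sobolev_coeff_sum_le u that) auto
    then show "bdd_above (sum (\<lambda>m::int^'n. (1 + (norm (int_vec m))\<^sup>2) powr 1 * (cmod (fourier_coeff \<T> (Pu u) m))\<^sup>2) ` {F. F \<subseteq> UNIV \<and> finite F})"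
      by (intro bdd_aboveI2) auto
  qed auto
  with pd show ?thesis by (simp add: Sobolev_def)
qed

text \<open>Against an exponential the derivative in \<open>W\<close> costs a factor
  \<open>m $ k\<close>; by Cauchy-Schwarz the weight of exponent -1 absorbs these factors, and
  Bessel bounds the remaining coefficients of \<open>a * D k u\<close> and
  \<open>b * P u\<close>.\<close>

lemma Sobolev_elliptic_op:
  assumes u: "u \<in> L2p \<T>"
  shows "elliptic_op a b (Pu u) \<in> Sobolev (- 1)"
proof -
  let ?aD = "\<lambda>k x. complex_of_real (a x) * D k u x" and ?bP = "\<lambda>x. complex_of_real (b x) * P u x"
  have aD: "?aD k \<in> L2p \<T>" and bP: "?bP \<in> L2p \<T>" for k
    by (intro a_mult b_mult D P u)+
  define V where "V = \<T> ^ CARD('n)"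
  have V: "V > 0" by (simp add: V_def)
  have "periodic_distribution \<T> (W u)"
  proof (rule periodic_distributionI[where N = 1 and B = "((\<Sum>k\<in>UNIV. tnorm \<T> (?aD k)) + tnorm \<T> ?bP) * sqrt V"])
    fix \<phi> \<eta> :: "real^'n \<Rightarrow> complex" and c d assume \<phi>: "\<phi> \<in> tests \<T>" and \<eta>: "\<eta> \<in> tests \<T>"
    have pd: "pderiv_at k (\<lambda>x. c * \<phi> x + d * \<eta> x) = (\<lambda>x. c * pderiv_at k \<phi> x + d * pderiv_at k \<eta> x)" for k
      using tests_smooth[OF \<phi>] tests_smooth[OF \<eta>] by (simp add: pderiv_add smooth_cmult pderiv_cmult)
    have lin: "pair \<T> f (\<lambda>x. c * \<phi>' x + d * \<eta>' x) = c * pair \<T> f \<phi>' + d * pair \<T> f \<eta>'"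
      if "f \<in> L2p \<T>" "\<phi>' \<in> tests \<T>" "\<eta>' \<in> tests \<T>" for f \<phi>' \<eta>'
      using that by (subst pair_add(1)) (auto simp: pair_cmult intro: L2p_cmult tests_in_L2p)
    show "W u (\<lambda>x. c * \<phi> x + d * \<eta> x) = c * W u \<phi> + d * W u \<eta>"
      unfolding W_def pd lin[OF aD tests_pderiv[OF \<phi>] tests_pderiv[OF \<eta>]] lin[OF bP \<phi> \<eta>]
      by (simp add: sum.distrib sum_distrib_left distrib_left)
  next
    fix \<phi> :: "real^'n \<Rightarrow> complex" and M
    assume \<phi>: "\<phi> \<in> tests \<T>" and M: "\<And>ds x. length ds \<le> 1 \<Longrightarrow> cmod (iter_pderiv ds \<phi> x) \<le> M"
    have 1: "cmod (pair \<T> (?aD k) (pderiv_at k \<phi>)) \<le> tnorm \<T> (?aD k) * (sqrt V * M)" for k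
    proof -
      have "cmod (pair \<T> (?aD k) (pderiv_at k \<phi>)) \<le> tnorm \<T> (?aD k) * tnorm \<T> (pderiv_at k \<phi>)"
        by (intro norm_pair_le aD tests_in_L2p tests_pderiv \<phi>)
      also have "\<dots> \<le> tnorm \<T> (?aD k) * (sqrt V * M)"
        unfolding V_def using M[of "[k]"] by (intro mult_left_mono tnorm_tests_le tests_pderiv \<phi>) auto
      finally show ?thesis .
    qed
    have 2: "cmod (pair \<T> ?bP \<phi>) \<le> tnorm \<T> ?bP * (sqrt V * M)"
    proof -
      have "cmod (pair \<T> ?bP \<phi>) \<le> tnorm \<T> ?bP * tnorm \<T> \<phi>"
        by (intro norm_pair_le bP tests_in_L2p \<phi>)
      also have "\<dots> \<le> tnorm \<T> ?bP * (sqrt V * M)"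
        unfolding V_def using M[of "[]"] by (intro mult_left_mono tnorm_tests_le \<phi>) auto
      finally show ?thesis .
    qed
    have "cmod (W u \<phi>) \<le> (\<Sum>k\<in>UNIV. tnorm \<T> (?aD k) * (sqrt V * M)) + tnorm \<T> ?bP * (sqrt V * M)"
      unfolding W_def by (intro norm_triangle_mono sum_norm_le 1 2)
    then show "cmod (W u \<phi>) \<le> ((\<Sum>k\<in>UNIV. tnorm \<T> (?aD k)) + tnorm \<T> ?bP) * sqrt V * M"
      by (simp add: sum_distrib_right distrib_right mult.assoc)
  qed
  then have pd: "periodic_distribution \<T> (elliptic_op a b (Pu u))"
    using periodic_distribution_cong[of \<T> "elliptic_op a b (Pu u)" "W u"] elliptic_op_eq[OF u] by blast
  let ?c = "\<lambda>k m. cmod (pair \<T> (?aD k) (expo \<T> (- m)))" and ?d = "\<lambda>m. cmod (pair \<T> ?bP (expo \<T> (- m)))"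
  have le: "(1 + (norm (int_vec m))\<^sup>2) powr (- 1) * (cmod (fourier_coeff \<T> (elliptic_op a b (Pu u)) m))\<^sup>2
    \<le> 2 / V\<^sup>2 * ((\<Sum>k\<in>UNIV. (?c k m)\<^sup>2) + (?d m)\<^sup>2)" for m :: "int^'n"
  proof -
    define s where "s = (\<Sum>k\<in>UNIV. (real_of_int (m $ k))\<^sup>2)"
    have s: "s \<ge> 0" by (auto simp: s_def intro: sum_nonneg)
    have n: "(norm (int_vec m))\<^sup>2 = s" by (simp add: norm_int_vec_square s_def)
    have pd: "pderiv_at k (expo \<T> (- m)) = (\<lambda>x. (- (\<i> * complex_of_real (real_of_int (m $ k)))) * expo \<T> (- m) x)" for k
      by (simp add: pderiv_expo freq_nth)
    have "cmod (W u (expo \<T> (- m))) \<le> (\<Sum>k\<in>UNIV. \<bar>real_of_int (m $ k)\<bar> * ?c k m) + ?d m"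
      unfolding W_def pd pair_cmult
      by (intro norm_triangle_mono sum_norm_le) (simp_all add: norm_mult)
    then have "(cmod (W u (expo \<T> (- m))))\<^sup>2 \<le> ((\<Sum>k\<in>UNIV. \<bar>real_of_int (m $ k)\<bar> * ?c k m) + ?d m)\<^sup>2"
      by (intro power_mono) auto
    also have "\<dots> \<le> 2 * (\<Sum>k\<in>UNIV. \<bar>real_of_int (m $ k)\<bar> * ?c k m)\<^sup>2 + 2 * (?d m)\<^sup>2"
      using sum_squares_bound[of "\<Sum>k\<in>UNIV. \<bar>real_of_int (m $ k)\<bar> * ?c k m" "?d m"] by (simp add: power2_sum)
    also have "(\<Sum>k\<in>UNIV. \<bar>real_of_int (m $ k)\<bar> * ?c k m)\<^sup>2 \<le> s * (\<Sum>k\<in>UNIV. (?c k m)\<^sup>2)"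
      using Cauchy_Schwarz_ineq_sum[of "\<lambda>k. \<bar>real_of_int (m $ k)\<bar>" "\<lambda>k. ?c k m" UNIV] by (simp add: s_def)
    also have "2 * (s * (\<Sum>k\<in>UNIV. (?c k m)\<^sup>2)) + 2 * (?d m)\<^sup>2 \<le> (1 + s) * (2 * ((\<Sum>k\<in>UNIV. (?c k m)\<^sup>2) + (?d m)\<^sup>2))"
      using s sum_nonneg[of UNIV "\<lambda>k. (?c k m)\<^sup>2"] by (simp add: algebra_simps)
    finally have 1: "(cmod (W u (expo \<T> (- m))))\<^sup>2 / (1 + s) \<le> 2 * ((\<Sum>k\<in>UNIV. (?c k m)\<^sup>2) + (?d m)\<^sup>2)"
      using s by (simp add: divide_le_eq mult.commute)
    have "fourier_coeff \<T> (elliptic_op a b (Pu u)) m = W u (expo \<T> (- m)) / of_real V"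
      unfolding fourier_coeff_eq V_def by (subst elliptic_op_eq[OF u tests_expo]) auto
    then have "(1 + (norm (int_vec m))\<^sup>2) powr (- 1) * (cmod (fourier_coeff \<T> (elliptic_op a b (Pu u)) m))\<^sup>2
      = ((cmod (W u (expo \<T> (- m))))\<^sup>2 / (1 + s)) / V\<^sup>2"
      using s V by (simp add: n norm_divide power_divide powr_minus_divide)
    also have "\<dots> \<le> (2 * ((\<Sum>k\<in>UNIV. (?c k m)\<^sup>2) + (?d m)\<^sup>2)) / V\<^sup>2"
      by (intro divide_right_mono 1) auto
    finally show ?thesis by simp
  qed
  have "(\<lambda>m::int^'n. (1 + (norm (int_vec m))\<^sup>2) powr (- 1) * (cmod (fourier_coeff \<T> (elliptic_op a b (Pu u)) m))\<^sup>2) summable_on UNIV"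
  proof (rule nonneg_bdd_above_summable_on)
    have "(\<Sum>m\<in>F. (1 + (norm (int_vec m))\<^sup>2) powr (- 1) * (cmod (fourier_coeff \<T> (elliptic_op a b (Pu u)) m))\<^sup>2)
      \<le> 2 / V\<^sup>2 * ((\<Sum>k\<in>UNIV. V * (tnorm \<T> (?aD k))\<^sup>2) + V * (tnorm \<T> ?bP)\<^sup>2)" if F: "finite F" for F :: "(int^'n) set"
    proof -
      have "(\<Sum>m\<in>F. (1 + (norm (int_vec m))\<^sup>2) powr (- 1) * (cmod (fourier_coeff \<T> (elliptic_op a b (Pu u)) m))\<^sup>2)
        \<le> (\<Sum>m\<in>F. 2 / V\<^sup>2 * ((\<Sum>k\<in>UNIV. (?c k m)\<^sup>2) + (?d m)\<^sup>2))" by (intro sum_mono le)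
      also have "\<dots> = 2 / V\<^sup>2 * ((\<Sum>k\<in>UNIV. \<Sum>m\<in>F. (?c k m)\<^sup>2) + (\<Sum>m\<in>F. (?d m)\<^sup>2))"
        by (simp only: sum_distrib_left[symmetric] sum.distrib sum.swap[of _ F])
      also have "\<dots> \<le> 2 / V\<^sup>2 * ((\<Sum>k\<in>UNIV. V * (tnorm \<T> (?aD k))\<^sup>2) + V * (tnorm \<T> ?bP)\<^sup>2)"
        unfolding V_def by (intro mult_left_mono add_mono sum_mono Bessel_minus F aD bP) auto
      finally show ?thesis .
    qed
    then show "bdd_above (sum (\<lambda>m::int^'n. (1 + (norm (int_vec m))\<^sup>2) powr (- 1) * (cmod (fourier_coeff \<T> (elliptic_op a b (Pu u)) m))\<^sup>2) ` {F. F \<subseteq> UNIV \<and> finite F})"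
      by (intro bdd_aboveI2) auto
  qed auto
  with pd show ?thesis by (simp add: Sobolev_def)
qed

section \<open>The composite operator\<close>

abbreviation PLPu :: "(real^'n \<Rightarrow> complex) \<Rightarrow> real^'n \<Rightarrow> complex" where
  "PLPu u \<equiv> PLP K x g a b u"

text \<open>Conjugate atoms are test functions, so in the frame series of the left factor the
  elliptic operator may be replaced by \<open>W u\<close>; the result is the transposed expansion of
  the form.\<close>

lemma preconditioned_eq:
  assumes u: "u \<in> L2p \<T>" and \<phi>: "\<phi> \<in> tests \<T>"
  shows "preconditioner K x g a (elliptic_op a b (Pu u)) \<phi> = form u (\<lambda>y. cnj (\<phi> y))"
proof (rule preconditioner_eq[OF \<phi>])
  have "((\<lambda>i. of_real (1 / L ^ CARD('n) * \<sigma> i) * W u (\<lambda>y. cnj (p i y)) * pair \<T> (p i) \<phi>) has_sum form u (\<lambda>y. cnj (\<phi> y))) (J \<times> UNIV)"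
    using has_sum_form[OF u L2p_cnj[OF tests_in_L2p[OF \<phi>]]] by simp
  moreover have "elliptic_op a b (Pu u) (\<lambda>y. cnj (p i y)) = W u (\<lambda>y. cnj (p i y))" if "i \<in> J \<times> UNIV" for i
    by (intro elliptic_op_eq u tests_cnj p_tests that)
  ultimately show "((\<lambda>i. of_real (1 / L ^ CARD('n) * \<sigma> i) * elliptic_op a b (Pu u) (\<lambda>y. cnj (p i y)) * pair \<T> (p i) \<phi>) has_sum form u (\<lambda>y. cnj (\<phi> y))) (J \<times> UNIV)"
    by (subst has_sum_cong) auto
qed

definition M :: real where "M = \<bar>A\<bar> * (real CARD('n) * D_bound\<^sup>2 + 1)"

lemma PLPu:
  assumes u: "u \<in> L2p \<T>"
  shows "represents (PLPu u) (preconditioner K x g a (elliptic_op a b (Pu u)))"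
    "PLPu u \<in> L2p \<T>"
    "v \<in> L2p \<T> \<Longrightarrow> pair \<T> (PLPu u) (\<lambda>y. cnj (v y)) = form u v"
    "tnorm \<T> (PLPu u) \<le> M * tnorm \<T> u"
proof -
  obtain h where h: "h \<in> L2p \<T>" "\<forall>v\<in>L2p \<T>. pair \<T> h (\<lambda>y. cnj (v y)) = form u v" "tnorm \<T> h \<le> M * tnorm \<T> u"
    using T_exists[OF u] unfolding M_def by blast
  have "represents h (preconditioner K x g a (elliptic_op a b (Pu u)))"
  proof -
    have "form u (\<lambda>y. cnj (\<phi> y)) = pair \<T> h \<phi>" if "\<phi> \<in> tests \<T>" for \<phi>
      using h(2)[rule_format, OF L2p_cnj[OF tests_in_L2p[OF that]]] by simp
    then show ?thesis using h(1) by (simp add: represents_def L2_eq_L2p preconditioned_eq[OF u] dist_of_eq_pair)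
  qed
  note r = represents_L2_rep[OF this, folded PLP_def]
  show "represents (PLPu u) (preconditioner K x g a (elliptic_op a b (Pu u)))" by (rule r(1))
  then show L2: "PLPu u \<in> L2p \<T>" by (simp add: represents_def L2_eq_L2p)
  show "pair \<T> (PLPu u) (\<lambda>y. cnj (v y)) = form u v" if "v \<in> L2p \<T>"
    using pair_cong_AE[OF L2 h(1) L2p_cnj[OF that] r(2)] h(2) that by simp
  show "tnorm \<T> (PLPu u) \<le> M * tnorm \<T> u"
    using tnorm_cong_AE[OF L2 h(1) r(2)] h(3) by simp
qed

lemma PLPu_symmetric:
  assumes u: "u \<in> L2p \<T>" and v: "v \<in> L2p \<T>"
  shows "pair \<T> (PLPu u) (\<lambda>y. cnj (v y)) = pair \<T> u (\<lambda>y. cnj (PLPu v y))"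
proof -
  have "pair \<T> u (\<lambda>y. cnj (PLPu v y)) = cnj (pair \<T> (PLPu v) (\<lambda>y. cnj (u y)))"
    by (simp add: cnj_pair pair_commute)
  then show ?thesis using PLPu(3)[OF u v] PLPu(3)[OF v u] form_hermitian[of u v] by simp
qed

text \<open>\<open>L2_rep\<close> chooses a representative for each argument separately. Symmetry
  moves the operator onto a fixed exponential, so every Fourier coefficient of the image is visibly
  linear in the argument.\<close>

lemma PLPu_linear:
  assumes u: "u \<in> L2p \<T>" and v: "v \<in> L2p \<T>"
  shows "AE y in torus \<T>. PLPu (\<lambda>y. u y + c * v y) y = PLPu u y + c * PLPu v y"
proof (rule Fourier_unique)
  have uv: "(\<lambda>y. u y + c * v y) \<in> L2p \<T>" by (intro L2p_add L2p_cmult u v)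
  show "PLPu (\<lambda>y. u y + c * v y) \<in> L2p \<T>" "(\<lambda>y. PLPu u y + c * PLPu v y) \<in> L2p \<T>"
    by (intro PLPu uv L2p_add L2p_cmult u v)+
  fix m :: "int^'n"
  have e: "expo \<T> (- m) \<in> L2p \<T>" "expo \<T> m \<in> L2p \<T>" by (intro expo_L2p, simp)+
  have *: "pair \<T> (PLPu f) (expo \<T> m) = pair \<T> f (\<lambda>y. cnj (PLPu (expo \<T> (- m)) y))" if "f \<in> L2p \<T>" for f
    using PLPu_symmetric[OF that e(1)] by (simp add: cnj_expo)
  have q: "(\<lambda>y. cnj (PLPu (expo \<T> (- m)) y)) \<in> L2p \<T>" by (intro L2p_cnj PLPu e)
  show "pair \<T> (PLPu (\<lambda>y. u y + c * v y)) (expo \<T> m) = pair \<T> (\<lambda>y. PLPu u y + c * PLPu v y) (expo \<T> m)"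
    unfolding *[OF uv] pair_add(2)[OF q u L2p_cmult[OF v]] pair_add(2)[OF e(2) PLPu(2)[OF u] L2p_cmult[OF PLPu(2)[OF v]]]
    by (simp only: pair_cmult * u v)
qed simp

lemma conclusion:
  "(\<forall>u\<in>L2. Pu u \<in> Sobolev 1 \<and> elliptic_op a b (Pu u) \<in> Sobolev (- 1) \<and>
      represents (PLPu u) (preconditioner K x g a (elliptic_op a b (Pu u))))
   \<and> selfadjoint_L2_operator (PLP K x g a b)
   \<and> boundedly_invertible_L2 (PLP K x g a b)
   \<and> (\<exists>c1 c2. 0 < c1 \<and> c1 \<le> c2 \<and>
        (\<forall>u\<in>L2. l2_inner (PLPu u) u \<in> \<real> \<and>
           c1 * (l2_norm u)\<^sup>2 \<le> Re (l2_inner (PLPu u) u) \<and>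
           Re (l2_inner (PLPu u) u) \<le> c2 * (l2_norm u)\<^sup>2))"
proof (intro conjI)
  have T: "\<T> > 0" by simp
  obtain c1 where c1: "c1 > 0" "\<And>u. u \<in> L2p \<T> \<Longrightarrow> c1 * (tnorm \<T> u)\<^sup>2 \<le> Re (form u u)"
    using form_lower_bound by blast
  have b: "bounded_L2_operator (PLP K x g a b)"
    by (rule bounded_L2_operatorI[OF PLPu(2) PLPu_linear PLPu(4)])
  show "\<forall>u\<in>L2. Pu u \<in> Sobolev 1 \<and> elliptic_op a b (Pu u) \<in> Sobolev (- 1) \<and>
      represents (PLPu u) (preconditioner K x g a (elliptic_op a b (Pu u)))"
    unfolding L2_eq_L2p using Sobolev_Pu Sobolev_elliptic_op PLPu(1) by blast
  show "selfadjoint_L2_operator (PLP K x g a b)"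
    using b by (simp add: selfadjoint_L2_operator_def L2_eq_L2p l2_inner_eq PLPu_symmetric)
  have coer: "c1 * (tnorm \<T> u)\<^sup>2 \<le> Re (pair \<T> (PLPu u) (\<lambda>y. cnj (u y)))" if "u \<in> L2p \<T>" for u
    using c1(2)[OF that] PLPu(3)[OF that that] by simp
  show "boundedly_invertible_L2 (PLP K x g a b)"
  proof (rule Lax_Milgram_torus[of \<T> "PLP K x g a b" M c1, OF T PLPu(2) PLPu_linear PLPu(4) coer c1(1)])
    fix R
    assume R: "\<And>u. u \<in> L2p \<T> \<Longrightarrow> R u \<in> L2p \<T>"
      "\<And>u. u \<in> L2p \<T> \<Longrightarrow> AE y in torus \<T>. PLPu (R u) y = u y"
      "\<And>u. u \<in> L2p \<T> \<Longrightarrow> AE y in torus \<T>. R (PLPu u) y = u y"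
      "\<And>u v d. u \<in> L2p \<T> \<Longrightarrow> v \<in> L2p \<T> \<Longrightarrow> AE y in torus \<T>. R (\<lambda>y. u y + d * v y) y = R u y + d * R v y"
      "\<And>u. u \<in> L2p \<T> \<Longrightarrow> tnorm \<T> (R u) \<le> (1 / c1) * tnorm \<T> u"
    show ?thesis
      unfolding boundedly_invertible_L2_def L2_eq_L2p
    proof (intro exI[of _ R] conjI ballI)
      show "bounded_L2_operator R" by (rule bounded_L2_operatorI[OF R(1) R(4) R(5)])
      fix u :: "real^'n \<Rightarrow> complex" assume u: "u \<in> L2p \<T>"
      show "AE y in lebesgue. R (PLPu u) y = u y"
        by (rule AE_lebesgue_if_AE_torus[OF T R(1)[OF PLPu(2)[OF u]] u R(3)[OF u]])
      show "AE y in lebesgue. PLPu (R u) y = u y"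
        by (rule AE_lebesgue_if_AE_torus[OF T PLPu(2)[OF R(1)[OF u]] u R(2)[OF u]])
    qed
  qed
  \<comment> \<open>The upper constant is \<open>max c1 M\<close>, which guarantees
    \<open>c1 \<le> c2\<close>.\<close>
  have "form u u \<in> \<real> \<and> c1 * (tnorm \<T> u)\<^sup>2 \<le> Re (form u u) \<and> Re (form u u) \<le> max c1 M * (tnorm \<T> u)\<^sup>2"
    if u: "u \<in> L2p \<T>" for u
  proof (intro conjI c1(2) u)
    show "form u u \<in> \<real>" using Im_form_self[OF u] by (simp add: complex_is_Real_iff)
    have "Re (form u u) \<le> cmod (form u u)" by (rule complex_Re_le_cmod)
    also have "\<dots> \<le> M * (tnorm \<T> u)\<^sup>2"
      using norm_form_le[OF u u] by (simp add: M_def power2_eq_square mult.assoc)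
    also have "\<dots> \<le> max c1 M * (tnorm \<T> u)\<^sup>2" by (intro mult_right_mono) auto
    finally show "Re (form u u) \<le> max c1 M * (tnorm \<T> u)\<^sup>2" .
  qed
  then show "\<exists>c1 c2. 0 < c1 \<and> c1 \<le> c2 \<and>
        (\<forall>u\<in>L2. l2_inner (PLPu u) u \<in> \<real> \<and>
           c1 * (l2_norm u)\<^sup>2 \<le> Re (l2_inner (PLPu u) u) \<and>
           Re (l2_inner (PLPu u) u) \<le> c2 * (l2_norm u)\<^sup>2)"
    unfolding L2_eq_L2p l2_inner_eq l2_norm_eq
    by (intro exI[of _ c1] exI[of _ "max c1 M"] conjI ballI) (use c1(1) PLPu(3) in auto)
qed

end

theorem theorem3p1:
  fixes K :: nat
    and a b :: "real^'n::finite \<Rightarrow> real"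
    and C C\<^sub>0 :: real
    and x :: "nat \<Rightarrow> real^'n"
    and g :: "nat \<Rightarrow> real^'n \<Rightarrow> real"
  assumes "K \<ge> 2"
    and "periodic (2 * pi) a" and "a \<in> borel_measurable lebesgue" and "bounded (range a)"
    and "periodic (2 * pi) b" and "b \<in> borel_measurable lebesgue" and "bounded (range b)"
    and "C > 0" and "\<And>y. a y \<ge> C"
    and "C\<^sub>0 > 0" and "\<And>y. b y \<ge> C\<^sub>0"
    and "bij_betw x {1..K ^ CARD('n)} (window_grid K)"
    and "window_functions K x g"
  shows "(\<forall>u\<in>L2.
           preconditioner K x g a (dist_of (2 * pi) u) \<in> Sobolev 1 \<and>
           elliptic_op a b (preconditioner K x g a (dist_of (2 * pi) u)) \<in> Sobolev (-1) \<and>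
           represents (PLP K x g a b u)
             (preconditioner K x g a (elliptic_op a b (preconditioner K x g a (dist_of (2 * pi) u)))))
         \<and> selfadjoint_L2_operator (PLP K x g a b)
         \<and> boundedly_invertible_L2 (PLP K x g a b)
         \<and> (\<exists>c1 c2. 0 < c1 \<and> c1 \<le> c2 \<and>
              (\<forall>u\<in>L2. l2_inner (PLP K x g a b u) u \<in> \<real> \<and>
                 c1 * (l2_norm u)\<^sup>2 \<le> Re (l2_inner (PLP K x g a b u) u) \<and>
                 Re (l2_inner (PLP K x g a b u) u) \<le> c2 * (l2_norm u)\<^sup>2))"
proof -
  interpret windowed_problem K a b C C\<^sub>0 x g
    by unfold_locales (fact assms)+
  show ?thesis by (rule conclusion)
qed

end
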